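(* Let $(A,\sigma)$ be a C*-dynamical system with $A$ unital and separable. Fix $\beta_0\in(0,\infty)$ and suppose $\varphi$ is an extremal $\sigma$-KMS$_{\beta_0}$ state of type I of $(A,\sigma)$. Let $(\pi,\mathcal H,\rho)$ be the admissible triple associated to $\varphi$ and let $H:=\frac{-1}{\beta_0}\log\rho$ be the represented Hamiltonian. For each positive $\beta$ such that $e^{-\beta H}\,(=\rho^{\beta/\beta_0})$ is of trace class, define a state on $A$ by $$\varphi_{\beta_0,\beta}(a):=\frac{\operatorname{Tr}(\pi(a)e^{-\beta H})}{\operatorname{Tr}(e^{-\beta H})}\qquad (a\in A).$$ Then $\varphi_{\beta_0,\beta}$ is an extremal $\sigma$-KMS$_\beta$ state of type I and $(\pi,\mathcal H,\rho^{\beta/\beta_0})$ is an admissible triple for $\varphi_{\beta_0,\beta}$, so all the states $\varphi_{\beta_0,\beta}$ have $H$ as represented Hamiltonian, and $Z_{\varphi_{\beta_0,\beta}}(s)=\operatorname{Tr}(e^{-sH})$ for every $\beta>\beta_c$. Moreover, the quasi-equivalence class of the state $\varphi$ among all $\sigma$-KMS$_\beta$ states for $\beta>0$ is precisely $\{\varphi_{\beta_0,\beta}:\beta>\beta_c\}$.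
   Context: A C*-dynamical system $(A,\sigma)$ consists of a C*-algebra $A$ and a homomorphism $\sigma:\mathbb R\to\operatorname{Aut}(A)$ with $t\mapsto\sigma_t(a)$ norm continuous for each $a\in A$. A state $\varphi$ is $\sigma$-KMS$_\beta$ if $\varphi(ab)=\varphi(b\,\sigma_{i\beta}(a))$ for all $\sigma$-analytic $a,b$. An extremal KMS$_\beta$ state is of type I if $\pi_\varphi(A)''$ is a type I factor, where $\pi_\varphi$ is its GNS representation. Two states are quasi-equivalent if their GNS representations are quasi-equivalent. The inverse temperatures $\beta$ indexing the states $\varphi_{\beta_0,\beta}$ are positive throughout. For an extremal $\sigma$-KMS$_{\beta}$ state $\varphi$ of type I with $\beta\in(0,\infty)$, an admissible triple $(\pi,\mathcal H,\rho)$ for $\varphi$ consists of an irreducible representation $\pi$ of $A$ on a separable Hilbert space $\mathcal H$ and a positive trace-class operator $\rho$ of norm $1$ on $\mathcal H$ with $\varphi(a)=\operatorname{Tr}(\pi(a)\rho)/\operatorname{Tr}(\rho)$ for all $a\in A$; such a triple exists and is unique up to unitary equivalence, $\rho$ is strictly positive, and $\pi(\sigma_t(a))=\rho^{-it/\beta}\pi(a)\rho^{it/\beta}$ for all $a\in A$, $t\in\mathbb R$. The represented Hamiltonian of $\varphi$ is $H=\frac{-1}{\beta}\log\rho$, and $\beta_c:=\inf\{\beta'\in[-\infty,\infty):\operatorname{Tr}(e^{-\beta' H})<\infty\}$, which lies in $[0,\infty)\cup\{-\infty\}$ and equals $-\infty$ exactly when $\mathcal H$ is finite-dimensional. The partition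 function of $\varphi$ is $Z_\varphi(s):=\operatorname{Tr}(e^{-sH})$, defined for $\operatorname{Re}s>\beta_c$.
   Formalization: The class is shown to be all φ_{β₀,β} with β>0 and e^{-βH} of trace class; it equals {φ_{β₀,β}: β>β_c} unless β_c>0 and e^{-β_cH} is itself of trace class, where the claim as stated fails (φ_{β₀,β_c} also belongs to the class). *)

theory Defs
  imports "HOL-Analysis.Analysis"
begin

section \<open>Complex vector spaces, C*-algebras and Hilbert spaces\<close>

class complex_vec = real_vector +
  fixes scaleC :: "complex \<Rightarrow> 'a \<Rightarrow> 'a" (infixr "*\<^sub>C" 75)
  assumes scaleC_add_right: "c *\<^sub>C (x + y) = c *\<^sub>C x + c *\<^sub>C y"
    and scaleC_add_left: "(c + d) *\<^sub>C x = c *\<^sub>C x + d *\<^sub>C x"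
    and scaleC_scaleC: "c *\<^sub>C d *\<^sub>C x = (c * d) *\<^sub>C x"
    and scaleC_of_real: "complex_of_real r *\<^sub>C x = r *\<^sub>R x"

text \<open>Unital C*-algebras. The class \<^class>\<open>real_normed_algebra_1\<close> excludes only the zero algebra,
  which has no states.\<close>

class unital_cstar_algebra = complex_vec + real_normed_algebra_1 + banach +
  fixes star :: "'a \<Rightarrow> 'a"
  assumes norm_scaleC: "norm (c *\<^sub>C x) = cmod c * norm x"
    and scaleC_mult_left: "(c *\<^sub>C x) * y = c *\<^sub>C (x * y)"
    and scaleC_mult_right: "x * (c *\<^sub>C y) = c *\<^sub>C (x * y)"
    and star_star: "star (star x) = x"
    and star_add: "star (x + y) = star x + star y"
    and star_scaleC: "star (c *\<^sub>C x) = cnj c *\<^sub>C star x"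
    and star_mult: "star (x * y) = star y * star x"
    and cstar_identity: "norm (star x * x) = (norm x)\<^sup>2"

text \<open>Inner products are linear in the second variable.\<close>

class chilbert_space = complex_vec + banach +
  fixes cinner :: "'a \<Rightarrow> 'a \<Rightarrow> complex"
  assumes cinner_commute: "cinner x y = cnj (cinner y x)"
    and cinner_add_right: "cinner x (y + z) = cinner x y + cinner x z"
    and cinner_scaleC_right: "cinner x (c *\<^sub>C y) = c * cinner x y"
    and cinner_self: "cinner x x = complex_of_real ((norm x)\<^sup>2)"

instantiation complex :: complex_vec
begin
definition scaleC_complex :: "complex \<Rightarrow> complex \<Rightarrow> complex" where
  "scaleC_complex c x = c * x"
instance
  by standard (simp_all add: scaleC_complex_def algebra_simps scaleR_conv_of_real)
end

definition clinear :: "('v::complex_vec \<Rightarrow> 'w::complex_vec) \<Rightarrow> bool" where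
  "clinear f \<longleftrightarrow> (\<forall>x y. f (x + y) = f x + f y) \<and> (\<forall>c x. f (c *\<^sub>C x) = c *\<^sub>C f x)"


section \<open>The Hilbert space of square-summable sequences\<close>

typedef ell2 = "{f :: nat \<Rightarrow> complex. summable (\<lambda>n. (cmod (f n))\<^sup>2)}"
  by (rule exI[of _ "\<lambda>_. 0"]) simp

lemma summable_ell2: "summable (\<lambda>n. (cmod (Rep_ell2 x n))\<^sup>2)"
  using Rep_ell2[of x] by simp

lemma ell2_summable_add:
  assumes "summable (\<lambda>n. (cmod (f n))\<^sup>2)" "summable (\<lambda>n. (cmod (g n))\<^sup>2)"
  shows "summable (\<lambda>n. (cmod (f n + g n))\<^sup>2)"
proof (rule summable_comparison_test')
  show "summable (\<lambda>n. 2 * (cmod (f n))\<^sup>2 + 2 * (cmod (g n))\<^sup>2)"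
    using assms by (intro summable_add summable_mult)
  fix n :: nat
  have "(cmod (f n + g n))\<^sup>2 \<le> (cmod (f n) + cmod (g n))\<^sup>2"
    by (intro power_mono norm_triangle_ineq) simp
  also have "\<dots> \<le> 2 * (cmod (f n))\<^sup>2 + 2 * (cmod (g n))\<^sup>2"
    using sum_squares_bound[of "cmod (f n)" "cmod (g n)"] by (simp add: power2_sum)
  finally show "norm ((cmod (f n + g n))\<^sup>2) \<le> 2 * (cmod (f n))\<^sup>2 + 2 * (cmod (g n))\<^sup>2"
    by simp
qed

lemma ell2_summable_scale:
  assumes "summable (\<lambda>n. (cmod (f n))\<^sup>2)"
  shows "summable (\<lambda>n. (cmod (c * f n))\<^sup>2)"
  using summable_mult[OF assms, of "(cmod c)\<^sup>2"] by (simp add: norm_mult power_mult_distrib)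

instantiation ell2 :: complex_vec
begin
definition zero_ell2 :: ell2 where "zero_ell2 = Abs_ell2 (\<lambda>_. 0)"
definition plus_ell2 :: "ell2 \<Rightarrow> ell2 \<Rightarrow> ell2" where
  "plus_ell2 x y = Abs_ell2 (\<lambda>n. Rep_ell2 x n + Rep_ell2 y n)"
definition scaleC_ell2 :: "complex \<Rightarrow> ell2 \<Rightarrow> ell2" where
  "scaleC_ell2 c x = Abs_ell2 (\<lambda>n. c * Rep_ell2 x n)"
definition scaleR_ell2 :: "real \<Rightarrow> ell2 \<Rightarrow> ell2" where
  "scaleR_ell2 r x = complex_of_real r *\<^sub>C x"
definition uminus_ell2 :: "ell2 \<Rightarrow> ell2" where "uminus_ell2 x = (- 1) *\<^sub>C x"
definition minus_ell2 :: "ell2 \<Rightarrow> ell2 \<Rightarrow> ell2" where "minus_ell2 x y = x + (- y)"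

lemma Rep_ell2_zero: "Rep_ell2 0 n = 0"
  unfolding zero_ell2_def by (simp add: Abs_ell2_inverse)
lemma Rep_ell2_plus: "Rep_ell2 (x + y) n = Rep_ell2 x n + Rep_ell2 y n"
  unfolding plus_ell2_def
  by (simp add: Abs_ell2_inverse ell2_summable_add summable_ell2)
lemma Rep_ell2_scaleC: "Rep_ell2 (c *\<^sub>C x) n = c * Rep_ell2 x n"
  unfolding scaleC_ell2_def
  by (subst Abs_ell2_inverse) (use ell2_summable_scale[OF summable_ell2] in auto)
lemma Rep_ell2_scaleR: "Rep_ell2 (r *\<^sub>R x) n = complex_of_real r * Rep_ell2 x n"
  unfolding scaleR_ell2_def by (rule Rep_ell2_scaleC)
lemma Rep_ell2_uminus: "Rep_ell2 (- x) n = - Rep_ell2 x n"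
  unfolding uminus_ell2_def by (simp add: Rep_ell2_scaleC)
lemma Rep_ell2_minus: "Rep_ell2 (x - y) n = Rep_ell2 x n - Rep_ell2 y n"
  unfolding minus_ell2_def by (simp add: Rep_ell2_plus Rep_ell2_uminus)

lemmas Rep_ell2_simps = Rep_ell2_zero Rep_ell2_plus Rep_ell2_scaleC Rep_ell2_scaleR
  Rep_ell2_uminus Rep_ell2_minus

lemma ell2_eqI: "(\<And>n. Rep_ell2 x n = Rep_ell2 y n) \<Longrightarrow> x = y"
  using Rep_ell2_inject by blast

instance
  by standard (rule ell2_eqI, simp add: Rep_ell2_simps algebra_simps)+
end

lemma ell2_sum_le: "(\<Sum>n<m. (cmod (Rep_ell2 x n))\<^sup>2) \<le> (\<Sum>n. (cmod (Rep_ell2 x n))\<^sup>2)"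
  by (rule sum_le_suminf[OF summable_ell2]) auto

instantiation ell2 :: real_normed_vector
begin
definition norm_ell2 :: "ell2 \<Rightarrow> real" where
  "norm_ell2 x = sqrt (\<Sum>n. (cmod (Rep_ell2 x n))\<^sup>2)"
definition sgn_ell2 :: "ell2 \<Rightarrow> ell2" where "sgn_ell2 x = x /\<^sub>R norm x"
definition dist_ell2 :: "ell2 \<Rightarrow> ell2 \<Rightarrow> real" where "dist_ell2 x y = norm (x - y)"
definition uniformity_ell2 :: "(ell2 \<times> ell2) filter" where
  "uniformity_ell2 = (INF e\<in>{0<..}. principal {(x, y). dist x y < e})"
definition open_ell2 :: "ell2 set \<Rightarrow> bool" where
  "open_ell2 U \<longleftrightarrow> (\<forall>x\<in>U. eventually (\<lambda>(x', y). x' = x \<longrightarrow> y \<in> U) uniformity)"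

lemma L2_le_norm_ell2: "L2_set (\<lambda>n. cmod (Rep_ell2 x n)) {..<m} \<le> norm x"
  unfolding L2_set_def norm_ell2_def using ell2_sum_le by simp

lemma norm_ell2_le:
  assumes "\<And>m. L2_set (\<lambda>n. cmod (Rep_ell2 x n)) {..<m} \<le> c"
  shows "norm x \<le> c"
proof -
  have c: "0 \<le> c" using assms[of 0] by simp
  have "(\<Sum>n<m. (cmod (Rep_ell2 x n))\<^sup>2) \<le> c\<^sup>2" for m
    using assms[of m] c unfolding L2_set_def by (metis real_sqrt_le_iff real_sqrt_unique)
  then have "(\<Sum>n. (cmod (Rep_ell2 x n))\<^sup>2) \<le> c\<^sup>2"
    by (intro suminf_le_const summable_ell2)
  then show ?thesis
    unfolding norm_ell2_def using c by (metis real_sqrt_le_iff real_sqrt_unique)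
qed

instance
proof
  fix x y :: ell2 and a :: real
  show "dist x y = norm (x - y)" by (rule dist_ell2_def)
  show "sgn x = x /\<^sub>R norm x" by (rule sgn_ell2_def)
  show "uniformity = (INF e\<in>{0<..}. principal {(x, y :: ell2). dist x y < e})"
    by (rule uniformity_ell2_def)
  show "open U \<longleftrightarrow> (\<forall>x\<in>U. \<forall>\<^sub>F (x', y) in uniformity. x' = x \<longrightarrow> y \<in> U)" for U :: "ell2 set"
    by (rule open_ell2_def)
  show "norm x = 0 \<longleftrightarrow> x = 0"
  proof
    assume "norm x = 0"
    then have "(\<Sum>n. (cmod (Rep_ell2 x n))\<^sup>2) = 0" by (simp add: norm_ell2_def)
    then have "\<forall>n. (cmod (Rep_ell2 x n))\<^sup>2 = 0"
      by (subst (asm) suminf_eq_zero_iff[OF summable_ell2]) auto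
    then show "x = 0" by (intro ell2_eqI) (simp add: Rep_ell2_simps)
  qed (simp add: norm_ell2_def Rep_ell2_simps)
  show "norm (x + y) \<le> norm x + norm y"
  proof (rule norm_ell2_le)
    fix m
    have "L2_set (\<lambda>n. cmod (Rep_ell2 (x + y) n)) {..<m}
        \<le> L2_set (\<lambda>n. cmod (Rep_ell2 x n) + cmod (Rep_ell2 y n)) {..<m}"
      by (rule L2_set_mono) (auto simp: Rep_ell2_simps norm_triangle_ineq)
    also have "\<dots> \<le> L2_set (\<lambda>n. cmod (Rep_ell2 x n)) {..<m} + L2_set (\<lambda>n. cmod (Rep_ell2 y n)) {..<m}"
      by (rule L2_set_triangle_ineq)
    also have "\<dots> \<le> norm x + norm y"
      by (intro add_mono L2_le_norm_ell2)
    finally show "L2_set (\<lambda>n. cmod (Rep_ell2 (x + y) n)) {..<m} \<le> norm x + norm y" .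
  qed
  show "norm (a *\<^sub>R x) = \<bar>a\<bar> * norm x"
    by (simp add: norm_ell2_def Rep_ell2_simps norm_mult power_mult_distrib
        suminf_mult[OF summable_ell2] real_sqrt_mult)
qed
end

lemma ell2_component_le: "cmod (Rep_ell2 x n) \<le> norm x"
proof -
  have "cmod (Rep_ell2 x n) \<le> L2_set (\<lambda>n. cmod (Rep_ell2 x n)) {..<Suc n}"
    by (rule member_le_L2_set) auto
  then show ?thesis using L2_le_norm_ell2 order_trans by blast
qed

instance ell2 :: banach
proof
  fix X :: "nat \<Rightarrow> ell2"
  assume "Cauchy X"
  have "Cauchy (\<lambda>k. Rep_ell2 (X k) n)" for n
  proof (rule CauchyI)
    fix e :: real assume "0 < e"
    with CauchyD[OF \<open>Cauchy X\<close>] obtain M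
      where M: "\<And>j k. j \<ge> M \<Longrightarrow> k \<ge> M \<Longrightarrow> norm (X j - X k) < e" by blast
    have "cmod (Rep_ell2 (X j) n - Rep_ell2 (X k) n) < e" if "j \<ge> M" "k \<ge> M" for j k
      using ell2_component_le[of "X j - X k" n] M[OF that] by (simp add: Rep_ell2_simps)
    then show "\<exists>M. \<forall>j\<ge>M. \<forall>k\<ge>M. norm (Rep_ell2 (X j) n - Rep_ell2 (X k) n) < e" by blast
  qed
  then have "\<forall>n. \<exists>l. (\<lambda>k. Rep_ell2 (X k) n) \<longlonglongrightarrow> l"
    using Cauchy_convergent convergent_def by blast
  then obtain g where g: "\<And>n. (\<lambda>k. Rep_ell2 (X k) n) \<longlonglongrightarrow> g n" by metis
  have bound: "L2_set (\<lambda>n. cmod (Rep_ell2 (X j) n - g n)) {..<m} \<le> e"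
    if M: "\<And>j k. j \<ge> M \<Longrightarrow> k \<ge> M \<Longrightarrow> norm (X j - X k) < e" and "j \<ge> M" for M j m e
  proof (rule LIMSEQ_le_const2)
    show "(\<lambda>k. L2_set (\<lambda>n. cmod (Rep_ell2 (X j) n - Rep_ell2 (X k) n)) {..<m})
        \<longlonglongrightarrow> L2_set (\<lambda>n. cmod (Rep_ell2 (X j) n - g n)) {..<m}"
      unfolding L2_set_def by (intro tendsto_intros g)
    have "L2_set (\<lambda>n. cmod (Rep_ell2 (X j) n - Rep_ell2 (X k) n)) {..<m} \<le> e" if "k \<ge> M" for k
      using L2_le_norm_ell2[of "X j - X k" m] M[OF \<open>j \<ge> M\<close> that] by (simp add: Rep_ell2_simps)
    then show "\<exists>N. \<forall>k\<ge>N. L2_set (\<lambda>n. cmod (Rep_ell2 (X j) n - Rep_ell2 (X k) n)) {..<m} \<le> e"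
      by blast
  qed
  have diff_summable: "summable (\<lambda>n. (cmod (Rep_ell2 (X j) n - g n))\<^sup>2)"
    if M: "\<And>j k. j \<ge> M \<Longrightarrow> k \<ge> M \<Longrightarrow> norm (X j - X k) < e" and "j \<ge> M" for M j e
  proof (rule summableI_nonneg_bounded)
    fix m
    have "sqrt (\<Sum>n<m. (cmod (Rep_ell2 (X j) n - g n))\<^sup>2) \<le> e"
      using bound[OF M \<open>j \<ge> M\<close>, of m] unfolding L2_set_def by blast
    then show "(\<Sum>n<m. (cmod (Rep_ell2 (X j) n - g n))\<^sup>2) \<le> e\<^sup>2"
      by (rule sqrt_le_D)
  qed auto
  obtain M where M: "\<And>j k. j \<ge> M \<Longrightarrow> k \<ge> M \<Longrightarrow> norm (X j - X k) < 1"
    using CauchyD[OF \<open>Cauchy X\<close>, of 1] by auto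
  have "summable (\<lambda>n. (cmod (- 1 * (Rep_ell2 (X M) n - g n) + Rep_ell2 (X M) n))\<^sup>2)"
    by (intro ell2_summable_add ell2_summable_scale diff_summable[OF M] summable_ell2) auto
  then have "summable (\<lambda>n. (cmod (g n))\<^sup>2)" by simp
  then obtain L where L: "\<And>n. Rep_ell2 L n = g n"
    using Abs_ell2_inverse[of g] by (metis mem_Collect_eq)
  have "X \<longlonglongrightarrow> L"
  proof (rule LIMSEQ_I)
    fix r :: real assume "0 < r"
    then obtain M where M: "\<And>j k. j \<ge> M \<Longrightarrow> k \<ge> M \<Longrightarrow> norm (X j - X k) < r / 2"
      using CauchyD[OF \<open>Cauchy X\<close>, of "r / 2"] by auto
    have "norm (X j - L) \<le> r / 2" if "j \<ge> M" for j
    proof (rule norm_ell2_le)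
      fix m
      show "L2_set (\<lambda>n. cmod (Rep_ell2 (X j - L) n)) {..<m} \<le> r / 2"
        unfolding Rep_ell2_minus L using M that by (rule bound)
    qed
    then show "\<exists>no. \<forall>n\<ge>no. norm (X n - L) < r"
      using \<open>0 < r\<close> by (intro exI[of _ M]) force
  qed
  then show "convergent X" by (rule convergentI)
qed

instantiation ell2 :: chilbert_space
begin
definition cinner_ell2 :: "ell2 \<Rightarrow> ell2 \<Rightarrow> complex" where
  "cinner_ell2 x y = (\<Sum>n. cnj (Rep_ell2 x n) * Rep_ell2 y n)"

lemma summable_cinner_ell2: "summable (\<lambda>n. cnj (Rep_ell2 x n) * Rep_ell2 y n)"
proof (rule summable_comparison_test')
  show "summable (\<lambda>n. (cmod (Rep_ell2 x n))\<^sup>2 + (cmod (Rep_ell2 y n))\<^sup>2)"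
    by (intro summable_add summable_ell2)
  fix n :: nat
  have "2 * (cmod (Rep_ell2 x n) * cmod (Rep_ell2 y n))
      \<le> (cmod (Rep_ell2 x n))\<^sup>2 + (cmod (Rep_ell2 y n))\<^sup>2"
    using sum_squares_bound[of "cmod (Rep_ell2 x n)" "cmod (Rep_ell2 y n)"] by simp
  moreover have "0 \<le> cmod (Rep_ell2 x n) * cmod (Rep_ell2 y n)" by simp
  ultimately show "norm (cnj (Rep_ell2 x n) * Rep_ell2 y n)
      \<le> (cmod (Rep_ell2 x n))\<^sup>2 + (cmod (Rep_ell2 y n))\<^sup>2"
    unfolding norm_mult complex_mod_cnj by linarith
qed

instance
proof
  fix x y z :: ell2 and c :: complex
  have "(\<lambda>n. cnj (Rep_ell2 y n) * Rep_ell2 x n) sums cinner y x"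
    unfolding cinner_ell2_def by (rule summable_sums[OF summable_cinner_ell2])
  then have "(\<lambda>n. cnj (cnj (Rep_ell2 y n) * Rep_ell2 x n)) sums cnj (cinner y x)"
    by (simp only: sums_cnj)
  then show "cinner x y = cnj (cinner y x)"
    unfolding cinner_ell2_def[of x y] by (simp add: sums_iff mult.commute)
  show "cinner x (y + z) = cinner x y + cinner x z"
    unfolding cinner_ell2_def
    by (simp add: Rep_ell2_simps distrib_left suminf_add[OF summable_cinner_ell2 summable_cinner_ell2])
  show "cinner x (c *\<^sub>C y) = c * cinner x y"
    unfolding cinner_ell2_def
    by (simp add: Rep_ell2_simps mult.left_commute suminf_mult[OF summable_cinner_ell2])
  have "cnj (Rep_ell2 x n) * Rep_ell2 x n = complex_of_real ((cmod (Rep_ell2 x n))\<^sup>2)" for n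
    by (metis complex_norm_square mult.commute)
  moreover have "(norm x)\<^sup>2 = (\<Sum>n. (cmod (Rep_ell2 x n))\<^sup>2)"
    unfolding norm_ell2_def by (rule real_sqrt_pow2) (intro suminf_nonneg summable_ell2; simp)
  ultimately show "cinner x x = complex_of_real ((norm x)\<^sup>2)"
    unfolding cinner_ell2_def by (simp only: suminf_of_real[OF summable_ell2])
qed
end


section \<open>Operators on Hilbert spaces\<close>

definition bounded_clinear :: "('h::chilbert_space \<Rightarrow> 'h) \<Rightarrow> bool" where
  "bounded_clinear T \<longleftrightarrow> clinear T \<and> bounded_linear T"

definition adjoint_pair :: "('h::chilbert_space \<Rightarrow> 'h) \<Rightarrow> ('h \<Rightarrow> 'h) \<Rightarrow> bool" where
  "adjoint_pair T S \<longleftrightarrow> (\<forall>x y. cinner (T x) y = cinner x (S y))"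

definition closed_csubspace :: "'h::chilbert_space set \<Rightarrow> bool" where
  "closed_csubspace K \<longleftrightarrow> closed K \<and> 0 \<in> K \<and> (\<forall>x\<in>K. \<forall>y\<in>K. x + y \<in> K) \<and> (\<forall>c. \<forall>x\<in>K. c *\<^sub>C x \<in> K)"

definition orth_proj :: "'h::chilbert_space set \<Rightarrow> 'h \<Rightarrow> 'h" where
  "orth_proj K x = (THE y. y \<in> K \<and> (\<forall>v\<in>K. cinner v (x - y) = 0))"

text \<open>\<open>B(K)\<close> for a closed subspace \<open>K\<close>: an operator on \<open>K\<close> is identified with its extension by \<open>0\<close>
  on the orthogonal complement of \<open>K\<close>, so that equality of operators on \<open>K\<close> is equality of functions.
  The identity of \<open>K\<close> becomes the projection onto \<open>K\<close>.\<close>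

definition bounded_ops :: "'h::chilbert_space set \<Rightarrow> ('h \<Rightarrow> 'h) set" where
  "bounded_ops K = {T. bounded_clinear T \<and> range T \<subseteq> K \<and>
     (\<forall>x. (\<forall>v\<in>K. cinner v x = 0) \<longrightarrow> T x = 0)}"

definition positive_op :: "('h::chilbert_space \<Rightarrow> 'h) \<Rightarrow> bool" where
  "positive_op T \<longleftrightarrow> bounded_clinear T \<and> (\<forall>x. cinner x (T x) \<in> \<real>\<^sub>\<ge>\<^sub>0)"

definition is_onb :: "'h::chilbert_space set \<Rightarrow> bool" where
  "is_onb B \<longleftrightarrow> (\<forall>e\<in>B. norm e = 1) \<and> (\<forall>e\<in>B. \<forall>f\<in>B. e \<noteq> f \<longrightarrow> cinner e f = 0) \<and>
     (\<forall>x. (\<forall>e\<in>B. cinner e x = 0) \<longrightarrow> x = 0)"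

text \<open>The condition \<open>S * S = T\<^sup>* * T\<close> for a positive \<open>S\<close>.\<close>

definition is_abs_op :: "('h::chilbert_space \<Rightarrow> 'h) \<Rightarrow> ('h \<Rightarrow> 'h) \<Rightarrow> bool" where
  "is_abs_op T S \<longleftrightarrow> positive_op S \<and> (\<forall>x y. cinner (S x) (S y) = cinner (T x) (T y))"

definition trace_class :: "('h::chilbert_space \<Rightarrow> 'h) \<Rightarrow> bool" where
  "trace_class T \<longleftrightarrow> bounded_clinear T \<and>
     (\<exists>S B. is_abs_op T S \<and> is_onb B \<and> (\<lambda>e. cinner e (S e)) summable_on B)"

definition op_trace :: "('h::chilbert_space \<Rightarrow> 'h) \<Rightarrow> complex" where
  "op_trace T = (\<Sum>\<^sub>\<infinity>e\<in>(SOME B. is_onb B). cinner e (T e))"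


section \<open>Possibly unbounded operators and functional calculus\<close>

text \<open>A possibly unbounded operator is represented by its graph, so that equality of operators
  includes equality of domains.\<close>

definition op_graph :: "('h \<Rightarrow> 'h) \<Rightarrow> ('h \<times> 'h) set" where
  "op_graph T = {(x, T x) |x. True}"

definition of_graph :: "('h \<times> 'h) set \<Rightarrow> 'h \<Rightarrow> 'h" where
  "of_graph G x = (THE y. (x, y) \<in> G)"

text \<open>In particular a trace-class operator is everywhere defined.\<close>

definition trace_class_graph :: "('h::chilbert_space \<times> 'h) set \<Rightarrow> bool" where
  "trace_class_graph G \<longleftrightarrow> (\<exists>T. G = op_graph T \<and> trace_class T)"

definition eigenspace :: "('h::chilbert_space \<times> 'h) set \<Rightarrow> real \<Rightarrow> 'h set" where
  "eigenspace G l = {x. (x, l *\<^sub>R x) \<in> G}"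

definition eigenvalues :: "('h::chilbert_space \<times> 'h) set \<Rightarrow> real set" where
  "eigenvalues G = {l. eigenspace G l \<noteq> {0}}"

text \<open>The functional calculus \<open>f(G) = \<Sum>\<^sub>l f(l) P\<^sub>l\<close> of a self-adjoint operator \<open>G\<close> that has an
  orthonormal basis of eigenvectors, where \<open>P\<^sub>l\<close> is the projection onto the \<open>l\<close>-eigenspace. The
  spectral measure of such a \<open>G\<close> is concentrated on its eigenvalues, so this is the Borel functional
  calculus: the summands being orthogonal, the sum converges unconditionally exactly
  when \<open>\<Sum>\<^sub>l |f(l)|\<^sup>2 \<parallel>P\<^sub>l x\<parallel>\<^sup>2\<close> is finite, which is the usual domain. It is only applied to positive
  trace-class operators (which are compact), and to their logarithms.\<close>

definition fun_calc :: "(real \<Rightarrow> complex) \<Rightarrow> ('h::chilbert_space \<times> 'h) set \<Rightarrow> ('h \<times> 'h) set" where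
  "fun_calc f G = {(x, y). ((\<lambda>l. f l *\<^sub>C orth_proj (eigenspace G l) x) has_sum y) (eigenvalues G)}"

definition op_powr :: "('h::chilbert_space \<Rightarrow> 'h) \<Rightarrow> real \<Rightarrow> 'h \<Rightarrow> 'h" where
  "op_powr T p = of_graph (fun_calc (\<lambda>l. complex_of_real (l powr p)) (op_graph T))"

definition neg_exp :: "complex \<Rightarrow> ('h::chilbert_space \<times> 'h) set \<Rightarrow> ('h \<times> 'h) set" where
  "neg_exp s G = fun_calc (\<lambda>l. exp (- s * complex_of_real l)) G"


section \<open>Representations and von Neumann algebras\<close>

text \<open>A nondegenerate *-representation of \<open>A\<close> on the closed subspace \<open>K\<close>.\<close>

definition star_rep :: "'h::chilbert_space set \<Rightarrow> ('a::unital_cstar_algebra \<Rightarrow> 'h \<Rightarrow> 'h) \<Rightarrow> bool" where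
  "star_rep K \<pi> \<longleftrightarrow> closed_csubspace K \<and> (\<forall>a. \<pi> a \<in> bounded_ops K) \<and>
     (\<forall>x. clinear (\<lambda>a. \<pi> a x)) \<and> (\<forall>a b. \<pi> (a * b) = \<pi> a \<circ> \<pi> b) \<and>
     (\<forall>a. adjoint_pair (\<pi> a) (\<pi> (star a))) \<and> (\<forall>x\<in>K. \<pi> 1 x = x)"

definition irreducible_rep ::
  "'h::chilbert_space set \<Rightarrow> ('a::unital_cstar_algebra \<Rightarrow> 'h \<Rightarrow> 'h) \<Rightarrow> bool" where
  "irreducible_rep K \<pi> \<longleftrightarrow> star_rep K \<pi> \<and> K \<noteq> {0} \<and>
     (\<forall>V. closed_csubspace V \<and> V \<subseteq> K \<and> (\<forall>a. \<forall>x\<in>V. \<pi> a x \<in> V) \<longrightarrow> V = {0} \<or> V = K)"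

definition commutant :: "'h::chilbert_space set \<Rightarrow> ('h \<Rightarrow> 'h) set \<Rightarrow> ('h \<Rightarrow> 'h) set" where
  "commutant K S = {T \<in> bounded_ops K. \<forall>A\<in>S. T \<circ> A = A \<circ> T}"

definition bicommutant :: "'h::chilbert_space set \<Rightarrow> ('h \<Rightarrow> 'h) set \<Rightarrow> ('h \<Rightarrow> 'h) set" where
  "bicommutant K S = commutant K (commutant K S)"

definition is_projection :: "('h::chilbert_space \<Rightarrow> 'h) \<Rightarrow> bool" where
  "is_projection p \<longleftrightarrow> bounded_clinear p \<and> p \<circ> p = p \<and> adjoint_pair p p"

definition factor :: "'h::chilbert_space set \<Rightarrow> ('h \<Rightarrow> 'h) set \<Rightarrow> bool" where
  "factor K M \<longleftrightarrow> (\<forall>T\<in>M. \<exists>S\<in>M. adjoint_pair T S) \<and> bicommutant K M = M \<and>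
     M \<inter> commutant K M = {(\<lambda>x. c *\<^sub>C orth_proj K x) |c. True}"

text \<open>A factor is of type I if it contains a minimal nonzero projection.\<close>

definition type_I_factor :: "'h::chilbert_space set \<Rightarrow> ('h \<Rightarrow> 'h) set \<Rightarrow> bool" where
  "type_I_factor K M \<longleftrightarrow> factor K M \<and>
     (\<exists>p\<in>M. is_projection p \<and> p \<noteq> (\<lambda>x. 0) \<and>
        (\<forall>q\<in>M. is_projection q \<and> p \<circ> q = q \<longrightarrow> q = (\<lambda>x. 0) \<or> q = p))"

text \<open>Quasi-equivalence: \<open>\<pi>\<^sub>1(a) \<mapsto> \<pi>\<^sub>2(a)\<close> extends to a *-isomorphism \<open>\<pi>\<^sub>1(A)'' \<rightarrow> \<pi>\<^sub>2(A)''\<close>.\<close>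

definition quasi_equivalent_reps ::
  "'h::chilbert_space set \<Rightarrow> ('a::unital_cstar_algebra \<Rightarrow> 'h \<Rightarrow> 'h) \<Rightarrow>
   'k::chilbert_space set \<Rightarrow> ('a \<Rightarrow> 'k \<Rightarrow> 'k) \<Rightarrow> bool" where
  "quasi_equivalent_reps K\<^sub>1 \<pi>\<^sub>1 K\<^sub>2 \<pi>\<^sub>2 \<longleftrightarrow>
     (let M\<^sub>1 = bicommutant K\<^sub>1 (range \<pi>\<^sub>1); M\<^sub>2 = bicommutant K\<^sub>2 (range \<pi>\<^sub>2) in
      \<exists>\<Theta>. bij_betw \<Theta> M\<^sub>1 M\<^sub>2 \<and>
        (\<forall>S\<in>M\<^sub>1. \<forall>T\<in>M\<^sub>1. \<Theta> (\<lambda>x. S x + T x) = (\<lambda>x. \<Theta> S x + \<Theta> T x)) \<and>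
        (\<forall>c. \<forall>T\<in>M\<^sub>1. \<Theta> (\<lambda>x. c *\<^sub>C T x) = (\<lambda>x. c *\<^sub>C \<Theta> T x)) \<and>
        (\<forall>S\<in>M\<^sub>1. \<forall>T\<in>M\<^sub>1. \<Theta> (S \<circ> T) = \<Theta> S \<circ> \<Theta> T) \<and>
        (\<forall>S\<in>M\<^sub>1. \<forall>T\<in>M\<^sub>1. adjoint_pair S T \<longrightarrow> adjoint_pair (\<Theta> S) (\<Theta> T)) \<and>
        (\<forall>a. \<Theta> (\<pi>\<^sub>1 a) = \<pi>\<^sub>2 a))"


section \<open>States and their GNS representations\<close>

definition is_state :: "('a::unital_cstar_algebra \<Rightarrow> complex) \<Rightarrow> bool" where
  "is_state \<phi> \<longleftrightarrow> clinear \<phi> \<and> (\<forall>a. \<phi> (star a * a) \<in> \<real>\<^sub>\<ge>\<^sub>0) \<and> \<phi> 1 = 1"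

text \<open>GNS triples, which are unique up to unitary equivalence. Since a state of a separable
  C*-algebra has a separable GNS space, its GNS representation can always be realised on a closed
  subspace \<open>K\<close> of the sequence space \<^typ>\<open>ell2\<close> (possibly of finite dimension), and the definitions
  below do so. The notions defined from it do not depend on the choice of the realisation.\<close>

definition gns_triple ::
  "('a::{unital_cstar_algebra, second_countable_topology} \<Rightarrow> complex) \<Rightarrow>
   ell2 set \<Rightarrow> ('a \<Rightarrow> ell2 \<Rightarrow> ell2) \<Rightarrow> ell2 \<Rightarrow> bool" where
  "gns_triple \<phi> K \<pi> \<xi> \<longleftrightarrow> star_rep K \<pi> \<and> \<xi> \<in> K \<and> closure (range (\<lambda>a. \<pi> a \<xi>)) = K \<and>
     (\<forall>a. \<phi> a = cinner \<xi> (\<pi> a \<xi>))"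

definition type_I_state ::
  "('a::{unital_cstar_algebra, second_countable_topology} \<Rightarrow> complex) \<Rightarrow> bool" where
  "type_I_state \<phi> \<longleftrightarrow>
     (\<exists>K \<pi> \<xi>. gns_triple \<phi> K \<pi> \<xi> \<and> type_I_factor K (bicommutant K (range \<pi>)))"

definition quasi_equivalent_states ::
  "('a::{unital_cstar_algebra, second_countable_topology} \<Rightarrow> complex) \<Rightarrow> ('a \<Rightarrow> complex) \<Rightarrow> bool" where
  "quasi_equivalent_states \<phi> \<psi> \<longleftrightarrow>
     (\<exists>K\<^sub>1 \<pi>\<^sub>1 \<xi>\<^sub>1 K\<^sub>2 \<pi>\<^sub>2 \<xi>\<^sub>2. gns_triple \<phi> K\<^sub>1 \<pi>\<^sub>1 \<xi>\<^sub>1 \<and> gns_triple \<psi> K\<^sub>2 \<pi>\<^sub>2 \<xi>\<^sub>2 \<and>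
        quasi_equivalent_reps K\<^sub>1 \<pi>\<^sub>1 K\<^sub>2 \<pi>\<^sub>2)"


section \<open>C*-dynamical systems and KMS states\<close>

definition star_automorphism :: "('a::unital_cstar_algebra \<Rightarrow> 'a) \<Rightarrow> bool" where
  "star_automorphism f \<longleftrightarrow> bij f \<and> clinear f \<and> (\<forall>a b. f (a * b) = f a * f b) \<and>
     (\<forall>a. f (star a) = star (f a))"

definition cstar_dynamical_system :: "(real \<Rightarrow> 'a::unital_cstar_algebra \<Rightarrow> 'a) \<Rightarrow> bool" where
  "cstar_dynamical_system \<sigma> \<longleftrightarrow> (\<forall>t. star_automorphism (\<sigma> t)) \<and>
     (\<forall>s t. \<sigma> (s + t) = \<sigma> s \<circ> \<sigma> t) \<and> (\<forall>a. continuous_on UNIV (\<lambda>t. \<sigma> t a))"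

text \<open>\<open>F\<close> is the (unique) entire extension \<open>z \<mapsto> \<sigma>\<^sub>z(a)\<close> of \<open>t \<mapsto> \<sigma>\<^sub>t(a)\<close>.\<close>

definition analytic_extension ::
  "(real \<Rightarrow> 'a::unital_cstar_algebra \<Rightarrow> 'a) \<Rightarrow> 'a \<Rightarrow> (complex \<Rightarrow> 'a) \<Rightarrow> bool" where
  "analytic_extension \<sigma> a F \<longleftrightarrow> (\<forall>z. \<exists>d. (F has_derivative (\<lambda>h. h *\<^sub>C d)) (at z)) \<and>
     (\<forall>t. F (complex_of_real t) = \<sigma> t a)"

definition KMS_state ::
  "(real \<Rightarrow> 'a::unital_cstar_algebra \<Rightarrow> 'a) \<Rightarrow> real \<Rightarrow> ('a \<Rightarrow> complex) \<Rightarrow> bool" where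
  "KMS_state \<sigma> \<beta> \<phi> \<longleftrightarrow> is_state \<phi> \<and>
     (\<forall>a b F G. analytic_extension \<sigma> a F \<and> analytic_extension \<sigma> b G \<longrightarrow>
        \<phi> (a * b) = \<phi> (b * F (\<i> * complex_of_real \<beta>)))"

definition extremal_KMS_state ::
  "(real \<Rightarrow> 'a::unital_cstar_algebra \<Rightarrow> 'a) \<Rightarrow> real \<Rightarrow> ('a \<Rightarrow> complex) \<Rightarrow> bool" where
  "extremal_KMS_state \<sigma> \<beta> \<phi> \<longleftrightarrow> KMS_state \<sigma> \<beta> \<phi> \<and>
     (\<forall>\<psi>\<^sub>1 \<psi>\<^sub>2 t. KMS_state \<sigma> \<beta> \<psi>\<^sub>1 \<and> KMS_state \<sigma> \<beta> \<psi>\<^sub>2 \<and> 0 < t \<and> t < 1 \<and>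
        \<phi> = (\<lambda>a. complex_of_real t * \<psi>\<^sub>1 a + complex_of_real (1 - t) * \<psi>\<^sub>2 a) \<longrightarrow>
        \<psi>\<^sub>1 = \<phi> \<and> \<psi>\<^sub>2 = \<phi>)"


section \<open>Admissible triples and represented Hamiltonians\<close>

text \<open>The separable Hilbert space of the triple is the type \<^typ>\<open>'h\<close>.\<close>

definition admissible_triple ::
  "('a::unital_cstar_algebra \<Rightarrow> complex) \<Rightarrow>
   ('a \<Rightarrow> 'h::{chilbert_space, second_countable_topology} \<Rightarrow> 'h) \<Rightarrow> ('h \<Rightarrow> 'h) \<Rightarrow> bool" where
  "admissible_triple \<phi> \<pi> \<rho> \<longleftrightarrow> irreducible_rep UNIV \<pi> \<and>
     positive_op \<rho> \<and> trace_class \<rho> \<and> onorm \<rho> = 1 \<and>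
     (\<forall>a. \<phi> a = op_trace (\<pi> a \<circ> \<rho>) / op_trace \<rho>)"

definition represented_hamiltonian :: "real \<Rightarrow> ('h::chilbert_space \<Rightarrow> 'h) \<Rightarrow> ('h \<times> 'h) set" where
  "represented_hamiltonian \<beta> \<rho> = fun_calc (\<lambda>l. complex_of_real (- 1 / \<beta> * ln l)) (op_graph \<rho>)"

definition critical_beta :: "('h::chilbert_space \<times> 'h) set \<Rightarrow> ereal" where
  "critical_beta H = Inf {ereal b |b. trace_class_graph (neg_exp (complex_of_real b) H)}"

text \<open>The partition function of a KMS\<open>\<^sub>\<beta>\<close> state depends only on the state: all its admissible
  triples (here those on \<^typ>\<open>'h\<close>) are unitarily equivalent and give the same trace.\<close>

definition partition_function ::
  "'h::{chilbert_space, second_countable_topology} itself \<Rightarrow> real \<Rightarrow>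
   ('a::unital_cstar_algebra \<Rightarrow> complex) \<Rightarrow> complex \<Rightarrow> complex" where
  "partition_function _ \<beta> \<phi> s =
     (THE z. \<exists>(\<pi> :: 'a \<Rightarrow> 'h \<Rightarrow> 'h) \<rho>. admissible_triple \<phi> \<pi> \<rho> \<and>
        z = op_trace (of_graph (neg_exp s (represented_hamiltonian \<beta> \<rho>))))"

definition gibbs_state ::
  "('a::unital_cstar_algebra \<Rightarrow> 'h::chilbert_space \<Rightarrow> 'h) \<Rightarrow> ('h \<times> 'h) set \<Rightarrow> real \<Rightarrow> 'a \<Rightarrow> complex" where
  "gibbs_state \<pi> H \<beta> a =
     op_trace (\<pi> a \<circ> of_graph (neg_exp (complex_of_real \<beta>) H)) /
     op_trace (of_graph (neg_exp (complex_of_real \<beta>) H))"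

end

theory Submission
  imports Defs "HOL-Complex_Analysis.Conformal_Mappings" "HOL-Probability.Distributions"
begin

text \<open>
  Let \<open>\<rho>\<close> be the density matrix of the given state \<open>\<phi>\<close>, and let \<open>h\<^sub>e\<close> be the eigenvalues of the Hamiltonian
  \<open>H = - log \<rho> / \<beta>\<^sub>0\<close> for an orthonormal basis \<open>B\<close> of eigenvectors \<open>e\<close> in the Hilbert space \<open>\<H>\<close>. The KMS
  condition extends from \<open>\<pi>(A)\<close> to its weak closure \<open>B(\<H>)\<close>, and on matrix units it says that
  \<open>r\<^sub>e \<langle>e, \<pi>(a) f\<rangle> = r\<^sub>f \<langle>e, \<pi>(\<sigma>\<^bsub>i\<beta>\<^esub>(a)) f\<rangle>\<close> for \<open>\<beta> = \<beta>\<^sub>0\<close> and the eigenvalues \<open>r\<close> of \<open>\<rho>\<close>. A matrix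
  element of \<open>z \<mapsto> \<pi>(\<sigma>\<^sub>z(a))\<close> is bounded on horizontal strips and by this relation quasi-periodic in the
  imaginary direction; by Liouville's theorem it is \<open>e\<^bsup>iz(h\<^sub>e - h\<^sub>f)\<^esup> \<langle>e, \<pi>(a) f\<rangle>\<close>
  (\<open>KMS_density_modular\<close>). So \<open>e\<^bsup>itH\<^esup>\<close> implements the dynamics, and this no longer refers to \<open>\<beta>\<^sub>0\<close>: whenever
  \<open>e\<^bsup>-\<beta>H\<^esup>\<close> has finite trace, cyclicity of the trace makes its normalisation a KMS state for \<open>\<beta>\<close>
  (\<open>Gibbs_KMS\<close>). Its GNS representation is the multiple \<open>\<pi> \<otimes> 1\<close> of \<open>\<pi>\<close> on \<open>\<H> \<otimes> \<H>\<close> with the cyclic vector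
  \<open>\<Sum>\<^sub>e \<surd>w\<^sub>e e \<otimes> e\<close>, where \<open>w\<close> are the Boltzmann weights, and generates the type I factor \<open>B(\<H>) \<otimes> 1\<close>. In particular
  all these states are quasi-equivalent.

  The converse is carried by \<open>KMS_functional_Gibbs\<close>. Let \<open>\<theta>\<close> be a normal homomorphism from \<open>B(\<H>)\<close> into
  the von Neumann algebra of a representation \<open>\<pi>\<^sub>2\<close> with \<open>\<theta>(\<pi>(a)) = \<pi>\<^sub>2(a)\<close>, and take a KMS state for \<open>\<beta>\<close> of the form
  \<open>\<langle>\<eta>, \<pi>\<^sub>2(a) \<xi>\<rangle>\<close>. The KMS condition determines \<open>\<langle>\<eta>, \<theta>(|e\<rangle>\<langle>f|) \<xi>\<rangle>\<close> up to a common factor, so the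
  state is the Gibbs state for \<open>\<beta>\<close>, and \<open>e\<^bsup>-\<beta>H\<^esup>\<close> has finite trace. This applies in three situations:

  \<^item> A KMS state dominated by a multiple of a Gibbs state is a vector functional in the GNS representation of the
    latter, by the Riesz representation theorem. Hence Gibbs states are extremal (\<open>Gibbs_extremal\<close>).

  \<^item> If \<open>\<psi>\<close> is quasi-equivalent to \<open>\<phi>\<close>, the isomorphism of von Neumann algebras, composed with
    \<open>T \<mapsto> T \<otimes> 1\<close>, is such a normal extension. Hence \<open>\<psi>\<close> is a Gibbs state (\<open>quasi_equivalent_KMS\<close>).

  \<^item> Given two admissible triples of one state, Schur's lemma identifies the irreducible representations, and both
    density matrices become Gibbs density matrices of the same state. So they are proportional, and equal because
    both have norm \<open>1\<close> (\<open>admissible_spectrum_unique\<close>). The partition function is therefore well defined.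

  Everything else is a computation with diagonal operators: \<open>e\<^bsup>-sH\<^esup>\<close> is of trace class iff the series
  \<open>\<Sum>\<^sub>e e\<^bsup>-Re(s) h\<^sub>e\<^esup>\<close> converges, its trace is then \<open>\<Sum>\<^sub>e e\<^bsup>-s h\<^sub>e\<^esup>\<close>, and the normalisation
  \<open>\<parallel>\<rho>\<parallel> = 1\<close> means \<open>inf h = 0\<close>. This gives \<open>\<parallel>e\<^bsup>-\<beta>H\<^esup>\<parallel> = 1\<close> for all \<open>\<beta> > 0\<close>, and convergence above the
  critical inverse temperature.

  The operator theory behind this is developed from the definitions: orthogonal projections and adjoints,
  the spectral theorem for positive operators of finite trace, Schur's lemma, the density theorem for
  two vectors, and the density of analytic elements. Square roots come from one fixed-point iteration,
  which serves C*-algebras and operators alike.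
\<close>

section \<open>Inner products\<close>

interpretation cvec: vector_space "scaleC :: complex \<Rightarrow> 'a::complex_vec \<Rightarrow> 'a"
proof
  show "1 *\<^sub>C x = x" for x :: 'a using scaleC_of_real[of 1 x] by simp
qed (simp_all add: scaleC_add_right scaleC_add_left scaleC_scaleC)

lemma scaleR_scaleC: "r *\<^sub>R x = complex_of_real r *\<^sub>C x"
  by (simp add: scaleC_of_real)

lemma cinner_add_left: "cinner (x + y) z = cinner x z + cinner y z"
  by (metis cinner_commute cinner_add_right complex_cnj_add)

lemma cinner_scaleC_left: "cinner (c *\<^sub>C x) y = cnj c * cinner x y"
  by (metis cinner_commute cinner_scaleC_right complex_cnj_mult)

lemma cinner_scaleR_right: "cinner x (r *\<^sub>R y) = r *\<^sub>R cinner x y"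
  by (simp add: scaleR_scaleC cinner_scaleC_right scaleC_complex_def)

lemma cinner_scaleR_left: "cinner (r *\<^sub>R x) y = r *\<^sub>R cinner x y"
  by (simp add: scaleR_scaleC cinner_scaleC_left scaleC_complex_def)

lemma cinner_zero_right [simp]: "cinner x 0 = 0"
  using cinner_scaleC_right[of x 0 0] by simp

lemma cinner_zero_left [simp]: "cinner 0 x = 0"
  using cinner_scaleC_left[of 0 0 x] by simp

lemma cinner_eq_zero_commute: "cinner x y = 0 \<Longrightarrow> cinner y x = 0"
  by (metis cinner_commute complex_cnj_zero)

lemma norm_scaleC_hilbert: "norm (c *\<^sub>C x) = cmod c * norm (x::'h::chilbert_space)"
proof -
  have "complex_of_real ((norm (c *\<^sub>C x))\<^sup>2) = complex_of_real ((cmod c * norm x)\<^sup>2)"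
    unfolding cinner_self[symmetric] cinner_scaleC_left cinner_scaleC_right
    using complex_norm_square[of c] by (simp add: cinner_self power_mult_distrib mult_ac)
  then have "(norm (c *\<^sub>C x))\<^sup>2 = (cmod c * norm x)\<^sup>2"
    using of_real_eq_iff by blast
  then show ?thesis by (simp add: power2_eq_iff_nonneg)
qed

lemma norm_eq_cinner: "(norm x)\<^sup>2 = Re (cinner x x)"
  by (simp add: cinner_self)

lemma norm_add_square:
  "(norm (x + y))\<^sup>2 = (norm x)\<^sup>2 + (norm y)\<^sup>2 + 2 * Re (cinner x (y::'h::chilbert_space))"
proof -
  have "Re (cinner y x) = Re (cinner x y)" by (subst cinner_commute) simp
  moreover have "(norm (x + y))\<^sup>2 = Re (cinner x x + cinner y x + (cinner x y + cinner y y))"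
    unfolding norm_eq_cinner[of "x + y"] cinner_add_left cinner_add_right by simp
  ultimately show ?thesis by (simp add: norm_eq_cinner[of x] norm_eq_cinner[of y])
qed

lemma cinner_minus_right: "cinner x (- y) = - cinner x y"
  using cinner_scaleC_right[of x "-1" y] by simp

lemma cinner_minus_left: "cinner (- x) y = - cinner x y"
  using cinner_scaleC_left[of "-1" x y] by simp

lemma cinner_diff_right: "cinner x (y - z) = cinner x y - cinner x z"
  using cinner_add_right[of x y "- z"] by (simp add: cinner_minus_right)

lemma cinner_diff_left: "cinner (x - y) z = cinner x z - cinner y z"
  using cinner_add_left[of x "- y" z] by (simp add: cinner_minus_left)

lemma Cauchy_Schwarz_cinner: "cmod (cinner x y) \<le> norm x * norm (y::'h::chilbert_space)"
proof (cases "x = 0")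
  case False
  define c where "c = cinner x y / complex_of_real ((norm x)\<^sup>2)"
  have nx: "norm x > 0" using False by simp
  have "0 \<le> (norm (y - c *\<^sub>C x))\<^sup>2" by simp
  also have "(norm (y - c *\<^sub>C x))\<^sup>2
      = (norm y)\<^sup>2 + (cmod c * norm x)\<^sup>2 - 2 * Re (cinner y (c *\<^sub>C x))"
    using norm_add_square[of y "- (c *\<^sub>C x)"] by (simp add: cinner_minus_right norm_scaleC_hilbert)
  also have "Re (cinner y (c *\<^sub>C x)) = (cmod (cinner x y))\<^sup>2 / (norm x)\<^sup>2"
    unfolding cinner_scaleC_right c_def
    by (subst cinner_commute[of y x])
       (simp add: complex_mult_cnj cmod_power2 flip: of_real_power)
  also have "(cmod c * norm x)\<^sup>2 = (cmod (cinner x y))\<^sup>2 / (norm x)\<^sup>2"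
    using nx unfolding c_def norm_divide norm_of_real by (simp add: power2_eq_square field_simps)
  finally have "(cmod (cinner x y))\<^sup>2 / (norm x)\<^sup>2 \<le> (norm y)\<^sup>2" by simp
  then have "(cmod (cinner x y))\<^sup>2 \<le> (norm x * norm y)\<^sup>2"
    using nx by (simp add: field_simps power_mult_distrib)
  then show ?thesis by (rule power2_le_imp_le) simp
qed simp

lemma bounded_bilinear_cinner:
  "bounded_bilinear (cinner :: 'h::chilbert_space \<Rightarrow> 'h \<Rightarrow> complex)"
  by standard (auto simp: cinner_add_left cinner_add_right cinner_scaleR_left cinner_scaleR_right
      intro!: exI[of _ 1] Cauchy_Schwarz_cinner)

lemma bounded_bilinear_scaleC_hilbert:
  "bounded_bilinear (scaleC :: complex \<Rightarrow> 'h::chilbert_space \<Rightarrow> 'h)"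
  by standard (auto simp: scaleC_add_left scaleC_add_right scaleR_scaleC scaleC_scaleC
      norm_scaleC_hilbert scaleC_complex_def mult_ac intro!: exI[of _ 1])

lemma bounded_bilinear_scaleC_cstar:
  "bounded_bilinear (scaleC :: complex \<Rightarrow> 'a::unital_cstar_algebra \<Rightarrow> 'a)"
  by standard (auto simp: scaleC_add_left scaleC_add_right scaleR_scaleC scaleC_scaleC
      norm_scaleC scaleC_complex_def mult_ac intro!: exI[of _ 1])

interpretation cinner: bounded_bilinear "cinner :: 'h::chilbert_space \<Rightarrow> 'h \<Rightarrow> complex"
  by (rule bounded_bilinear_cinner)
interpretation scaleC_hilbert: bounded_bilinear "scaleC :: complex \<Rightarrow> 'h::chilbert_space \<Rightarrow> 'h"
  by (rule bounded_bilinear_scaleC_hilbert)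
interpretation scaleC_cstar: bounded_bilinear "scaleC :: complex \<Rightarrow> 'a::unital_cstar_algebra \<Rightarrow> 'a"
  by (rule bounded_bilinear_scaleC_cstar)

lemma cinner_eqI: "(\<And>z. cinner z x = cinner z y) \<Longrightarrow> x = (y::'h::chilbert_space)"
proof -
  assume "\<And>z. cinner z x = cinner z y"
  then have "cinner (x - y) (x - y) = 0" by (simp add: cinner_diff_right)
  then show "x = y" by (simp add: cinner_self)
qed

lemma cinner_eqI': "(\<And>z. cinner x z = cinner y z) \<Longrightarrow> x = (y::'h::chilbert_space)"
  by (rule cinner_eqI) (metis cinner_commute)

lemma cmod_cinner_commute: "cmod (cinner x y) = cmod (cinner y x)"
  by (metis cinner_commute complex_mod_cnj)

text \<open>The scalars as a Hilbert space make functionals a special case of operators: the adjoint of a bounded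
  functional is then its Riesz representation.\<close>

instantiation complex :: chilbert_space
begin
definition cinner_complex :: "complex \<Rightarrow> complex \<Rightarrow> complex" where "cinner_complex x y = cnj x * y"
instance
proof
  fix x y z c :: complex
  show "cinner x y = cnj (cinner y x)" by (simp add: cinner_complex_def)
  show "cinner x (y + z) = cinner x y + cinner x z" by (simp add: cinner_complex_def distrib_left)
  show "cinner x (c *\<^sub>C y) = c * cinner x y" by (simp add: cinner_complex_def scaleC_complex_def)
  show "cinner x x = complex_of_real ((norm x)\<^sup>2)"
    unfolding cinner_complex_def complex_norm_square by simp
qed
end

text \<open>The direct sum of two Hilbert spaces carries the density theorem for two vectors.\<close>

instantiation prod :: (complex_vec, complex_vec) complex_vec
begin
definition scaleC_prod :: "complex \<Rightarrow> 'a \<times> 'b \<Rightarrow> 'a \<times> 'b" where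
  "scaleC_prod c x = (c *\<^sub>C fst x, c *\<^sub>C snd x)"
instance
  by standard (simp_all only: scaleC_prod_def scaleC_add_left scaleC_add_right scaleC_scaleC
      scaleC_of_real scaleR_prod_def fst_conv snd_conv fst_add snd_add add_Pair)
end

instantiation prod :: (chilbert_space, chilbert_space) chilbert_space
begin
definition cinner_prod :: "'a \<times> 'b \<Rightarrow> 'a \<times> 'b \<Rightarrow> complex" where
  "cinner_prod x y = cinner (fst x) (fst y) + cinner (snd x) (snd y)"
instance
proof
  fix x y z :: "'a \<times> 'b" and c :: complex
  show "cinner x y = cnj (cinner y x)"
    unfolding cinner_prod_def complex_cnj_add by (metis cinner_commute)
  show "cinner x x = complex_of_real ((norm x)\<^sup>2)"
    unfolding cinner_prod_def cinner_self norm_prod_def by simp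
  show "cinner x (y + z) = cinner x y + cinner x z"
    unfolding cinner_prod_def fst_add snd_add cinner_add_right by simp
  show "cinner x (c *\<^sub>C y) = c * cinner x y"
    unfolding cinner_prod_def scaleC_prod_def fst_conv snd_conv cinner_scaleC_right
    by (simp add: distrib_left)
qed
end

section \<open>Bounded complex-linear maps\<close>

text \<open>Bounded complex-linear maps between possibly different spaces; on a single Hilbert space the
  predicate is \<^const>\<open>bounded_clinear\<close>. Likewise \<open>adjoints\<close> below extends \<^const>\<open>adjoint_pair\<close>.\<close>

definition cblin ::
  "('v::{complex_vec, real_normed_vector} \<Rightarrow> 'w::{complex_vec, real_normed_vector}) \<Rightarrow> bool" where
  "cblin f \<longleftrightarrow> clinear f \<and> bounded_linear f"

definition adjoints :: "('h::chilbert_space \<Rightarrow> 'k::chilbert_space) \<Rightarrow> ('k \<Rightarrow> 'h) \<Rightarrow> bool" where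
  "adjoints T S \<longleftrightarrow> (\<forall>x y. cinner (T x) y = cinner x (S y))"

lemma bounded_clinear_eq: "bounded_clinear T \<longleftrightarrow> cblin T"
  by (simp add: bounded_clinear_def cblin_def)

lemma adjoint_pair_eq: "adjoint_pair T S \<longleftrightarrow> adjoints T S"
  by (simp add: adjoint_pair_def adjoints_def)

lemma adjointsD: "adjoints T S \<Longrightarrow> cinner (T x) y = cinner x (S y)"
  by (simp add: adjoints_def)

lemma adjointsD': "adjoints T S \<Longrightarrow> cinner x (T y) = cinner (S x) y"
  using cinner_commute[of x "T y"] cinner_commute[of "S x" y] by (simp add: adjoints_def)

lemma adjoints_sym: "adjoints T S \<Longrightarrow> adjoints S T"
  unfolding adjoints_def[of S T] by (simp add: adjointsD')

lemma adjoints_unique: "adjoints T S \<Longrightarrow> adjoints T S' \<Longrightarrow> S = S'"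
  by (intro ext, rule cinner_eqI) (metis adjointsD)

lemma cblin_bounded_linear: "cblin f \<Longrightarrow> bounded_linear f" by (simp add: cblin_def)
lemma cblin_add: "cblin f \<Longrightarrow> f (x + y) = f x + f y" by (simp add: cblin_def clinear_def)
lemma cblin_scaleC: "cblin f \<Longrightarrow> f (c *\<^sub>C x) = c *\<^sub>C f x" by (simp add: cblin_def clinear_def)
lemma cblin_zero: "cblin f \<Longrightarrow> f 0 = 0" by (simp add: cblin_def linear_simps)
lemma cblin_diff: "cblin f \<Longrightarrow> f (x - y) = f x - f y" by (simp add: cblin_def linear_simps)
lemma cblin_sum: "cblin f \<Longrightarrow> f (sum g I) = (\<Sum>i\<in>I. f (g i))"
  by (simp add: cblin_def bounded_linear.linear linear_sum)
lemma cblin_has_sum: "cblin f \<Longrightarrow> (g has_sum s) I \<Longrightarrow> ((\<lambda>i. f (g i)) has_sum f s) I"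
  by (simp add: cblin_def has_sum_bounded_linear)
lemma cblin_tendsto: "cblin f \<Longrightarrow> (g \<longlongrightarrow> l) F \<Longrightarrow> ((\<lambda>x. f (g x)) \<longlongrightarrow> f l) F"
  by (simp add: cblin_def bounded_linear.tendsto)
lemma cblin_continuous_on: "cblin f \<Longrightarrow> continuous_on S f"
  by (simp add: cblin_def linear_continuous_on)

lemma cblin_bound: "cblin f \<Longrightarrow> \<exists>C>0. \<forall>x. norm (f x) \<le> C * norm x"
  unfolding cblin_def by (metis bounded_linear.pos_bounded mult.commute)

lemma clinear_scaleR: "clinear f \<Longrightarrow> f (r *\<^sub>R x) = r *\<^sub>R f x"
  by (simp add: clinear_def scaleR_scaleC)

lemma clinear_diff: "clinear f \<Longrightarrow> f (x - y) = f x - f y"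
  unfolding clinear_def by (metis add_diff_cancel diff_add_cancel)

lemma clinear_zero: "clinear f \<Longrightarrow> f 0 = 0"
  unfolding clinear_def by (metis add_cancel_right_right)

lemma cblinI:
  assumes "clinear f" "\<And>x. norm (f x) \<le> C * norm x"
  shows "cblin f"
proof -
  have "bounded_linear f"
    using assms clinear_scaleR[OF assms(1)]
    by (intro bounded_linear_intro[of f C]) (auto simp: clinear_def mult.commute)
  then show ?thesis using assms by (simp add: cblin_def)
qed

text \<open>Linearity is automatic for a map that has an adjoint, which saves checking it for operators defined by
  infinite series.\<close>

lemma clinear_of_adjoints:
  assumes "adjoints T S" shows "clinear T"
  unfolding clinear_def
  by (intro conjI allI; rule cinner_eqI';
      simp add: adjointsD[OF assms] cinner_add_left cinner_scaleC_left)

lemma cblin_adjointsI: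
  assumes "adjoints T S" "\<And>x. norm (T x) \<le> C * norm x"
  shows "cblin T"
  using cblinI[OF clinear_of_adjoints] assms by blast

lemma cblin_comp: "cblin f \<Longrightarrow> cblin g \<Longrightarrow> cblin (f \<circ> g)"
  unfolding cblin_def clinear_def using bounded_linear_compose[of f g] by (auto simp: comp_def)

lemma cblin_compose: "cblin f \<Longrightarrow> cblin g \<Longrightarrow> cblin (\<lambda>x. f (g x))"
  using cblin_comp[of f g] by (simp add: comp_def)

lemma cblin_id: "cblin (\<lambda>x. x)" by (simp add: cblin_def clinear_def)

lemma cblin_plus: "cblin f \<Longrightarrow> cblin g \<Longrightarrow> cblin (\<lambda>x. f x + g x)"
  unfolding cblin_def clinear_def by (auto simp: bounded_linear_add scaleC_add_right)

lemma cblin_minus: "cblin f \<Longrightarrow> cblin g \<Longrightarrow> cblin (\<lambda>x. f x - g x)"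
  unfolding cblin_def clinear_def
  by (auto simp: bounded_linear_sub cvec.scale_right_diff_distrib)

lemma cblin_scale: "cblin f \<Longrightarrow> cblin (\<lambda>x. c *\<^sub>C (f x :: 'h::chilbert_space))"
  unfolding cblin_def clinear_def
  by (auto simp: scaleC_add_right scaleC_scaleC mult.commute
      intro: bounded_linear_compose[OF scaleC_hilbert.bounded_linear_right])

lemma cblin_cinner: "cblin (\<lambda>x. cinner v x)"
  by (rule cblinI[of _ "norm v"])
     (auto simp: clinear_def cinner_add_right cinner_scaleC_right scaleC_complex_def
       Cauchy_Schwarz_cinner)

lemma adjoints_scale: "adjoints T S \<Longrightarrow> adjoints (\<lambda>x. c *\<^sub>C T x) (\<lambda>x. cnj c *\<^sub>C S x)"
  by (simp add: adjoints_def cinner_scaleC_left cinner_scaleC_right)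

lemma cblin_eq_on_closure:
  assumes "cblin f" "cblin g" "\<And>x. x \<in> S \<Longrightarrow> f x = g x" "x \<in> closure S"
  shows "f x = g x"
proof -
  have "closed {x. f x = g x}"
    using assms(1,2)[THEN cblin_continuous_on, of UNIV] by (intro closed_Collect_eq) auto
  then have "closure S \<subseteq> {x. f x = g x}" using assms(3) by (intro closure_minimal) auto
  then show ?thesis using assms(4) by auto
qed

definition rank1 :: "'h::chilbert_space \<Rightarrow> 'h \<Rightarrow> 'h \<Rightarrow> 'h" where
  "rank1 x y = (\<lambda>z. cinner y z *\<^sub>C x)"

lemma cblin_rank1: "cblin (rank1 x y)"
proof (rule cblinI[of _ "norm y * norm x"])
  show "clinear (rank1 x y)"
    by (simp add: rank1_def clinear_def cinner_add_right scaleC_add_left cinner_scaleC_right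
        scaleC_scaleC)
  show "norm (rank1 x y z) \<le> norm y * norm x * norm z" for z
    using mult_right_mono[OF Cauchy_Schwarz_cinner[of y z], of "norm x"]
    by (simp add: rank1_def norm_scaleC_hilbert mult_ac)
qed

lemma adjoints_rank1: "adjoints (rank1 x y) (rank1 y x)"
  unfolding adjoints_def rank1_def
  by (simp add: cinner_scaleC_left cinner_scaleC_right mult.commute flip: cinner_commute)

lemma comp_rank1: "cblin T \<Longrightarrow> T \<circ> rank1 x y = rank1 (T x) y"
  by (auto simp: rank1_def cblin_scaleC)

lemma rank1_comp: "adjoints T S \<Longrightarrow> rank1 x y \<circ> T = rank1 x (S y)"
  by (auto simp: rank1_def adjointsD')

lemma rank1_comp_rank1: "rank1 x y \<circ> rank1 z w = (\<lambda>v. cinner y z *\<^sub>C rank1 x w v)"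
  by (auto simp: rank1_def cinner_scaleC_right scaleC_scaleC mult.commute)

section \<open>Orthogonal series\<close>

lemma norm_sum_orthogonal:
  fixes v :: "'i \<Rightarrow> 'h::chilbert_space"
  assumes "finite F" "\<And>i j. i \<in> F \<Longrightarrow> j \<in> F \<Longrightarrow> i \<noteq> j \<Longrightarrow> cinner (v i) (v j) = 0"
  shows "(norm (sum v F))\<^sup>2 = (\<Sum>i\<in>F. (norm (v i))\<^sup>2)"
  using assms
proof (induction F)
  case (insert i F)
  have "cinner (v i) (sum v F) = 0"
    unfolding cinner.sum_right using insert.hyps by (intro sum.neutral ballI insert.prems) auto
  moreover have "(norm (sum v F))\<^sup>2 = (\<Sum>i\<in>F. (norm (v i))\<^sup>2)"
    by (rule insert.IH, rule insert.prems) auto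
  ultimately show ?case using insert.hyps by (simp add: norm_add_square)
qed simp

text \<open>By Pythagoras, the difference of two partial sums has as squared norm the difference of partial sums of
  the squared norms, so the Cauchy property carries over.\<close>

lemma summable_orthogonal:
  fixes v :: "'i \<Rightarrow> 'h::chilbert_space"
  assumes orth: "\<And>i j. i \<in> I \<Longrightarrow> j \<in> I \<Longrightarrow> i \<noteq> j \<Longrightarrow> cinner (v i) (v j) = 0"
    and summ: "(\<lambda>i. (norm (v i))\<^sup>2) summable_on I"
  shows "v summable_on I"
proof -
  let ?q = "\<lambda>F. \<Sum>i\<in>F. (norm (v i))\<^sup>2"
  obtain L where lim: "(?q \<longlongrightarrow> L) (finite_subsets_at_top I)"
    using summ unfolding summable_on_def has_sum_def by blast
  have "\<exists>P. eventually P (finite_subsets_at_top I) \<and>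
              (\<forall>F F'. P F \<and> P F' \<longrightarrow> dist (sum v F) (sum v F') < e)" if "e > 0" for e
  proof -
    \<comment> \<open>Two partial sums of the squares then differ by at most \<open>(e/4)\<^sup>2\<close>.\<close>
    have "eventually (\<lambda>F. dist (?q F) L < e\<^sup>2 / 32) (finite_subsets_at_top I)"
      using lim \<open>e > 0\<close> by (intro tendstoD) auto
    then have "\<exists>G. finite G \<and> G \<subseteq> I \<and>
        (\<forall>F. finite F \<and> G \<subseteq> F \<and> F \<subseteq> I \<longrightarrow> dist (?q F) L < e\<^sup>2 / 32)"
      by (simp only: eventually_finite_subsets_at_top)
    then obtain G where GG: "finite G \<and> G \<subseteq> I \<and>
        (\<forall>F. finite F \<and> G \<subseteq> F \<and> F \<subseteq> I \<longrightarrow> dist (?q F) L < e\<^sup>2 / 32)"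
      by (rule exE)
    then have G: "finite G" "G \<subseteq> I" by simp_all
    have GF: "dist (?q F) L < e\<^sup>2 / 32" if "finite F" "G \<subseteq> F" "F \<subseteq> I" for F
      using GG that by blast
    have close: "dist (sum v F) (sum v G) \<le> e / 4" if "finite F" "G \<subseteq> F" "F \<subseteq> I" for F
    proof -
      have "(dist (sum v F) (sum v G))\<^sup>2 = (norm (sum v (F - G)))\<^sup>2"
        unfolding dist_norm using sum_diff[OF that(1,2), of v] by simp
      also have "\<dots> = ?q (F - G)"
        using that by (intro norm_sum_orthogonal orth) auto
      also have "\<dots> = ?q F - ?q G" using that by (intro sum_diff)
      also have "\<dots> \<le> (e / 4)\<^sup>2"
      proof -
        have "(e / 4)\<^sup>2 = e\<^sup>2 / 16" by (simp add: power_divide)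
        moreover have "0 \<le> e\<^sup>2" by simp
        ultimately show ?thesis
          using GF[OF that] GF[OF G(1) order_refl G(2)] unfolding dist_real_def by linarith
      qed
      finally show ?thesis by (rule power2_le_imp_le) (use \<open>e > 0\<close> in simp)
    qed
    show ?thesis
    proof (intro exI conjI allI impI)
      show "eventually (\<lambda>F. finite F \<and> G \<subseteq> F \<and> F \<subseteq> I) (finite_subsets_at_top I)"
        unfolding eventually_finite_subsets_at_top by (intro exI[of _ G]) (use G in simp)
      fix F F' assume H: "(finite F \<and> G \<subseteq> F \<and> F \<subseteq> I) \<and> finite F' \<and> G \<subseteq> F' \<and> F' \<subseteq> I"
      have "dist (sum v F) (sum v G) \<le> e / 4" by (rule close) (use H in simp_all)
      moreover have "dist (sum v F') (sum v G) \<le> e / 4" by (rule close) (use H in simp_all)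
      ultimately show "dist (sum v F) (sum v F') < e"
        using dist_triangle2[of "sum v F" "sum v F'" "sum v G"] \<open>e > 0\<close> by linarith
    qed
  qed
  then have "cauchy_filter (filtermap (sum v) (finite_subsets_at_top I))"
    by (simp only: cauchy_filter_metric_filtermap) simp
  then have "convergent_filter (filtermap (sum v) (finite_subsets_at_top I))"
    by (simp only: convergent_filter_iff_cauchy)
  then show ?thesis
    by (simp only: convergent_filter_iff filterlim_def summable_on_def has_sum_def)
qed

text \<open>The hypothesis on \<open>u\<close> says that \<open>u - v i\<close> is orthogonal to \<open>v i\<close>, so \<open>u - s\<close> is orthogonal to \<open>s\<close> for
  each finite partial sum \<open>s\<close>. This is Bessel's inequality for orthogonal subspaces instead of vectors.\<close>

lemma orthogonal_parts:
  fixes v :: "'i \<Rightarrow> 'h::chilbert_space"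
  assumes orth: "\<And>i j. i \<in> I \<Longrightarrow> j \<in> I \<Longrightarrow> i \<noteq> j \<Longrightarrow> cinner (v i) (v j) = 0"
    and part: "\<And>i. i \<in> I \<Longrightarrow> cinner (v i) u = complex_of_real ((norm (v i))\<^sup>2)"
  shows "(\<lambda>i. (norm (v i))\<^sup>2) summable_on I" and "(\<Sum>\<^sub>\<infinity>i\<in>I. (norm (v i))\<^sup>2) \<le> (norm u)\<^sup>2"
    and "v summable_on I"
proof -
  have fin: "(\<Sum>i\<in>F. (norm (v i))\<^sup>2) \<le> (norm u)\<^sup>2" if F: "finite F" "F \<subseteq> I" for F
  proof -
    define s where "s = sum v F"
    have ns: "(norm s)\<^sup>2 = (\<Sum>i\<in>F. (norm (v i))\<^sup>2)"
      unfolding s_def by (rule norm_sum_orthogonal[OF F(1)]) (use F(2) in \<open>auto intro!: orth\<close>)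
    have "cinner s u = (\<Sum>i\<in>F. complex_of_real ((norm (v i))\<^sup>2))"
      unfolding s_def cinner.sum_left by (rule sum.cong[OF refl]) (rule part[OF subsetD[OF F(2)]])
    then have eq: "cinner s u = complex_of_real ((norm s)\<^sup>2)" unfolding ns by simp
    \<comment> \<open>Cauchy-Schwarz for \<open>\<langle>s, u\<rangle> = \<parallel>s\<parallel>\<^sup>2\<close>.\<close>
    have "(norm s)\<^sup>2 \<le> norm s * norm u" using Cauchy_Schwarz_cinner[of s u] unfolding eq norm_of_real by simp
    then have "norm s \<le> norm u" by (cases "norm s = 0") (simp_all add: power2_eq_square)
    then show ?thesis unfolding ns[symmetric] by (rule power_mono) simp
  qed
  show s: "(\<lambda>i. (norm (v i))\<^sup>2) summable_on I"
    by (rule nonneg_bdd_above_summable_on, simp, rule bdd_aboveI2[where M = "(norm u)\<^sup>2"]) (use fin in simp)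
  then show "(\<Sum>\<^sub>\<infinity>i\<in>I. (norm (v i))\<^sup>2) \<le> (norm u)\<^sup>2"
    by (rule infsum_le_finite_sums) (rule fin)
  show "v summable_on I" by (rule summable_orthogonal[OF orth s])
qed

lemma has_sum_norm_orthogonal:
  fixes v :: "'i \<Rightarrow> 'h::chilbert_space"
  assumes orth: "\<And>i j. i \<in> I \<Longrightarrow> j \<in> I \<Longrightarrow> i \<noteq> j \<Longrightarrow> cinner (v i) (v j) = 0"
    and s: "(v has_sum s) I"
  shows "((\<lambda>i. (norm (v i))\<^sup>2) has_sum (norm s)\<^sup>2) I"
proof -
  have vs: "cinner (v j) s = complex_of_real ((norm (v j))\<^sup>2)" if "j \<in> I" for j
  proof -
    have "((\<lambda>i. cinner (v j) (v i)) has_sum cinner (v j) s) I"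
      using s by (rule cblin_has_sum[OF cblin_cinner])
    moreover have "((\<lambda>i. cinner (v j) (v i)) has_sum cinner (v j) (v j)) I"
      using that orth by (intro has_sum_finite_neutralI[of "{j}"]) auto
    ultimately show ?thesis unfolding cinner_self[symmetric] by (rule has_sum_unique)
  qed
  have sv: "cinner s (v j) = complex_of_real ((norm (v j))\<^sup>2)" if "j \<in> I" for j
    unfolding cinner_commute[of s "v j"] vs[OF that] by simp
  have "((\<lambda>i. cinner s (v i)) has_sum cinner s s) I"
    using s by (rule cblin_has_sum[OF cblin_cinner])
  then have "((\<lambda>i. complex_of_real ((norm (v i))\<^sup>2)) has_sum complex_of_real ((norm s)\<^sup>2)) I"
    unfolding cinner_self using has_sum_cong[of I _ _ "complex_of_real ((norm s)\<^sup>2)", OF sv] by simp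
  then show ?thesis by (simp only: has_sum_of_real_iff)
qed

definition orthonormal_family :: "'i set \<Rightarrow> ('i \<Rightarrow> 'h::chilbert_space) \<Rightarrow> bool" where
  "orthonormal_family I b \<longleftrightarrow> (\<forall>i\<in>I. \<forall>j\<in>I. cinner (b i) (b j) = (if i = j then 1 else 0))"

lemma orthonormal_familyD:
  "orthonormal_family I b \<Longrightarrow> i \<in> I \<Longrightarrow> j \<in> I \<Longrightarrow> cinner (b i) (b j) = (if i = j then 1 else 0)"
  by (simp add: orthonormal_family_def)

lemma norm_eq_1_cinner: "cinner x x = 1 \<longleftrightarrow> norm (x::'h::chilbert_space) = 1"
proof -
  have "cinner x x = 1 \<longleftrightarrow> (norm x)\<^sup>2 = 1"
    unfolding cinner_self using of_real_eq_iff[of "(norm x)\<^sup>2" 1, where ?'a=complex] by simp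
  also have "\<dots> \<longleftrightarrow> norm x = 1" using power2_eq_iff_nonneg[of "norm x" 1] by simp
  finally show ?thesis .
qed

lemma orthonormal_family_norm: "orthonormal_family I b \<Longrightarrow> i \<in> I \<Longrightarrow> norm (b i) = 1"
  using orthonormal_familyD[of I b i i] by (simp flip: norm_eq_1_cinner)

lemma Bessel:
  assumes b: "orthonormal_family I b"
  shows "(\<lambda>i. (cmod (cinner (b i) x))\<^sup>2) summable_on I"
    and "(\<Sum>\<^sub>\<infinity>i\<in>I. (cmod (cinner (b i) x))\<^sup>2) \<le> (norm x)\<^sup>2"
proof -
  let ?v = "\<lambda>i. cinner (b i) x *\<^sub>C b i"
  have n: "(norm (?v i))\<^sup>2 = (cmod (cinner (b i) x))\<^sup>2" if "i \<in> I" for i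
    by (simp add: norm_scaleC_hilbert orthonormal_family_norm[OF b that])
  have part: "cinner (?v i) x = complex_of_real ((norm (?v i))\<^sup>2)" if "i \<in> I" for i
    unfolding n[OF that] cinner_scaleC_left complex_norm_square by (rule mult.commute)
  have orth: "cinner (?v i) (?v j) = 0" if "i \<in> I" "j \<in> I" "i \<noteq> j" for i j
    using that by (simp add: cinner_scaleC_left cinner_scaleC_right orthonormal_familyD[OF b])
  note parts = orthogonal_parts(1,2)[of I ?v x, OF orth part]
  show "(\<lambda>i. (cmod (cinner (b i) x))\<^sup>2) summable_on I"
    by (rule summable_on_cong[THEN iffD1, OF n parts(1)])
  show "(\<Sum>\<^sub>\<infinity>i\<in>I. (cmod (cinner (b i) x))\<^sup>2) \<le> (norm x)\<^sup>2"
    by (rule order_trans[OF eq_refl parts(2)], rule infsum_cong) (simp add: n)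
qed

text \<open>The operator \<open>\<Sum>\<^sub>i d\<^sub>i |g\<^sub>i\<rangle>\<langle>b\<^sub>i|\<close> between two orthonormal families: it yields projections, diagonal
  operators and partial isometries.\<close>

definition family_op ::
  "'i set \<Rightarrow> ('i \<Rightarrow> 'h::chilbert_space) \<Rightarrow> ('i \<Rightarrow> 'k::chilbert_space) \<Rightarrow> ('i \<Rightarrow> complex) \<Rightarrow> 'h \<Rightarrow> 'k" where
  "family_op I b g d x = (\<Sum>\<^sub>\<infinity>i\<in>I. (d i * cinner (b i) x) *\<^sub>C g i)"

context
  fixes I :: "'i set" and b :: "'i \<Rightarrow> 'h::chilbert_space" and g :: "'i \<Rightarrow> 'k::chilbert_space"
    and d :: "'i \<Rightarrow> complex" and C :: real
  assumes b: "orthonormal_family I b" and g: "orthonormal_family I g"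
    and d: "\<And>i. i \<in> I \<Longrightarrow> cmod (d i) \<le> C"
begin

lemma family_op_has_sum: "((\<lambda>i. (d i * cinner (b i) x) *\<^sub>C g i) has_sum family_op I b g d x) I"
proof -
  have "(\<lambda>i. (norm ((d i * cinner (b i) x) *\<^sub>C g i))\<^sup>2) summable_on I"
  proof (rule summable_on_comparison_test)
    show "(\<lambda>i. C\<^sup>2 * (cmod (cinner (b i) x))\<^sup>2) summable_on I"
      by (intro summable_on_cmult_right Bessel[OF b])
    fix i assume "i \<in> I"
    then have "(cmod (d i))\<^sup>2 \<le> C\<^sup>2" using d by (intro power_mono) auto
    then show "(norm ((d i * cinner (b i) x) *\<^sub>C g i))\<^sup>2 \<le> C\<^sup>2 * (cmod (cinner (b i) x))\<^sup>2"
      unfolding norm_scaleC_hilbert orthonormal_family_norm[OF g \<open>i \<in> I\<close>] norm_mult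
        power_mult_distrib
      by (simp add: mult_right_mono)
  qed auto
  then have "(\<lambda>i. (d i * cinner (b i) x) *\<^sub>C g i) summable_on I"
    by (intro summable_orthogonal)
       (auto simp: cinner_scaleC_left cinner_scaleC_right orthonormal_familyD[OF g])
  then show ?thesis unfolding family_op_def by simp
qed

lemma cinner_family_op: "i \<in> I \<Longrightarrow> cinner (g i) (family_op I b g d x) = d i * cinner (b i) x"
proof -
  assume i: "i \<in> I"
  have "((\<lambda>j. cinner (g i) ((d j * cinner (b j) x) *\<^sub>C g j)) has_sum cinner (g i) (family_op I b g d x)) I"
    by (rule cblin_has_sum[OF cblin_cinner family_op_has_sum])
  moreover have "((\<lambda>j. cinner (g i) ((d j * cinner (b j) x) *\<^sub>C g j)) has_sum (d i * cinner (b i) x)) I"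
    using i by (intro has_sum_finite_neutralI[of "{i}"])
      (auto simp: cinner_scaleC_right orthonormal_familyD[OF g])
  ultimately show ?thesis by (rule has_sum_unique)
qed

lemma norm_family_op_le:
  assumes "0 \<le> C" shows "norm (family_op I b g d x) \<le> C * norm x"
proof -
  have "((\<lambda>i. (norm ((d i * cinner (b i) x) *\<^sub>C g i))\<^sup>2) has_sum (norm (family_op I b g d x))\<^sup>2) I"
    by (rule has_sum_norm_orthogonal[OF _ family_op_has_sum])
       (auto simp: cinner_scaleC_left cinner_scaleC_right orthonormal_familyD[OF g])
  moreover have "((\<lambda>i. C\<^sup>2 * (cmod (cinner (b i) x))\<^sup>2) has_sum
      C\<^sup>2 * (\<Sum>\<^sub>\<infinity>i\<in>I. (cmod (cinner (b i) x))\<^sup>2)) I"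
    by (intro has_sum_cmult_right has_sum_infsum Bessel[OF b])
  ultimately have "(norm (family_op I b g d x))\<^sup>2 \<le> C\<^sup>2 * (\<Sum>\<^sub>\<infinity>i\<in>I. (cmod (cinner (b i) x))\<^sup>2)"
  proof (rule has_sum_mono)
    fix i assume "i \<in> I"
    then have "(cmod (d i))\<^sup>2 \<le> C\<^sup>2" using d by (intro power_mono) auto
    then show "(norm ((d i * cinner (b i) x) *\<^sub>C g i))\<^sup>2 \<le> C\<^sup>2 * (cmod (cinner (b i) x))\<^sup>2"
      unfolding norm_scaleC_hilbert orthonormal_family_norm[OF g \<open>i \<in> I\<close>] norm_mult
        power_mult_distrib
      by (simp add: mult_right_mono)
  qed
  also have "\<dots> \<le> C\<^sup>2 * (norm x)\<^sup>2" by (intro mult_left_mono Bessel[OF b]) auto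
  finally have "(norm (family_op I b g d x))\<^sup>2 \<le> (C * norm x)\<^sup>2" by (simp add: power_mult_distrib)
  then show ?thesis by (rule power2_le_imp_le) (simp add: assms)
qed

lemma family_op_bound_ge_0: "norm (family_op I b g d x) \<le> \<bar>C\<bar> * norm x"
proof (cases "I = {}")
  case False
  then obtain i where "i \<in> I" by auto
  then have "0 \<le> C" using d[of i] norm_ge_zero[of "d i"] by linarith
  then show ?thesis using norm_family_op_le by simp
qed (simp add: family_op_def)

lemma cblin_family_op: "cblin (family_op I b g d)"
proof (rule cblinI)
  show "clinear (family_op I b g d)"
    unfolding clinear_def
  proof (intro conjI allI)
    show "family_op I b g d (x + y) = family_op I b g d x + family_op I b g d y" for x y
      using has_sum_add[OF family_op_has_sum[of x] family_op_has_sum[of y]]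
      by (intro has_sum_unique[OF family_op_has_sum])
         (simp add: cinner_add_right scaleC_add_left distrib_left)
    show "family_op I b g d (c *\<^sub>C x) = c *\<^sub>C family_op I b g d x" for c x
      using cblin_has_sum[OF cblin_scale[OF cblin_id, of c] family_op_has_sum[of x]]
      by (intro has_sum_unique[OF family_op_has_sum])
         (simp add: cinner_scaleC_right scaleC_scaleC mult_ac)
  qed
qed (rule family_op_bound_ge_0)

lemma cinner_family_op_orth: "(\<And>i. i \<in> I \<Longrightarrow> cinner (g i) y = 0) \<Longrightarrow> cinner y (family_op I b g d x) = 0"
proof -
  assume *: "\<And>i. i \<in> I \<Longrightarrow> cinner (g i) y = 0"
  have "((\<lambda>i. cinner y ((d i * cinner (b i) x) *\<^sub>C g i)) has_sum cinner y (family_op I b g d x)) I"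
    by (rule cblin_has_sum[OF cblin_cinner family_op_has_sum])
  moreover have "((\<lambda>i. cinner y ((d i * cinner (b i) x) *\<^sub>C g i)) has_sum 0) I"
    using * by (intro has_sum_0) (simp add: cinner_scaleC_right cinner_eq_zero_commute)
  ultimately show ?thesis by (rule has_sum_unique)
qed

end

lemma adjoints_family_op:
  assumes b: "orthonormal_family I b" and g: "orthonormal_family I g"
    and d: "\<And>i. i \<in> I \<Longrightarrow> cmod (d i) \<le> C"
  shows "adjoints (family_op I b g d) (family_op I g b (\<lambda>i. cnj (d i)))"
  unfolding adjoints_def
proof (intro allI)
  fix x y
  have d': "\<And>i. i \<in> I \<Longrightarrow> cmod (cnj (d i)) \<le> C" using d by simp
  have "((\<lambda>i. cinner y ((d i * cinner (b i) x) *\<^sub>C g i)) has_sum cinner y (family_op I b g d x)) I"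
    by (rule cblin_has_sum[OF cblin_cinner family_op_has_sum[OF b g d]])
  then have "((\<lambda>i. cnj (cinner y ((d i * cinner (b i) x) *\<^sub>C g i))) has_sum
      cnj (cinner y (family_op I b g d x))) I"
    by (simp only: has_sum_cnj_iff)
  moreover have "cnj (cinner y ((d i * cinner (b i) x) *\<^sub>C g i)) =
      cinner x ((cnj (d i) * cinner (g i) y) *\<^sub>C b i)" for i
    unfolding cinner_scaleC_right complex_cnj_mult
    by (simp add: cinner_commute[of "b i" x] cinner_commute[of y "g i"])
  moreover have "cnj (cinner y (family_op I b g d x)) = cinner (family_op I b g d x) y"
    by (rule cinner_commute[symmetric])
  ultimately have "((\<lambda>i. cinner x ((cnj (d i) * cinner (g i) y) *\<^sub>C b i)) has_sum
      cinner (family_op I b g d x) y) I"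
    by (simp only:)
  then show "cinner (family_op I b g d x) y = cinner x (family_op I g b (\<lambda>i. cnj (d i)) y)"
    by (rule has_sum_unique[OF _ cblin_has_sum[OF cblin_cinner family_op_has_sum[OF g b d']]])
qed

section \<open>Orthonormal bases, projections and adjoints\<close>

text \<open>Zorn's lemma, with the vectors restricted to a set \<open>P\<close>: for a closed subspace \<open>P\<close> it gives a basis of
  \<open>P\<close> and hence the projection onto it, for the eigenvectors of an operator it gives an eigenbasis.\<close>

lemma maximal_orthonormal_subset:
  fixes P :: "'h::chilbert_space set"
  shows "\<exists>E\<subseteq>P. orthonormal_family E (\<lambda>x. x) \<and>
    (\<forall>x\<in>P. norm x = 1 \<longrightarrow> (\<exists>e\<in>E. cinner e x \<noteq> 0))"
proof -
  let ?A = "{E. E \<subseteq> P \<and> orthonormal_family E (\<lambda>x. x)}"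
  have "\<exists>M\<in>?A. \<forall>X\<in>?A. M \<subseteq> X \<longrightarrow> X = M"
  proof (rule subset_Zorn')
    fix C assume C: "subset.chain ?A C"
    have sub: "E \<in> C \<Longrightarrow> E \<subseteq> P \<and> orthonormal_family E (\<lambda>x. x)" for E
      using C by (auto simp: subset.chain_def)
    have "cinner x y = (if x = y then 1 else 0)" if xy: "x \<in> \<Union>C" "y \<in> \<Union>C" for x y
    proof -
      obtain E F where EF: "E \<in> C" "x \<in> E" "F \<in> C" "y \<in> F" using xy by blast
      then have "E \<subseteq> F \<or> F \<subseteq> E" using C by (auto simp: subset_chain_def)
      then obtain G where "G \<in> C" "x \<in> G" "y \<in> G" using EF by blast
      then show ?thesis using sub[of G] by (simp add: orthonormal_family_def)
    qed
    then have "orthonormal_family (\<Union>C) (\<lambda>x. x)" by (simp add: orthonormal_family_def)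
    then show "\<Union>C \<in> ?A" using sub by blast
  qed
  then obtain M where MA: "M \<in> ?A" and mx: "\<forall>X\<in>?A. M \<subseteq> X \<longrightarrow> X = M" by (rule bexE)
  have M: "M \<subseteq> P" "orthonormal_family M (\<lambda>x. x)" using MA by simp_all
  have max: "X = M" if "X \<subseteq> P" "orthonormal_family X (\<lambda>x. x)" "M \<subseteq> X" for X
    using mx that by simp
  have "\<exists>e\<in>M. cinner e x \<noteq> 0" if x: "x \<in> P" "norm x = 1" for x
  proof (rule ccontr)
    assume "\<not> ?thesis"
    then have 0: "cinner e x = 0" "cinner x e = 0" if "e \<in> M" for e
      using that cinner_eq_zero_commute by blast+
    have xM: "x \<notin> M" using 0(1)[of x] x(2) by (auto simp: norm_eq_1_cinner[THEN iffD2])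
    have "orthonormal_family (insert x M) (\<lambda>x. x)"
      using M(2) 0 x(2) xM unfolding orthonormal_family_def by (auto simp: norm_eq_1_cinner)
    then have "insert x M = M" by (intro max) (use M x in auto)
    then have "x \<in> M" by blast
    then have "cinner x x = 0" by (rule 0)
    then show False using x(2) by (simp add: norm_eq_1_cinner[THEN iffD2])
  qed
  then show ?thesis using M by blast
qed

lemma is_onb_iff:
  "is_onb B \<longleftrightarrow> orthonormal_family B (\<lambda>x. x) \<and> (\<forall>x. (\<forall>e\<in>B. cinner e x = 0) \<longrightarrow> x = 0)"
  unfolding is_onb_def orthonormal_family_def by (auto simp: norm_eq_1_cinner)

lemma is_onb_orthonormal: "is_onb B \<Longrightarrow> orthonormal_family B (\<lambda>x. x)"
  by (simp add: is_onb_iff)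

lemma onb_coords_eqI:
  assumes "is_onb B" "\<And>e. e \<in> B \<Longrightarrow> cinner e x = cinner e y" shows "x = y"
proof -
  have "\<forall>e\<in>B. cinner e (x - y) = 0" using assms(2) by (simp add: cinner_diff_right)
  then have "x - y = 0" using assms(1) unfolding is_onb_iff by blast
  then show ?thesis by simp
qed

lemma onb_expansion:
  assumes B: "is_onb B" shows "((\<lambda>e. cinner e x *\<^sub>C e) has_sum x) B"
proof -
  note o = is_onb_orthonormal[OF B]
  have "family_op B (\<lambda>x. x) (\<lambda>x. x) (\<lambda>_. 1) x = x"
    by (rule onb_coords_eqI[OF B]) (simp add: cinner_family_op[OF o o, of "\<lambda>_. 1" 1])
  then show ?thesis using family_op_has_sum[OF o o, of "\<lambda>_. 1" 1 x] by simp
qed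

lemma onb_Parseval:
  assumes B: "is_onb B" shows "((\<lambda>e. cinner x e * cinner e y) has_sum cinner x y) B"
  using cblin_has_sum[OF cblin_cinner onb_expansion[OF B, of y], of x]
  by (simp add: cinner_scaleC_right mult.commute)

lemma onb_norm: 
  assumes B: "is_onb B" shows "((\<lambda>e. (cmod (cinner e x))\<^sup>2) has_sum (norm x)\<^sup>2) B"
proof -
  have "((\<lambda>e. (norm (cinner e x *\<^sub>C e))\<^sup>2) has_sum (norm x)\<^sup>2) B"
    by (rule has_sum_norm_orthogonal[OF _ onb_expansion[OF B]])
       (use B in \<open>auto simp: is_onb_def cinner_scaleC_left cinner_scaleC_right\<close>)
  then show ?thesis
    by (rule has_sum_cong[THEN iffD1, rotated])
       (use B in \<open>simp add: norm_scaleC_hilbert is_onb_def\<close>)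
qed

lemma ex_onb: "\<exists>B::'h::chilbert_space set. is_onb B"
proof -
  obtain E :: "'h set" where E: "orthonormal_family E (\<lambda>x. x)"
    and max: "\<And>x. norm x = 1 \<Longrightarrow> \<exists>e\<in>E. cinner e x \<noteq> 0"
    using maximal_orthonormal_subset[of UNIV] by auto
  have "x = 0" if x: "\<forall>e\<in>E. cinner e x = 0" for x
  proof (rule ccontr)
    assume "x \<noteq> 0"
    then have "norm (x /\<^sub>R norm x) = 1" by simp
    then show False using max x by (fastforce simp: cinner_scaleR_right)
  qed
  then show ?thesis using E by (auto simp: is_onb_iff)
qed

lemma closed_csubspace_has_sum:
  assumes K: "closed_csubspace K" and f: "\<And>i. i \<in> I \<Longrightarrow> f i \<in> K" and s: "(f has_sum s) I"
  shows "s \<in> K"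
proof -
  have fin: "finite F \<Longrightarrow> F \<subseteq> I \<Longrightarrow> sum f F \<in> K" for F
    by (induction F rule: finite_induct) (use K f in \<open>auto simp: closed_csubspace_def\<close>)
  show ?thesis
  proof (rule Lim_in_closed_set)
    show "closed K" using K by (simp add: closed_csubspace_def)
    show "(sum f \<longlongrightarrow> s) (finite_subsets_at_top I)" using s by (simp add: has_sum_def)
    show "\<forall>\<^sub>F F in finite_subsets_at_top I. sum f F \<in> K"
      by (rule eventually_finite_subsets_at_top_weakI) (rule fin)
  qed simp
qed

lemma closed_csubspace_diff: "closed_csubspace K \<Longrightarrow> x \<in> K \<Longrightarrow> y \<in> K \<Longrightarrow> x - y \<in> K"
proof -
  assume K: "closed_csubspace K" and "x \<in> K" "y \<in> K"
  then have "x + (- 1) *\<^sub>C y \<in> K" unfolding closed_csubspace_def by blast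
  then show ?thesis by simp
qed

lemma closed_csubspace_perp: "closed_csubspace {x. \<forall>e\<in>E. cinner e x = 0}"
proof -
  have "{x. \<forall>e\<in>E. cinner e x = 0} = (\<Inter>e\<in>E. {x. cinner e x = 0})" by blast
  then have "closed {x. \<forall>e\<in>E. cinner e x = 0}"
    by (auto intro!: closed_INT closed_Collect_eq cblin_continuous_on[OF cblin_cinner] continuous_on_const)
  then show ?thesis by (simp add: closed_csubspace_def cinner_add_right cinner_scaleC_right)
qed

context
  fixes K :: "'h::chilbert_space set"
  assumes K: "closed_csubspace K"
begin

text \<open>The projection is \<open>\<Sum>\<^sub>e |e\<rangle>\<langle>e|\<close> over a maximal orthonormal subset of \<open>K\<close>. It fixes \<open>K\<close> pointwise:
  for \<open>x\<close> in \<open>K\<close>, the normalisation of \<open>x - P x\<close> would otherwise contradict maximality.\<close>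

lemma orth_proj_exists:
  "\<exists>P. cblin P \<and> adjoints P P \<and> (\<forall>x. norm (P x) \<le> norm x) \<and>
    (\<forall>x. P x \<in> K \<and> (\<forall>v\<in>K. cinner v (x - P x) = 0))"
proof -
  obtain E where EK: "E \<subseteq> K" and E: "orthonormal_family E (\<lambda>x. x)"
    and max: "\<And>x. x \<in> K \<Longrightarrow> norm x = 1 \<Longrightarrow> \<exists>e\<in>E. cinner e x \<noteq> 0"
    using maximal_orthonormal_subset[of K] by blast
  define P where "P = family_op E (\<lambda>x. x) (\<lambda>x. x) (\<lambda>_. 1)"
  have one: "\<And>i. i \<in> E \<Longrightarrow> cmod 1 \<le> 1" by simp
  have PK: "P x \<in> K" for x
    unfolding P_def
    by (rule closed_csubspace_has_sum[OF K _ family_op_has_sum[OF E E one]])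
       (use EK K in \<open>auto simp: closed_csubspace_def\<close>)
  have coord: "e \<in> E \<Longrightarrow> cinner e (x - P x) = 0" for e x
    unfolding P_def cinner_diff_right by (simp add: cinner_family_op[OF E E one])
  have Pid: "P x = x" if "x \<in> K" for x
  proof (rule ccontr)
    assume ne: "P x \<noteq> x"
    let ?y = "x - P x"
    have y: "?y \<in> K" using that PK closed_csubspace_diff[OF K] by blast
    then have "?y /\<^sub>R norm ?y \<in> K" using K by (simp add: closed_csubspace_def scaleR_scaleC)
    moreover have "norm (?y /\<^sub>R norm ?y) = 1" using ne by simp
    ultimately obtain e where "e \<in> E" "cinner e (?y /\<^sub>R norm ?y) \<noteq> 0" using max by blast
    then show False using coord unfolding cinner_scaleR_right by simp
  qed
  have perp: "cinner v (x - P x) = 0" if "v \<in> K" for v x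
  proof -
    have "cinner (x - P x) (P v) = 0"
      unfolding P_def by (rule cinner_family_op_orth[OF E E one]) (use coord in \<open>simp_all add: P_def\<close>)
    then show ?thesis using Pid[OF that] cinner_eq_zero_commute by simp
  qed
  have "cblin P" unfolding P_def by (rule cblin_family_op[OF E E one])
  moreover have "adjoints P P"
    using adjoints_family_op[OF E E one] unfolding P_def by simp
  moreover have "norm (P x) \<le> norm x" for x
    using norm_family_op_le[OF E E one, where x = x] unfolding P_def by simp
  ultimately show ?thesis using PK perp by blast
qed

lemma orth_proj_eqI:
  assumes "y \<in> K" "\<And>v. v \<in> K \<Longrightarrow> cinner v (x - y) = 0"
  shows "orth_proj K x = y"
  unfolding orth_proj_def
proof (rule the_equality)
  show "y \<in> K \<and> (\<forall>v\<in>K. cinner v (x - y) = 0)" using assms by blast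
  fix z assume z: "z \<in> K \<and> (\<forall>v\<in>K. cinner v (x - z) = 0)"
  have d: "z - y \<in> K" using z assms closed_csubspace_diff[OF K] by blast
  have "cinner (z - y) (x - y) - cinner (z - y) (x - z) = 0" using z assms d by simp
  then have "cinner (z - y) (z - y) = 0" by (simp add: cinner_diff_right)
  then show "z = y" by (simp add: cinner_self)
qed

lemma orth_proj_props:
  "cblin (orth_proj K) \<and> adjoints (orth_proj K) (orth_proj K) \<and> (\<forall>x. norm (orth_proj K x) \<le> norm x) \<and>
    (\<forall>x. orth_proj K x \<in> K \<and> (\<forall>v\<in>K. cinner v (x - orth_proj K x) = 0))"
proof -
  obtain P where P: "cblin P \<and> adjoints P P \<and> (\<forall>x. norm (P x) \<le> norm x) \<and>
    (\<forall>x. P x \<in> K \<and> (\<forall>v\<in>K. cinner v (x - P x) = 0))"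
    using orth_proj_exists by (rule exE)
  have "orth_proj K = P" by (intro ext orth_proj_eqI) (use P in simp_all)
  then show ?thesis using P by simp
qed

lemma cblin_orth_proj: "cblin (orth_proj K)" using orth_proj_props by simp
lemma adjoints_orth_proj: "adjoints (orth_proj K) (orth_proj K)" using orth_proj_props by simp
lemma norm_orth_proj: "norm (orth_proj K x) \<le> norm x" using orth_proj_props by simp
lemma orth_proj_in: "orth_proj K x \<in> K" using orth_proj_props by simp
lemma orth_proj_perp: "v \<in> K \<Longrightarrow> cinner v (x - orth_proj K x) = 0" using orth_proj_props by simp
lemma orth_proj_id: "x \<in> K \<Longrightarrow> orth_proj K x = x" by (rule orth_proj_eqI) simp_all
lemma orth_proj_zero: "(\<And>v. v \<in> K \<Longrightarrow> cinner v x = 0) \<Longrightarrow> orth_proj K x = 0"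
  by (rule orth_proj_eqI) (use K in \<open>simp_all add: closed_csubspace_def\<close>)

lemma bounded_ops_proj: "T \<in> bounded_ops K \<Longrightarrow> T (orth_proj K x) = T x"
proof -
  assume T: "T \<in> bounded_ops K"
  have "T (x - orth_proj K x) = 0" using T orth_proj_perp[of _ x] unfolding bounded_ops_def by blast
  then show ?thesis using T cblin_diff[of T x "orth_proj K x"] by (simp add: bounded_ops_def bounded_clinear_eq)
qed

end

text \<open>The adjoint is given by the coordinates \<open>\<langle>T e, y\<rangle>\<close> with respect to a basis. They are
  square-summable: for a finite partial sum \<open>w\<close>, \<open>\<parallel>w\<parallel>\<^sup>2 = \<langle>T w, y\<rangle> \<le> C \<parallel>w\<parallel> \<parallel>y\<parallel>\<close>.\<close>

lemma ex_adjoint: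
  fixes T :: "'h::chilbert_space \<Rightarrow> 'k::chilbert_space"
  assumes T: "cblin T" shows "\<exists>S. cblin S \<and> adjoints T S"
proof -
  obtain B :: "'h set" where B: "is_onb B" using ex_onb by blast
  obtain C where C: "C > 0" "\<And>x. norm (T x) \<le> C * norm x" using cblin_bound[OF T] by blast
  have o: "cinner e f = (if e = f then 1 else 0)" if "e \<in> B" "f \<in> B" for e f
    using is_onb_orthonormal[OF B] that by (simp add: orthonormal_family_def)
  have fin: "(\<Sum>e\<in>F. (norm (cinner (T e) y *\<^sub>C e))\<^sup>2) \<le> (C * norm y)\<^sup>2" if F: "finite F" "F \<subseteq> B" for F y
  proof -
    define w where "w = (\<Sum>e\<in>F. cinner (T e) y *\<^sub>C e)"
    have nw: "(norm w)\<^sup>2 = (\<Sum>e\<in>F. (norm (cinner (T e) y *\<^sub>C e))\<^sup>2)"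
      unfolding w_def using F by (intro norm_sum_orthogonal)
        (simp_all add: cinner_scaleC_left cinner_scaleC_right o subset_iff)
    have ne: "e \<in> F \<Longrightarrow> norm e = 1" for e using F B by (auto simp: is_onb_def)
    have "cinner (T w) y = (\<Sum>e\<in>F. cnj (cinner (T e) y) * cinner (T e) y)"
      unfolding w_def cblin_sum[OF T] cblin_scaleC[OF T] cinner.sum_left cinner_scaleC_left ..
    also have "\<dots> = (\<Sum>e\<in>F. complex_of_real ((norm (cinner (T e) y *\<^sub>C e))\<^sup>2))"
      by (rule sum.cong) (simp_all add: norm_scaleC_hilbert ne complex_norm_square mult.commute del: of_real_power)
    finally have eq: "cinner (T w) y = complex_of_real ((norm w)\<^sup>2)" unfolding nw by simp
    have "(norm w)\<^sup>2 \<le> norm (T w) * norm y"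
      using Cauchy_Schwarz_cinner[of "T w" y] unfolding eq norm_of_real by simp
    also have "\<dots> \<le> (C * norm w) * norm y" by (intro mult_right_mono C) simp
    finally have "norm w \<le> C * norm y"
      using C(1) by (cases "norm w = 0") (simp_all add: power2_eq_square mult_ac)
    then show ?thesis unfolding nw[symmetric] by (rule power_mono) simp
  qed
  define S where "S y = (\<Sum>\<^sub>\<infinity>e\<in>B. cinner (T e) y *\<^sub>C e)" for y
  have S: "((\<lambda>e. cinner (T e) y *\<^sub>C e) has_sum S y) B" for y
    unfolding S_def
  proof (rule has_sum_infsum, rule summable_orthogonal)
    show "(\<lambda>e. (norm (cinner (T e) y *\<^sub>C e))\<^sup>2) summable_on B"
      by (rule nonneg_bdd_above_summable_on, simp, rule bdd_aboveI2[where M = "(C * norm y)\<^sup>2"])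
         (use fin in simp)
  qed (simp_all add: cinner_scaleC_left cinner_scaleC_right o)
  have adj: "cinner (T x) y = cinner x (S y)" for x y
  proof -
    have "((\<lambda>e. T (cinner e x *\<^sub>C e)) has_sum T x) B" by (rule cblin_has_sum[OF T onb_expansion[OF B]])
    from cblin_has_sum[OF cblin_cinner this, of y]
    have "((\<lambda>e. cnj (cinner y (T (cinner e x *\<^sub>C e)))) has_sum cnj (cinner y (T x))) B"
      by (simp only: has_sum_cnj_iff)
    then have "((\<lambda>e. cinner (T (cinner e x *\<^sub>C e)) y) has_sum cinner (T x) y) B"
      unfolding cinner_commute[symmetric] .
    moreover have "((\<lambda>e. cinner x (cinner (T e) y *\<^sub>C e)) has_sum cinner x (S y)) B"
      by (rule cblin_has_sum[OF cblin_cinner S])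
    moreover have "cinner (T (cinner e x *\<^sub>C e)) y = cinner x (cinner (T e) y *\<^sub>C e)" for e
      unfolding cblin_scaleC[OF T] cinner_scaleC_left cinner_scaleC_right cinner_commute[symmetric]
      by (rule mult.commute)
    ultimately show ?thesis by (simp only:) (rule has_sum_unique)
  qed
  have a: "adjoints T S" using adj by (simp add: adjoints_def)
  have "norm (S y) \<le> C * norm y" for y
  proof -
    have "(norm (S y))\<^sup>2 = cmod (cinner (T (S y)) y)" unfolding adj cinner_self norm_of_real by simp
    also have "\<dots> \<le> norm (T (S y)) * norm y" by (rule Cauchy_Schwarz_cinner)
    also have "\<dots> \<le> (C * norm (S y)) * norm y" by (intro mult_right_mono C) simp
    finally show ?thesis using C(1) by (cases "norm (S y) = 0") (simp_all add: power2_eq_square mult_ac)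
  qed
  then have "cblin S" by (rule cblin_adjointsI[OF adjoints_sym[OF a]])
  then show ?thesis using a by blast
qed

lemma closure_range_csubspace:
  fixes D :: "'a::complex_vec \<Rightarrow> 'k::chilbert_space"
  assumes D: "clinear D" shows "closed_csubspace (closure (range D))"
  unfolding closed_csubspace_def
proof (intro conjI ballI allI)
  show "closed (closure (range D))" by simp
  have "D 0 \<in> closure (range D)" by (rule subsetD[OF closure_subset]) simp
  then show "0 \<in> closure (range D)" by (simp add: clinear_zero[OF D])
  fix x assume "x \<in> closure (range D)"
  then obtain u where u: "\<And>n. u n \<in> range D" "u \<longlonglongrightarrow> x" unfolding closure_sequential by blast
  show "c *\<^sub>C x \<in> closure (range D)" for c
    unfolding closure_sequential
  proof (intro exI conjI allI)
    show "(\<lambda>n. c *\<^sub>C u n) \<longlonglongrightarrow> c *\<^sub>C x" by (intro scaleC_hilbert.tendsto tendsto_const u(2))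
    fix n obtain a where "u n = D a" using u(1)[of n] by (rule rangeE)
    then have "c *\<^sub>C u n = D (c *\<^sub>C a)" using D by (simp add: clinear_def)
    then show "c *\<^sub>C u n \<in> range D" by simp
  qed
  fix y assume "y \<in> closure (range D)"
  then obtain v where v: "\<And>n. v n \<in> range D" "v \<longlonglongrightarrow> y" unfolding closure_sequential by blast
  show "x + y \<in> closure (range D)"
    unfolding closure_sequential
  proof (intro exI conjI allI)
    show "(\<lambda>n. u n + v n) \<longlonglongrightarrow> x + y" by (intro tendsto_add u v)
    fix n obtain a where "u n = D a" using u(1)[of n] by (rule rangeE)
    moreover obtain b where "v n = D b" using v(1)[of n] by (rule rangeE)
    ultimately have "u n + v n = D (a + b)" using D by (simp add: clinear_def)
    then show "u n + v n \<in> range D" by simp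
  qed
qed

text \<open>Extension by continuity: a map that is bounded by a second one factors through the closure of
  the range of the latter. It serves both to identify GNS representations and, with scalar values
  and an adjoint, as the Riesz representation of functionals on a dense subspace.\<close>

lemma bounded_factorization:
  fixes D1 :: "'a::complex_vec \<Rightarrow> 'k::chilbert_space" and D2 :: "'a \<Rightarrow> 'm::chilbert_space"
  assumes D1: "clinear D1" and D2: "clinear D2" and C: "C \<ge> 0" "\<And>a. norm (D2 a) \<le> C * norm (D1 a)"
  obtains G where "cblin G" "\<And>a. G (D1 a) = D2 a" "\<And>x. norm (G x) \<le> C * norm x"
    "\<And>x. (\<And>v. v \<in> closure (range D1) \<Longrightarrow> cinner v x = 0) \<Longrightarrow> G x = 0"
    "\<And>x. G x \<in> closure (range D2)"
proof -
  let ?K = "closure (range D1)"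
  have K: "closed_csubspace ?K" by (rule closure_range_csubspace[OF D1])
  \<comment> \<open>\<open>R\<close> is the closure of the graph of \<open>D1 a \<mapsto> D2 a\<close>; the norm bound makes it single-valued.\<close>
  define R where "R x y \<longleftrightarrow> (\<exists>s. (\<lambda>n. D1 (s n)) \<longlonglongrightarrow> x \<and> (\<lambda>n. D2 (s n)) \<longlonglongrightarrow> y)" for x y
  have Rnorm: "norm y \<le> C * norm x" if "R x y" for x y
  proof -
    obtain s where s: "(\<lambda>n. D1 (s n)) \<longlonglongrightarrow> x" "(\<lambda>n. D2 (s n)) \<longlonglongrightarrow> y" using \<open>R x y\<close> unfolding R_def by blast
    show ?thesis
    proof (rule LIMSEQ_le)
      show "(\<lambda>n. norm (D2 (s n))) \<longlonglongrightarrow> norm y" by (intro tendsto_norm s)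
      show "(\<lambda>n. C * norm (D1 (s n))) \<longlonglongrightarrow> C * norm x" by (intro tendsto_mult tendsto_const tendsto_norm s)
    qed (use C(2) in blast)
  qed
  have Radd: "R (x + x') (y + y')" if R: "R x y" "R x' y'" for x y x' y'
  proof -
    obtain s where s: "(\<lambda>n. D1 (s n)) \<longlonglongrightarrow> x" "(\<lambda>n. D2 (s n)) \<longlonglongrightarrow> y" using R(1) unfolding R_def by blast
    obtain s' where s': "(\<lambda>n. D1 (s' n)) \<longlonglongrightarrow> x'" "(\<lambda>n. D2 (s' n)) \<longlonglongrightarrow> y'" using R(2) unfolding R_def by blast
    have "(\<lambda>n. D1 (s n + s' n)) \<longlonglongrightarrow> x + x'" "(\<lambda>n. D2 (s n + s' n)) \<longlonglongrightarrow> y + y'"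
      using tendsto_add[OF s(1) s'(1)] tendsto_add[OF s(2) s'(2)] D1 D2
      by (simp_all add: clinear_def)
    then show ?thesis unfolding R_def by (intro exI conjI)
  qed
  have Rscale: "R (c *\<^sub>C x) (c *\<^sub>C y)" if R: "R x y" for c x y
  proof -
    obtain s where s: "(\<lambda>n. D1 (s n)) \<longlonglongrightarrow> x" "(\<lambda>n. D2 (s n)) \<longlonglongrightarrow> y" using R unfolding R_def by blast
    have "(\<lambda>n. D1 (c *\<^sub>C s n)) \<longlonglongrightarrow> c *\<^sub>C x" "(\<lambda>n. D2 (c *\<^sub>C s n)) \<longlonglongrightarrow> c *\<^sub>C y"
      using scaleC_hilbert.tendsto[OF tendsto_const s(1), of c]
        scaleC_hilbert.tendsto[OF tendsto_const s(2), of c] D1 D2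
      by (simp_all add: clinear_def)
    then show ?thesis unfolding R_def by (intro exI conjI)
  qed
  have Runique: "y = y'" if "R x y" "R x y'" for x y y'
  proof -
    have "R (x + (-1) *\<^sub>C x) (y + (-1) *\<^sub>C y')" by (intro Radd Rscale that)
    from Rnorm[OF this] show ?thesis by simp
  qed
  have Rex: "\<exists>y. R x y \<and> y \<in> closure (range D2)" if xK: "x \<in> ?K" for x
  proof -
    obtain u where u: "\<And>n. u n \<in> range D1" "u \<longlonglongrightarrow> x" using xK unfolding closure_sequential by blast
    have "\<forall>n. \<exists>a. u n = D1 a" using u(1) by auto
    then obtain s where s: "\<And>n. u n = D1 (s n)" by metis
    have "Cauchy u" using u(2) LIMSEQ_imp_Cauchy by blast
    have "Cauchy (\<lambda>n. D2 (s n))"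
    proof (rule CauchyI)
      fix e :: real assume e: "e > 0"
      then have "e / (C + 1) > 0" using C(1) by simp
      then obtain M where M: "\<And>m n. m \<ge> M \<Longrightarrow> n \<ge> M \<Longrightarrow> norm (u m - u n) < e / (C + 1)"
        using CauchyD[OF \<open>Cauchy u\<close>] by blast
      have "norm (D2 (s m) - D2 (s n)) < e" if "m \<ge> M" "n \<ge> M" for m n
      proof -
        have "norm (D2 (s m) - D2 (s n)) \<le> C * norm (u m - u n)"
          using C(2)[of "s m - s n"] by (simp add: clinear_diff[OF D1] clinear_diff[OF D2] s)
        also have "\<dots> \<le> (C + 1) * norm (u m - u n)" by (intro mult_right_mono) auto
        also have "\<dots> < (C + 1) * (e / (C + 1))" using M[OF that] C(1) by (intro mult_strict_left_mono) auto
        finally show ?thesis using C(1) by simp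
      qed
      then show "\<exists>M. \<forall>m\<ge>M. \<forall>n\<ge>M. norm (D2 (s m) - D2 (s n)) < e" by blast
    qed
    then obtain y where y: "(\<lambda>n. D2 (s n)) \<longlonglongrightarrow> y" using Cauchy_convergent convergent_def by blast
    have "u = (\<lambda>n. D1 (s n))" using s by (rule ext)
    then have "R x y" unfolding R_def using u(2) y by (intro exI[of _ s]) simp
    moreover have "y \<in> closure (range D2)" unfolding closure_sequential using y by (intro exI[of _ "\<lambda>n. D2 (s n)"]) simp
    ultimately show ?thesis by blast
  qed
  define G where "G x = (THE y. R (orth_proj ?K x) y)" for x
  have RG: "R (orth_proj ?K x) (G x)" for x
  proof -
    obtain y where y: "R (orth_proj ?K x) y" using Rex[OF orth_proj_in[OF K]] by blast
    show ?thesis unfolding G_def by (rule theI[where P = "R (orth_proj ?K x)", OF y]) (rule Runique[OF _ y])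
  qed
  have Geq: "R (orth_proj ?K x) y \<Longrightarrow> G x = y" for x y by (rule Runique[OF RG])
  have "clinear G" unfolding clinear_def
  proof (intro conjI allI)
    show "G (x + y) = G x + G y" for x y
      by (rule Geq) (simp add: cblin_add[OF cblin_orth_proj[OF K]] Radd RG)
    show "G (c *\<^sub>C x) = c *\<^sub>C G x" for c x
      by (rule Geq) (simp add: cblin_scaleC[OF cblin_orth_proj[OF K]] Rscale RG)
  qed
  moreover have nG: "norm (G x) \<le> C * norm x" for x
    by (rule order_trans[OF Rnorm[OF RG] mult_left_mono[OF norm_orth_proj[OF K] C(1)]])
  ultimately have 1: "cblin G" by (rule cblinI)
  have 2: "G (D1 a) = D2 a" for a
  proof (rule Geq)
    have "D1 a \<in> ?K" by (rule subsetD[OF closure_subset]) simp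
    then show "R (orth_proj ?K (D1 a)) (D2 a)"
      unfolding orth_proj_id[OF K \<open>D1 a \<in> ?K\<close>] R_def by (intro exI[of _ "\<lambda>_. a"]) simp
  qed
  have 3: "G x = 0" if "\<And>v. v \<in> ?K \<Longrightarrow> cinner v x = 0" for x
  proof -
    have "orth_proj ?K x = 0" using that by (rule orth_proj_zero[OF K])
    then show ?thesis using Rnorm[OF RG[of x]] by simp
  qed
  have 4: "G x \<in> closure (range D2)" for x
  proof -
    obtain y where y: "R (orth_proj ?K x) y" "y \<in> closure (range D2)"
      using Rex[OF orth_proj_in[OF K]] by blast
    then show ?thesis using Geq[OF y(1)] by simp
  qed
  show ?thesis by (rule that[OF 1 2 nG 3 4])
qed

section \<open>Square roots and contractivity\<close>

text \<open>The equation \<open>b = (x + b\<^sup>2) / 2\<close>, that is \<open>(1 - b)\<^sup>2 = 1 - x\<close>, is solved by iteration. The same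
  iteration for the number \<open>1\<close> instead of \<open>x\<close> is a convergent majorant, including the boundary
  case \<open>\<parallel>x\<parallel> = 1\<close>, in which the iteration is no contraction.\<close>

lemma half_square_fixpoint:
  fixes m :: "'b::banach \<Rightarrow> 'b \<Rightarrow> 'b"
  assumes m: "bounded_bilinear m" and mn: "\<And>x y. norm (m x y) \<le> norm x * norm y" and x: "norm x \<le> 1"
    and S: "closed S" "0 \<in> S" "\<And>b. b \<in> S \<Longrightarrow> (x + m b b) /\<^sub>R 2 \<in> S"
  shows "\<exists>b\<in>S. norm b \<le> 1 \<and> b = (x + m b b) /\<^sub>R 2"
proof -
  interpret m: bounded_bilinear m by fact
  define b where "b = rec_nat 0 (\<lambda>_ b. (x + m b b) /\<^sub>R 2)"
  define \<beta> :: "nat \<Rightarrow> real" where "\<beta> = rec_nat 0 (\<lambda>_ r. (1 + r\<^sup>2) / 2)"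
  have b0: "b 0 = 0" and bS: "b (Suc n) = (x + m (b n) (b n)) /\<^sub>R 2" for n by (simp_all add: b_def)
  have \<beta>0: "\<beta> 0 = 0" and \<beta>S: "\<beta> (Suc n) = (1 + (\<beta> n)\<^sup>2) / 2" for n by (simp_all add: \<beta>_def)
  have \<beta>b: "0 \<le> \<beta> n \<and> \<beta> n \<le> 1" for n
    by (induction n) (simp_all add: \<beta>0 \<beta>S power_le_one)
  have inc: "\<beta> n \<le> \<beta> (Suc n)" for n
    using sum_squares_bound[of "\<beta> n" 1] by (simp add: \<beta>S)
  \<comment> \<open>The numbers \<open>\<beta> n\<close>, which increase to at most \<open>1\<close>, dominate both the iterates and their increments.\<close>
  have step: "norm (b n) \<le> \<beta> n \<and> norm (b (Suc n) - b n) \<le> \<beta> (Suc n) - \<beta> n" for n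
  proof (induction n)
    case 0 show ?case using x by (simp add: b0 bS \<beta>0 \<beta>S m.zero_left)
  next
    case (Suc n)
    have 1: "norm (b (Suc n)) \<le> \<beta> (Suc n)"
      using norm_triangle_ineq[of "b n" "b (Suc n) - b n"] Suc by simp
    have "b (Suc (Suc n)) - b (Suc n) =
        (m (b (Suc n)) (b (Suc n) - b n) + m (b (Suc n) - b n) (b n)) /\<^sub>R 2"
      unfolding bS[of "Suc n"] bS[of n, symmetric]
      by (subst (3) bS) (simp add: m.diff_left m.diff_right scaleR_diff_right[symmetric] flip: scaleR_diff_right)
    then have "norm (b (Suc (Suc n)) - b (Suc n)) \<le>
        (norm (m (b (Suc n)) (b (Suc n) - b n)) + norm (m (b (Suc n) - b n) (b n))) / 2"
      by (simp add: norm_triangle_ineq)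
    also have "\<dots> \<le> (\<beta> (Suc n) * (\<beta> (Suc n) - \<beta> n) + (\<beta> (Suc n) - \<beta> n) * \<beta> n) / 2"
      using Suc 1 \<beta>b[of n] \<beta>b[of "Suc n"] inc[of n]
      by (intro divide_right_mono add_mono order_trans[OF mn] mult_mono) auto
    also have "\<dots> = \<beta> (Suc (Suc n)) - \<beta> (Suc n)"
    proof -
      have "(\<beta> n)\<^sup>2 = 2 * \<beta> (Suc n) - 1" using \<beta>S[of n] by (simp add: eq_divide_eq)
      moreover have "\<beta> (Suc n) * (\<beta> (Suc n) - \<beta> n) + (\<beta> (Suc n) - \<beta> n) * \<beta> n
          = (\<beta> (Suc n))\<^sup>2 - (\<beta> n)\<^sup>2"
        by (simp add: power2_eq_square algebra_simps)
      ultimately show ?thesis unfolding \<beta>S[of "Suc n"] by (simp add: field_simps)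
    qed
    finally show ?case using 1 by simp
  qed
  have diff: "norm (b (n + k) - b n) \<le> \<beta> (n + k) - \<beta> n" for n k
  proof (induction k)
    case (Suc k)
    have "norm (b (n + Suc k) - b n) \<le> norm (b (Suc (n + k)) - b (n + k)) + norm (b (n + k) - b n)"
      using norm_triangle_ineq[of "b (Suc (n + k)) - b (n + k)" "b (n + k) - b n"] by simp
    then show ?case using Suc step[of "n + k"] by simp
  qed simp
  have "incseq \<beta>" by (rule incseq_SucI) (rule inc)
  then obtain L where "\<beta> \<longlonglongrightarrow> L" using incseq_convergent[of \<beta> 1] \<beta>b by blast
  then have C\<beta>: "Cauchy \<beta>" by (rule LIMSEQ_imp_Cauchy)
  have "Cauchy b"
  proof (rule CauchyI)
    fix e :: real assume "e > 0"
    then obtain M where M: "\<And>i j. i \<ge> M \<Longrightarrow> j \<ge> M \<Longrightarrow> norm (\<beta> i - \<beta> j) < e"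
      using CauchyD[OF C\<beta>] by blast
    have le: "norm (b j - b i) < e" if "i \<ge> M" "j \<ge> i" for i j
    proof -
      have "norm (b j - b i) \<le> \<beta> j - \<beta> i" using diff[of i "j - i"] that by simp
      also have "\<dots> < e" using M[of j i] that by simp
      finally show ?thesis .
    qed
    have "norm (b i - b j) < e" if "i \<ge> M" "j \<ge> M" for i j
      using le[of i j] le[of j i] that by (cases "i \<le> j") (simp_all add: norm_minus_commute)
    then show "\<exists>M. \<forall>i\<ge>M. \<forall>j\<ge>M. norm (b i - b j) < e" by blast
  qed
  then obtain l where l: "b \<longlonglongrightarrow> l" using Cauchy_convergent convergent_def by blast
  have "b n \<in> S" for n by (induction n) (simp_all only: b0 bS S(2,3))
  then have "l \<in> S" using closed_sequentially[OF S(1)] l by blast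
  moreover have "norm l \<le> 1"
  proof (rule LIMSEQ_le_const2[OF tendsto_norm[OF l]])
    show "\<exists>N. \<forall>n\<ge>N. norm (b n) \<le> 1" using step \<beta>b order_trans by blast
  qed
  moreover have "l = (x + m l l) /\<^sub>R 2"
  proof (rule LIMSEQ_unique)
    show "(\<lambda>n. b (Suc n)) \<longlonglongrightarrow> l" using l by (rule LIMSEQ_Suc)
    show "(\<lambda>n. b (Suc n)) \<longlonglongrightarrow> (x + m l l) /\<^sub>R 2"
      unfolding bS by (intro tendsto_intros m.tendsto l)
  qed
  ultimately show ?thesis by blast
qed

lemma norm_star [simp]: "norm (star x) = norm (x::'a::unital_cstar_algebra)"
proof -
  have le: "norm x \<le> norm (star x)" for x :: 'a
  proof (cases "norm x = 0")
    case False
    have "norm x * norm x \<le> norm (star x) * norm x"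
      using norm_mult_ineq[of "star x" x] cstar_identity[of x] by (simp add: power2_eq_square)
    then show ?thesis using False by (simp add: mult_le_cancel_right)
  qed simp
  show ?thesis using le[of x] le[of "star x"] by (simp add: star_star)
qed

lemma star_one [simp]: "star 1 = (1::'a::unital_cstar_algebra)"
  by (metis mult_1_left mult_1_right star_mult star_star)

lemma star_scaleR: "star (r *\<^sub>R x) = r *\<^sub>R star (x::'a::unital_cstar_algebra)"
  by (simp add: scaleR_scaleC star_scaleC)

lemma bounded_linear_star: "bounded_linear (star :: 'a::unital_cstar_algebra \<Rightarrow> 'a)"
  by (rule bounded_linear_intro[of _ 1]) (simp_all add: star_add star_scaleR)

lemmas star_diff = linear_diff[OF bounded_linear.linear[OF bounded_linear_star]]
lemmas star_zero = linear_0[OF bounded_linear.linear[OF bounded_linear_star]]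

text \<open>The square root of \<open>1 - x\<close> is \<open>1 - b\<close> for the fixed point \<open>b\<close>. The closed set in which the iteration
  takes place makes it self-adjoint and lets it commute with everything that commutes with \<open>x\<close>.\<close>

lemma cstar_sqrt:
  fixes x :: "'a::unital_cstar_algebra"
  assumes sx: "star x = x" and nx: "norm x \<le> 1"
  obtains d where "star d = d" "d * d = 1 - x" "\<And>y. y * x = x * y \<Longrightarrow> y * d = d * y"
proof -
  let ?S = "{b. star b = b} \<inter> (\<Inter>y\<in>{y. y * x = x * y}. {b. y * b = b * y})"
  have "\<exists>b\<in>?S. norm b \<le> 1 \<and> b = (x + b * b) /\<^sub>R 2"
  proof (rule half_square_fixpoint[OF bounded_bilinear_mult norm_mult_ineq nx])
    show "closed ?S"
      by (intro closed_Int closed_INT ballI closed_Collect_eq linear_continuous_on bounded_linear_star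
          continuous_intros)
    fix b assume b: "b \<in> ?S"
    have "y * (x + b * b) = (x + b * b) * y" if "y * x = x * y" for y
    proof -
      have "y * b = b * y" using b that by blast
      then have "y * (b * b) = (b * b) * y" by (metis mult.assoc)
      then show ?thesis using that by (simp add: distrib_left distrib_right)
    qed
    moreover have "star b = b" using b by blast
    ultimately show "(x + b * b) /\<^sub>R 2 \<in> ?S" by (simp add: star_scaleR star_add star_mult sx)
  qed (simp add: star_zero)
  then obtain b where bS: "b \<in> ?S" and bb: "norm b \<le> 1 \<and> b = (x + b * b) /\<^sub>R 2" by (rule bexE)
  have "y * b = b * y" if "y * x = x * y" for y
    using INT_D[OF IntD2[OF bS], of y] that by simp
  then have b: "star b = b" "\<And>y. y * x = x * y \<Longrightarrow> y * b = b * y" "b = (x + b * b) /\<^sub>R 2"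
    using IntD1[OF bS] conjunct2[OF bb] by blast+
  have "2 *\<^sub>R b = x + b * b" by (subst b(3)) simp
  then have "(1 - b) * (1 - b) = 1 - x" by (simp add: scaleR_2 algebra_simps)
  moreover have "star (1 - b) = 1 - b" using b(1) by (simp add: star_diff)
  moreover have "y * (1 - b) = (1 - b) * y" if "y * x = x * y" for y
    using b(2)[OF that] by (simp add: left_diff_distrib right_diff_distrib)
  ultimately show ?thesis by (intro that[of "1 - b"])
qed

text \<open>If \<open>\<parallel>a\<parallel> \<le> 1\<close> is self-adjoint, then \<open>u = a + i \<surd>(1 - a\<^sup>2)\<close> is unitary with real part \<open>a\<close>. A unital
  *-homomorphism maps \<open>u\<close> to a unitary, so it is contractive.\<close>

lemma star_hom_contractive:
  fixes f :: "'a::unital_cstar_algebra \<Rightarrow> 'b::unital_cstar_algebra"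
  assumes f: "clinear f" "\<And>a b. f (a * b) = f a * f b" "\<And>a. f (star a) = star (f a)" "f 1 = 1"
  shows "norm (f a) \<le> norm a"
proof -
  have sa1: "norm (f a) \<le> 1" if sa: "star a = a" and na: "norm a \<le> 1" for a
  proof -
    have "norm (a * a) \<le> 1 * 1" by (rule order_trans[OF norm_mult_ineq]) (intro mult_mono na; simp)
    then have na2: "norm (a * a) \<le> 1" by simp
    have saa: "star (a * a) = a * a" by (simp add: star_mult sa)
    obtain d where d: "star d = d" "d * d = 1 - a * a" "\<And>y. y * (a * a) = (a * a) * y \<Longrightarrow> y * d = d * y"
      by (rule cstar_sqrt[OF saa na2], rule that)
    have ad: "a * d = d * a" by (rule d(3)) (simp add: mult.assoc)
    let ?u = "f a + \<i> *\<^sub>C f d"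
    have su: "star ?u = f a - \<i> *\<^sub>C f d"
      by (simp add: star_add star_scaleC f(3)[symmetric] sa d(1))
    have "star ?u * ?u = f (a * a) + f (d * d) + \<i> *\<^sub>C (f (a * d) - f (d * a))"
      unfolding su f(2) by (simp add: algebra_simps scaleC_mult_left scaleC_mult_right scaleC_scaleC
          cvec.scale_right_diff_distrib)
    also have "\<dots> = f (a * a + d * d)" using f(1) ad by (simp add: clinear_def)
    also have "\<dots> = 1" by (simp add: d(2) f(4))
    finally have "(norm ?u)\<^sup>2 = 1" unfolding cstar_identity[symmetric] by simp
    then have nu: "norm ?u = 1" using power2_eq_iff_nonneg[of "norm ?u" 1] by simp
    have "f a = (?u + star ?u) /\<^sub>R 2" unfolding su by (simp add: scaleR_2[symmetric])
    also have "norm \<dots> \<le> (norm ?u + norm (star ?u)) / 2"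
      using norm_triangle_ineq[of ?u "star ?u"] by simp
    finally show ?thesis using nu by simp
  qed
  have sa: "norm (f a) \<le> norm a" if "star a = a" for a
  proof (cases "a = 0")
    case False
    have "norm (f (a /\<^sub>R norm a)) \<le> 1" by (rule sa1) (use that False in \<open>simp_all add: star_scaleR\<close>)
    then show ?thesis using False by (simp add: clinear_scaleR[OF f(1)] field_simps)
  qed (simp add: clinear_zero[OF f(1)])
  have "(norm (f a))\<^sup>2 = norm (f (star a * a))" by (simp add: f cstar_identity)
  also have "\<dots> \<le> norm (star a * a)" by (rule sa) (simp add: star_mult star_star)
  also have "\<dots> = (norm a)\<^sup>2" by (rule cstar_identity)
  finally show ?thesis by (rule power2_le_imp_le) simp
qed

context
  fixes K :: "'h::chilbert_space set" and \<pi> :: "'a::unital_cstar_algebra \<Rightarrow> 'h \<Rightarrow> 'h"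
  assumes rep: "star_rep K \<pi>"
begin

lemma star_rep_closed: "closed_csubspace K" using rep by (simp add: star_rep_def)
lemma star_rep_bounded_ops: "\<pi> a \<in> bounded_ops K" using rep by (simp add: star_rep_def)
lemma star_rep_cblin: "cblin (\<pi> a)"
  using star_rep_bounded_ops by (simp add: bounded_ops_def bounded_clinear_eq)
lemma star_rep_in: "\<pi> a x \<in> K" using star_rep_bounded_ops[of a] by (auto simp: bounded_ops_def)
lemma star_rep_clinear: "clinear (\<lambda>a. \<pi> a x)" using rep by (simp add: star_rep_def)
lemma star_rep_mult: "\<pi> (a * b) x = \<pi> a (\<pi> b x)" using rep by (simp add: star_rep_def)
lemma star_rep_adjoints: "adjoints (\<pi> a) (\<pi> (star a))"
  using rep by (simp add: star_rep_def adjoint_pair_eq)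
lemma star_rep_one: "x \<in> K \<Longrightarrow> \<pi> 1 x = x" using rep by (simp add: star_rep_def)
lemma star_rep_add: "\<pi> (a + b) x = \<pi> a x + \<pi> b x"
  using star_rep_clinear[of x] by (simp add: clinear_def)
lemma star_rep_scaleC: "\<pi> (c *\<^sub>C a) x = c *\<^sub>C \<pi> a x"
  using star_rep_clinear[of x] by (simp add: clinear_def)
lemma star_rep_scaleR: "\<pi> (r *\<^sub>R a) x = r *\<^sub>R \<pi> a x"
  by (simp add: scaleR_scaleC star_rep_scaleC)
lemma star_rep_diff: "\<pi> (a - b) x = \<pi> a x - \<pi> b x"
  using clinear_diff[OF star_rep_clinear] by blast

text \<open>With \<open>c = a\<^sup>* a / \<parallel>a\<parallel>\<^sup>2\<close> and \<open>d = \<surd>(1 - c)\<close> the identity \<open>a\<^sup>* a / \<parallel>a\<parallel>\<^sup>2 + d\<^sup>2 = 1\<close> yields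
  \<open>\<parallel>\<pi>(a) x\<parallel>\<^sup>2 / \<parallel>a\<parallel>\<^sup>2 + \<parallel>\<pi>(d) x\<parallel>\<^sup>2 = \<langle>x, \<pi>(1) x\<rangle>\<close>. The identity of \<open>A\<close> is represented by
  the projection onto \<open>K\<close>, so this is not a unital homomorphism into the operators on the whole space.\<close>

lemma star_rep_contractive: "norm (\<pi> a x) \<le> norm a * norm x"
proof (cases "a = 0")
  case True
  then show ?thesis using clinear_zero[OF star_rep_clinear] by simp
next
  case False
  have n1: "norm (\<pi> 1 x) \<le> norm x"
  proof (cases "\<pi> 1 x = 0")
    case False
    have "complex_of_real ((norm (\<pi> 1 x))\<^sup>2) = cinner x (\<pi> 1 x)"
      unfolding cinner_self[symmetric] adjointsD[OF star_rep_adjoints] star_rep_mult[symmetric] by simp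
    then have "(norm (\<pi> 1 x))\<^sup>2 = cmod (cinner x (\<pi> 1 x))"
      by (metis norm_of_real abs_power2)
    also have "\<dots> \<le> norm x * norm (\<pi> 1 x)" by (rule Cauchy_Schwarz_cinner)
    finally show ?thesis using False by (simp add: power2_eq_square)
  qed simp
  define c where "c = (star a * a) /\<^sub>R (norm a)\<^sup>2"
  have "star c = c" by (simp add: c_def star_scaleR star_mult star_star)
  moreover have "norm c \<le> 1" using False by (simp add: c_def cstar_identity)
  ultimately obtain d where d: "star d = d" "d * d = 1 - c" using cstar_sqrt by blast
  have "cinner (\<pi> d x) (\<pi> d x) = cinner x (\<pi> 1 x) - cinner x (\<pi> c x)"
    unfolding adjointsD[OF star_rep_adjoints] star_rep_mult[symmetric] d star_rep_diff cinner_diff_right ..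
  moreover have "cinner x (\<pi> c x) = complex_of_real ((norm (\<pi> a x))\<^sup>2 / (norm a)\<^sup>2)"
    unfolding c_def star_rep_scaleR cinner_scaleR_right star_rep_mult
      adjointsD[OF star_rep_adjoints, symmetric] cinner_self
    by (simp add: scaleR_conv_of_real divide_inverse mult.commute)
  ultimately have "complex_of_real ((norm (\<pi> d x))\<^sup>2 + (norm (\<pi> a x))\<^sup>2 / (norm a)\<^sup>2) = cinner x (\<pi> 1 x)"
    by (simp add: cinner_self)
  then have "(norm (\<pi> d x))\<^sup>2 + (norm (\<pi> a x))\<^sup>2 / (norm a)\<^sup>2 = Re (cinner x (\<pi> 1 x))"
    by (metis Re_complex_of_real)
  also have "\<dots> \<le> norm x * norm (\<pi> 1 x)"
    using Cauchy_Schwarz_cinner[of x "\<pi> 1 x"] complex_Re_le_cmod order_trans by blast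
  also have "\<dots> \<le> norm x * norm x" by (intro mult_left_mono n1) simp
  finally have "(norm (\<pi> a x))\<^sup>2 / (norm a)\<^sup>2 \<le> (norm x)\<^sup>2"
    using zero_le_power2[of "norm (\<pi> d x)"] unfolding power2_eq_square[of "norm x"] by linarith
  then have "(norm (\<pi> a x))\<^sup>2 \<le> (norm a * norm x)\<^sup>2"
    using False by (simp add: field_simps power_mult_distrib)
  then show ?thesis by (rule power2_le_imp_le) simp
qed

lemma star_rep_bounded_linear: "bounded_linear (\<lambda>a. \<pi> a x)"
  by (rule bounded_linear_intro[of _ "norm x"])
     (simp_all add: star_rep_add star_rep_scaleR star_rep_contractive)

end

section \<open>Analytic elements\<close>

context
  fixes \<sigma> :: "real \<Rightarrow> 'a::unital_cstar_algebra \<Rightarrow> 'a"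
  assumes dyn: "cstar_dynamical_system \<sigma>"
begin

lemma dyn_clinear: "clinear (\<sigma> t)" 
  using dyn by (simp add: cstar_dynamical_system_def star_automorphism_def)
lemma dyn_mult: "\<sigma> t (a * b) = \<sigma> t a * \<sigma> t b"
  using dyn by (simp add: cstar_dynamical_system_def star_automorphism_def)
lemma dyn_star: "\<sigma> t (star a) = star (\<sigma> t a)"
  using dyn by (simp add: cstar_dynamical_system_def star_automorphism_def)
lemma dyn_bij: "bij (\<sigma> t)"
  using dyn by (simp add: cstar_dynamical_system_def star_automorphism_def)
lemma dyn_add: "\<sigma> (s + t) a = \<sigma> s (\<sigma> t a)"
  using dyn by (simp add: cstar_dynamical_system_def)
lemma dyn_continuous: "continuous_on UNIV (\<lambda>t. \<sigma> t a)"
  using dyn by (simp add: cstar_dynamical_system_def)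

lemma dyn_zero: "\<sigma> 0 a = a"
proof -
  have "\<sigma> 0 (\<sigma> 0 a) = \<sigma> 0 a" using dyn_add[of 0 0 a] by simp
  then show ?thesis by (rule injD[OF bij_is_inj[OF dyn_bij]])
qed

lemma dyn_one: "\<sigma> t 1 = 1"
proof -
  obtain b where b: "1 = \<sigma> t b" using bij_is_surj[OF dyn_bij, of t] by (rule surjE)
  have "\<sigma> t 1 = \<sigma> t 1 * \<sigma> t b" using b by simp
  also have "\<dots> = 1" unfolding dyn_mult[symmetric] using b by simp
  finally show ?thesis .
qed

lemma dyn_contractive: "norm (\<sigma> t a) \<le> norm a"
  by (rule star_hom_contractive[OF dyn_clinear dyn_mult dyn_star dyn_one])

lemma dyn_bounded_linear: "bounded_linear (\<sigma> t)"
  by (rule bounded_linear_intro[of _ 1])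
     (use dyn_clinear[of t] in \<open>simp_all add: clinear_def clinear_scaleR dyn_contractive\<close>)

end

lemma exp_remainder: "cmod (exp u - 1 - u) \<le> exp (cmod u) * (cmod u)\<^sup>2"
  using Taylor_exp_field[of u 1] by (simp add: power2_eq_square numeral_2_eq_2 diff_diff_eq)

text \<open>Completing the square: \<open>c |t| \<le> c\<^sup>2 + t\<^sup>2/4\<close>. All integrands below are of this type, so they are
  dominated by a multiple of \<open>e\<^bsup>-t\<^sup>2/4\<^esup>\<close>.\<close>

lemma std_normal_density_bound:
  assumes "0 \<le> c"
  shows "std_normal_density t * exp (c * \<bar>t\<bar>) \<le> (1 / sqrt (2 * pi) * exp (c\<^sup>2)) * exp (- (t\<^sup>2 / 4))"
proof -
  have "0 \<le> (\<bar>t\<bar> / 2 - c)\<^sup>2" by simp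
  then have "c * \<bar>t\<bar> \<le> c\<^sup>2 + t\<^sup>2 / 4"
    by (simp add: power2_diff power_divide mult.commute)
  then have le: "- t\<^sup>2 / 2 + c * \<bar>t\<bar> \<le> c\<^sup>2 + - (t\<^sup>2 / 4)" by simp
  have "exp (- t\<^sup>2 / 2) * exp (c * \<bar>t\<bar>) \<le> exp (c\<^sup>2) * exp (- (t\<^sup>2 / 4))"
    unfolding exp_add[symmetric] using le by simp
  then have "1 / sqrt (2 * pi) * (exp (- t\<^sup>2 / 2) * exp (c * \<bar>t\<bar>)) \<le>
      1 / sqrt (2 * pi) * (exp (c\<^sup>2) * exp (- (t\<^sup>2 / 4)))"
    by (rule mult_left_mono) simp
  then show ?thesis by (simp add: normal_density_def)
qed

lemma integrable_gauss4: "integrable lborel (\<lambda>t::real. C * exp (- (t\<^sup>2 / 4)))"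
proof -
  have "integrable lborel (\<lambda>t. (C * sqrt (2 * pi * (sqrt 2)\<^sup>2)) * normal_density 0 (sqrt 2) t)"
    by (intro integrable_mult_right integrable_normal_density) simp
  then show ?thesis by (simp add: normal_density_def)
qed

text \<open>The Gaussian average of an orbit has the entire extension
  \<open>z \<mapsto> e\<^bsup>-z\<^sup>2/2\<^esup> \<integral> k(t) e\<^bsup>tz\<^esup> \<sigma>\<^sub>t(a) dt\<close>, where \<open>k\<close> is the standard Gaussian density.\<close>

lemma gaussian_average_analytic:
  fixes \<sigma> :: "real \<Rightarrow> 'a::{unital_cstar_algebra, second_countable_topology} \<Rightarrow> 'a"
  assumes dyn: "cstar_dynamical_system \<sigma>"
  shows "\<exists>F. analytic_extension \<sigma> (\<integral>t. std_normal_density t *\<^sub>R \<sigma> t a \<partial>lborel) F"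
proof -
  \<comment> \<open>Translation by \<open>s\<close> turns the density \<open>k(t)\<close> into \<open>k(t - s) = e\<^bsup>-s\<^sup>2/2\<^esup> k(t) e\<^bsup>ts\<^esup>\<close>, which is entire in \<open>s\<close>.\<close>
  define w where "w t z = complex_of_real (std_normal_density t) * exp (complex_of_real t * z)" for t z
  have cont_k: "continuous_on UNIV std_normal_density"
    unfolding normal_density_def by (intro continuous_intros) simp_all
  have cont_w: "continuous_on UNIV (\<lambda>t. w t z)" for z
    unfolding w_def by (intro continuous_intros cont_k)
  have kpos: "0 \<le> std_normal_density t" for t by simp
  have re: "Re (complex_of_real t * z) \<le> cmod z * \<bar>t\<bar>" for t z
    using complex_Re_le_cmod[of "complex_of_real t * z"] by (simp add: norm_mult mult.commute)
  have wb: "cmod (w t z) \<le> std_normal_density t * exp (cmod z * \<bar>t\<bar>)" for t z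
    unfolding w_def norm_mult norm_of_real norm_exp_eq_Re abs_of_nonneg[OF kpos]
    by (intro mult_left_mono kpos) (use re in simp)
  have meas: "(\<lambda>t. f t *\<^sub>C \<sigma> t a) \<in> borel_measurable lborel" if "continuous_on UNIV f" for f
    using borel_measurable_continuous_onI[OF scaleC_cstar.continuous_on[OF that dyn_continuous[OF dyn]]]
    by simp
  define G where "G z = (\<integral>t. w t z *\<^sub>C \<sigma> t a \<partial>lborel)" for z
  define D where "D z = (\<integral>t. (complex_of_real t * w t z) *\<^sub>C \<sigma> t a \<partial>lborel)" for z
  define N where "N c t = (1 / sqrt (2 * pi) * exp (c\<^sup>2) * norm a) * exp (- (t\<^sup>2 / 4))" for c t :: real
  have intN: "integrable lborel (N c)" for c unfolding N_def by (rule integrable_gauss4)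
  have kN: "std_normal_density t * exp (c * \<bar>t\<bar>) * norm (\<sigma> t a) \<le> N c t" if "0 \<le> c" for c t
  proof -
    have "std_normal_density t * exp (c * \<bar>t\<bar>) * norm (\<sigma> t a) \<le>
        (1 / sqrt (2 * pi) * exp (c\<^sup>2)) * exp (- (t\<^sup>2 / 4)) * norm a"
      by (intro mult_mono std_normal_density_bound that dyn_contractive[OF dyn]) simp_all
    then show ?thesis by (simp add: N_def mult_ac)
  qed
  have intG: "integrable lborel (\<lambda>t. w t z *\<^sub>C \<sigma> t a)" for z
  proof (rule Bochner_Integration.integrable_bound[OF intN[of "cmod z"] meas[OF cont_w]])
    have "norm (w t z *\<^sub>C \<sigma> t a) \<le> norm (N (cmod z) t)" for t
    proof -
      have "norm (w t z *\<^sub>C \<sigma> t a) \<le> std_normal_density t * exp (cmod z * \<bar>t\<bar>) * norm (\<sigma> t a)"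
        unfolding norm_scaleC by (intro mult_right_mono wb) simp
      also have "\<dots> \<le> N (cmod z) t" by (rule kN) simp
      finally show ?thesis by simp
    qed
    then show "AE t in lborel. norm (w t z *\<^sub>C \<sigma> t a) \<le> norm (N (cmod z) t)" by simp
  qed
  have te: "\<bar>t\<bar> \<le> exp \<bar>t\<bar>" for t :: real using exp_ge_add_one_self[of "\<bar>t\<bar>"] by linarith
  have intD: "integrable lborel (\<lambda>t. (complex_of_real t * w t z) *\<^sub>C \<sigma> t a)" for z
  proof (rule Bochner_Integration.integrable_bound[OF intN[of "cmod z + 1"]])
    show "(\<lambda>t. (complex_of_real t * w t z) *\<^sub>C \<sigma> t a) \<in> borel_measurable lborel"
      by (rule meas) (intro continuous_intros cont_w)
    have "norm ((complex_of_real t * w t z) *\<^sub>C \<sigma> t a) \<le> norm (N (cmod z + 1) t)" for t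
    proof -
      have "cmod (complex_of_real t * w t z) \<le> exp \<bar>t\<bar> * (std_normal_density t * exp (cmod z * \<bar>t\<bar>))"
        unfolding norm_mult norm_of_real by (intro mult_mono te wb) simp_all
      also have "\<dots> = std_normal_density t * exp ((cmod z + 1) * \<bar>t\<bar>)"
      proof -
        have "exp ((cmod z + 1) * \<bar>t\<bar>) = exp \<bar>t\<bar> * exp (cmod z * \<bar>t\<bar>)"
          unfolding exp_add[symmetric] by (simp add: algebra_simps)
        then show ?thesis by simp
      qed
      finally have "norm ((complex_of_real t * w t z) *\<^sub>C \<sigma> t a) \<le>
          std_normal_density t * exp ((cmod z + 1) * \<bar>t\<bar>) * norm (\<sigma> t a)"
        unfolding norm_scaleC by (rule mult_right_mono) simp
      also have "\<dots> \<le> N (cmod z + 1) t" by (rule kN) simp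
      finally show ?thesis by simp
    qed
    then show "AE t in lborel. norm ((complex_of_real t * w t z) *\<^sub>C \<sigma> t a) \<le> norm (N (cmod z + 1) t)"
      by simp
  qed
  \<comment> \<open>Differentiation under the integral sign, by the quadratic bound on the remainder of \<open>exp\<close>.\<close>
  have Gder: "(G has_derivative (\<lambda>h. h *\<^sub>C D z)) (at z)" for z
    unfolding has_derivative_at
  proof
    show "bounded_linear (\<lambda>h. h *\<^sub>C D z)" by (rule scaleC_cstar.bounded_linear_left)
    define M where "M = 2 * (\<integral>t. N (cmod z + 2) t \<partial>lborel)"
    have est: "norm (G (z + h) - G z - h *\<^sub>C D z) \<le> M * (cmod h)\<^sup>2" if h: "cmod h \<le> 1" for h
    proof -
      have eq: "G (z + h) - G z - h *\<^sub>C D z =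
          (\<integral>t. w t (z + h) *\<^sub>C \<sigma> t a - w t z *\<^sub>C \<sigma> t a - h *\<^sub>C ((complex_of_real t * w t z) *\<^sub>C \<sigma> t a) \<partial>lborel)"
      proof -
        have iD: "integrable lborel (\<lambda>t. h *\<^sub>C ((complex_of_real t * w t z) *\<^sub>C \<sigma> t a))"
          by (rule integrable_bounded_linear[OF scaleC_cstar.bounded_linear_right intD])
        show ?thesis
          unfolding G_def D_def integral_bounded_linear[OF scaleC_cstar.bounded_linear_right intD, symmetric]
            Bochner_Integration.integral_diff[OF Bochner_Integration.integrable_diff[OF intG intG] iD]
            Bochner_Integration.integral_diff[OF intG intG] ..
      qed
      have pt: "norm (w t (z + h) *\<^sub>C \<sigma> t a - w t z *\<^sub>C \<sigma> t a - h *\<^sub>C ((complex_of_real t * w t z) *\<^sub>C \<sigma> t a))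
          \<le> 2 * (cmod h)\<^sup>2 * N (cmod z + 2) t" for t
      proof -
        let ?u = "complex_of_real t * h"
        have u: "cmod ?u = \<bar>t\<bar> * cmod h" by (simp add: norm_mult)
        have "w t (z + h) *\<^sub>C \<sigma> t a - w t z *\<^sub>C \<sigma> t a - h *\<^sub>C ((complex_of_real t * w t z) *\<^sub>C \<sigma> t a) =
            (w t z * (exp ?u - 1 - ?u)) *\<^sub>C \<sigma> t a"
          unfolding scaleC_scaleC cvec.scale_left_diff_distrib[symmetric]
          by (simp add: w_def exp_add algebra_simps)
        then have "norm (w t (z + h) *\<^sub>C \<sigma> t a - w t z *\<^sub>C \<sigma> t a - h *\<^sub>C ((complex_of_real t * w t z) *\<^sub>C \<sigma> t a)) =
            cmod (w t z) * cmod (exp ?u - 1 - ?u) * norm (\<sigma> t a)"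
          by (simp add: norm_scaleC norm_mult)
        also have "\<dots> \<le> (std_normal_density t * exp (cmod z * \<bar>t\<bar>)) *
            (exp \<bar>t\<bar> * (2 * exp \<bar>t\<bar> * (cmod h)\<^sup>2)) * norm (\<sigma> t a)"
        proof (intro mult_right_mono mult_mono wb order_trans[OF exp_remainder])
          have "\<bar>t\<bar> * cmod h \<le> \<bar>t\<bar> * 1" by (intro mult_left_mono h) simp
          then show "exp (cmod ?u) \<le> exp \<bar>t\<bar>" by (simp add: u)
          have "t\<^sup>2 / 2 \<le> exp \<bar>t\<bar>" using exp_lower_Taylor_quadratic[of "\<bar>t\<bar>"] by simp
          then have "t\<^sup>2 \<le> 2 * exp \<bar>t\<bar>" by simp
          then show "(cmod ?u)\<^sup>2 \<le> 2 * exp \<bar>t\<bar> * (cmod h)\<^sup>2"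
            unfolding u power_mult_distrib power2_abs by (intro mult_right_mono) simp_all
        qed simp_all
        also have "\<dots> = 2 * (cmod h)\<^sup>2 * (std_normal_density t * exp ((cmod z + 2) * \<bar>t\<bar>) * norm (\<sigma> t a))"
        proof -
          have "exp ((cmod z + 2) * \<bar>t\<bar>) = exp (cmod z * \<bar>t\<bar>) * (exp \<bar>t\<bar> * exp \<bar>t\<bar>)"
            unfolding exp_add[symmetric] by (simp add: algebra_simps)
          then show ?thesis by (simp add: mult_ac)
        qed
        also have "\<dots> \<le> 2 * (cmod h)\<^sup>2 * N (cmod z + 2) t"
          by (intro mult_left_mono kN) simp_all
        finally show ?thesis .
      qed
      have "norm (G (z + h) - G z - h *\<^sub>C D z) \<le> (\<integral>t. 2 * (cmod h)\<^sup>2 * N (cmod z + 2) t \<partial>lborel)"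
        unfolding eq
      proof (rule Bochner_Integration.integral_norm_bound_integral)
        show "integrable lborel (\<lambda>t. w t (z + h) *\<^sub>C \<sigma> t a - w t z *\<^sub>C \<sigma> t a - h *\<^sub>C ((complex_of_real t * w t z) *\<^sub>C \<sigma> t a))"
          by (intro Bochner_Integration.integrable_diff intG
              integrable_bounded_linear[OF scaleC_cstar.bounded_linear_right] intD)
        show "integrable lborel (\<lambda>t. 2 * (cmod h)\<^sup>2 * N (cmod z + 2) t)"
          by (intro integrable_mult_right intN)
      qed (rule pt)
      also have "\<dots> = M * (cmod h)\<^sup>2" by (simp add: M_def)
      finally show ?thesis .
    qed
    show "(\<lambda>h. norm (G (z + h) - G z - h *\<^sub>C D z) / norm h) \<midarrow>0\<rightarrow> 0"
    proof (rule Lim_null_comparison)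
      have "\<forall>\<^sub>F h in at (0::complex). cmod h < 1" by (simp add: eventually_at) (metis zero_less_one)
      then show "\<forall>\<^sub>F h in at 0. norm (norm (G (z + h) - G z - h *\<^sub>C D z) / norm h) \<le> M * cmod h"
      proof (rule eventually_mono)
        fix h :: complex assume "cmod h < 1"
        then have "norm (G (z + h) - G z - h *\<^sub>C D z) \<le> M * (cmod h)\<^sup>2" by (intro est) simp
        then show "norm (norm (G (z + h) - G z - h *\<^sub>C D z) / norm h) \<le> M * cmod h"
          by (cases "h = 0") (simp_all add: divide_le_eq power2_eq_square mult.assoc)
      qed
      show "((\<lambda>h. M * cmod h) \<longlongrightarrow> 0) (at 0)" by (auto intro!: tendsto_eq_intros)
    qed
  qed
  define F where "F z = exp (- (z\<^sup>2 / 2)) *\<^sub>C G z" for z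
  have "analytic_extension \<sigma> (\<integral>t. std_normal_density t *\<^sub>R \<sigma> t a \<partial>lborel) F"
    unfolding analytic_extension_def
  proof (intro conjI allI)
    fix z :: complex
    have e: "((\<lambda>z::complex. exp (- (z\<^sup>2 / 2))) has_derivative (\<lambda>h. h * (- z * exp (- (z\<^sup>2 / 2))))) (at z)"
    proof -
      have "((\<lambda>z. exp (- (z\<^sup>2 / 2))) has_field_derivative (- z * exp (- (z\<^sup>2 / 2)))) (at z)"
        by (auto intro!: derivative_eq_intros)
      then show ?thesis by (simp only: has_field_derivative_def mult.commute[of _ "- z * exp (- (z\<^sup>2 / 2))"])
    qed
    show "\<exists>d. (F has_derivative (\<lambda>h. h *\<^sub>C d)) (at z)"
      unfolding F_def
    proof (rule exI, rule has_derivative_eq_rhs, rule scaleC_cstar.FDERIV[OF e Gder])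
      show "(\<lambda>h. exp (- (z\<^sup>2 / 2)) *\<^sub>C h *\<^sub>C D z + (h * (- z * exp (- (z\<^sup>2 / 2)))) *\<^sub>C G z) =
        (\<lambda>h. h *\<^sub>C (exp (- (z\<^sup>2 / 2)) *\<^sub>C D z + (- z * exp (- (z\<^sup>2 / 2))) *\<^sub>C G z))"
        by (simp add: cvec.scale_right_diff_distrib scaleC_scaleC mult.commute)
    qed
  next
    fix s :: real
    have int0: "integrable lborel (\<lambda>t. std_normal_density t *\<^sub>R \<sigma> t a)"
      using intG[of 0] by (simp add: w_def scaleC_of_real)
    have "\<sigma> s (\<integral>t. std_normal_density t *\<^sub>R \<sigma> t a \<partial>lborel) =
        (\<integral>t. \<sigma> s (std_normal_density t *\<^sub>R \<sigma> t a) \<partial>lborel)"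
      by (rule integral_bounded_linear[symmetric, OF dyn_bounded_linear[OF dyn] int0])
    also have "\<dots> = (\<integral>t. std_normal_density t *\<^sub>R \<sigma> (s + t) a \<partial>lborel)"
      by (simp add: clinear_scaleR[OF dyn_clinear[OF dyn]] dyn_add[OF dyn])
    also have "\<dots> = (\<integral>t. std_normal_density (- s + t) *\<^sub>R \<sigma> t a \<partial>lborel)"
      by (subst lborel_integral_real_affine[of 1 _ "- s"]) simp_all
    also have "\<dots> = (\<integral>t. exp (- ((complex_of_real s)\<^sup>2 / 2)) *\<^sub>C (w t (complex_of_real s) *\<^sub>C \<sigma> t a) \<partial>lborel)"
    proof (rule Bochner_Integration.integral_cong[OF refl])
      fix t
      have "std_normal_density (- s + t) = exp (- (s\<^sup>2 / 2)) * (std_normal_density t * exp (t * s))"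
      proof -
        have "- (- s + t)\<^sup>2 / 2 = - (s\<^sup>2 / 2) + (- t\<^sup>2 / 2 + t * s)"
          by (simp add: power2_eq_square field_simps)
        then show ?thesis by (simp add: normal_density_def exp_add[symmetric] del: exp_add)
      qed
      then show "std_normal_density (- s + t) *\<^sub>R \<sigma> t a =
          exp (- ((complex_of_real s)\<^sup>2 / 2)) *\<^sub>C (w t (complex_of_real s) *\<^sub>C \<sigma> t a)"
        unfolding scaleC_scaleC w_def scaleR_scaleC
        by (simp add: exp_of_real[symmetric])
    qed
    also have "\<dots> = F (complex_of_real s)"
      unfolding F_def G_def
      by (rule integral_bounded_linear[OF scaleC_cstar.bounded_linear_right intG])
    finally show "F (complex_of_real s) = \<sigma> s (\<integral>t. std_normal_density t *\<^sub>R \<sigma> t a \<partial>lborel)" ..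
  qed
  then show ?thesis by blast
qed

text \<open>Averaging against narrower and narrower Gaussians, which amounts to slowing down the dynamics,
  approximates every element by analytic ones.\<close>

lemma analytic_dense:
  fixes \<sigma> :: "real \<Rightarrow> 'a::{unital_cstar_algebra, second_countable_topology} \<Rightarrow> 'a"
  assumes dyn: "cstar_dynamical_system \<sigma>"
  shows "closure {b. \<exists>F. analytic_extension \<sigma> b F} = UNIV"
proof -
  have "a \<in> closure {b. \<exists>F. analytic_extension \<sigma> b F}" for a
  proof -
    define s where "s n t = std_normal_density t *\<^sub>R \<sigma> (t / real (Suc n)) a" for n t
    have dynn: "cstar_dynamical_system (\<lambda>t. \<sigma> (t / real (Suc n)))" for n
      unfolding cstar_dynamical_system_def
    proof (intro conjI allI)
      show "star_automorphism (\<sigma> (t / real (Suc n)))" for t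
        using dyn by (simp add: cstar_dynamical_system_def)
      show "\<sigma> ((s + t) / real (Suc n)) = \<sigma> (s / real (Suc n)) \<circ> \<sigma> (t / real (Suc n))" for s t
        using dyn by (simp add: cstar_dynamical_system_def add_divide_distrib)
      show "continuous_on UNIV (\<lambda>t. \<sigma> (t / real (Suc n)) a)" for a
        by (rule continuous_on_compose2[OF dyn_continuous[OF dyn, of a]])
           (auto intro!: continuous_intros)
    qed
    have an: "\<exists>F. analytic_extension \<sigma> (\<integral>t. s n t \<partial>lborel) F" for n
    proof -
      let ?N = "real (Suc n)" and ?b = "\<integral>t. s n t \<partial>lborel"
      obtain F where F: "analytic_extension (\<lambda>t. \<sigma> (t / ?N)) ?b F"
        using gaussian_average_analytic[OF dynn[of n], of a] unfolding s_def by blast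
      have "analytic_extension \<sigma> ?b (\<lambda>z. F (complex_of_real ?N * z))"
        unfolding analytic_extension_def
      proof (intro conjI allI)
        fix z
        obtain d where d: "(F has_derivative (\<lambda>h. h *\<^sub>C d)) (at (complex_of_real ?N * z))"
          using F unfolding analytic_extension_def by blast
        have l: "((\<lambda>z. complex_of_real ?N * z) has_derivative (\<lambda>h. complex_of_real ?N * h)) (at z)"
          by (intro derivative_intros)
        have "((\<lambda>z. F (complex_of_real ?N * z)) has_derivative (\<lambda>h. (complex_of_real ?N * h) *\<^sub>C d)) (at z)"
          by (rule has_derivative_compose[OF l d])
        moreover have "(\<lambda>h. (complex_of_real ?N * h) *\<^sub>C d) = (\<lambda>h. h *\<^sub>C (complex_of_real ?N *\<^sub>C d))"
          unfolding scaleC_scaleC by (simp only: mult.commute)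
        ultimately have "((\<lambda>z. F (complex_of_real ?N * z)) has_derivative
            (\<lambda>h. h *\<^sub>C (complex_of_real ?N *\<^sub>C d))) (at z)" by (simp only:)
        then show "\<exists>d. ((\<lambda>z. F (complex_of_real ?N * z)) has_derivative (\<lambda>h. h *\<^sub>C d)) (at z)"
          by (rule exI)
      next
        fix t
        have "F (complex_of_real (?N * t)) = \<sigma> (?N * t / ?N) ?b"
          using F unfolding analytic_extension_def by blast
        then show "F (complex_of_real ?N * complex_of_real t) = \<sigma> t ?b" by simp
      qed
      then show ?thesis by blast
    qed
    have cs: "continuous_on UNIV (s n)" for n
      unfolding s_def normal_density_def
      by (intro continuous_intros dyn_continuous[OF dynn]) simp_all
    have "(\<lambda>n. \<integral>t. s n t \<partial>lborel) \<longlonglongrightarrow> (\<integral>t. std_normal_density t *\<^sub>R a \<partial>lborel)"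
    proof (rule integral_dominated_convergence[where w = "\<lambda>t. std_normal_density t * norm a"])
      show "integrable lborel (\<lambda>t. std_normal_density t * norm a)" by (intro integrable_mult_left integrable_normal_density) simp
      show "(\<lambda>t. std_normal_density t *\<^sub>R a) \<in> borel_measurable lborel" by simp
      show "s n \<in> borel_measurable lborel" for n
        using borel_measurable_continuous_onI[OF cs] by simp
      show "AE t in lborel. norm (s n t) \<le> std_normal_density t * norm a" for n
        unfolding s_def by (simp add: dyn_contractive[OF dyn] mult_left_mono)
      have "(\<lambda>n. s n t) \<longlonglongrightarrow> std_normal_density t *\<^sub>R a" for t
      proof -
        have "isCont (\<lambda>t. \<sigma> t a) 0"
          using dyn_continuous[OF dyn, of a] by (simp add: continuous_on_eq_continuous_at)
        moreover have "(\<lambda>n. t / real (Suc n)) \<longlonglongrightarrow> 0"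
          using LIMSEQ_Suc[OF lim_const_over_n[of t]] by simp
        ultimately have "(\<lambda>n. \<sigma> (t / real (Suc n)) a) \<longlonglongrightarrow> \<sigma> 0 a" by (rule isCont_tendsto_compose)
        then show ?thesis unfolding s_def dyn_zero[OF dyn] by (intro tendsto_scaleR tendsto_const)
      qed
      then show "AE t in lborel. (\<lambda>n. s n t) \<longlonglongrightarrow> std_normal_density t *\<^sub>R a" by simp
    qed
    then have "(\<lambda>n. \<integral>t. s n t \<partial>lborel) \<longlonglongrightarrow> a" by (simp add: integral_scaleR_left)
    then show ?thesis unfolding closure_sequential using an
      by (intro exI[of _ "\<lambda>n. \<integral>t. s n t \<partial>lborel"]) simp
  qed
  then show ?thesis by blast
qed

section \<open>Matrix elements of analytic orbits\<close>

lemma analytic_extension_shift: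
  assumes dyn: "cstar_dynamical_system \<sigma>" and F: "analytic_extension \<sigma> a F"
  shows "analytic_extension \<sigma> (F (complex_of_real t)) (\<lambda>w. F (complex_of_real t + w))"
  unfolding analytic_extension_def
proof (intro conjI allI)
  fix w
  obtain d where d: "(F has_derivative (\<lambda>h. h *\<^sub>C d)) (at (complex_of_real t + w))"
    using F unfolding analytic_extension_def by blast
  have "((\<lambda>w. complex_of_real t + w) has_derivative (\<lambda>h. h)) (at w)" by (auto intro!: derivative_eq_intros)
  from has_derivative_compose[OF this d]
  show "\<exists>d. ((\<lambda>w. F (complex_of_real t + w)) has_derivative (\<lambda>h. h *\<^sub>C d)) (at w)" by blast
next
  have Fr: "F (complex_of_real r) = \<sigma> r a" for r using F unfolding analytic_extension_def by blast
  show "F (complex_of_real t + complex_of_real r) = \<sigma> r (F (complex_of_real t))" for r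
    unfolding of_real_add[symmetric] Fr dyn_add[OF dyn, symmetric] by (simp add: add.commute)
qed

lemma entire_zero_on_reals:
  assumes "f holomorphic_on UNIV" "\<And>t. f (complex_of_real t) = 0" shows "f z = 0"
proof (rule analytic_continuation[of f UNIV "range complex_of_real" 0])
  show "(0::complex) islimpt range complex_of_real"
    unfolding islimpt_approachable
  proof (intro allI impI)
    fix e :: real assume "e > 0"
    then show "\<exists>x'\<in>range complex_of_real. x' \<noteq> 0 \<and> dist x' 0 < e"
    proof (intro bexI[of _ "complex_of_real (e / 2)"])
      show "complex_of_real (e / 2) \<in> range complex_of_real" by (rule rangeI)
    qed simp
  qed
qed (use assms in auto)

lemma analytic_extension_holomorphic:
  assumes F: "analytic_extension \<sigma> a F" and L: "bounded_linear L" "clinear L"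
  shows "(\<lambda>z. L (F z) :: complex) holomorphic_on UNIV"
proof -
  have "\<exists>d. ((\<lambda>z. L (F z)) has_field_derivative d) (at z)" for z
  proof -
    obtain d where d: "(F has_derivative (\<lambda>h. h *\<^sub>C d)) (at z)"
      using F unfolding analytic_extension_def by blast
    have "((\<lambda>z. L (F z)) has_derivative (\<lambda>h. L (h *\<^sub>C d))) (at z)"
      by (rule bounded_linear.has_derivative[OF L(1) d])
    moreover have "(\<lambda>h. L (h *\<^sub>C d)) = (*) (L d)"
      using L(2) by (simp add: clinear_def scaleC_complex_def mult.commute fun_eq_iff)
    ultimately show ?thesis unfolding has_field_derivative_def by (intro exI) simp
  qed
  then show ?thesis unfolding holomorphic_on_def field_differentiable_def by simp
qed

lemma star_rep_functional:
  assumes rep: "star_rep K \<pi>"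
  shows "bounded_linear (\<lambda>a. cinner x (\<pi> a y))" "clinear (\<lambda>a. cinner x (\<pi> a y))"
  using bounded_linear_compose[OF cinner.bounded_linear_right star_rep_bounded_linear[OF rep], of x y]
    star_rep_clinear[OF rep, of y]
  by (auto simp: clinear_def cinner_add_right cinner_scaleC_right scaleC_complex_def)

lemma star_rep_twist:
  assumes rep: "star_rep K \<pi>" and dyn: "cstar_dynamical_system \<sigma>"
  shows "star_rep K (\<lambda>a. \<pi> (\<sigma> t a))"
  using rep dyn_clinear[OF dyn, of t] unfolding star_rep_def
  by (simp add: dyn_mult[OF dyn] dyn_star[OF dyn] dyn_one[OF dyn] clinear_def)

text \<open>Twisting the representation by \<open>\<sigma>\<^sub>t\<close> leaves it contractive, so matrix elements of an analytic
  orbit are bounded on horizontal strips.\<close>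

lemma matrix_element_strip_bound:
  assumes rep: "star_rep K \<pi>" and dyn: "cstar_dynamical_system \<sigma>" and F: "analytic_extension \<sigma> a F"
  shows "cmod (cinner x (\<pi> (F z) y)) \<le> norm x * norm y * norm (F (\<i> * complex_of_real (Im z)))"
proof -
  define t where "t = complex_of_real (Re z)"
  have shift: "analytic_extension \<sigma> (F t) (\<lambda>w. F (t + w))"
    unfolding t_def by (rule analytic_extension_shift[OF dyn F])
  note rep' = star_rep_twist[OF rep dyn, of "Re z"]
  have "cinner x (\<pi> (F (t + w)) y) - cinner x (\<pi> (\<sigma> (Re z) (F w)) y) = 0" for w
  proof (rule entire_zero_on_reals[of "\<lambda>w. cinner x (\<pi> (F (t + w)) y) - cinner x (\<pi> (\<sigma> (Re z) (F w)) y)"])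
    show "(\<lambda>w. cinner x (\<pi> (F (t + w)) y) - cinner x (\<pi> (\<sigma> (Re z) (F w)) y)) holomorphic_on UNIV"
      by (intro holomorphic_on_diff analytic_extension_holomorphic[OF shift]
          analytic_extension_holomorphic[OF F] star_rep_functional[OF rep] star_rep_functional[OF rep'])
    fix r
    have Fr: "F (complex_of_real r) = \<sigma> r a" for r using F unfolding analytic_extension_def by blast
    have "F (t + complex_of_real r) = \<sigma> (Re z) (F (complex_of_real r))"
      unfolding t_def of_real_add[symmetric] Fr dyn_add[OF dyn] ..
    then show "cinner x (\<pi> (F (t + complex_of_real r)) y) - cinner x (\<pi> (\<sigma> (Re z) (F (complex_of_real r))) y) = 0"
      by simp
  qed
  from this[of "\<i> * complex_of_real (Im z)"]
  have "cinner x (\<pi> (F z) y) = cinner x (\<pi> (\<sigma> (Re z) (F (\<i> * complex_of_real (Im z)))) y)"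
    unfolding t_def complex_eq[symmetric] by simp
  also have "cmod \<dots> \<le> norm x * norm (\<pi> (\<sigma> (Re z) (F (\<i> * complex_of_real (Im z)))) y)"
    by (rule Cauchy_Schwarz_cinner)
  also have "\<dots> \<le> norm x * (norm (F (\<i> * complex_of_real (Im z))) * norm y)"
    by (intro mult_left_mono star_rep_contractive[OF rep']) simp
  finally show ?thesis by (simp add: mult_ac)
qed

text \<open>Quasi-periodicity in the imaginary direction determines a matrix element of an analytic orbit:
  after division by the exponential with the same factor it is periodic, hence bounded, hence constant
  by Liouville.\<close>

lemma quasi_periodic_matrix_element:
  assumes rep: "star_rep K \<pi>" and dyn: "cstar_dynamical_system \<sigma>" and F: "analytic_extension \<sigma> a F"
    and \<beta>: "\<beta> > 0" and \<kappa>: "\<kappa> > 0"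
    and per: "\<And>t. cinner x (\<pi> (F (complex_of_real t + \<i> * complex_of_real \<beta>)) y) =
      complex_of_real \<kappa> * cinner x (\<pi> (F (complex_of_real t)) y)"
  shows "cinner x (\<pi> (F z) y) = exp (- (\<i> * z * complex_of_real (ln \<kappa> / \<beta>))) * cinner x (\<pi> a y)"
proof -
  define c where "c = complex_of_real (ln \<kappa> / \<beta>)"
  define p where "p = \<i> * complex_of_real \<beta>"
  define f where "f z = cinner x (\<pi> (F z) y)" for z
  have holf: "f holomorphic_on UNIV"
    unfolding f_def by (rule analytic_extension_holomorphic[OF F star_rep_functional[OF rep]])
  have hols: "(\<lambda>z. f (z + p)) holomorphic_on UNIV"
  proof -
    have "(f \<circ> (\<lambda>z. z + p)) holomorphic_on UNIV"
      by (rule holomorphic_on_compose_gen[of _ _ f UNIV]) (auto intro!: holomorphic_intros holf)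
    then show ?thesis by (simp add: comp_def)
  qed
  have fp: "f (z + p) = complex_of_real \<kappa> * f z" for z
  proof -
    have "f (z + p) - complex_of_real \<kappa> * f z = 0"
    proof (rule entire_zero_on_reals[of "\<lambda>z. f (z + p) - complex_of_real \<kappa> * f z"])
      show "(\<lambda>z. f (z + p) - complex_of_real \<kappa> * f z) holomorphic_on UNIV"
        by (intro holomorphic_intros holf hols)
      show "f (complex_of_real t + p) - complex_of_real \<kappa> * f (complex_of_real t) = 0" for t
        unfolding f_def p_def per by simp
    qed
    then show ?thesis by simp
  qed
  define g where "g z = f z * exp (\<i> * z * c)" for z
  have holg: "g holomorphic_on UNIV"
    unfolding g_def by (intro holomorphic_intros holf)
  have gp: "g (z + p) = g z" for z
  proof -
    have "\<i> * (z + p) * c = \<i> * z * c + complex_of_real (- ln \<kappa>)"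
    proof -
      have "\<i> * p * c = complex_of_real (- ln \<kappa>)"
        using \<beta> by (simp add: p_def c_def mult.assoc[symmetric])
      then show ?thesis by (simp add: distrib_left distrib_right)
    qed
    then have "exp (\<i> * (z + p) * c) = exp (\<i> * z * c) * complex_of_real (exp (- ln \<kappa>))"
      by (simp only: exp_add exp_of_real)
    also have "exp (- ln \<kappa>) = 1 / \<kappa>" using \<kappa> by (simp add: exp_minus divide_inverse)
    finally show ?thesis using \<kappa> unfolding g_def fp by simp
  qed
  interpret periodic_fun_simple g p by standard (rule gp)
  have Fc: "continuous_on {0..\<beta>} (\<lambda>s. F (\<i> * complex_of_real s))"
  proof (rule continuous_on_compose2[where t = UNIV and g = F])
    have "isCont F z" for z
      using F has_derivative_continuous unfolding analytic_extension_def by blast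
    then show "continuous_on UNIV F" by (simp add: continuous_on_eq_continuous_at)
  qed (auto intro!: continuous_intros)
  have "bounded ((\<lambda>s. F (\<i> * complex_of_real s)) ` {0..\<beta>})"
    by (rule compact_imp_bounded[OF compact_continuous_image[OF Fc]]) simp
  then obtain M where M: "\<And>s. s \<in> {0..\<beta>} \<Longrightarrow> norm (F (\<i> * complex_of_real s)) \<le> M"
    unfolding bounded_iff by blast
  define M' where "M' = norm x * norm y * M * exp (\<bar>ln \<kappa> / \<beta>\<bar> * \<beta>)"
  have gb: "cmod (g z) \<le> M'" if z: "0 \<le> Im z" "Im z \<le> \<beta>" for z
  proof -
    have "cmod (f z) \<le> norm x * norm y * norm (F (\<i> * complex_of_real (Im z)))"
      unfolding f_def by (rule matrix_element_strip_bound[OF rep dyn F])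
    also have "\<dots> \<le> norm x * norm y * M" by (intro mult_left_mono M) (use z in simp_all)
    finally have 1: "cmod (f z) \<le> norm x * norm y * M" .
    have "Re (\<i> * z * c) = - (Im z * (ln \<kappa> / \<beta>))" by (simp add: c_def)
    also have "\<dots> \<le> \<bar>Im z * (ln \<kappa> / \<beta>)\<bar>" by (rule abs_ge_minus_self)
    also have "\<dots> = \<bar>ln \<kappa> / \<beta>\<bar> * Im z" using z by (simp add: abs_mult)
    also have "\<dots> \<le> \<bar>ln \<kappa> / \<beta>\<bar> * \<beta>" by (intro mult_left_mono z) simp
    finally have 2: "cmod (exp (\<i> * z * c)) \<le> exp (\<bar>ln \<kappa> / \<beta>\<bar> * \<beta>)" unfolding norm_exp_eq_Re by simp
    have "0 \<le> norm x * norm y * M" using 1 norm_ge_zero order_trans by blast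
    then show ?thesis unfolding g_def M'_def norm_mult by (intro mult_mono 1 2) simp_all
  qed
  have "cmod (g z) \<le> M'" for z
  proof -
    define n where "n = \<lfloor>Im z / \<beta>\<rfloor>"
    have "cmod (g (z + of_int (- n) * p)) \<le> M'"
    proof (rule gb)
      have "real_of_int n \<le> Im z / \<beta>" unfolding n_def by (rule of_int_floor_le)
      then show "0 \<le> Im (z + of_int (- n) * p)" using \<beta> by (simp add: p_def pos_le_divide_eq)
      have "Im z / \<beta> \<le> real_of_int n + 1" unfolding n_def by linarith
      then show "Im (z + of_int (- n) * p) \<le> \<beta>" using \<beta> by (simp add: p_def pos_divide_le_eq algebra_simps)
    qed
    then show ?thesis unfolding plus_of_int .
  qed
  then have "bounded (range g)" by (auto simp: bounded_iff)
  then have "g constant_on UNIV" using holg by (rule Liouville_theorem[rotated])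
  then have "g z = g 0" unfolding constant_on_def by auto
  moreover have "F 0 = a"
  proof -
    have "F (complex_of_real 0) = \<sigma> 0 a" using F unfolding analytic_extension_def by blast
    then show ?thesis by (simp add: dyn_zero[OF dyn])
  qed
  ultimately have "f z * exp (\<i> * z * c) = cinner x (\<pi> a y)" by (simp add: g_def f_def)
  then have "f z * exp (\<i> * z * c) * exp (- (\<i> * z * c)) = exp (- (\<i> * z * c)) * cinner x (\<pi> a y)"
    by simp
  moreover have "exp (\<i> * z * c) * exp (- (\<i> * z * c)) = 1" by (simp add: exp_minus)
  ultimately have "f z = exp (- (\<i> * z * c)) * cinner x (\<pi> a y)" by (simp only: mult.assoc mult_1_right)
  then show ?thesis by (simp add: f_def c_def)
qed

section \<open>Schur's lemma and the density theorem\<close>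

text \<open>The positive square root \<open>N = |T|\<close> of \<open>T\<^sup>2\<close>, characterised by just those properties that the
  spectral dichotomy below uses.\<close>

lemma ex_modulus:
  fixes T :: "'h::chilbert_space \<Rightarrow> 'h"
  assumes T: "cblin T" and sa: "adjoints T T" and le: "\<And>x. norm (T x) \<le> norm x" and ne: "\<exists>x::'h. x \<noteq> 0"
  shows "\<exists>N. bounded_linear N \<and> (\<forall>x. N (N x) = T (T x)) \<and> (\<forall>x. 0 \<le> Re (cinner x (N x))) \<and>
    (\<forall>R. bounded_linear R \<and> (\<forall>x. R (T x) = T (R x)) \<longrightarrow> (\<forall>x. R (N x) = N (R x)))"
proof -
  have bT: "bounded_linear T" by (rule cblin_bounded_linear[OF T])
  \<comment> \<open>The fixed point of \<open>b = (X + b\<^sup>2)/2\<close> for \<open>X = 1 - T\<^sup>2\<close> satisfies \<open>(1 - b)\<^sup>2 = T\<^sup>2\<close> and \<open>b \<le> 1\<close>.\<close>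
  define X where "X = id_blinfun - (Blinfun T o\<^sub>L Blinfun T)"
  have Xa: "blinfun_apply X v = v - T (T v)" for v
    by (simp add: X_def blinfun.diff_left bounded_linear_Blinfun_apply[OF bT])
  have nX: "norm X \<le> 1"
  proof (rule norm_blinfun_bound)
    fix v
    have "cinner v (T (T v)) = complex_of_real ((norm (T v))\<^sup>2)"
      unfolding cinner_self[symmetric] adjointsD[OF sa] ..
    then have "Re (cinner v (T (T v))) = (norm (T v))\<^sup>2" by simp
    then have "(norm (v - T (T v)))\<^sup>2 = (norm v)\<^sup>2 + (norm (T (T v)))\<^sup>2 - 2 * (norm (T v))\<^sup>2"
      using norm_add_square[of v "- T (T v)"] by (simp add: cinner_minus_right)
    moreover have "(norm (T (T v)))\<^sup>2 \<le> (norm (T v))\<^sup>2" by (rule power_mono[OF le]) simp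
    ultimately have "(norm (v - T (T v)))\<^sup>2 \<le> (norm v)\<^sup>2"
      using zero_le_power2[of "norm (T v)"] by linarith
    then have "norm (v - T (T v)) \<le> norm v" by (rule power2_le_imp_le) simp
    then show "norm (blinfun_apply X v) \<le> 1 * norm v" by (simp add: Xa)
  qed simp
  let ?S = "\<Inter>R\<in>{R. R o\<^sub>L X = X o\<^sub>L R}. {b. R o\<^sub>L b = b o\<^sub>L R}"
  have "\<exists>b\<in>?S. norm b \<le> 1 \<and> b = (X + (b o\<^sub>L b)) /\<^sub>R 2"
  proof (rule half_square_fixpoint[OF bounded_bilinear_blinfun_compose norm_blinfun_compose nX])
    show "closed ?S"
      by (intro closed_INT ballI closed_Collect_eq
          bounded_linear.continuous_on[OF bounded_bilinear.bounded_linear_right[OF bounded_bilinear_blinfun_compose]]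
          bounded_linear.continuous_on[OF bounded_bilinear.bounded_linear_left[OF bounded_bilinear_blinfun_compose]]
          continuous_on_id)
    show "0 \<in> ?S" by (auto intro!: blinfun_eqI simp: blinfun.zero_right)
    fix b assume b: "b \<in> ?S"
    show "(X + (b o\<^sub>L b)) /\<^sub>R 2 \<in> ?S"
    proof (rule INT_I)
      fix R assume "R \<in> {R. R o\<^sub>L X = X o\<^sub>L R}"
      then have R: "R o\<^sub>L X = X o\<^sub>L R" and Rb: "R o\<^sub>L b = b o\<^sub>L R" using INT_D[OF b, of R] by auto
      have RX: "blinfun_apply R (blinfun_apply X v) = blinfun_apply X (blinfun_apply R v)" for v
        using arg_cong[OF R, of "\<lambda>A. blinfun_apply A v"] by simp
      have RB: "blinfun_apply R (blinfun_apply b v) = blinfun_apply b (blinfun_apply R v)" for v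
        using arg_cong[OF Rb, of "\<lambda>A. blinfun_apply A v"] by simp
      show "(X + (b o\<^sub>L b)) /\<^sub>R 2 \<in> {b. R o\<^sub>L b = b o\<^sub>L R}"
        by (auto intro!: blinfun_eqI simp: blinfun.add_left blinfun.scaleR_left blinfun.scaleR_right
            blinfun.add_right RX RB)
    qed
  qed
  then obtain b where bS: "b \<in> ?S" and nb: "norm b \<le> 1" and beq: "b = (X + (b o\<^sub>L b)) /\<^sub>R 2" by blast
  define N where "N v = v - blinfun_apply b v" for v
  have b2: "blinfun_apply b v + blinfun_apply b v = v - T (T v) + blinfun_apply b (blinfun_apply b v)" for v
  proof -
    have "2 *\<^sub>R b = X + (b o\<^sub>L b)" by (subst beq) simp
    from arg_cong[OF this, of "\<lambda>A. blinfun_apply A v"]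
    show ?thesis by (simp add: blinfun.add_left blinfun.scaleR_left Xa scaleR_2)
  qed
  have "bounded_linear N"
    unfolding N_def by (intro bounded_linear_sub bounded_linear_ident blinfun.bounded_linear_right)
  moreover have "N (N v) = T (T v)" for v
    using b2[of v] by (simp add: N_def blinfun.diff_right algebra_simps)
  moreover have "0 \<le> Re (cinner v (N v))" for v
  proof -
    have "Re (cinner v (blinfun_apply b v)) \<le> norm v * norm (blinfun_apply b v)"
      using Cauchy_Schwarz_cinner[of v "blinfun_apply b v"] complex_Re_le_cmod order_trans by blast
    also have "\<dots> \<le> norm v * (1 * norm v)"
      by (intro mult_left_mono order_trans[OF norm_blinfun] mult_right_mono nb) simp_all
    finally show ?thesis by (simp add: N_def cinner_diff_right cinner_self power2_eq_square)
  qed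
  moreover have "R (N v) = N (R v)" if R: "bounded_linear R" "\<And>x. R (T x) = T (R x)" for R v
  proof -
    have "Blinfun R o\<^sub>L X = X o\<^sub>L Blinfun R"
      by (intro blinfun_eqI)
         (simp add: Xa bounded_linear_Blinfun_apply[OF R(1)] R(2) linear_diff[OF bounded_linear.linear[OF R(1)]])
    then have "Blinfun R o\<^sub>L b = b o\<^sub>L Blinfun R" using INT_D[OF bS, of "Blinfun R"] by simp
    from arg_cong[OF this, of "\<lambda>A. blinfun_apply A v"]
    show ?thesis
      by (simp add: N_def bounded_linear_Blinfun_apply[OF R(1)] linear_diff[OF bounded_linear.linear[OF R(1)]])
  qed
  ultimately show ?thesis by (intro exI[of _ N]) simp
qed

context
  fixes \<pi> :: "'a::unital_cstar_algebra \<Rightarrow> 'h::chilbert_space \<Rightarrow> 'h"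
  assumes irr: "irreducible_rep UNIV \<pi>"
begin

lemma irreducible_star_rep: "star_rep UNIV \<pi>" using irr by (simp add: irreducible_rep_def)

lemma irreducible_invariant:
  assumes "closed_csubspace V" "\<And>a x. x \<in> V \<Longrightarrow> \<pi> a x \<in> V"
  shows "V = {0} \<or> V = UNIV"
  using irr assms unfolding irreducible_rep_def by simp

lemma irreducible_nontrivial: "\<exists>x::'h. x \<noteq> 0"
  using irr unfolding irreducible_rep_def by auto

text \<open>The kernel of \<open>|T| - T\<close> is invariant and contains the range of \<open>|T| + T\<close>, so \<open>T = |T|\<close>
  or \<open>T = - |T|\<close>.\<close>

lemma irreducible_dichotomy:
  assumes T: "cblin T" and sa: "adjoints T T" and comm: "\<And>a x. \<pi> a (T x) = T (\<pi> a x)"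
  shows "(\<forall>x. 0 \<le> Re (cinner x (T x))) \<or> (\<forall>x. Re (cinner x (T x)) \<le> 0)"
proof -
  have main: "(\<forall>x. 0 \<le> Re (cinner x (T x))) \<or> (\<forall>x. Re (cinner x (T x)) \<le> 0)"
    if T: "cblin T" and sa: "adjoints T T" and comm: "\<And>a x. \<pi> a (T x) = T (\<pi> a x)"
      and le: "\<And>x. norm (T x) \<le> norm x" for T
  proof -
    obtain N where N: "bounded_linear N" "\<And>x. N (N x) = T (T x)" "\<And>x. 0 \<le> Re (cinner x (N x))"
      and NR: "\<And>R x. bounded_linear R \<Longrightarrow> (\<And>x. R (T x) = T (R x)) \<Longrightarrow> R (N x) = N (R x)"
      using ex_modulus[OF T sa le irreducible_nontrivial] by blast
    interpret N: bounded_linear N by (rule N(1))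
    \<comment> \<open>\<open>N\<close> is obtained as a real-linear operator. It commutes with complex scalars and with \<open>\<pi> a\<close> because
      \<open>T\<close> does.\<close>
    have NT: "T (N x) = N (T x)" for x by (rule NR[OF cblin_bounded_linear[OF T]]) simp
    have Nc: "c *\<^sub>C N x = N (c *\<^sub>C x)" for c x
      by (rule NR[OF scaleC_hilbert.bounded_linear_right]) (simp add: cblin_scaleC[OF T])
    have N\<pi>: "\<pi> a (N x) = N (\<pi> a x)" for a x
      by (rule NR[OF cblin_bounded_linear[OF star_rep_cblin[OF irreducible_star_rep]]]) (rule comm)
    define V where "V = {x. N x = T x}"
    have "closed_csubspace V"
      unfolding closed_csubspace_def
    proof (intro conjI ballI allI)
      show "closed V" unfolding V_def
        by (intro closed_Collect_eq N.continuous_on continuous_on_id cblin_continuous_on[OF T])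
    qed (simp_all add: V_def N.zero N.add cblin_zero[OF T] cblin_add[OF T] cblin_scaleC[OF T] Nc[symmetric])
    moreover have "\<pi> a x \<in> V" if "x \<in> V" for a x
      using that by (simp add: V_def N\<pi>[symmetric] comm[symmetric])
    ultimately have "V = {0} \<or> V = UNIV" by (rule irreducible_invariant)
    then show ?thesis
    proof
      assume V0: "V = {0}"
      have "N x = - T x" for x
      proof -
        have "N x + T x \<in> V" by (simp add: V_def N.add cblin_add[OF T] N(2) NT)
        then have "N x + T x = 0" using V0 by simp
        then show ?thesis by (rule eq_neg_iff_add_eq_0[THEN iffD2])
      qed
      then show ?thesis using N(3) by (simp add: cinner_minus_right)
    next
      assume "V = UNIV"
      then have "N x = T x" for x by (auto simp: V_def)
      then show ?thesis using N(3) by simp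
    qed
  qed
  \<comment> \<open>The general case follows by scaling \<open>T\<close> to norm at most \<open>1\<close>.\<close>
  obtain C where C: "C > 0" "\<And>x. norm (T x) \<le> C * norm x" using cblin_bound[OF T] by blast
  let ?T = "\<lambda>x. complex_of_real (1 / C) *\<^sub>C T x"
  have "(\<forall>x. 0 \<le> Re (cinner x (?T x))) \<or> (\<forall>x. Re (cinner x (?T x)) \<le> 0)"
  proof (rule main)
    show "cblin ?T" by (rule cblin_scale[OF T])
    show "adjoints ?T ?T" using adjoints_scale[OF sa, of "complex_of_real (1 / C)"] by simp
    show "\<pi> a (?T x) = ?T (\<pi> a x)" for a x
      by (simp add: cblin_scaleC[OF star_rep_cblin[OF irreducible_star_rep]] comm)
    show "norm (?T x) \<le> norm x" for x
      using C by (simp add: norm_scaleC_hilbert norm_divide divide_le_eq mult.commute)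
  qed
  moreover have "Re (cinner x (?T x)) = Re (cinner x (T x)) / C" for x
    by (simp add: cinner_scaleC_right flip: of_real_divide of_real_inverse)
  ultimately show ?thesis using C(1) by (simp add: zero_le_divide_iff divide_le_0_iff)
qed

text \<open>By the dichotomy, every \<open>T - l\<close> is positive or negative, so the quadratic form of \<open>T\<close> cannot take
  two different values \<open>m\<close> and \<open>n\<close> on unit vectors: \<open>l = (m + n)/2\<close> would separate them. This replaces the
  spectral theorem.\<close>

lemma Schur_selfadjoint:
  assumes T: "cblin T" and sa: "adjoints T T" and comm: "\<And>a x. \<pi> a (T x) = T (\<pi> a x)"
  shows "\<exists>m. \<forall>x. T x = complex_of_real m *\<^sub>C x"
proof -
  obtain e0 :: 'h where "e0 \<noteq> 0" using irreducible_nontrivial by blast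
  define e where "e = e0 /\<^sub>R norm e0"
  have ne: "norm e = 1" using \<open>e0 \<noteq> 0\<close> by (simp add: e_def)
  define m where "m = Re (cinner e (T e))"
  define S where "S l x = T x - complex_of_real l *\<^sub>C x" for l x
  have cS: "cblin (S l)" for l
    unfolding S_def by (intro cblin_minus T cblin_scale cblin_id)
  have saS: "adjoints (S l) (S l)" for l
    unfolding adjoints_def S_def
    by (simp add: cinner_diff_left cinner_diff_right adjointsD[OF sa] cinner_scaleC_left cinner_scaleC_right)
  have commS: "\<pi> a (S l x) = S l (\<pi> a x)" for a l x
    unfolding S_def
    by (simp add: cblin_diff[OF star_rep_cblin[OF irreducible_star_rep]] comm
        cblin_scaleC[OF star_rep_cblin[OF irreducible_star_rep]])
  have form: "Re (cinner x (S l x)) = Re (cinner x (T x)) - l * (norm x)\<^sup>2" for l x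
    by (simp add: S_def cinner_diff_right cinner_scaleC_right cinner_self)
  have q: "Re (cinner x (T x)) = m * (norm x)\<^sup>2" for x
  proof (rule ccontr)
    assume neq: "Re (cinner x (T x)) \<noteq> m * (norm x)\<^sup>2"
    then have "x \<noteq> 0" by auto
    then have nx: "(norm x)\<^sup>2 > 0" by simp
    define n where "n = Re (cinner x (T x)) / (norm x)\<^sup>2"
    have nn: "Re (cinner x (T x)) = n * (norm x)\<^sup>2" using nx by (simp add: n_def)
    have "n \<noteq> m" using neq nn by auto
    define l where "l = (m + n) / 2"
    have 1: "Re (cinner e (S l e)) = (m - n) / 2" unfolding form ne m_def[symmetric] by (simp add: l_def field_simps)
    have 2: "Re (cinner x (S l x)) = (n - m) / 2 * (norm x)\<^sup>2" unfolding form nn by (simp add: l_def field_simps)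
    have "(\<forall>x. 0 \<le> Re (cinner x (S l x))) \<or> (\<forall>x. Re (cinner x (S l x)) \<le> 0)"
      by (rule irreducible_dichotomy[OF cS saS commS])
    then show False
    proof
      assume *: "\<forall>x. 0 \<le> Re (cinner x (S l x))"
      have "0 \<le> (m - n) / 2" using *[rule_format, of e] unfolding 1 .
      moreover have "0 \<le> (n - m) / 2" using *[rule_format, of x] nx unfolding 2 by (simp add: zero_le_mult_iff)
      ultimately show False using \<open>n \<noteq> m\<close> by simp
    next
      assume *: "\<forall>x. Re (cinner x (S l x)) \<le> 0"
      have "(m - n) / 2 \<le> 0" using *[rule_format, of e] unfolding 1 .
      moreover have "(n - m) / 2 \<le> 0" using *[rule_format, of x] nx unfolding 2 by (simp add: mult_le_0_iff)
      ultimately show False using \<open>n \<noteq> m\<close> by simp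
    qed
  qed
  have z: "Re (cinner x (S m x)) = 0" for x unfolding form q by simp
  \<comment> \<open>Polarisation: a self-adjoint operator with vanishing quadratic form is zero.\<close>
  have "S m y = 0" for y
  proof -
    have "Re (cinner (S m y) (S m (S m y))) = 0" "Re (cinner y (S m y)) = 0" by (rule z)+
    moreover have "Re (cinner (S m y + y) (S m (S m y + y))) = 0" by (rule z)
    moreover have "cinner y (S m (S m y)) = cinner (S m y) (S m y)"
      by (rule adjointsD[OF saS, symmetric])
    ultimately have "Re (cinner (S m y) (S m y)) = 0"
      by (simp add: cblin_add[OF cS] cinner_add_left cinner_add_right)
    then show ?thesis by (simp add: cinner_self)
  qed
  then have "T x = complex_of_real m *\<^sub>C x" for x by (simp add: S_def)
  then show ?thesis by blast
qed

text \<open>The real and imaginary parts of \<open>T\<close> commute with the representation, because the adjoint of \<open>T\<close> does.\<close>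

lemma Schur:
  assumes T: "cblin T" and comm: "\<And>a x. \<pi> a (T x) = T (\<pi> a x)"
  shows "\<exists>c. \<forall>x. T x = c *\<^sub>C x"
proof -
  note rep = irreducible_star_rep
  obtain S where S: "cblin S" and adj: "adjoints T S" using ex_adjoint[OF T] by blast
  have commS: "\<pi> a (S x) = S (\<pi> a x)" for a x
  proof (rule cinner_eqI)
    fix z
    have r: "adjoints (\<pi> (star a)) (\<pi> a)" using star_rep_adjoints[OF rep, of "star a"] by (simp add: star_star)
    have "cinner z (\<pi> a (S x)) = cinner (T (\<pi> (star a) z)) x"
      unfolding adjointsD[OF adj] adjointsD[OF r] ..
    also have "\<dots> = cinner z (S (\<pi> a x))"
      unfolding comm[symmetric] adjointsD[OF r] adjointsD[OF adj] ..
    finally show "cinner z (\<pi> a (S x)) = cinner z (S (\<pi> a x))" .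
  qed
  define A where "A x = (1/2) *\<^sub>C (T x + S x)" for x
  define B where "B x = (- \<i> / 2) *\<^sub>C (T x - S x)" for x
  have cA: "cblin A" unfolding A_def by (intro cblin_scale cblin_plus T S)
  have cB: "cblin B" unfolding B_def by (intro cblin_scale cblin_minus T S)
  have aA: "adjoints A A" unfolding A_def adjoints_def
    by (simp add: cinner_scaleC_left cinner_scaleC_right cinner_add_left cinner_add_right
        adjointsD[OF adj] adjointsD[OF adjoints_sym[OF adj]] add.commute)
  have aB: "adjoints B B" unfolding B_def adjoints_def
    by (simp add: cinner_scaleC_left cinner_scaleC_right cinner_diff_left cinner_diff_right
        adjointsD[OF adj] adjointsD[OF adjoints_sym[OF adj]] algebra_simps)
  have kA: "\<pi> a (A x) = A (\<pi> a x)" for a x unfolding A_def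
    by (simp add: cblin_scaleC[OF star_rep_cblin[OF rep]] cblin_add[OF star_rep_cblin[OF rep]] comm commS)
  have kB: "\<pi> a (B x) = B (\<pi> a x)" for a x
    unfolding B_def cblin_scaleC[OF star_rep_cblin[OF rep]] cblin_diff[OF star_rep_cblin[OF rep]] comm commS ..
  obtain m where m: "\<And>x. A x = complex_of_real m *\<^sub>C x" using Schur_selfadjoint[OF cA aA kA] by blast
  obtain n where n: "\<And>x. B x = complex_of_real n *\<^sub>C x" using Schur_selfadjoint[OF cB aB kB] by blast
  have "T x = (complex_of_real m + \<i> * complex_of_real n) *\<^sub>C x" for x
  proof -
    have "T x = A x + \<i> *\<^sub>C B x"
    proof -
      have "A x + \<i> *\<^sub>C B x = (1/2) *\<^sub>C (T x + S x) + (1/2) *\<^sub>C (T x - S x)"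
        by (simp add: A_def B_def scaleC_scaleC)
      also have "\<dots> = (1/2 + 1/2) *\<^sub>C T x"
        unfolding scaleC_add_left scaleC_add_right cvec.scale_right_diff_distrib by simp
      finally show ?thesis by simp
    qed
    then show ?thesis by (simp add: m n scaleC_scaleC scaleC_add_left)
  qed
  then show ?thesis by blast
qed

end

lemma commutantD: "T \<in> commutant K S \<Longrightarrow> A \<in> S \<Longrightarrow> T (A x) = A (T x)"
  unfolding commutant_def by (auto dest!: bspec[of _ _ A] fun_cong[of _ _ x])

lemma commutant_bounded_ops: "T \<in> commutant K S \<Longrightarrow> T \<in> bounded_ops K"
  by (simp add: commutant_def)

lemma commutantI: "T \<in> bounded_ops K \<Longrightarrow> (\<And>A x. A \<in> S \<Longrightarrow> T (A x) = A (T x)) \<Longrightarrow> T \<in> commutant K S"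
  by (auto simp: commutant_def fun_eq_iff)

lemma bounded_opsI:
  "cblin T \<Longrightarrow> (\<And>x. T x \<in> K) \<Longrightarrow> (\<And>x. (\<And>v. v \<in> K \<Longrightarrow> cinner v x = 0) \<Longrightarrow> T x = 0) \<Longrightarrow> T \<in> bounded_ops K"
  by (auto simp: bounded_ops_def bounded_clinear_eq)

lemma bounded_ops_cblin: "T \<in> bounded_ops K \<Longrightarrow> cblin T"
  by (simp add: bounded_ops_def bounded_clinear_eq)

lemma bounded_ops_in: "T \<in> bounded_ops K \<Longrightarrow> T x \<in> K"
  by (auto simp: bounded_ops_def)

lemma invariant_projection_commutes:
  assumes M: "closed_csubspace M" and A: "cblin A" "adjoints A A'"
    and inv: "\<And>v. v \<in> M \<Longrightarrow> A v \<in> M" "\<And>v. v \<in> M \<Longrightarrow> A' v \<in> M"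
  shows "orth_proj M (A z) = A (orth_proj M z)"
proof (rule orth_proj_eqI[OF M])
  show "A (orth_proj M z) \<in> M" by (intro inv orth_proj_in[OF M])
  fix v assume v: "v \<in> M"
  have "cinner v (A z - A (orth_proj M z)) = cinner (A' v) (z - orth_proj M z)"
    unfolding cblin_diff[OF A(1), symmetric] adjointsD[OF adjoints_sym[OF A(2)]] ..
  also have "\<dots> = 0" by (intro orth_proj_perp[OF M] inv v)
  finally show "cinner v (A z - A (orth_proj M z)) = 0" .
qed

text \<open>Von Neumann's density theorem for two vectors, in dual form. The projection onto the closed
  orbit of \<open>(x\<^sub>1, x\<^sub>2)\<close> under \<open>\<pi> \<oplus> \<pi>\<close> has matrix entries in the commutant of \<open>\<pi>\<close>, so
  it commutes with \<open>T \<oplus> T\<close>.\<close>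

lemma bicommutant_two_vectors:
  fixes \<pi> :: "'a::unital_cstar_algebra \<Rightarrow> 'k::chilbert_space \<Rightarrow> 'k"
  assumes rep: "star_rep K \<pi>" and T: "T \<in> bicommutant K (range \<pi>)" and x: "x1 \<in> K" "x2 \<in> K"
    and eq: "\<And>b. cinner y1 (\<pi> b x1) = cinner y2 (\<pi> b x2)"
  shows "cinner y1 (T x1) = cinner y2 (T x2)"
proof -
  have K: "closed_csubspace K" by (rule star_rep_closed[OF rep])
  define D where "D b = (\<pi> b x1, \<pi> b x2)" for b
  have D: "clinear D"
    unfolding clinear_def D_def by (simp add: star_rep_add[OF rep] star_rep_scaleC[OF rep] scaleC_prod_def)
  define M where "M = closure (range D)"
  have M: "closed_csubspace M" unfolding M_def by (rule closure_range_csubspace[OF D])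
  define Q where "Q b z = (\<pi> b (fst z), \<pi> b (snd z))" for b and z :: "'k \<times> 'k"
  have aQ: "adjoints (Q b) (Q (star b))" for b
    unfolding adjoints_def Q_def cinner_prod_def by (simp add: adjointsD[OF star_rep_adjoints[OF rep]])
  have cQ: "cblin (Q b)" for b
  proof -
    have "bounded_linear (Q b)" unfolding Q_def
      by (intro bounded_linear_Pair bounded_linear_compose[OF cblin_bounded_linear[OF star_rep_cblin[OF rep]]]
          bounded_linear_fst bounded_linear_snd)
    then show ?thesis using clinear_of_adjoints[OF aQ] by (simp add: cblin_def)
  qed
  have QM: "Q b z \<in> M" if "z \<in> M" for b z
  proof -
    have "Q b ` closure (range D) \<subseteq> closure (Q b ` range D)"
      by (rule closure_bounded_linear_image_subset[OF cblin_bounded_linear[OF cQ]])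
    also have "\<dots> \<subseteq> closure (range D)"
      by (rule closure_mono) (auto simp: Q_def D_def star_rep_mult[OF rep, symmetric])
    finally show ?thesis using that unfolding M_def by blast
  qed
  define P where "P = orth_proj M"
  have cP: "cblin P" unfolding P_def by (rule cblin_orth_proj[OF M])
  have PQ: "P (Q b z) = Q b (P z)" for b z
    unfolding P_def by (rule invariant_projection_commutes[OF M cQ aQ QM QM])
  have MK: "z \<in> M \<Longrightarrow> fst z \<in> K \<and> snd z \<in> K" for z
  proof -
    have "closure (range D) \<subseteq> K \<times> K"
    proof (rule closure_minimal)
      show "closed (K \<times> K)" using K by (intro closed_Times) (simp_all add: closed_csubspace_def)
    qed (auto simp: D_def star_rep_in[OF rep])
    moreover assume "z \<in> M"
    ultimately show ?thesis unfolding M_def by auto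
  qed
  \<comment> \<open>\<open>p\<close> is one of the two coordinates and \<open>j\<close> one of the two inclusions, so \<open>p P j\<close> is an entry of the matrix of \<open>P\<close>.\<close>
  have block: "T (p (P (j v))) = p (P (j (T v)))"
    if p: "cblin p" "\<And>b z. p (Q b z) = \<pi> b (p z)" "\<And>z. z \<in> M \<Longrightarrow> p z \<in> K"
      and j: "cblin j" "\<And>b v. Q b (j v) = j (\<pi> b v)"
        "\<And>v z. (\<And>u. u \<in> K \<Longrightarrow> cinner u v = 0) \<Longrightarrow> z \<in> M \<Longrightarrow> cinner z (j v) = 0"
    for p :: "'k \<times> 'k \<Rightarrow> 'k" and j v
  proof -
    have "(\<lambda>v. p (P (j v))) \<in> commutant K (range \<pi>)"
    proof (rule commutantI)
      show "(\<lambda>v. p (P (j v))) \<in> bounded_ops K"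
      proof (rule bounded_opsI)
        show "cblin (\<lambda>v. p (P (j v)))" by (intro cblin_compose[OF p(1)] cblin_compose[OF cP] j(1))
        show "p (P (j v)) \<in> K" for v by (intro p(3)) (simp add: P_def orth_proj_in[OF M])
        fix v assume "\<And>u. u \<in> K \<Longrightarrow> cinner u v = 0"
        then have "P (j v) = 0" unfolding P_def by (intro orth_proj_zero[OF M] j(3))
        then show "p (P (j v)) = 0" by (simp add: cblin_zero[OF p(1)])
      qed
      fix A v assume "A \<in> range \<pi>"
      then obtain b where A: "A = \<pi> b" by (rule rangeE)
      show "p (P (j (A v))) = A (p (P (j v)))" unfolding A j(2)[symmetric] PQ p(2) ..
    qed
    from commutantD[OF T[unfolded bicommutant_def] this] show ?thesis .
  qed
  have fs: "cblin (fst :: 'k \<times> 'k \<Rightarrow> 'k)" "cblin (snd :: 'k \<times> 'k \<Rightarrow> 'k)"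
    by (auto simp: cblin_def clinear_def scaleC_prod_def bounded_linear_fst bounded_linear_snd)
  have js: "cblin (\<lambda>v::'k. (v, 0 :: 'k))" "cblin (\<lambda>v::'k. (0 :: 'k, v))"
    by (auto simp: cblin_def clinear_def scaleC_prod_def
        intro!: bounded_linear_Pair bounded_linear_ident bounded_linear_zero)
  note z = cblin_zero[OF star_rep_cblin[OF rep]]
  have b11: "T (fst (P (v, 0))) = fst (P (T v, 0))" for v
    by (rule block[OF fs(1) _ _ js(1)]) (auto simp: Q_def z cinner_prod_def MK)
  have b12: "T (fst (P (0, v))) = fst (P (0, T v))" for v
    by (rule block[OF fs(1) _ _ js(2)]) (auto simp: Q_def z cinner_prod_def MK)
  have b21: "T (snd (P (v, 0))) = snd (P (T v, 0))" for v
    by (rule block[OF fs(2) _ _ js(1)]) (auto simp: Q_def z cinner_prod_def MK)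
  have b22: "T (snd (P (0, v))) = snd (P (0, T v))" for v
    by (rule block[OF fs(2) _ _ js(2)]) (auto simp: Q_def z cinner_prod_def MK)
  have cT: "cblin T" by (rule bounded_ops_cblin[OF commutant_bounded_ops[OF T[unfolded bicommutant_def]]])
  have spl: "P (u, v) = P (u, 0) + P (0, v)" for u v
    using cblin_add[OF cP, of "(u, 0)" "(0, v)"] by simp
  have "(x1, x2) = D 1" unfolding D_def by (simp add: star_rep_one[OF rep] x)
  then have "(x1, x2) \<in> M" unfolding M_def by (simp add: subsetD[OF closure_subset])
  then have P12: "P (x1, x2) = (x1, x2)" unfolding P_def by (rule orth_proj_id[OF M])
  have "P (T x1, T x2) = (T x1, T x2)"
  proof (rule prod_eqI)
    have "T x1 = T (fst (P (x1, x2)))" by (simp add: P12)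
    also have "\<dots> = fst (P (T x1, T x2))"
      unfolding spl[of x1 x2] spl[of "T x1" "T x2"] fst_add cblin_add[OF cT] b11 b12 ..
    finally show "fst (P (T x1, T x2)) = fst (T x1, T x2)" by simp
    have "T x2 = T (snd (P (x1, x2)))" by (simp add: P12)
    also have "\<dots> = snd (P (T x1, T x2))"
      unfolding spl[of x1 x2] spl[of "T x1" "T x2"] snd_add cblin_add[OF cT] b21 b22 ..
    finally show "snd (P (T x1, T x2)) = snd (T x1, T x2)" by simp
  qed
  then have TM: "(T x1, T x2) \<in> M" using orth_proj_in[OF M, of "(T x1, T x2)"] by (simp add: P_def)
  have "closed {z. cinner y1 (fst z) = cinner y2 (snd z)}"
    by (intro closed_Collect_eq continuous_intros cinner.continuous_on)
  then have "M \<subseteq> {z. cinner y1 (fst z) = cinner y2 (snd z)}"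
    unfolding M_def by (intro closure_minimal) (auto simp: D_def eq)
  then show ?thesis using TM by auto
qed

section \<open>Positive operators of finite trace\<close>

lemma positive_op_cblin: "positive_op S \<Longrightarrow> cblin S"
  by (simp add: positive_op_def bounded_clinear_eq)

lemma positive_op_form: "positive_op S \<Longrightarrow> cinner x (S x) = complex_of_real (Re (cinner x (S x)))"
  unfolding positive_op_def by (metis nonneg_Reals_cases Re_complex_of_real)

lemma positive_op_ge0: "positive_op S \<Longrightarrow> 0 \<le> Re (cinner x (S x))"
  unfolding positive_op_def by (simp add: complex_nonneg_Reals_iff)

lemma positive_op_selfadjoint:
  assumes S: "positive_op S" shows "adjoints S S"
  unfolding adjoints_def
proof (intro allI)
  fix x y
  note c = positive_op_cblin[OF S]
  have im: "Im (cinner z (S z)) = 0" for z using positive_op_form[OF S, of z] by (metis Im_complex_of_real)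
  have 1: "Im (cinner x (S y)) + Im (cinner y (S x)) = 0"
    using im[of "x + y"] im[of x] im[of y] by (simp add: cblin_add[OF c] cinner_add_left cinner_add_right)
  have 2: "Re (cinner x (S y)) - Re (cinner y (S x)) = 0"
    using im[of "x + \<i> *\<^sub>C y"] im[of x] im[of y]
    by (simp add: cblin_add[OF c] cblin_scaleC[OF c] cinner_add_left cinner_add_right
        cinner_scaleC_left cinner_scaleC_right)
  have "cinner x (S y) = cnj (cinner y (S x))" by (rule complex_eqI) (use 1 2 in simp_all)
  then show "cinner (S x) y = cinner x (S y)" unfolding cinner_commute[of "S x" y] by simp
qed

text \<open>The quadratic polynomial \<open>t \<mapsto> \<langle>x - t u\<^sup>* y, S (x - t u\<^sup>* y)\<rangle>\<close> with \<open>u = \<langle>x, S y\<rangle>\<close> is nonnegative.\<close>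

lemma positive_form_Cauchy_Schwarz:
  assumes S: "positive_op S"
  shows "(cmod (cinner x (S y)))\<^sup>2 \<le> Re (cinner x (S x)) * Re (cinner y (S y))"
proof (cases "cinner x (S y) = 0")
  case True
  then show ?thesis using positive_op_ge0[OF S] by simp
next
  case False
  note c = positive_op_cblin[OF S] and sa = positive_op_selfadjoint[OF S]
  define u where "u = cinner x (S y)"
  define U where "U = (cmod u)\<^sup>2"
  have Upos: "U > 0" using False by (simp add: U_def u_def)
  define a where "a = Re (cinner x (S x))"
  define b where "b = Re (cinner y (S y))"
  have quad: "0 \<le> a - 2 * t * U + t\<^sup>2 * U * b" for t :: real
  proof -
    define l where "l = complex_of_real (- t) * cnj u"
    have yx: "cinner y (S x) = cnj u"
      unfolding u_def using cinner_commute[of y "S x"] adjointsD[OF sa, of x y] by simp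
    have uu: "u * cnj u = complex_of_real U" unfolding U_def complex_norm_square ..
    have "cinner (x + l *\<^sub>C y) (S (x + l *\<^sub>C y)) =
        cinner x (S x) + l * u + cnj l * cnj u + (l * cnj l) * cinner y (S y)"
      by (simp add: cblin_add[OF c] cblin_scaleC[OF c] cinner_add_left cinner_add_right
          cinner_scaleC_left cinner_scaleC_right yx u_def[symmetric] algebra_simps)
    also have "l * u = complex_of_real (- t * U)" by (simp add: l_def uu[symmetric] mult_ac)
    also have "cnj l * cnj u = complex_of_real (- t * U)" by (simp add: l_def uu[symmetric] mult_ac)
    also have "l * cnj l = complex_of_real (t\<^sup>2 * U)"
      by (simp add: l_def uu[symmetric] power2_eq_square mult_ac)
    finally have "Re (cinner (x + l *\<^sub>C y) (S (x + l *\<^sub>C y))) = a - 2 * t * U + t\<^sup>2 * U * b"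
      by (simp add: a_def b_def)
    then show ?thesis using positive_op_ge0[OF S, of "x + l *\<^sub>C y"] by simp
  qed
  have b0: "b > 0"
  proof (rule ccontr)
    assume "\<not> b > 0"
    then have "b = 0" using positive_op_ge0[OF S, of y] by (simp add: b_def)
    \<comment> \<open>For \<open>b = 0\<close> the polynomial \<open>a - 2 t U\<close> takes the value \<open>-1\<close> at this \<open>t\<close>.\<close>
    then show False using quad[of "(a + 1) / (2 * U)"] Upos by (simp add: field_simps)
  qed
  have "0 \<le> a - U / b" using quad[of "1 / b"] b0 by (simp add: field_simps power2_eq_square)
  then have "U \<le> a * b" using b0 by (simp add: field_simps)
  then show ?thesis by (simp add: U_def u_def a_def b_def)
qed

text \<open>Summing the Cauchy-Schwarz inequality over a basis bounds the operator norm of a positive operator by its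
  trace.\<close>

context
  fixes S :: "'h::chilbert_space \<Rightarrow> 'h" and C :: "'h set" and \<tau> :: real
  assumes S: "positive_op S" and C: "is_onb C"
    and \<tau>: "((\<lambda>e. Re (cinner e (S e))) has_sum \<tau>) C"
begin

lemma finite_trace_nonneg: "0 \<le> \<tau>"
  using \<tau> by (rule has_sum_nonneg) (rule positive_op_ge0[OF S])

lemma finite_trace_form_bound: "(norm (S x))\<^sup>2 \<le> \<tau> * Re (cinner x (S x))"
proof (rule has_sum_mono[OF onb_norm[OF C] has_sum_cmult_left[OF \<tau>]])
  show "(cmod (cinner e (S x)))\<^sup>2 \<le> Re (cinner e (S e)) * Re (cinner x (S x))" for e
    by (rule positive_form_Cauchy_Schwarz[OF S])
qed

lemma finite_trace_norm_bound: "norm (S x) \<le> \<tau> * norm x"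
proof -
  have "Re (cinner x (S x)) \<le> norm x * norm (S x)"
    using Cauchy_Schwarz_cinner[of x "S x"] complex_Re_le_cmod order_trans by blast
  then have "(norm (S x))\<^sup>2 \<le> \<tau> * (norm x * norm (S x))"
    using finite_trace_form_bound[of x] finite_trace_nonneg by (meson mult_left_mono order_trans)
  then show ?thesis using finite_trace_nonneg
    by (cases "norm (S x) = 0") (simp_all add: power2_eq_square mult.assoc[symmetric])
qed

end

text \<open>Compressing \<open>S\<close> to the complement of finitely many basis vectors leaves a positive operator
  whose trace is a tail of the original series, so \<open>S\<close> is a norm limit of operators of finite
  rank.\<close>

lemma finite_trace_tail:
  fixes S :: "'h::chilbert_space \<Rightarrow> 'h"
  assumes S: "positive_op S" and C: "is_onb C" and F: "finite F" "F \<subseteq> C"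
    and t: "((\<lambda>e. Re (cinner e (S e))) has_sum t) (C - F)" and y: "\<And>e. e \<in> F \<Longrightarrow> cinner e y = 0"
  shows "Re (cinner y (S y)) \<le> t * (norm y)\<^sup>2"
proof -
  define W where "W = {x. \<forall>e\<in>F. cinner e x = 0}"
  have W: "closed_csubspace W" unfolding W_def by (rule closed_csubspace_perp)
  define Q where "Q = orth_proj W"
  have cQ: "cblin Q" and aQ: "adjoints Q Q" unfolding Q_def
    by (rule cblin_orth_proj[OF W], rule adjoints_orth_proj[OF W])
  have o: "cinner e f = (if e = f then 1 else 0)" if "e \<in> C" "f \<in> C" for e f
    using is_onb_orthonormal[OF C] that by (simp add: orthonormal_family_def)
  have QF: "Q e = 0" if "e \<in> F" for e
    unfolding Q_def by (rule orth_proj_zero[OF W])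
      (use that in \<open>auto simp: W_def intro: cinner_eq_zero_commute\<close>)
  have QC: "Q e = e" if "e \<in> C - F" for e
    unfolding Q_def by (rule orth_proj_id[OF W]) (use that F in \<open>auto simp: W_def o subset_iff\<close>)
  define S' where "S' x = Q (S (Q x))" for x
  have form: "cinner x (S' x) = cinner (Q x) (S (Q x))" for x
    unfolding S'_def adjointsD[OF aQ] ..
  have S': "positive_op S'"
    unfolding positive_op_def bounded_clinear_eq
  proof (intro conjI allI)
    show "cblin S'" unfolding S'_def by (intro cblin_compose[OF cQ] cblin_compose[OF positive_op_cblin[OF S]] cQ)
    show "cinner x (S' x) \<in> \<real>\<^sub>\<ge>\<^sub>0" for x using S unfolding form positive_op_def by blast
  qed
  have "((\<lambda>e. Re (cinner e (S' e))) has_sum t) (C - F)"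
    using t by (rule has_sum_cong[THEN iffD1, rotated]) (simp add: form QC)
  then have "((\<lambda>e. Re (cinner e (S' e))) has_sum t) C"
    by (rule has_sum_cong_neutral[THEN iffD1, rotated -1]) (use F in \<open>auto simp: form QF\<close>)
  from finite_trace_norm_bound[OF S' C this, of y]
  have n: "norm (S' y) \<le> t * norm y" .
  have "Q y = y" unfolding Q_def by (rule orth_proj_id[OF W]) (use y in \<open>simp add: W_def\<close>)
  then have "Re (cinner y (S y)) = Re (cinner y (S' y))" by (simp add: form)
  also have "\<dots> \<le> norm y * norm (S' y)"
    using Cauchy_Schwarz_cinner[of y "S' y"] complex_Re_le_cmod order_trans by blast
  also have "\<dots> \<le> norm y * (t * norm y)" by (intro mult_left_mono n) simp
  finally show ?thesis by (simp add: power2_eq_square mult_ac)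
qed

text \<open>A compact set that contains the image of the unit ball under an operator of finite rank.\<close>

lemma compact_finite_combinations:
  fixes S :: "'h::chilbert_space \<Rightarrow> 'h"
  assumes "finite F"
  shows "\<exists>K. compact K \<and> (\<forall>c. (\<forall>e\<in>F. cmod (c e) \<le> 1) \<longrightarrow> (\<Sum>e\<in>F. c e *\<^sub>C S e) \<in> K)"
  using assms
proof (induction F)
  case empty show ?case by (rule exI[of _ "{0}"]) simp
next
  case (insert e F)
  then obtain K where K: "compact K" "\<And>c. \<forall>e\<in>F. cmod (c e) \<le> 1 \<Longrightarrow> (\<Sum>e\<in>F. c e *\<^sub>C S e) \<in> K" by blast
  let ?L = "(\<lambda>c. c *\<^sub>C S e) ` cball 0 1"
  have "compact ?L"
    by (intro compact_continuous_image linear_continuous_on scaleC_hilbert.bounded_linear_left compact_cball)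
  then have "compact {x + y |x y. x \<in> ?L \<and> y \<in> K}" using K(1) by (rule compact_sums)
  moreover have "(\<Sum>e\<in>insert e F. c e *\<^sub>C S e) \<in> {x + y |x y. x \<in> ?L \<and> y \<in> K}"
    if c: "\<forall>f\<in>insert e F. cmod (c f) \<le> 1" for c
  proof -
    have "(\<Sum>e\<in>F. c e *\<^sub>C S e) \<in> K" using c by (intro K(2)) simp
    moreover have "c e *\<^sub>C S e \<in> ?L" using c by (intro imageI) simp
    ultimately have "c e *\<^sub>C S e + (\<Sum>e\<in>F. c e *\<^sub>C S e) \<in> {x + y |x y. x \<in> ?L \<and> y \<in> K}"
      by blast
    then show ?thesis using insert.hyps by simp
  qed
  ultimately show ?case by blast
qed

text \<open>Up to an error of any given size, the image of the unit ball lies in a compact set, by the bound for the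
  tail, so it is totally bounded.\<close>

lemma finite_trace_compact:
  fixes S :: "'h::chilbert_space \<Rightarrow> 'h"
  assumes S: "positive_op S" and C: "is_onb C" and \<tau>: "((\<lambda>e. Re (cinner e (S e))) has_sum \<tau>) C"
    and x: "\<And>n::nat. norm (x n) \<le> 1"
  shows "\<exists>r y. strict_mono r \<and> (\<lambda>n. S (x (r n))) \<longlonglongrightarrow> y"
proof -
  note c = positive_op_cblin[OF S]
  let ?A = "S ` cball 0 1"
  have approx: "\<exists>K. compact K \<and> (\<forall>v\<in>cball 0 1. \<exists>k\<in>K. dist k (S v) < \<epsilon>)" if \<epsilon>: "\<epsilon> > 0" for \<epsilon>
  proof -
    have t0: "0 \<le> \<tau>" by (rule finite_trace_nonneg[OF S C \<tau>])
    \<comment> \<open>Chosen so that \<open>\<tau> \<delta> < \<epsilon>\<^sup>2\<close>, which is the bound for \<open>\<parallel>S y\<parallel>\<^sup>2\<close> below.\<close>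
    define \<delta> where "\<delta> = (\<epsilon>\<^sup>2 / 2) / (\<tau> + 1)"
    have \<delta>: "\<delta> > 0" using \<epsilon> t0 by (simp add: \<delta>_def)
    obtain F where F: "finite F" "F \<subseteq> C" "dist (\<Sum>e\<in>F. Re (cinner e (S e))) \<tau> \<le> \<delta>"
      using has_sum_finite_approximation[OF \<tau> \<delta>] by blast
    define t where "t = \<tau> - (\<Sum>e\<in>F. Re (cinner e (S e)))"
    have ht: "((\<lambda>e. Re (cinner e (S e))) has_sum t) (C - F)"
    proof -
      have "(\<lambda>e. Re (cinner e (S e))) summable_on (C - F)"
        by (rule summable_on_subset_banach[OF has_sum_imp_summable[OF \<tau>]]) blast
      then obtain u where u: "((\<lambda>e. Re (cinner e (S e))) has_sum u) (C - F)"
        unfolding summable_on_def by blast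
      have "((\<lambda>e. Re (cinner e (S e))) has_sum ((\<Sum>e\<in>F. Re (cinner e (S e))) + u)) (F \<union> (C - F))"
        using F(1) u by (intro has_sum_Un_disjoint has_sum_finite) auto
      moreover have "F \<union> (C - F) = C" using F(2) by blast
      ultimately have "(\<Sum>e\<in>F. Re (cinner e (S e))) + u = \<tau>" using \<tau> has_sum_unique by metis
      then have "u = t" by (simp add: t_def)
      then show ?thesis using u by simp
    qed
    have t: "t \<le> \<delta>" using F(3) by (simp add: t_def dist_real_def abs_le_iff)
    have tt: "0 \<le> t" using ht by (rule has_sum_nonneg) (rule positive_op_ge0[OF S])
    obtain K where K: "compact K" "\<And>c. \<forall>e\<in>F. cmod (c e) \<le> 1 \<Longrightarrow> (\<Sum>e\<in>F. c e *\<^sub>C S e) \<in> K"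
      using compact_finite_combinations[OF F(1), of S] by blast
    have o: "cinner e f = (if e = f then 1 else 0)" if "e \<in> C" "f \<in> C" for e f
      using is_onb_orthonormal[OF C] that by (simp add: orthonormal_family_def)
    have "\<exists>k\<in>K. dist k (S v) < \<epsilon>" if v: "v \<in> cball 0 1" for v
    proof -
      define w where "w = (\<Sum>e\<in>F. cinner e v *\<^sub>C e)"
      define y where "y = v - w"
      have ye: "cinner e y = 0" if "e \<in> F" for e
      proof -
        have "cinner e w = (\<Sum>f\<in>F. if e = f then cinner f v else 0)"
          unfolding w_def cinner.sum_right using that F(2)
          by (intro sum.cong) (auto simp: cinner_scaleC_right o subset_iff)
        also have "\<dots> = cinner e v" using that F(1) by simp
        finally show ?thesis by (simp add: y_def cinner_diff_right)
      qed
      have "cinner w y = 0" unfolding w_def cinner.sum_left by (intro sum.neutral) (simp add: cinner_scaleC_left ye)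
      then have "(norm v)\<^sup>2 = (norm w)\<^sup>2 + (norm y)\<^sup>2" using norm_add_square[of w y] by (simp add: y_def)
      moreover have "(norm v)\<^sup>2 \<le> 1" using v by (simp add: power_le_one)
      ultimately have ny: "(norm y)\<^sup>2 \<le> 1" using zero_le_power2[of "norm w"] by linarith
      have "(norm (S y))\<^sup>2 \<le> \<tau> * Re (cinner y (S y))" by (rule finite_trace_form_bound[OF S C \<tau>])
      also have "\<dots> \<le> \<tau> * (t * (norm y)\<^sup>2)"
        by (intro mult_left_mono t0 finite_trace_tail[OF S C F(1,2) ht ye])
      also have "\<dots> \<le> \<tau> * (\<delta> * 1)" by (intro mult_left_mono mult_mono t0 t ny) (use tt \<delta> in simp_all)
      also have "\<dots> < \<epsilon>\<^sup>2"
      proof -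
        have "\<tau> * \<delta> \<le> (\<tau> + 1) * \<delta>" using \<delta> by simp
        also have "\<dots> = \<epsilon>\<^sup>2 / 2"
          unfolding \<delta>_def by (rule nonzero_mult_div_cancel_left[of "\<tau> + 1" "\<epsilon>\<^sup>2 / 2", unfolded times_divide_eq_right[symmetric]])
            (use t0 in simp)
        also have "\<dots> < \<epsilon>\<^sup>2" using \<epsilon> by simp
        finally show ?thesis by simp
      qed
      finally have "norm (S y) < \<epsilon>" by (rule power2_less_imp_less) (use \<epsilon> in simp)
      moreover have "S v = S w + S y" by (simp add: y_def cblin_diff[OF c])
      moreover have "S w = (\<Sum>e\<in>F. cinner e v *\<^sub>C S e)"
        unfolding w_def cblin_sum[OF c] cblin_scaleC[OF c] ..
      moreover have "(\<Sum>e\<in>F. cinner e v *\<^sub>C S e) \<in> K"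
      proof (rule K(2), rule ballI)
        fix e assume "e \<in> F"
        then have "norm e = 1" using F(2) C by (auto simp: is_onb_def)
        then show "cmod (cinner e v) \<le> 1"
          using Cauchy_Schwarz_cinner[of e v] v by simp
      qed
      ultimately show ?thesis by (intro bexI[of _ "S w"]) (simp_all add: dist_norm)
    qed
    then show ?thesis using K(1) by blast
  qed
  have "compact (closure ?A)"
    unfolding compact_eq_totally_bounded
  proof (intro conjI allI impI)
    show "uniform_space_class.complete (closure ?A)" by (simp add: complete_eq_closed)
    fix e :: real assume e: "e > 0"
    then obtain K where K: "compact K" "\<And>v. v \<in> cball 0 1 \<Longrightarrow> \<exists>k\<in>K. dist k (S v) < e / 3"
      using approx[of "e / 3"] by auto
    obtain k where k: "finite k" "K \<subseteq> (\<Union>x\<in>k. ball x (e / 3))"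
      using K(1) e unfolding compact_eq_totally_bounded by (meson divide_pos_pos zero_less_numeral)
    have "closure ?A \<subseteq> (\<Union>x\<in>k. ball x e)"
    proof
      fix z assume "z \<in> closure ?A"
      then obtain u where u: "u \<in> ?A" "dist u z < e / 3"
        using e closure_approachable[of z ?A] by (metis divide_pos_pos zero_less_numeral)
      then obtain p where p: "p \<in> K" "dist p u < e / 3" using K(2) by blast
      then obtain q where q: "q \<in> k" "dist q p < e / 3" using k(2) by auto
      have "dist q z \<le> dist q p + (dist p u + dist u z)"
        using dist_triangle[of q z p] dist_triangle[of p z u] by linarith
      then have "dist q z < e" using u p q by linarith
      then show "z \<in> (\<Union>x\<in>k. ball x e)" using q(1) by auto
    qed
    then show "\<exists>k. finite k \<and> closure ?A \<subseteq> (\<Union>x\<in>k. ball x e)" using k(1) by blast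
  qed
  then have "seq_compact (closure ?A)" by (simp add: compact_eq_seq_compact_metric)
  moreover have "\<forall>n. S (x n) \<in> closure ?A" using x closure_subset by fastforce
  ultimately have "\<exists>l\<in>closure ?A. \<exists>r. strict_mono r \<and> ((\<lambda>n. S (x n)) \<circ> r) \<longlonglongrightarrow> l"
    unfolding seq_compact_def by (elim allE[of _ "\<lambda>n. S (x n)"]) (rule mp)
  then show ?thesis unfolding comp_def by blast
qed

text \<open>The supremum \<open>m\<close> of the quadratic form over the unit vectors of \<open>W\<close> is an eigenvalue: for a maximising
  sequence, \<open>\<parallel>S x\<^sub>n - m x\<^sub>n\<parallel>\<^sup>2 \<le> m (m - \<langle>x\<^sub>n, S x\<^sub>n\<rangle>)\<close> tends to \<open>0\<close>, and by compactness
  \<open>S x\<^sub>n\<close> converges along a subsequence, hence so does \<open>x\<^sub>n\<close> if \<open>m > 0\<close>.\<close>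

lemma finite_trace_eigenvector:
  fixes S :: "'h::chilbert_space \<Rightarrow> 'h"
  assumes S: "positive_op S" and C: "is_onb C" and \<tau>: "((\<lambda>e. Re (cinner e (S e))) has_sum \<tau>) C"
    and W: "closed_csubspace W" "\<And>x. x \<in> W \<Longrightarrow> S x \<in> W" "W \<noteq> {0}"
  shows "\<exists>x\<in>W. norm x = 1 \<and> (\<exists>l. S x = complex_of_real l *\<^sub>C x)"
proof -
  note c = positive_op_cblin[OF S]
  let ?U = "{x \<in> W. norm x = 1}"
  let ?q = "\<lambda>x. Re (cinner x (S x))"
  obtain v0 where "v0 \<in> W" "v0 \<noteq> 0" using W by (auto simp: closed_csubspace_def)
  then have v: "v0 /\<^sub>R norm v0 \<in> ?U" using W(1) by (simp add: closed_csubspace_def scaleR_scaleC norm_scaleC_hilbert norm_inverse)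
  have qb: "?q x \<le> \<tau>" if "norm x = 1" for x
  proof -
    have "?q x \<le> norm x * norm (S x)"
      using Cauchy_Schwarz_cinner[of x "S x"] complex_Re_le_cmod order_trans by blast
    then show ?thesis using finite_trace_norm_bound[OF S C \<tau>, of x] that by simp
  qed
  define m where "m = Sup (?q ` ?U)"
  have bdd: "bdd_above (?q ` ?U)" using qb by (intro bdd_aboveI2[where M = \<tau>]) simp
  have qm: "?q x \<le> m" if "x \<in> ?U" for x unfolding m_def using that bdd by (intro cSUP_upper)
  have m0: "0 \<le> m" using qm[OF v] positive_op_ge0[OF S] order_trans by blast
  have qmW: "?q x \<le> m * (norm x)\<^sup>2" if "x \<in> W" for x
  proof (cases "x = 0")
    case False
    then have "x /\<^sub>R norm x \<in> ?U" using that W(1)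
      by (simp add: closed_csubspace_def scaleR_scaleC norm_scaleC_hilbert norm_inverse)
    then have "?q (x /\<^sub>R norm x) \<le> m" by (rule qm)
    moreover have "?q (x /\<^sub>R norm x) = ?q x / (norm x)\<^sup>2"
      using clinear_scaleR[of S] c by (simp add: cblin_def cinner_scaleR_left cinner_scaleR_right power2_eq_square divide_inverse)
    ultimately show ?thesis using False by (simp add: divide_le_eq)
  qed (simp add: cblin_zero[OF c])
  show ?thesis
  proof (cases "m = 0")
    case True
    have "?q (v0 /\<^sub>R norm v0) = 0"
      using qm[OF v] positive_op_ge0[OF S, of "v0 /\<^sub>R norm v0"] True by simp
    then have "(norm (S (v0 /\<^sub>R norm v0)))\<^sup>2 \<le> 0"
      using finite_trace_form_bound[OF S C \<tau>, of "v0 /\<^sub>R norm v0"] by simp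
    then have "S (v0 /\<^sub>R norm v0) = complex_of_real 0 *\<^sub>C (v0 /\<^sub>R norm v0)" by simp
    then show ?thesis using v by blast
  next
    case False
    then have mp: "m > 0" using m0 by simp
    have "\<exists>x\<in>?U. m - 1 / real (Suc n) < ?q x" for n
    proof -
      have "m - 1 / real (Suc n) < Sup (?q ` ?U)" unfolding m_def[symmetric] by simp
      then show ?thesis using less_cSUP_iff[OF _ bdd] v by blast
    qed
    then obtain x where x: "\<And>n. x n \<in> ?U" "\<And>n. m - 1 / real (Suc n) < ?q (x n)" by metis
    have Sx: "(norm (S v))\<^sup>2 \<le> m * ?q v" if "v \<in> W" for v
    proof (cases "S v = 0")
      case False
      have "((norm (S v))\<^sup>2)\<^sup>2 \<le> ?q (S v) * ?q v"
        using positive_form_Cauchy_Schwarz[OF S, of "S v" v] by (simp add: cinner_self norm_power)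
      also have "\<dots> \<le> (m * (norm (S v))\<^sup>2) * ?q v"
        by (intro mult_right_mono qmW W(2) that positive_op_ge0[OF S])
      finally have "(norm (S v))\<^sup>2 * (norm (S v))\<^sup>2 \<le> (m * ?q v) * (norm (S v))\<^sup>2"
        by (simp only: power2_eq_square mult_ac)
      then show ?thesis by (rule mult_right_le_imp_le) (use False in simp)
    qed (use m0 positive_op_ge0[OF S] in simp)
    have near: "norm (S (x n) - complex_of_real m *\<^sub>C x n) \<le> sqrt (m / real (Suc n))" for n
    proof -
      have "(norm (S (x n) - complex_of_real m *\<^sub>C x n))\<^sup>2 =
          (norm (S (x n)))\<^sup>2 + m\<^sup>2 - 2 * m * ?q (x n)"
      proof -
        have "Re (cinner (S (x n)) (x n)) = ?q (x n)"
          by (simp add: adjointsD[OF positive_op_selfadjoint[OF S]])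
        then show ?thesis
          using norm_add_square[of "S (x n)" "- (complex_of_real m *\<^sub>C x n)"] x(1)[of n]
          by (simp add: cinner_minus_right cinner_scaleC_right norm_scaleC_hilbert)
      qed
      also have "\<dots> \<le> m * ?q (x n) + m\<^sup>2 - 2 * m * ?q (x n)" using Sx[of "x n"] x(1)[of n] by simp
      also have "\<dots> = m * (m - ?q (x n))" by (simp add: power2_eq_square algebra_simps)
      also have "\<dots> \<le> m * (1 / real (Suc n))" using x(2)[of n] m0 by (intro mult_left_mono) simp_all
      finally have "(norm (S (x n) - complex_of_real m *\<^sub>C x n))\<^sup>2 \<le> m / real (Suc n)" by simp
      then show ?thesis by (rule real_le_rsqrt)
    qed
    have "norm (x n) \<le> 1" for n using x(1)[of n] by simp
    then obtain r y where r: "strict_mono r" and y: "(\<lambda>n. S (x (r n))) \<longlonglongrightarrow> y"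
      using finite_trace_compact[OF S C \<tau>] by blast
    have "(\<lambda>n. m / real (Suc n)) \<longlonglongrightarrow> 0"
      using LIMSEQ_Suc[OF lim_const_over_n[of m]] by simp
    then have "(\<lambda>n. sqrt (m / real (Suc n))) \<longlonglongrightarrow> 0" using tendsto_real_sqrt by fastforce
    then have "(\<lambda>n. S (x n) - complex_of_real m *\<^sub>C x n) \<longlonglongrightarrow> 0"
      by (rule Lim_null_comparison[rotated]) (rule always_eventually, rule allI, rule near)
    then have "(\<lambda>n. S (x (r n)) - complex_of_real m *\<^sub>C x (r n)) \<longlonglongrightarrow> 0"
      using LIMSEQ_subseq_LIMSEQ[OF _ r] by (force simp: comp_def)
    from tendsto_diff[OF y this]
    have "(\<lambda>n. complex_of_real m *\<^sub>C x (r n)) \<longlonglongrightarrow> y" by simp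
    then have "(\<lambda>n. complex_of_real (1 / m) *\<^sub>C complex_of_real m *\<^sub>C x (r n)) \<longlonglongrightarrow> complex_of_real (1 / m) *\<^sub>C y"
      by (intro scaleC_hilbert.tendsto tendsto_const)
    then have xl: "(\<lambda>n. x (r n)) \<longlonglongrightarrow> complex_of_real (1 / m) *\<^sub>C y" (is "_ \<longlonglongrightarrow> ?z")
      using mp by (simp add: scaleC_scaleC)
    have "?z \<in> W" using W(1) xl x(1) closed_sequentially[of W "\<lambda>n. x (r n)"] by (simp add: closed_csubspace_def)
    moreover have "norm ?z = 1"
    proof (rule LIMSEQ_unique[OF tendsto_norm[OF xl]])
      show "(\<lambda>n. norm (x (r n))) \<longlonglongrightarrow> 1" using x(1) by simp
    qed
    moreover have "S ?z = complex_of_real m *\<^sub>C ?z"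
    proof -
      have "S ?z = y" by (rule LIMSEQ_unique[OF cblin_tendsto[OF c xl] y])
      then show ?thesis using mp by (simp add: scaleC_scaleC)
    qed
    ultimately show ?thesis by blast
  qed
qed

text \<open>The orthogonal complement of a maximal orthonormal set of eigenvectors is invariant; if it were nonzero,
  it would contain a further eigenvector.\<close>

lemma finite_trace_eigenbasis:
  fixes S :: "'h::chilbert_space \<Rightarrow> 'h"
  assumes S: "positive_op S" and C: "is_onb C" and \<tau>: "((\<lambda>e. Re (cinner e (S e))) has_sum \<tau>) C"
  shows "\<exists>E r. is_onb E \<and> (\<forall>e\<in>E. S e = complex_of_real (r e) *\<^sub>C e \<and> 0 \<le> r e)"
proof -
  let ?P = "{x. \<exists>l. S x = complex_of_real l *\<^sub>C x}"
  obtain E where EP: "E \<subseteq> ?P" and E: "orthonormal_family E (\<lambda>x. x)"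
    and max: "\<And>x. x \<in> ?P \<Longrightarrow> norm x = 1 \<Longrightarrow> \<exists>e\<in>E. cinner e x \<noteq> 0"
    using maximal_orthonormal_subset[of ?P] by blast
  define W where "W = {x. \<forall>e\<in>E. cinner e x = 0}"
  have W: "closed_csubspace W" unfolding W_def by (rule closed_csubspace_perp)
  have inv: "S x \<in> W" if "x \<in> W" for x
  proof -
    have "cinner e (S x) = 0" if e: "e \<in> E" for e
    proof -
      obtain l where "S e = complex_of_real l *\<^sub>C e" using EP e by blast
      then show ?thesis unfolding adjointsD[OF positive_op_selfadjoint[OF S], symmetric]
        using \<open>x \<in> W\<close> e by (simp add: cinner_scaleC_left W_def)
    qed
    then show ?thesis by (simp add: W_def)
  qed
  have "W = {0}"
  proof (rule ccontr)
    assume "W \<noteq> {0}"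
    then obtain x where "x \<in> W" "norm x = 1" "x \<in> ?P"
      using finite_trace_eigenvector[OF S C \<tau> W inv] by blast
    then show False using max by (auto simp: W_def)
  qed
  then have onb: "is_onb E" using E by (auto simp: is_onb_iff W_def)
  have "\<forall>e\<in>E. \<exists>l. S e = complex_of_real l *\<^sub>C e \<and> 0 \<le> l"
  proof
    fix e assume e: "e \<in> E"
    then obtain l where l: "S e = complex_of_real l *\<^sub>C e" using EP by blast
    have "cinner e (S e) = complex_of_real l"
      unfolding l cinner_scaleC_right using orthonormal_familyD[OF E e e] by simp
    then show "\<exists>l. S e = complex_of_real l *\<^sub>C e \<and> 0 \<le> l"
      using l positive_op_ge0[OF S, of e] by auto
  qed
  then obtain r where "\<forall>e\<in>E. S e = complex_of_real (r e) *\<^sub>C e \<and> 0 \<le> r e" by (rule bchoice[THEN exE])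
  then show ?thesis using onb by blast
qed

lemma onb_operator_eqI:
  assumes B: "is_onb B" and T: "cblin T" "cblin S" "\<And>e. e \<in> B \<Longrightarrow> T e = S e"
  shows "T = S"
proof
  fix x
  have "((\<lambda>e. T (cinner e x *\<^sub>C e)) has_sum T x) B" by (rule cblin_has_sum[OF T(1) onb_expansion[OF B]])
  moreover have "((\<lambda>e. T (cinner e x *\<^sub>C e)) has_sum S x) B"
    using cblin_has_sum[OF T(2) onb_expansion[OF B]]
    by (rule has_sum_cong[THEN iffD1, rotated]) (simp add: cblin_scaleC[OF T(1)] cblin_scaleC[OF T(2)] T(3))
  ultimately show "T x = S x" by (rule has_sum_unique)
qed

text \<open>The positive square root of \<open>T\<^sup>2\<close> is unique if one square root has an eigenbasis: on an
  eigenvector \<open>e\<close> of \<open>S\<close> with eigenvalue \<open>l > 0\<close>, the vector \<open>T e - l e\<close> satisfies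
  \<open>T y = - l y\<close> and so vanishes.\<close>

lemma abs_op_positive_unique:
  fixes T :: "'h::chilbert_space \<Rightarrow> 'h"
  assumes T: "positive_op T" and S: "is_abs_op T S"
    and E: "is_onb E" and r: "\<And>e. e \<in> E \<Longrightarrow> S e = complex_of_real (r e) *\<^sub>C e \<and> 0 \<le> r e"
  shows "T = S"
proof (rule onb_operator_eqI[OF E positive_op_cblin[OF T]])
  have pS: "positive_op S" and ST: "\<And>x y. cinner (S x) (S y) = cinner (T x) (T y)"
    using S by (simp_all add: is_abs_op_def)
  note c = positive_op_cblin[OF T]
  show "cblin S" by (rule positive_op_cblin[OF pS])
  have TT: "T (T x) = S (S x)" for x
  proof (rule cinner_eqI)
    show "cinner z (T (T x)) = cinner z (S (S x))" for z
      using adjointsD[OF positive_op_selfadjoint[OF T], of z "T x"]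
        adjointsD[OF positive_op_selfadjoint[OF pS], of z "S x"] ST[of z x] by simp
  qed
  fix e assume e: "e \<in> E"
  define l where "l = complex_of_real (r e)"
  have Se: "S e = l *\<^sub>C e" and l0: "0 \<le> r e" using r[OF e] by (simp_all add: l_def)
  show "T e = S e"
  proof (cases "r e = 0")
    case True
    then have "cinner (T e) (T e) = 0" unfolding ST[symmetric] Se by (simp add: l_def)
    then show ?thesis using True by (simp add: Se l_def cinner_self)
  next
    case False
    define y where "y = T e - l *\<^sub>C e"
    have "T y = S (S e) - l *\<^sub>C T e" by (simp add: y_def cblin_diff[OF c] cblin_scaleC[OF c] TT)
    also have "S (S e) = l *\<^sub>C l *\<^sub>C e" by (simp add: Se cblin_scaleC[OF positive_op_cblin[OF pS]])
    finally have Ty: "T y = - (l *\<^sub>C y)" by (simp add: y_def cvec.scale_right_diff_distrib)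
    have "Re (cinner y (T y)) = - (r e * (norm y)\<^sup>2)"
      unfolding Ty by (simp add: cinner_minus_right cinner_scaleC_right cinner_self l_def)
    then have "r e * (norm y)\<^sup>2 \<le> 0" using positive_op_ge0[OF T, of y] by simp
    then have "y = 0" using False l0 by (simp add: mult_le_0_iff)
    then show ?thesis by (simp add: y_def Se)
  qed
qed

text \<open>The definition of a trace-class operator supplies a basis in which the absolute value \<open>S\<close> has finite
  trace. This makes \<open>S\<close> diagonalisable, and then \<open>S = T\<close> by uniqueness of the square root.\<close>

lemma trace_class_positive:
  fixes T :: "'h::chilbert_space \<Rightarrow> 'h"
  assumes T: "positive_op T" "trace_class T"
  shows "\<exists>C. is_onb C \<and> (\<lambda>e. Re (cinner e (T e))) summable_on C"
    and "\<exists>E r. is_onb E \<and> (\<forall>e\<in>E. T e = complex_of_real (r e) *\<^sub>C e \<and> 0 \<le> r e)"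
proof -
  obtain S C where S: "is_abs_op T S" and C: "is_onb C" and s: "(\<lambda>e. cinner e (S e)) summable_on C"
    using T(2) unfolding trace_class_def by blast
  have pS: "positive_op S" using S by (simp add: is_abs_op_def)
  have sR: "(\<lambda>e. Re (cinner e (S e))) summable_on C" using s by (rule summable_on_Re)
  then have "((\<lambda>e. Re (cinner e (S e))) has_sum (\<Sum>\<^sub>\<infinity>e\<in>C. Re (cinner e (S e)))) C" by simp
  from finite_trace_eigenbasis[OF pS C this]
  obtain E r where E: "is_onb E" "\<And>e. e \<in> E \<Longrightarrow> S e = complex_of_real (r e) *\<^sub>C e \<and> 0 \<le> r e" by blast
  have "T = S" by (rule abs_op_positive_unique[OF T(1) S E])
  then show "\<exists>C. is_onb C \<and> (\<lambda>e. Re (cinner e (T e))) summable_on C"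
    and "\<exists>E r. is_onb E \<and> (\<forall>e\<in>E. T e = complex_of_real (r e) *\<^sub>C e \<and> 0 \<le> r e)"
    using C sR E by blast+
qed

section \<open>Diagonal operators, functional calculus and traces\<close>

text \<open>The maximal operator that multiplies the coordinates with respect to \<open>B\<close> by \<open>d\<close>.\<close>

definition diag_graph :: "'h::chilbert_space set \<Rightarrow> ('h \<Rightarrow> complex) \<Rightarrow> ('h \<times> 'h) set" where
  "diag_graph B d = {(x, y). \<forall>e\<in>B. cinner e y = d e * cinner e x}"

definition diag_op :: "'h::chilbert_space set \<Rightarrow> ('h \<Rightarrow> complex) \<Rightarrow> 'h \<Rightarrow> 'h" where
  "diag_op B d = family_op B (\<lambda>e. e) (\<lambda>e. e) d"

lemma diag_graph_cong: "(\<And>e. e \<in> B \<Longrightarrow> d e = d' e) \<Longrightarrow> diag_graph B d = diag_graph B d'"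
  by (auto simp: diag_graph_def)

context
  fixes B :: "'h::chilbert_space set" and d :: "'h \<Rightarrow> complex" and C :: real
  assumes B: "is_onb B" and d: "\<And>e. e \<in> B \<Longrightarrow> cmod (d e) \<le> C"
begin

lemma cblin_diag_op: "cblin (diag_op B d)"
  unfolding diag_op_def by (rule cblin_family_op[OF is_onb_orthonormal[OF B] is_onb_orthonormal[OF B] d])

lemma cinner_diag_op: "e \<in> B \<Longrightarrow> cinner e (diag_op B d x) = d e * cinner e x"
  unfolding diag_op_def by (rule cinner_family_op[OF is_onb_orthonormal[OF B] is_onb_orthonormal[OF B] d])

lemma diag_op_basis: "e \<in> B \<Longrightarrow> diag_op B d e = d e *\<^sub>C e"
  by (rule onb_coords_eqI[OF B])
     (use orthonormal_familyD[OF is_onb_orthonormal[OF B]] in \<open>simp add: cinner_diag_op cinner_scaleC_right\<close>)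

lemma norm_diag_op: "0 \<le> C \<Longrightarrow> norm (diag_op B d x) \<le> C * norm x"
  unfolding diag_op_def by (rule norm_family_op_le[OF is_onb_orthonormal[OF B] is_onb_orthonormal[OF B] d])

lemma adjoints_diag_op: "adjoints (diag_op B d) (diag_op B (\<lambda>e. cnj (d e)))"
  unfolding diag_op_def by (rule adjoints_family_op[OF is_onb_orthonormal[OF B] is_onb_orthonormal[OF B] d])

lemma diag_graph_eq_op_graph: "diag_graph B d = op_graph (diag_op B d)"
proof -
  have "y = diag_op B d x" if "\<forall>e\<in>B. cinner e y = d e * cinner e x" for x y
    by (rule onb_coords_eqI[OF B]) (simp add: that cinner_diag_op)
  then show ?thesis by (auto simp: diag_graph_def op_graph_def cinner_diag_op)
qed

end

lemma of_graph_op_graph [simp]: "of_graph (op_graph T) = T"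
  by (rule ext) (simp add: of_graph_def op_graph_def)

lemma cinner_eigen_expansion:
  assumes B: "is_onb B" and T: "cblin T" "\<And>e. e \<in> B \<Longrightarrow> T e = d e *\<^sub>C e" and e: "e \<in> B"
  shows "cinner e (T x) = d e * cinner e x"
proof -
  have "((\<lambda>f. T (cinner f x *\<^sub>C f)) has_sum T x) B" by (rule cblin_has_sum[OF T(1) onb_expansion[OF B]])
  from cblin_has_sum[OF cblin_cinner this]
  have "((\<lambda>f. cinner e (T (cinner f x *\<^sub>C f))) has_sum cinner e (T x)) B" .
  moreover have "((\<lambda>f. cinner e (T (cinner f x *\<^sub>C f))) has_sum (d e * cinner e x)) B"
    using e orthonormal_familyD[OF is_onb_orthonormal[OF B] e]
    by (intro has_sum_finite_neutralI[of "{e}"])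
       (auto simp: cblin_scaleC[OF T(1)] T(2) cinner_scaleC_right)
  ultimately show ?thesis by (rule has_sum_unique)
qed

lemma op_graph_eq_diag_graph:
  assumes B: "is_onb B" and T: "cblin T" "\<And>e. e \<in> B \<Longrightarrow> T e = d e *\<^sub>C e"
  shows "op_graph T = diag_graph B d"
proof -
  have "y = T x" if "\<forall>e\<in>B. cinner e y = d e * cinner e x" for x y
    by (rule onb_coords_eqI[OF B]) (simp add: that cinner_eigen_expansion[OF B T])
  then show ?thesis by (auto simp: diag_graph_def op_graph_def cinner_eigen_expansion[OF B T])
qed

lemma op_graph_diag_graphD:
  assumes B: "is_onb B" and eq: "diag_graph B d = op_graph T" and e: "e \<in> B"
  shows "T e = d e *\<^sub>C e"
proof -
  have "(e, d e *\<^sub>C e) \<in> diag_graph B d"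
    using orthonormal_familyD[OF is_onb_orthonormal[OF B] _ e]
    by (auto simp: diag_graph_def cinner_scaleC_right)
  then show ?thesis by (auto simp: eq op_graph_def)
qed

text \<open>On a diagonal operator the functional calculus acts on the diagonal entries: the series over the
  eigenvalues is the basis expansion, grouped by eigenvalue.\<close>

lemma fun_calc_diag_graph:
  fixes l :: "'h::chilbert_space \<Rightarrow> real"
  assumes B: "is_onb B"
  shows "fun_calc f (diag_graph B (\<lambda>e. complex_of_real (l e))) = diag_graph B (\<lambda>e. f (l e))"
proof -
  let ?G = "diag_graph B (\<lambda>e. complex_of_real (l e))"
  note o = orthonormal_familyD[OF is_onb_orthonormal[OF B]]
  have eig: "eigenspace ?G a = {x. \<forall>e\<in>B. l e \<noteq> a \<longrightarrow> cinner e x = 0}" for a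
    unfolding eigenspace_def diag_graph_def
    by (auto simp: cinner_scaleR_right scaleR_conv_of_real)
  have closed: "closed_csubspace (eigenspace ?G a)" for a
    using closed_csubspace_perp[of "{e \<in> B. l e \<noteq> a}"] by (simp add: eig Ball_def imp_conjL)
  have mem: "e \<in> eigenspace ?G (l e)" if "e \<in> B" for e
    using that by (auto simp: eig o)
  have proj: "cinner e (orth_proj (eigenspace ?G a) x) = (if l e = a then cinner e x else 0)"
    if e: "e \<in> B" for e a x
  proof (cases "l e = a")
    case True
    then have "cinner e (x - orth_proj (eigenspace ?G a) x) = 0"
      using mem[OF e] by (intro orth_proj_perp[OF closed]) simp
    then show ?thesis using True by (simp add: cinner_diff_right)
  next
    case False
    then show ?thesis using orth_proj_in[OF closed, of a x] e by (auto simp: eig)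
  qed
  have ev: "eigenvalues ?G = l ` B"
  proof
    show "l ` B \<subseteq> eigenvalues ?G"
    proof
      fix a assume "a \<in> l ` B"
      then obtain e where "e \<in> B" "a = l e" by blast
      moreover have "e \<noteq> 0" using \<open>e \<in> B\<close> B by (auto simp: is_onb_def)
      ultimately show "a \<in> eigenvalues ?G" using mem[of e] by (auto simp: eigenvalues_def)
    qed
    show "eigenvalues ?G \<subseteq> l ` B"
    proof
      fix a assume "a \<in> eigenvalues ?G"
      then have "eigenspace ?G a \<noteq> {0}" by (simp add: eigenvalues_def)
      then obtain x where x: "x \<in> eigenspace ?G a" "x \<noteq> 0"
        using closed[of a] unfolding closed_csubspace_def by blast
      then obtain e where "e \<in> B" "cinner e x \<noteq> 0" using B unfolding is_onb_def by blast
      then show "a \<in> l ` B" using x by (auto simp: eig)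
    qed
  qed
  \<comment> \<open>The family \<open>\<langle>e, y\<rangle> e\<close> is summed first over the basis vectors with a given eigenvalue.\<close>
  have group: "((\<lambda>a. orth_proj (eigenspace ?G a) y) has_sum y) (l ` B)" for y
  proof -
    have bij: "bij_betw (\<lambda>e. (l e, e)) B (SIGMA a:l ` B. {e \<in> B. l e = a})"
      by (rule bij_betwI[where g = snd]) auto
    have "((\<lambda>(a, e). cinner e y *\<^sub>C e) has_sum y) (SIGMA a:l ` B. {e \<in> B. l e = a})"
      using has_sum_reindex_bij_betw[OF bij, of "\<lambda>(a, e). cinner e y *\<^sub>C e" y] onb_expansion[OF B, of y]
      by simp
    moreover have "((\<lambda>e. (\<lambda>(a, e). cinner e y *\<^sub>C e) (a, e)) has_sum orth_proj (eigenspace ?G a) y) {e \<in> B. l e = a}"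
      for a
    proof -
      have "((\<lambda>e. cinner e (orth_proj (eigenspace ?G a) y) *\<^sub>C e) has_sum orth_proj (eigenspace ?G a) y) B"
        by (rule onb_expansion[OF B])
      then show ?thesis
        by (rule has_sum_cong_neutral[THEN iffD1, rotated -1]) (auto simp: proj)
    qed
    ultimately show ?thesis by (rule has_sum_SigmaD)
  qed
  show ?thesis
  proof (rule set_eqI, safe)
    fix x y
    assume "(x, y) \<in> fun_calc f ?G"
    then have s: "((\<lambda>a. f a *\<^sub>C orth_proj (eigenspace ?G a) x) has_sum y) (l ` B)"
      by (simp add: fun_calc_def ev)
    have "cinner e y = f (l e) * cinner e x" if e: "e \<in> B" for e
    proof (rule has_sum_unique[OF cblin_has_sum[OF cblin_cinner s]])
      show "((\<lambda>a. cinner e (f a *\<^sub>C orth_proj (eigenspace ?G a) x)) has_sum (f (l e) * cinner e x)) (l ` B)"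
        using e by (intro has_sum_finite_neutralI[of "{l e}"]) (auto simp: cinner_scaleC_right proj)
    qed
    then show "(x, y) \<in> diag_graph B (\<lambda>e. f (l e))" by (simp add: diag_graph_def)
  next
    fix x y
    assume "(x, y) \<in> diag_graph B (\<lambda>e. f (l e))"
    then have xy: "\<And>e. e \<in> B \<Longrightarrow> cinner e y = f (l e) * cinner e x" by (simp add: diag_graph_def)
    have "f a *\<^sub>C orth_proj (eigenspace ?G a) x = orth_proj (eigenspace ?G a) y" for a
      by (rule onb_coords_eqI[OF B]) (simp add: cinner_scaleC_right proj xy)
    then show "(x, y) \<in> fun_calc f ?G" using group[of y] by (simp add: fun_calc_def ev)
  qed
qed

text \<open>Independence of the trace of the basis, and its cyclicity, in one: the double series
  \<open>\<Sum> d\<^sub>b \<langle>b,X c\<rangle>\<langle>c,A b\<rangle>\<close> converges absolutely.\<close>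

lemma diag_trace_cyclic:
  fixes B C :: "'h::chilbert_space set"
  assumes B: "is_onb B" and C: "is_onb C" and d: "(\<lambda>b. cmod (d b)) summable_on B"
    and A: "cblin A" and X: "cblin X" and T: "cblin T" "\<And>b. b \<in> B \<Longrightarrow> T b = d b *\<^sub>C b"
  shows "((\<lambda>c. cinner c (A (T (X c)))) has_sum (\<Sum>\<^sub>\<infinity>b\<in>B. d b * cinner b (X (A b)))) C"
    and "(\<lambda>b. d b * cinner b (X (A b))) summable_on B"
proof -
  obtain M where M: "M > 0" "\<And>x. norm (A x) \<le> M * norm x" using cblin_bound[OF A] by blast
  obtain X' where X': "cblin X'" "adjoints X X'" using ex_adjoint[OF X] by blast
  obtain M' where M': "M' > 0" "\<And>x. norm (X' x) \<le> M' * norm x" using cblin_bound[OF X'(1)] by blast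
  define f where "f = (\<lambda>(b, c). d b * (cinner b (X c) * cinner c (A b)))"
  have nb: "norm b = 1" if "b \<in> B" for b using B that by (simp add: is_onb_def)
  have inner_le: "(\<lambda>c. norm (f (b, c))) summable_on C \<and> (\<Sum>\<^sub>\<infinity>c\<in>C. norm (f (b, c))) \<le> cmod (d b) * ((M'\<^sup>2 + M\<^sup>2) / 2)"
    if b: "b \<in> B" for b
  proof -
    define g where "g c = cmod (d b) * (((cmod (cinner c (X' b)))\<^sup>2 + (cmod (cinner c (A b)))\<^sup>2) / 2)" for c
    have g: "(g has_sum (cmod (d b) * (((norm (X' b))\<^sup>2 + (norm (A b))\<^sup>2) / 2))) C"
      unfolding g_def
      using has_sum_cmult_right[OF has_sum_cmult_left[OF has_sum_add[OF onb_norm[OF C, of "X' b"] onb_norm[OF C, of "A b"]], of "1/2"]]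
      by simp
    have fg: "norm (f (b, c)) \<le> g c" for c
    proof -
      have "cmod (cinner b (X c)) * cmod (cinner c (A b)) \<le> ((cmod (cinner c (X' b)))\<^sup>2 + (cmod (cinner c (A b)))\<^sup>2) / 2"
        using sum_squares_bound[of "cmod (cinner c (X' b))" "cmod (cinner c (A b))"]
        by (simp add: adjointsD'[OF X'(2)] cmod_cinner_commute[of "X' b" c])
      then have "cmod (d b) * (cmod (cinner b (X c)) * cmod (cinner c (A b))) \<le> g c"
        unfolding g_def by (rule mult_left_mono) simp
      then show ?thesis by (simp add: f_def norm_mult)
    qed
    have s: "(\<lambda>c. norm (f (b, c))) summable_on C"
      by (rule summable_on_comparison_test[OF has_sum_imp_summable[OF g]]) (use fg in simp_all)
    have "(\<Sum>\<^sub>\<infinity>c\<in>C. norm (f (b, c))) \<le> cmod (d b) * (((norm (X' b))\<^sup>2 + (norm (A b))\<^sup>2) / 2)"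
      by (rule has_sum_mono[OF has_sum_infsum[OF s] g]) (rule fg)
    also have "\<dots> \<le> cmod (d b) * ((M'\<^sup>2 + M\<^sup>2) / 2)"
    proof -
      have "(norm (A b))\<^sup>2 \<le> M\<^sup>2" using M(2)[of b] nb[OF b] by (intro power_mono) simp_all
      moreover have "(norm (X' b))\<^sup>2 \<le> M'\<^sup>2" using M'(2)[of b] nb[OF b] by (intro power_mono) simp_all
      ultimately show ?thesis by (intro mult_left_mono) simp_all
    qed
    finally show ?thesis using s by blast
  qed
  have abs: "(\<lambda>p. norm (f p)) summable_on (B \<times> C)"
    unfolding Infinite_Sum.abs_summable_on_Sigma_iff
  proof (intro conjI ballI)
    show "(\<lambda>c. norm (f (b, c))) summable_on C" if "b \<in> B" for b using inner_le[OF that] by simp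
    show "(\<lambda>b. norm (\<Sum>\<^sub>\<infinity>c\<in>C. norm (f (b, c)))) summable_on B"
    proof (rule summable_on_comparison_test)
      show "(\<lambda>b. cmod (d b) * ((M'\<^sup>2 + M\<^sup>2) / 2)) summable_on B" by (intro summable_on_cmult_left d)
      show "norm (\<Sum>\<^sub>\<infinity>c\<in>C. norm (f (b, c))) \<le> cmod (d b) * ((M'\<^sup>2 + M\<^sup>2) / 2)" if "b \<in> B" for b
        using inner_le[OF that] infsum_nonneg[of C "\<lambda>c. norm (f (b, c))"] by simp
    qed simp
  qed
  then have "f summable_on (B \<times> C)" by (rule Infinite_Sum.abs_summable_summable)
  then have fs: "(f has_sum infsum f (B \<times> C)) (B \<times> C)" by simp
  have "((\<lambda>c. f (b, c)) has_sum (d b * cinner b (X (A b)))) C" for b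
    unfolding f_def using has_sum_cmult_right[OF onb_Parseval[OF C, of "X' b" "A b"], of "d b"]
    by (simp add: adjointsD'[OF X'(2)])
  from has_sum_SigmaD[OF fs this]
  have 1: "((\<lambda>b. d b * cinner b (X (A b))) has_sum infsum f (B \<times> C)) B" .
  then show "(\<lambda>b. d b * cinner b (X (A b))) summable_on B" by (rule has_sum_imp_summable)
  have "((\<lambda>(c, b). f (b, c)) has_sum infsum f (B \<times> C)) (C \<times> B)"
    using fs by (subst (asm) has_sum_swap) simp
  moreover have "((\<lambda>b. (\<lambda>(c, b). f (b, c)) (c, b)) has_sum cinner c (A (T (X c)))) B" for c
  proof -
    have "((\<lambda>b. A (T (cinner b (X c) *\<^sub>C b))) has_sum A (T (X c))) B"
      by (rule cblin_has_sum[OF cblin_compose[OF A T(1)] onb_expansion[OF B]])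
    from cblin_has_sum[OF cblin_cinner this, of c]
    show ?thesis
      by (rule has_sum_cong[THEN iffD1, rotated])
         (simp add: f_def cblin_scaleC[OF T(1)] cblin_scaleC[OF A] T(2) cinner_scaleC_right mult_ac)
  qed
  ultimately have "((\<lambda>c. cinner c (A (T (X c)))) has_sum infsum f (B \<times> C)) C" by (rule has_sum_SigmaD)
  then show "((\<lambda>c. cinner c (A (T (X c)))) has_sum (\<Sum>\<^sub>\<infinity>b\<in>B. d b * cinner b (X (A b)))) C"
    using infsumI[OF 1] by simp
qed

lemma op_trace_comp_diag:
  fixes B :: "'h::chilbert_space set"
  assumes "is_onb B" "(\<lambda>b. cmod (d b)) summable_on B"
    "cblin A" "cblin T" "\<And>b. b \<in> B \<Longrightarrow> T b = d b *\<^sub>C b"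
  shows "op_trace (A \<circ> T) = (\<Sum>\<^sub>\<infinity>b\<in>B. d b * cinner b (A b))"
proof -
  have "is_onb (SOME B::'h set. is_onb B)" using ex_onb by (rule someI_ex)
  from infsumI[OF diag_trace_cyclic(1)[OF assms(1) this assms(2,3) cblin_id assms(4,5)]]
  show ?thesis by (simp add: op_trace_def)
qed

lemma op_trace_diag:
  fixes B :: "'h::chilbert_space set"
  assumes B: "is_onb B" and "(\<lambda>b. cmod (d b)) summable_on B"
    "cblin T" "\<And>b. b \<in> B \<Longrightarrow> T b = d b *\<^sub>C b"
  shows "op_trace T = (\<Sum>\<^sub>\<infinity>b\<in>B. d b)"
proof -
  have "op_trace ((\<lambda>x. x) \<circ> T) = (\<Sum>\<^sub>\<infinity>b\<in>B. d b * cinner b b)"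
    by (rule op_trace_comp_diag[OF B assms(2) cblin_id assms(3,4)])
  also have "\<dots> = (\<Sum>\<^sub>\<infinity>b\<in>B. d b)"
    by (rule infsum_cong) (simp add: orthonormal_familyD[OF is_onb_orthonormal[OF B]])
  finally show ?thesis by (simp add: comp_def)
qed

lemma summable_norm_bounded:
  assumes "(\<lambda>b. cmod (d b)) summable_on B" "b \<in> B"
  shows "cmod (d b) \<le> (\<Sum>\<^sub>\<infinity>b\<in>B. cmod (d b))"
  using finite_sum_le_infsum[OF assms(1), of "{b}"] assms(2) by simp

lemma positive_op_diag:
  assumes B: "is_onb B" and T: "cblin T" "\<And>e. e \<in> B \<Longrightarrow> T e = complex_of_real (t e) *\<^sub>C e"
    and t: "\<And>e. e \<in> B \<Longrightarrow> 0 \<le> t e"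
  shows "positive_op T" and "((\<lambda>e. t e * (cmod (cinner e x))\<^sup>2) has_sum Re (cinner x (T x))) B"
proof -
  have s: "((\<lambda>e. complex_of_real (t e * (cmod (cinner e x))\<^sup>2)) has_sum cinner x (T x)) B" for x
    using onb_Parseval[OF B, of x "T x"]
    by (rule has_sum_cong[THEN iffD1, rotated])
       (simp add: cinner_eigen_expansion[OF B T] complex_norm_square cinner_commute[of x] mult_ac del: of_real_power)
  then show r: "((\<lambda>e. t e * (cmod (cinner e x))\<^sup>2) has_sum Re (cinner x (T x))) B" for x
    using has_sum_Re[OF s[of x]] by simp
  have "cinner x (T x) \<in> \<real>\<^sub>\<ge>\<^sub>0" for x
  proof -
    have "0 \<le> Re (cinner x (T x))" by (rule has_sum_nonneg[OF r]) (simp add: t)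
    moreover have "Im (cinner x (T x)) = 0" using has_sum_Im[OF s[of x]] by (simp add: has_sum_unique)
    ultimately show ?thesis by (simp add: complex_nonneg_Reals_iff)
  qed
  then show "positive_op T" using T(1) by (simp add: positive_op_def bounded_clinear_eq)
qed

text \<open>The absolute value of a diagonal operator is the diagonal operator with entries \<open>|d b|\<close>.\<close>

lemma trace_class_diag:
  fixes B :: "'h::chilbert_space set"
  assumes B: "is_onb B" and d: "(\<lambda>b. cmod (d b)) summable_on B"
  shows "trace_class (diag_op B d)" and "diag_graph B d = op_graph (diag_op B d)" and "cblin (diag_op B d)"
    and "b \<in> B \<Longrightarrow> diag_op B d b = d b *\<^sub>C b"
proof -
  define M where "M = (\<Sum>\<^sub>\<infinity>b\<in>B. cmod (d b))"
  have dM: "\<And>b. b \<in> B \<Longrightarrow> cmod (d b) \<le> M" unfolding M_def by (rule summable_norm_bounded[OF d])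
  define t where "t b = complex_of_real (cmod (d b))" for b
  have tM: "\<And>b. b \<in> B \<Longrightarrow> cmod (t b) \<le> M" using dM by (simp add: t_def)
  show c: "cblin (diag_op B d)" by (rule cblin_diag_op[OF B dM])
  show "diag_graph B d = op_graph (diag_op B d)" by (rule diag_graph_eq_op_graph[OF B dM])
  show "b \<in> B \<Longrightarrow> diag_op B d b = d b *\<^sub>C b" by (rule diag_op_basis[OF B dM])
  have ct: "cblin (diag_op B t)" by (rule cblin_diag_op[OF B tM])
  have bt: "diag_op B t b = t b *\<^sub>C b" if "b \<in> B" for b by (rule diag_op_basis[OF B tM that])
  have "positive_op (diag_op B t)"
    by (rule positive_op_diag(1)[OF B ct, of "\<lambda>b. cmod (d b)"]) (simp_all add: bt t_def)
  moreover have "cinner (diag_op B t x) (diag_op B t y) = cinner (diag_op B d x) (diag_op B d y)" for x y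
  proof (rule has_sum_unique[OF onb_Parseval[OF B]])
    have coord: "cinner (diag_op B d' x) e = cnj (d' e * cinner e x)"
      if "e \<in> B" "\<And>b. b \<in> B \<Longrightarrow> cmod (d' b) \<le> M" for d' e
      by (subst cinner_commute) (simp add: cinner_diag_op[OF B that(2) that(1)])
    have dd: "cnj (t e * cinner e x) * (t e * cinner e y) = cnj (d e * cinner e x) * (d e * cinner e y)" for e
    proof -
      have "cnj (t e) * t e = cnj (d e) * d e" using complex_norm_square[of "d e"]
        by (simp add: t_def power2_eq_square mult.commute)
      then show ?thesis by (simp add: mult_ac)
    qed
    show "((\<lambda>e. cinner (diag_op B t x) e * cinner e (diag_op B t y)) has_sum
        cinner (diag_op B d x) (diag_op B d y)) B"
      using onb_Parseval[OF B, of "diag_op B d x" "diag_op B d y"]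
      by (rule has_sum_cong[THEN iffD1, rotated])
         (simp only: coord[OF _ tM] coord[OF _ dM] cinner_diag_op[OF B tM] cinner_diag_op[OF B dM] dd)
  qed
  ultimately have "is_abs_op (diag_op B d) (diag_op B t)" by (simp add: is_abs_op_def)
  moreover have "(\<lambda>e. cinner e (diag_op B t e)) summable_on B"
  proof -
    have "(\<lambda>e. complex_of_real (cmod (d e))) summable_on B" using d by (rule summable_on_of_real)
    then show ?thesis
      by (rule summable_on_cong[THEN iffD1, rotated])
         (simp add: bt cinner_scaleC_right orthonormal_familyD[OF is_onb_orthonormal[OF B]] t_def)
  qed
  ultimately show "trace_class (diag_op B d)"
    unfolding trace_class_def bounded_clinear_eq using c B by blast
qed

lemma trace_class_graph_diag: 
  "is_onb B \<Longrightarrow> (\<lambda>b. cmod (d b)) summable_on B \<Longrightarrow> trace_class_graph (diag_graph B d)"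
  unfolding trace_class_graph_def using trace_class_diag by blast

lemma has_sum_finite_sum:
  assumes "finite F" "\<And>b. b \<in> F \<Longrightarrow> (f b has_sum s b) C"
  shows "((\<lambda>c. \<Sum>b\<in>F. f b c) has_sum (\<Sum>b\<in>F. s b :: 'a::{topological_comm_monoid_add})) C"
  using assms by (induction F) (auto intro: has_sum_add)

text \<open>The basis \<open>C\<close> in which the trace is known to be finite need not be \<open>B\<close>. Exchanging the two sums of
  \<open>t b |\<langle>c, b\<rangle>|\<^sup>2\<close>, finitely many \<open>b\<close> at a time, bounds the partial sums of \<open>t\<close> by that trace.\<close>

lemma trace_class_positive_diag_summable:
  fixes B :: "'h::chilbert_space set"
  assumes B: "is_onb B" and T: "trace_class T" "\<And>e. e \<in> B \<Longrightarrow> T e = complex_of_real (t e) *\<^sub>C e"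
    and t: "\<And>e. e \<in> B \<Longrightarrow> 0 \<le> t e"
  shows "t summable_on B"
proof -
  have c: "cblin T" using T(1) by (simp add: trace_class_def bounded_clinear_eq)
  have p: "positive_op T" by (rule positive_op_diag(1)[OF B c T(2) t])
  have q: "((\<lambda>e. t e * (cmod (cinner e x))\<^sup>2) has_sum Re (cinner x (T x))) B" for x
    by (rule positive_op_diag(2)[OF B c T(2) t])
  obtain C where C: "is_onb C" and s: "(\<lambda>e. Re (cinner e (T e))) summable_on C"
    using trace_class_positive(1)[OF p T(1)] by blast
  have le: "sum t F \<le> (\<Sum>\<^sub>\<infinity>e\<in>C. Re (cinner e (T e)))" if F: "finite F" "F \<subseteq> B" for F
  proof -
    have "((\<lambda>c. t b * (cmod (cinner c b))\<^sup>2) has_sum t b * (norm b)\<^sup>2) C" for b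
      by (intro has_sum_cmult_right onb_norm[OF C])
    then have "((\<lambda>c. \<Sum>b\<in>F. t b * (cmod (cinner c b))\<^sup>2) has_sum (\<Sum>b\<in>F. t b * (norm b)\<^sup>2)) C"
      by (intro has_sum_finite_sum F(1))
    moreover have "(\<Sum>b\<in>F. t b * (norm b)\<^sup>2) = sum t F"
      using F(2) B by (intro sum.cong) (auto simp: is_onb_def)
    ultimately have "((\<lambda>c. \<Sum>b\<in>F. t b * (cmod (cinner c b))\<^sup>2) has_sum sum t F) C" by simp
    then show ?thesis
    proof (rule has_sum_mono[OF _ has_sum_infsum[OF s]])
      fix c
      have "(\<Sum>b\<in>F. t b * (cmod (cinner b c))\<^sup>2) \<le> Re (cinner c (T c))"
        by (rule finite_sum_le_has_sum[OF q F(1,2)]) (simp add: t)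
      then show "(\<Sum>b\<in>F. t b * (cmod (cinner c b))\<^sup>2) \<le> Re (cinner c (T c))"
        by (simp add: cmod_cinner_commute[of _ c])
    qed
  qed
  show ?thesis
    by (rule nonneg_bdd_above_summable_on, rule t, assumption,
        rule bdd_aboveI2[where M = "\<Sum>\<^sub>\<infinity>e\<in>C. Re (cinner e (T e))"]) (use le in simp)
qed

section \<open>Multiples of a representation inside the sequence space\<close>

text \<open>Balls of radius \<open>1/2\<close> around the vectors of an orthonormal basis are disjoint.\<close>

lemma countable_onb:
  fixes B :: "'h::{chilbert_space, second_countable_topology} set"
  assumes B: "is_onb B" shows "countable B"
proof -
  have far: "1 < dist e f" if "e \<in> B" "f \<in> B" "e \<noteq> f" for e f
  proof -
    have "(norm (e - f))\<^sup>2 = 2"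
      using that B norm_add_square[of e "- f"] by (simp add: is_onb_def cinner_minus_right)
    then have "1\<^sup>2 < (norm (e - f))\<^sup>2" by simp
    then show ?thesis unfolding dist_norm by (rule power2_less_imp_less) simp
  qed
  have disj: "e = f" if "e \<in> B" "f \<in> B" "z \<in> ball e (1/2)" "z \<in> ball f (1/2)" for e f z
  proof (rule ccontr)
    assume "e \<noteq> f"
    then show False using far[OF that(1,2)] that(3,4) dist_triangle2[of e f z] by simp
  qed
  have "countable ((\<lambda>e. ball e (1/2)) ` B)"
  proof (rule countable_disjoint_open_subsets)
    show "disjoint ((\<lambda>e. ball e (1 / 2)) ` B)"
    proof (rule pairwiseI)
      fix U V assume "U \<in> (\<lambda>e. ball e (1 / 2)) ` B" "V \<in> (\<lambda>e. ball e (1 / 2)) ` B" "U \<noteq> V"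
      then show "disjnt U V" unfolding disjnt_def using disj by blast
    qed
  qed auto
  moreover have "inj_on (\<lambda>e. ball e (1/2)) B"
  proof (rule inj_onI)
    fix e f assume "e \<in> B" "f \<in> B" "ball e (1/2) = ball f (1/2)"
    then show "e = f" using disj[of e f e] by (metis centre_in_ball zero_less_divide_1_iff zero_less_numeral)
  qed
  ultimately show ?thesis by (rule countable_image_inj_on)
qed

definition ell2_unit :: "nat \<Rightarrow> ell2" where
  "ell2_unit n = Abs_ell2 (\<lambda>m. if m = n then 1 else 0)"

lemma Rep_ell2_unit: "Rep_ell2 (ell2_unit n) m = (if m = n then 1 else 0)"
proof -
  have "summable (\<lambda>m. (cmod (if m = n then 1 else 0))\<^sup>2)"
    by (rule summable_finite[of "{n}"]) auto
  then show ?thesis by (simp add: ell2_unit_def Abs_ell2_inverse)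
qed

lemma cinner_ell2_unit: "cinner (ell2_unit n) (ell2_unit m) = (if n = m then 1 else 0)"
  unfolding cinner_ell2_def by (subst suminf_finite[of "{n}"]) (auto simp: Rep_ell2_unit)

text \<open>The Hilbert space \<open>\<H> \<otimes> \<H>\<close> with its basis indexed by \<open>B \<times> B\<close>, realised on the closed span
  \<open>amp_space\<close> of coordinate vectors of the sequence space: \<open>emb e\<close> is the isometry
  \<open>x \<mapsto> x \<otimes> e\<close> and \<open>coemb e\<close> its adjoint. In it, the GNS representation of every normal state of \<open>B(\<H>)\<close>
  with a diagonal density matrix can be found.\<close>

locale amplification =
  fixes B :: "'h::{chilbert_space, second_countable_topology} set"
  assumes B: "is_onb B"
begin

definition unit_vec :: "'h \<Rightarrow> 'h \<Rightarrow> ell2" where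
  "unit_vec e f = ell2_unit (to_nat_on (B \<times> B) (e, f))"

definition emb :: "'h \<Rightarrow> 'h \<Rightarrow> ell2" where
  "emb e = family_op B (\<lambda>f. f) (unit_vec e) (\<lambda>_. 1)"

definition coemb :: "'h \<Rightarrow> ell2 \<Rightarrow> 'h" where
  "coemb e = family_op B (unit_vec e) (\<lambda>f. f) (\<lambda>_. 1)"

lemma cinner_unit_vec:
  assumes "e \<in> B" "f \<in> B" "e' \<in> B" "f' \<in> B"
  shows "cinner (unit_vec e f) (unit_vec e' f') = (if e = e' \<and> f = f' then 1 else 0)"
proof -
  have "inj_on (to_nat_on (B \<times> B)) (B \<times> B)"
    by (intro inj_on_to_nat_on countable_SIGMA countable_onb[OF B])
  then show ?thesis using assms unfolding unit_vec_def cinner_ell2_unit by (auto dest: inj_onD)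
qed

lemma ortho_unit_vec: "e \<in> B \<Longrightarrow> orthonormal_family B (unit_vec e)"
  by (simp add: orthonormal_family_def cinner_unit_vec)

lemmas ortho_B = is_onb_orthonormal[OF B]

lemma one_le: "i \<in> B \<Longrightarrow> cmod 1 \<le> 1" by simp

lemma emb_coemb_adjoints: "e \<in> B \<Longrightarrow> adjoints (emb e) (coemb e)"
  using adjoints_family_op[OF ortho_B ortho_unit_vec one_le, of e] by (simp add: emb_def coemb_def)

lemma cblin_emb: "e \<in> B \<Longrightarrow> cblin (emb e)"
  unfolding emb_def by (rule cblin_family_op[OF ortho_B ortho_unit_vec one_le])

lemma cblin_coemb: "e \<in> B \<Longrightarrow> cblin (coemb e)"
  unfolding coemb_def by (rule cblin_family_op[OF ortho_unit_vec ortho_B one_le])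

lemma coemb_emb:
  assumes e: "e \<in> B" "e' \<in> B" shows "coemb e (emb e' x) = (if e = e' then x else 0)"
proof (rule onb_coords_eqI[OF B])
  fix f assume f: "f \<in> B"
  have 1: "cinner f (coemb e (emb e' x)) = cinner (unit_vec e f) (emb e' x)"
    unfolding coemb_def using cinner_family_op[OF ortho_unit_vec[OF e(1)] ortho_B one_le f] by simp
  show "cinner f (coemb e (emb e' x)) = cinner f (if e = e' then x else 0)"
  proof (cases "e = e'")
    case True
    have "cinner (unit_vec e' f) (emb e' x) = cinner f x"
      unfolding emb_def using cinner_family_op[OF ortho_B ortho_unit_vec[OF e(2)] one_le f] by simp
    then show ?thesis unfolding 1 by (simp add: True)
  next
    case False
    then have "cinner (unit_vec e f) (emb e' x) = 0" unfolding emb_def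
      by (intro cinner_family_op_orth[OF ortho_B ortho_unit_vec[OF e(2)] one_le])
         (simp_all add: cinner_unit_vec e f)
    then show ?thesis unfolding 1 using False by simp
  qed
qed

lemma cinner_emb: "e \<in> B \<Longrightarrow> e' \<in> B \<Longrightarrow> cinner (emb e x) (emb e' y) = (if e = e' then cinner x y else 0)"
  by (simp add: adjointsD[OF emb_coemb_adjoints] coemb_emb)

lemma norm_emb: "e \<in> B \<Longrightarrow> norm (emb e x) = norm x"
proof -
  assume e: "e \<in> B"
  have "(norm (emb e x))\<^sup>2 = (norm x)\<^sup>2" unfolding norm_eq_cinner using e by (simp add: cinner_emb)
  then show ?thesis by (simp add: power2_eq_iff_nonneg)
qed

lemma coemb_Bessel:
  "(\<lambda>e. (norm (coemb e u))\<^sup>2) summable_on B" "(\<Sum>\<^sub>\<infinity>e\<in>B. (norm (coemb e u))\<^sup>2) \<le> (norm u)\<^sup>2"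
proof -
  let ?v = "\<lambda>e. emb e (coemb e u)"
  have n: "(norm (?v e))\<^sup>2 = (norm (coemb e u))\<^sup>2" if "e \<in> B" for e by (simp add: norm_emb that)
  have part: "cinner (?v e) u = complex_of_real ((norm (?v e))\<^sup>2)" if "e \<in> B" for e
    unfolding n[OF that] cinner_self[symmetric] by (rule adjointsD[OF emb_coemb_adjoints[OF that]])
  have orth: "cinner (?v e) (?v f) = 0" if "e \<in> B" "f \<in> B" "e \<noteq> f" for e f
    using that by (simp add: cinner_emb)
  note parts = orthogonal_parts(1,2)[of B ?v u, OF orth part]
  show "(\<lambda>e. (norm (coemb e u))\<^sup>2) summable_on B"
    by (rule summable_on_cong[THEN iffD1, OF n parts(1)])
  show "(\<Sum>\<^sub>\<infinity>e\<in>B. (norm (coemb e u))\<^sup>2) \<le> (norm u)\<^sup>2"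
    by (rule order_trans[OF eq_refl parts(2)], rule infsum_cong) (simp add: n)
qed

text \<open>The operator \<open>T \<otimes> 1\<close>.\<close>

definition ampl :: "('h \<Rightarrow> 'h) \<Rightarrow> ell2 \<Rightarrow> ell2" where
  "ampl T u = (\<Sum>\<^sub>\<infinity>e\<in>B. emb e (T (coemb e u)))"

lemma ampl_has_sum:
  assumes T: "cblin T" shows "((\<lambda>e. emb e (T (coemb e u))) has_sum ampl T u) B"
  unfolding ampl_def
proof (rule has_sum_infsum, rule summable_orthogonal)
  show "cinner (emb e (T (coemb e u))) (emb f (T (coemb f u))) = 0" if "e \<in> B" "f \<in> B" "e \<noteq> f" for e f
    using that by (simp add: cinner_emb)
  obtain C where C: "C > 0" "\<And>x. norm (T x) \<le> C * norm x" using cblin_bound[OF T] by blast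
  show "(\<lambda>e. (norm (emb e (T (coemb e u))))\<^sup>2) summable_on B"
  proof (rule summable_on_comparison_test)
    show "(\<lambda>e. C\<^sup>2 * (norm (coemb e u))\<^sup>2) summable_on B" by (intro summable_on_cmult_right coemb_Bessel)
    show "(norm (emb e (T (coemb e u))))\<^sup>2 \<le> C\<^sup>2 * (norm (coemb e u))\<^sup>2" if "e \<in> B" for e
      unfolding norm_emb[OF that] power_mult_distrib[symmetric] by (intro power_mono C(2)) simp
  qed simp
qed

lemma coemb_ampl:
  assumes T: "cblin T" and e: "e \<in> B" shows "coemb e (ampl T u) = T (coemb e u)"
proof (rule has_sum_unique[OF cblin_has_sum[OF cblin_coemb[OF e] ampl_has_sum[OF T]]])
  show "((\<lambda>f. coemb e (emb f (T (coemb f u)))) has_sum T (coemb e u)) B"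
    using e by (intro has_sum_finite_neutralI[of "{e}"]) (auto simp: coemb_emb)
qed

lemma norm_ampl:
  assumes T: "cblin T" and C: "C \<ge> 0" "\<And>x. norm (T x) \<le> C * norm x"
  shows "norm (ampl T u) \<le> C * norm u"
proof -
  have "((\<lambda>e. (norm (emb e (T (coemb e u))))\<^sup>2) has_sum (norm (ampl T u))\<^sup>2) B"
    by (rule has_sum_norm_orthogonal[OF _ ampl_has_sum[OF T]]) (simp add: cinner_emb)
  moreover have "((\<lambda>e. C\<^sup>2 * (norm (coemb e u))\<^sup>2) has_sum C\<^sup>2 * (\<Sum>\<^sub>\<infinity>e\<in>B. (norm (coemb e u))\<^sup>2)) B"
    by (intro has_sum_cmult_right has_sum_infsum coemb_Bessel)
  ultimately have "(norm (ampl T u))\<^sup>2 \<le> C\<^sup>2 * (\<Sum>\<^sub>\<infinity>e\<in>B. (norm (coemb e u))\<^sup>2)"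
  proof (rule has_sum_mono)
    fix e assume e: "e \<in> B"
    show "(norm (emb e (T (coemb e u))))\<^sup>2 \<le> C\<^sup>2 * (norm (coemb e u))\<^sup>2"
      unfolding norm_emb[OF e] power_mult_distrib[symmetric] by (intro power_mono C(2)) simp
  qed
  also have "\<dots> \<le> C\<^sup>2 * (norm u)\<^sup>2" by (intro mult_left_mono coemb_Bessel) simp
  finally have "(norm (ampl T u))\<^sup>2 \<le> (C * norm u)\<^sup>2" by (simp add: power_mult_distrib)
  then show ?thesis by (rule power2_le_imp_le) (use C in simp)
qed

definition amp_space :: "ell2 set" where "amp_space = {u. ampl (\<lambda>x. x) u = u}"

lemma amp_space_expansion: "u \<in> amp_space \<Longrightarrow> ((\<lambda>e. emb e (coemb e u)) has_sum u) B"
  using ampl_has_sum[OF cblin_id, of u] by (simp add: amp_space_def)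

lemma amp_space_eqI:
  assumes "u \<in> amp_space" "v \<in> amp_space" "\<And>e. e \<in> B \<Longrightarrow> coemb e u = coemb e v"
  shows "u = v"
proof -
  have "((\<lambda>e. emb e (coemb e u)) has_sum v) B"
    using amp_space_expansion[OF assms(2)] by (rule has_sum_cong[THEN iffD1, rotated]) (simp add: assms(3))
  then show ?thesis by (rule has_sum_unique[OF amp_space_expansion[OF assms(1)]])
qed

lemma ampl_in: "cblin T \<Longrightarrow> ampl T u \<in> amp_space"
proof -
  assume T: "cblin T"
  have "ampl (\<lambda>x. x) (ampl T u) = (\<Sum>\<^sub>\<infinity>e\<in>B. emb e (coemb e (ampl T u)))" by (simp add: ampl_def)
  also have "\<dots> = (\<Sum>\<^sub>\<infinity>e\<in>B. emb e (T (coemb e u)))"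
    by (rule infsum_cong) (simp add: coemb_ampl[OF T])
  also have "\<dots> = ampl T u" by (simp add: ampl_def)
  finally show ?thesis by (simp add: amp_space_def)
qed

lemma emb_in: "e \<in> B \<Longrightarrow> emb e x \<in> amp_space"
proof -
  assume e: "e \<in> B"
  have "((\<lambda>f. emb f (coemb f (emb e x))) has_sum emb e x) B"
    using e by (intro has_sum_finite_neutralI[of "{e}"])
      (auto simp: coemb_emb cblin_zero[OF cblin_emb])
  then show ?thesis using ampl_has_sum[OF cblin_id, of "emb e x"] has_sum_unique by (auto simp: amp_space_def)
qed

lemma ampl_emb: "cblin T \<Longrightarrow> e \<in> B \<Longrightarrow> ampl T (emb e x) = emb e (T x)"
  by (rule amp_space_eqI) (auto simp: ampl_in emb_in coemb_ampl coemb_emb cblin_zero)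

lemma adjoints_ampl:
  assumes T: "cblin T" "cblin S" and adj: "adjoints T S" shows "adjoints (ampl T) (ampl S)"
  unfolding adjoints_def
proof (intro allI)
  fix u v
  have "((\<lambda>e. cinner v (emb e (T (coemb e u)))) has_sum cinner v (ampl T u)) B"
    by (rule cblin_has_sum[OF cblin_cinner ampl_has_sum[OF T(1)]])
  then have "((\<lambda>e. cnj (cinner v (emb e (T (coemb e u))))) has_sum cnj (cinner v (ampl T u))) B"
    by (simp only: has_sum_cnj_iff)
  then have 1: "((\<lambda>e. cinner (emb e (T (coemb e u))) v) has_sum cinner (ampl T u) v) B"
    unfolding cinner_commute[symmetric] .
  have 2: "((\<lambda>e. cinner u (emb e (S (coemb e v)))) has_sum cinner u (ampl S v)) B"
    by (rule cblin_has_sum[OF cblin_cinner ampl_has_sum[OF T(2)]])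
  have 3: "cinner (emb e (T (coemb e u))) v = cinner u (emb e (S (coemb e v)))" if "e \<in> B" for e
    by (simp add: adjointsD[OF emb_coemb_adjoints[OF that]] adjointsD[OF adj]
        adjointsD'[OF emb_coemb_adjoints[OF that]])
  show "cinner (ampl T u) v = cinner u (ampl S v)"
    by (rule has_sum_unique[OF 1]) (rule has_sum_cong[THEN iffD1, OF _ 2], rule 3[symmetric])
qed

lemma cblin_ampl:
  assumes T: "cblin T" shows "cblin (ampl T)"
proof -
  obtain S where S: "cblin S" "adjoints T S" using ex_adjoint[OF T] by blast
  obtain C where "C > 0" "\<And>x. norm (T x) \<le> C * norm x" using cblin_bound[OF T] by blast
  then have "\<And>u. norm (ampl T u) \<le> C * norm u" by (intro norm_ampl[OF T]) auto
  then show ?thesis by (rule cblin_adjointsI[OF adjoints_ampl[OF T S]])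
qed

lemma ampl_comp: "cblin S \<Longrightarrow> cblin T \<Longrightarrow> ampl (S \<circ> T) u = ampl S (ampl T u)"
  by (rule amp_space_eqI) (simp_all add: ampl_in cblin_comp coemb_ampl)

lemma ampl_compose: "cblin S \<Longrightarrow> cblin T \<Longrightarrow> ampl (S \<circ> T) = ampl S \<circ> ampl T"
  by (simp add: fun_eq_iff ampl_comp)

lemma closed_csubspace_amp_space: "closed_csubspace amp_space"
proof -
  note c = cblin_ampl[OF cblin_id]
  have "closed amp_space" unfolding amp_space_def
    by (intro closed_Collect_eq cblin_continuous_on[OF c] continuous_on_id)
  then show ?thesis
    by (auto simp: closed_csubspace_def amp_space_def cblin_zero[OF c] cblin_add[OF c] cblin_scaleC[OF c])
qed

lemma amp_space_add: "u \<in> amp_space \<Longrightarrow> v \<in> amp_space \<Longrightarrow> u + v \<in> amp_space"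
  using closed_csubspace_amp_space by (simp add: closed_csubspace_def)

lemma amp_space_scaleC: "u \<in> amp_space \<Longrightarrow> c *\<^sub>C u \<in> amp_space"
  using closed_csubspace_amp_space by (simp add: closed_csubspace_def)

lemma ampl_plus: "cblin S \<Longrightarrow> cblin T \<Longrightarrow> ampl (\<lambda>x. S x + T x) u = ampl S u + ampl T u"
  by (rule amp_space_eqI)
     (simp_all add: ampl_in cblin_plus coemb_ampl amp_space_add cblin_add[OF cblin_coemb])

lemma ampl_scaleC: "cblin T \<Longrightarrow> ampl (\<lambda>x. c *\<^sub>C T x) u = c *\<^sub>C ampl T u"
  by (rule amp_space_eqI)
     (simp_all add: ampl_in cblin_scale coemb_ampl amp_space_scaleC cblin_scaleC[OF cblin_coemb])

lemma coemb_orth: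
  assumes "\<And>v. v \<in> amp_space \<Longrightarrow> cinner v u = 0" "e \<in> B" shows "coemb e u = 0"
proof -
  have "cinner (coemb e u) (coemb e u) = cinner (emb e (coemb e u)) u"
    by (simp add: adjointsD[OF emb_coemb_adjoints[OF assms(2)]])
  also have "\<dots> = 0" by (intro assms(1) emb_in assms(2))
  finally show ?thesis by (simp add: cinner_self)
qed

lemma ampl_bounded_ops: "cblin T \<Longrightarrow> ampl T \<in> bounded_ops amp_space"
proof (rule bounded_opsI)
  assume T: "cblin T"
  show "cblin (ampl T)" by (rule cblin_ampl[OF T])
  show "ampl T u \<in> amp_space" for u by (rule ampl_in[OF T])
  fix u assume "\<And>v. v \<in> amp_space \<Longrightarrow> cinner v u = 0"
  then have "coemb e u = 0" if "e \<in> B" for e using that by (rule coemb_orth)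
  then show "ampl T u = 0" unfolding ampl_def
    by (intro infsum_0) (simp add: cblin_zero[OF T] cblin_zero[OF cblin_emb])
qed

lemma orth_proj_amp_space: "orth_proj amp_space = ampl (\<lambda>x. x)"
proof
  fix u
  show "orth_proj amp_space u = ampl (\<lambda>x. x) u"
  proof (rule orth_proj_eqI[OF closed_csubspace_amp_space ampl_in[OF cblin_id]])
    fix v assume "v \<in> amp_space"
    then have "cinner v (ampl (\<lambda>x. x) u) = cinner v u"
      using adjointsD[OF adjoints_ampl[OF cblin_id cblin_id], of v u]
      by (simp add: adjoints_def amp_space_def)
    then show "cinner v (u - ampl (\<lambda>x. x) u) = 0" by (simp add: cinner_diff_right)
  qed
qed

lemma ampl_inject: "ampl S = ampl T \<Longrightarrow> cblin S \<Longrightarrow> cblin T \<Longrightarrow> B \<noteq> {} \<Longrightarrow> S = T"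
proof
  fix x assume eq: "ampl S = ampl T" and c: "cblin S" "cblin T" and "B \<noteq> {}"
  then obtain e where e: "e \<in> B" by blast
  have "coemb e (ampl S (emb e x)) = coemb e (ampl T (emb e x))" by (simp add: eq)
  then show "S x = T x" using c e by (simp add: coemb_ampl coemb_emb)
qed

lemma star_rep_ampl:
  assumes rep: "star_rep UNIV \<pi>" shows "star_rep amp_space (\<lambda>a. ampl (\<pi> a))"
  unfolding star_rep_def
proof (intro conjI allI ballI)
  note c = star_rep_cblin[OF rep]
  show "closed_csubspace amp_space" by (rule closed_csubspace_amp_space)
  show "ampl (\<pi> a) \<in> bounded_ops amp_space" for a by (rule ampl_bounded_ops[OF c])
  show "clinear (\<lambda>a. ampl (\<pi> a) u)" for u
  proof -
    have 1: "\<pi> (a + b) = (\<lambda>x. \<pi> a x + \<pi> b x)" for a b by (simp add: fun_eq_iff star_rep_add[OF rep])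
    have 2: "\<pi> (z *\<^sub>C a) = (\<lambda>x. z *\<^sub>C \<pi> a x)" for z a by (simp add: fun_eq_iff star_rep_scaleC[OF rep])
    show ?thesis unfolding clinear_def 1 2 by (simp add: ampl_plus c ampl_scaleC)
  qed
  show "ampl (\<pi> (a * b)) = ampl (\<pi> a) \<circ> ampl (\<pi> b)" for a b
  proof -
    have "\<pi> (a * b) = \<pi> a \<circ> \<pi> b" by (simp add: fun_eq_iff star_rep_mult[OF rep])
    then show ?thesis by (simp add: ampl_compose c)
  qed
  show "adjoint_pair (ampl (\<pi> a)) (ampl (\<pi> (star a)))" for a
    unfolding adjoint_pair_eq by (rule adjoints_ampl[OF c c star_rep_adjoints[OF rep]])
  show "ampl (\<pi> 1) u = u" if "u \<in> amp_space" for u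
  proof -
    have "\<pi> 1 = (\<lambda>x. x)" by (simp add: fun_eq_iff star_rep_one[OF rep])
    then show ?thesis using that by (simp add: amp_space_def)
  qed
qed

context
  fixes \<pi> :: "'a::unital_cstar_algebra \<Rightarrow> 'h \<Rightarrow> 'h"
  assumes irr: "irreducible_rep UNIV \<pi>"
begin

lemma amp_rep: "star_rep amp_space (\<lambda>a. ampl (\<pi> a))"
  by (rule star_rep_ampl[OF irreducible_star_rep[OF irr]])

lemma B_nonempty: "B \<noteq> {}"
proof
  assume "B = {}"
  then have "\<And>x::'h. x = 0" using B by (simp add: is_onb_def)
  then show False using irreducible_nontrivial[OF irr] by blast
qed

text \<open>The commutant of \<open>\<pi>(A) \<otimes> 1\<close> consists of matrices with scalar entries, by Schur's lemma; such matrices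
  commute with all \<open>T \<otimes> 1\<close>.\<close>

lemma commutant_blocks_scalar:
  assumes S: "S \<in> commutant amp_space (range (\<lambda>a. ampl (\<pi> a)))" and e: "e \<in> B" "f \<in> B"
  shows "\<exists>s. \<forall>x. coemb e (S (emb f x)) = s *\<^sub>C x"
proof (rule Schur[OF irr])
  note c = star_rep_cblin[OF irreducible_star_rep[OF irr]]
  show "cblin (\<lambda>x. coemb e (S (emb f x)))"
    by (intro cblin_compose[OF cblin_coemb[OF e(1)]] cblin_emb[OF e(2)]
        cblin_compose[OF bounded_ops_cblin[OF commutant_bounded_ops[OF S]]])
  fix a x
  have "\<pi> a (coemb e (S (emb f x))) = coemb e (ampl (\<pi> a) (S (emb f x)))"
    by (rule coemb_ampl[OF c e(1), symmetric])
  also have "ampl (\<pi> a) (S (emb f x)) = S (ampl (\<pi> a) (emb f x))"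
    by (rule commutantD[OF S, symmetric]) simp
  finally show "\<pi> a (coemb e (S (emb f x))) = coemb e (S (emb f (\<pi> a x)))"
    by (simp add: ampl_emb[OF c e(2)])
qed

lemma ampl_commutes:
  assumes S: "S \<in> commutant amp_space (range (\<lambda>a. ampl (\<pi> a)))" and T: "cblin T"
  shows "ampl T (S u) = S (ampl T u)"
proof -
  have bS: "S \<in> bounded_ops amp_space" by (rule commutant_bounded_ops[OF S])
  have main: "ampl T (S u) = S (ampl T u)" if u: "u \<in> amp_space" for u
  proof (rule amp_space_eqI)
    fix e assume e: "e \<in> B"
    have "\<forall>f\<in>B. \<exists>s. \<forall>x. coemb e (S (emb f x)) = s *\<^sub>C x" using commutant_blocks_scalar[OF S e] by blast
    then obtain s where s: "\<And>f x. f \<in> B \<Longrightarrow> coemb e (S (emb f x)) = s f *\<^sub>C x" by (metis bchoice)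
    note c = cblin_compose[OF cblin_coemb[OF e] bounded_ops_cblin[OF bS]]
    have "((\<lambda>f. coemb e (S (emb f (coemb f u)))) has_sum coemb e (S u)) B"
      by (rule cblin_has_sum[OF c amp_space_expansion[OF u]])
    from cblin_has_sum[OF T this]
    have 1: "((\<lambda>f. T (coemb e (S (emb f (coemb f u))))) has_sum T (coemb e (S u))) B" .
    have 2: "((\<lambda>f. coemb e (S (emb f (T (coemb f u))))) has_sum coemb e (S (ampl T u))) B"
      by (rule cblin_has_sum[OF c ampl_has_sum[OF T]])
    have "T (coemb e (S u)) = coemb e (S (ampl T u))"
      by (rule has_sum_unique[OF 1], rule has_sum_cong[THEN iffD1, OF _ 2]) (simp add: s cblin_scaleC[OF T])
    then show "coemb e (ampl T (S u)) = coemb e (S (ampl T u))" by (simp add: coemb_ampl[OF T e])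
  qed (simp_all add: ampl_in[OF T] bounded_ops_in[OF bS])
  have "ampl T (S u) = ampl T (S (orth_proj amp_space u))"
    by (simp add: bounded_ops_proj[OF closed_csubspace_amp_space bS])
  also have "\<dots> = S (ampl T (orth_proj amp_space u))"
    by (rule main) (rule orth_proj_in[OF closed_csubspace_amp_space])
  finally show ?thesis by (simp add: bounded_ops_proj[OF closed_csubspace_amp_space ampl_bounded_ops[OF T]])
qed

lemma matrix_unit_commutant:
  assumes "e \<in> B" "f \<in> B"
  shows "(\<lambda>u. emb e (coemb f u)) \<in> commutant amp_space (range (\<lambda>a. ampl (\<pi> a)))"
proof (rule commutantI)
  note c = star_rep_cblin[OF irreducible_star_rep[OF irr]]
  show "(\<lambda>u. emb e (coemb f u)) \<in> bounded_ops amp_space"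
    by (rule bounded_opsI)
       (use assms in \<open>simp_all add: cblin_compose cblin_emb cblin_coemb emb_in coemb_orth cblin_zero[OF cblin_emb]\<close>)
  fix A u assume "A \<in> range (\<lambda>a. ampl (\<pi> a))"
  then obtain a where "A = ampl (\<pi> a)" by blast
  then show "emb e (coemb f (A u)) = A (emb e (coemb f u))" using assms by (simp add: coemb_ampl c ampl_emb)
qed

text \<open>An operator in the bicommutant commutes with the matrix units \<open>1 \<otimes> |e\<rangle>\<langle>f|\<close>, so its diagonal blocks
  all agree and the other blocks vanish.\<close>

lemma bicommutant_amp: "bicommutant amp_space (range (\<lambda>a. ampl (\<pi> a))) = {ampl T |T. cblin T}"
proof
  show "{ampl T |T. cblin T} \<subseteq> bicommutant amp_space (range (\<lambda>a. ampl (\<pi> a)))"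
    unfolding bicommutant_def by (auto intro!: commutantI ampl_bounded_ops ampl_commutes)
  show "bicommutant amp_space (range (\<lambda>a. ampl (\<pi> a))) \<subseteq> {ampl T |T. cblin T}"
  proof
    fix X assume X: "X \<in> bicommutant amp_space (range (\<lambda>a. ampl (\<pi> a)))"
    have bX: "X \<in> bounded_ops amp_space" using X by (simp add: bicommutant_def commutant_bounded_ops)
    obtain e where e: "e \<in> B" using B_nonempty by blast
    define T where "T x = coemb e (X (emb e x))" for x
    have T: "cblin T" unfolding T_def
      by (intro cblin_compose[OF cblin_coemb[OF e]] cblin_compose[OF bounded_ops_cblin[OF bX]] cblin_emb[OF e])
    have "X u = ampl T u" for u
    proof (rule amp_space_eqI)
      fix f assume f: "f \<in> B"
      have "X (emb e (coemb f u)) = emb e (coemb f (X u))"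
        by (rule commutantD[OF X[unfolded bicommutant_def] matrix_unit_commutant[OF e f]])
      then have "T (coemb f u) = coemb f (X u)" using e by (simp add: T_def coemb_emb)
      then show "coemb f (X u) = coemb f (ampl T u)" by (simp add: coemb_ampl[OF T f])
    qed (simp_all add: bounded_ops_in[OF bX] ampl_in[OF T])
    then have "X = ampl T" by (rule ext)
    then show "X \<in> {ampl T |T. cblin T}" using T by blast
  qed
qed

text \<open>\<open>B(\<H>) \<otimes> 1\<close> is a factor, as its center commutes with \<open>\<pi>(A) \<otimes> 1\<close> and so is scalar by Schur's lemma, and
  \<open>|e\<rangle>\<langle>e| \<otimes> 1\<close> is a minimal projection in it.\<close>

lemma type_I_amp: "type_I_factor amp_space (bicommutant amp_space (range (\<lambda>a. ampl (\<pi> a))))"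
proof -
  let ?R = "range (\<lambda>a. ampl (\<pi> a))"
  let ?M = "bicommutant amp_space ?R"
  note c\<pi> = star_rep_cblin[OF irreducible_star_rep[OF irr]]
  have mem: "cblin T \<Longrightarrow> ampl T \<in> ?M" for T using bicommutant_amp by blast
  have memE: "\<exists>T. cblin T \<and> X = ampl T" if "X \<in> ?M" for X using that bicommutant_amp by blast
  have adj: "\<forall>T\<in>?M. \<exists>S\<in>?M. adjoint_pair T S"
  proof
    fix X assume "X \<in> ?M"
    then obtain T where T: "cblin T" "X = ampl T" using memE by blast
    obtain S where "cblin S" "adjoints T S" using ex_adjoint[OF T(1)] by blast
    then show "\<exists>S\<in>?M. adjoint_pair X S"
      using T mem adjoints_ampl unfolding adjoint_pair_eq by blast
  qed
  have anti: "S \<subseteq> S' \<Longrightarrow> commutant amp_space S' \<subseteq> commutant amp_space S" for S S' :: "(ell2 \<Rightarrow> ell2) set"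
    unfolding commutant_def by blast
  have sub: "S \<subseteq> commutant amp_space (commutant amp_space S)" if "S \<subseteq> bounded_ops amp_space" for S
  proof
    fix X assume X: "X \<in> S"
    show "X \<in> commutant amp_space (commutant amp_space S)"
      by (rule commutantI) (use X that in \<open>auto simp: commutantD[OF _ X]\<close>)
  qed
  have RB: "?R \<subseteq> bounded_ops amp_space" using ampl_bounded_ops[OF c\<pi>] by blast
  have MM: "bicommutant amp_space ?M = ?M"
  proof
    show "?M \<subseteq> bicommutant amp_space ?M"
      unfolding bicommutant_def[of _ ?M] by (rule sub) (auto simp: bicommutant_def commutant_bounded_ops)
    have "commutant amp_space ?R \<subseteq> commutant amp_space ?M"
      unfolding bicommutant_def by (rule sub) (auto simp: commutant_bounded_ops)
    then have "commutant amp_space (commutant amp_space ?M) \<subseteq> commutant amp_space (commutant amp_space ?R)"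
      by (rule anti)
    then show "bicommutant amp_space ?M \<subseteq> ?M" by (simp add: bicommutant_def)
  qed
  have center: "?M \<inter> commutant amp_space ?M = {(\<lambda>x. c *\<^sub>C orth_proj amp_space x) |c. True}"
  proof
    show "?M \<inter> commutant amp_space ?M \<subseteq> {(\<lambda>x. c *\<^sub>C orth_proj amp_space x) |c. True}"
    proof
      fix X assume X: "X \<in> ?M \<inter> commutant amp_space ?M"
      then obtain T where T: "cblin T" "X = ampl T" using memE by blast
      obtain e where e: "e \<in> B" using B_nonempty by blast
      have "\<pi> a (T x) = T (\<pi> a x)" for a x
      proof -
        have "X (ampl (\<pi> a) (emb e x)) = ampl (\<pi> a) (X (emb e x))"
          using X mem[OF c\<pi>] by (intro commutantD) auto
        from arg_cong[OF this, of "coemb e"]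
        show ?thesis using e by (simp add: T coemb_ampl c\<pi> coemb_emb)
      qed
      then obtain s where "\<And>x. T x = s *\<^sub>C x" using Schur[OF irr T(1)] by blast
      then have Ts: "T = (\<lambda>x. s *\<^sub>C x)" by (rule ext)
      have "X = (\<lambda>x. s *\<^sub>C orth_proj amp_space x)"
        unfolding T(2) Ts orth_proj_amp_space by (rule ext) (rule ampl_scaleC[OF cblin_id])
      then show "X \<in> {(\<lambda>x. c *\<^sub>C orth_proj amp_space x) |c. True}" by blast
    qed
    show "{(\<lambda>x. c *\<^sub>C orth_proj amp_space x) |c. True} \<subseteq> ?M \<inter> commutant amp_space ?M"
    proof safe
      fix s
      have eq: "(\<lambda>x. s *\<^sub>C orth_proj amp_space x) = ampl (\<lambda>x. s *\<^sub>C x)"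
        by (simp add: orth_proj_amp_space ampl_scaleC[OF cblin_id] fun_eq_iff)
      have cs: "cblin (\<lambda>x::'h. s *\<^sub>C x)" by (intro cblin_scale cblin_id)
      show "(\<lambda>x. s *\<^sub>C orth_proj amp_space x) \<in> ?M" unfolding eq by (rule mem[OF cs])
      show "(\<lambda>x. s *\<^sub>C orth_proj amp_space x) \<in> commutant amp_space ?M" unfolding eq
      proof (rule commutantI[OF ampl_bounded_ops[OF cs]])
        fix A u assume "A \<in> ?M"
        then obtain T where T: "cblin T" "A = ampl T" using memE by blast
        show "ampl (\<lambda>x. s *\<^sub>C x) (A u) = A (ampl (\<lambda>x. s *\<^sub>C x) u)"
          unfolding T(2) ampl_comp[OF cs T(1), symmetric] ampl_comp[OF T(1) cs, symmetric]
          by (simp add: comp_def cblin_scaleC[OF T(1)])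
      qed
    qed
  qed
  obtain e where e: "e \<in> B" using B_nonempty by blast
  have ne: "cinner e e = 1" using orthonormal_familyD[OF ortho_B e e] by simp
  let ?E = "rank1 e e" and ?p = "ampl (rank1 e e)"
  have "is_projection ?p"
    unfolding is_projection_def bounded_clinear_eq adjoint_pair_eq ampl_compose[OF cblin_rank1 cblin_rank1, symmetric]
    by (simp add: cblin_ampl cblin_rank1 rank1_comp_rank1 ne adjoints_ampl adjoints_rank1)
  moreover have "?p \<noteq> (\<lambda>x. 0)"
  proof
    assume "?p = (\<lambda>x. 0)"
    then have "coemb e (?p (emb e e)) = coemb e 0" by simp
    then have "?E (coemb e (emb e e)) = 0"
      unfolding coemb_ampl[OF cblin_rank1 e] by (simp add: cblin_zero[OF cblin_coemb[OF e]])
    then have "e = 0" using e ne by (simp add: coemb_emb rank1_def)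
    then show False using ne by simp
  qed
  moreover have "q = (\<lambda>x. 0) \<or> q = ?p" if q: "q \<in> ?M" "is_projection q" "?p \<circ> q = q" for q
  proof -
    obtain Q where Q: "cblin Q" "q = ampl Q" using memE[OF q(1)] by blast
    have "ampl (?E \<circ> Q) = ampl Q" using q(3) by (simp add: Q ampl_compose cblin_rank1)
    then have EQ: "?E \<circ> Q = Q" by (rule ampl_inject) (simp_all add: cblin_comp cblin_rank1 Q B_nonempty)
    have "ampl (Q \<circ> Q) = ampl Q" using q(2) by (simp add: Q ampl_compose is_projection_def)
    then have QQ: "Q \<circ> Q = Q" by (rule ampl_inject) (simp_all add: cblin_comp Q B_nonempty)
    have aQ: "adjoints Q Q"
    proof -
      obtain S where S: "cblin S" "adjoints Q S" using ex_adjoint[OF Q(1)] by blast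
      have "adjoints (ampl Q) (ampl Q)" using q(2) by (simp add: Q is_projection_def adjoint_pair_eq)
      then have "ampl S = ampl Q" by (rule adjoints_unique[OF adjoints_ampl[OF Q(1) S]])
      then have "S = Q" by (rule ampl_inject) (simp_all add: S Q B_nonempty)
      then show ?thesis using S by simp
    qed
    have Qx: "Q x = cinner e (Q x) *\<^sub>C e" for x using fun_cong[OF EQ, of x] by (simp add: rank1_def)
    define s where "s = cinner e (Q e)"
    have Qe: "Q e = s *\<^sub>C e" using Qx[of e] by (simp add: s_def)
    have "cinner e (Q x) = cnj s * cinner e x" for x
      unfolding adjointsD[OF aQ, symmetric] Qe by (simp add: cinner_scaleC_left)
    then have Qs: "Q x = (cnj s * cinner e x) *\<^sub>C e" for x using Qx[of x] by simp
    have "cinner e (Q e) = cinner e ((cnj s * cinner e e) *\<^sub>C e)" by (rule arg_cong[OF Qs])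
    then have "s = cnj s" unfolding s_def[symmetric] cinner_scaleC_right ne by simp
    moreover have "s * s = s"
    proof -
      have "Q (Q e) = Q e" using fun_cong[OF QQ, of e] by simp
      then have "(s * s) *\<^sub>C e = s *\<^sub>C e" by (simp add: Qe cblin_scaleC[OF Q(1)] scaleC_scaleC)
      then have "cinner e ((s * s) *\<^sub>C e) = cinner e (s *\<^sub>C e)" by (rule arg_cong)
      then show ?thesis by (simp add: cinner_scaleC_right ne)
    qed
    ultimately have "s = 0 \<or> s = 1" by (metis mult_cancel_right1 mult_cancel_left2)
    then show ?thesis
    proof
      assume "s = 0"
      then have "Q = (\<lambda>x. 0)" by (simp add: Qs fun_eq_iff)
      then have "ampl Q u = 0" for u unfolding ampl_def by (intro infsum_0) (simp add: cblin_zero[OF cblin_emb])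
      then show ?thesis by (simp add: Q fun_eq_iff)
    next
      assume "s = 1"
      then have "Q = ?E" by (simp add: Qs rank1_def fun_eq_iff)
      then show ?thesis by (simp add: Q)
    qed
  qed
  ultimately show ?thesis
    unfolding type_I_factor_def factor_def using adj MM center mem[OF cblin_rank1] by blast
qed

end

text \<open>The vector \<open>\<Sum>\<^sub>e \<surd>w\<^sub>e e \<otimes> e\<close>, whose vector state on \<open>B(\<H>) \<otimes> 1\<close> has the density matrix with eigenvalues
  \<open>w\<close>.\<close>

definition gns_vec :: "('h \<Rightarrow> real) \<Rightarrow> ell2" where
  "gns_vec w = (\<Sum>\<^sub>\<infinity>e\<in>B. complex_of_real (sqrt (w e)) *\<^sub>C emb e e)"

context
  fixes w :: "'h \<Rightarrow> real"
  assumes w: "\<And>e. e \<in> B \<Longrightarrow> 0 \<le> w e" "w summable_on B"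
begin

lemma norm_B: "e \<in> B \<Longrightarrow> norm e = 1" using B by (simp add: is_onb_def)

lemma gns_vec_has_sum: "((\<lambda>e. complex_of_real (sqrt (w e)) *\<^sub>C emb e e) has_sum gns_vec w) B"
  unfolding gns_vec_def
proof (rule has_sum_infsum, rule summable_orthogonal)
  show "(\<lambda>e. (norm (complex_of_real (sqrt (w e)) *\<^sub>C emb e e))\<^sup>2) summable_on B"
    using w(2) by (rule summable_on_cong[THEN iffD1, rotated])
      (simp add: norm_scaleC_hilbert norm_emb norm_B w(1))
qed (simp add: cinner_scaleC_left cinner_scaleC_right cinner_emb)

lemma coemb_gns_vec: "e \<in> B \<Longrightarrow> coemb e (gns_vec w) = complex_of_real (sqrt (w e)) *\<^sub>C e"
proof (rule has_sum_unique[OF cblin_has_sum[OF cblin_coemb gns_vec_has_sum]])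
  assume e: "e \<in> B"
  then show "((\<lambda>f. coemb e (complex_of_real (sqrt (w f)) *\<^sub>C emb f f)) has_sum complex_of_real (sqrt (w e)) *\<^sub>C e) B"
    by (intro has_sum_finite_neutralI[of "{e}"]) (auto simp: coemb_emb cblin_scaleC[OF cblin_coemb])
qed

lemma gns_vec_in: "gns_vec w \<in> amp_space"
  by (rule closed_csubspace_has_sum[OF closed_csubspace_amp_space amp_space_scaleC[OF emb_in] gns_vec_has_sum])

lemma gns_vec_form:
  assumes T: "cblin T"
  shows "((\<lambda>e. complex_of_real (w e) * cinner e (T e)) has_sum cinner (gns_vec w) (ampl T (gns_vec w))) B"
proof -
  have "((\<lambda>e. cinner (gns_vec w) (emb e (T (coemb e (gns_vec w))))) has_sum cinner (gns_vec w) (ampl T (gns_vec w))) B"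
    by (rule cblin_has_sum[OF cblin_cinner ampl_has_sum[OF T]])
  then show ?thesis
  proof (rule has_sum_cong[THEN iffD1, rotated])
    fix e assume e: "e \<in> B"
    have "complex_of_real (sqrt (w e)) * complex_of_real (sqrt (w e)) = complex_of_real (w e)"
      using w(1)[OF e] by (simp flip: of_real_mult)
    then show "cinner (gns_vec w) (emb e (T (coemb e (gns_vec w)))) = complex_of_real (w e) * cinner e (T e)"
      unfolding adjointsD'[OF emb_coemb_adjoints[OF e]] coemb_gns_vec[OF e]
      by (simp add: cblin_scaleC[OF T] cinner_scaleC_left cinner_scaleC_right mult.assoc[symmetric])
  qed
qed

text \<open>Applying \<open>|x\<rangle>\<langle>e| \<otimes> 1\<close> to the vector gives \<open>\<surd>w\<^sub>e x \<otimes> e\<close>, and these vectors span the whole space. By the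
  density theorem it makes no difference whether \<open>B(\<H>)\<close> or \<open>\<pi>(A)\<close> acts.\<close>

lemma gns_vec_cyclic:
  assumes irr: "irreducible_rep UNIV \<pi>" and pos: "\<And>e. e \<in> B \<Longrightarrow> 0 < w e"
  shows "closure (range (\<lambda>a. ampl (\<pi> a) (gns_vec w))) = amp_space"
proof
  let ?\<xi> = "gns_vec w"
  let ?M = "closure (range (\<lambda>a. ampl (\<pi> a) ?\<xi>))"
  note rep = amp_rep[OF irr] and K = closed_csubspace_amp_space
  have M: "closed_csubspace ?M" by (rule closure_range_csubspace[OF star_rep_clinear[OF rep]])
  show "?M \<subseteq> amp_space"
    using K by (intro closure_minimal) (auto simp: closed_csubspace_def star_rep_in[OF rep])
  have TM: "ampl T ?\<xi> \<in> ?M" if T: "cblin T" for T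
  proof -
    define y where "y = ampl T ?\<xi> - orth_proj ?M (ampl T ?\<xi>)"
    have yM: "cinner y v = 0" if "v \<in> ?M" for v
      unfolding y_def by (rule cinner_eq_zero_commute) (rule orth_proj_perp[OF M that])
    have "cinner y (ampl T ?\<xi>) = cinner 0 (ampl T ?\<xi>)"
    proof (rule bicommutant_two_vectors[OF rep _ gns_vec_in gns_vec_in])
      show "ampl T \<in> bicommutant amp_space (range (\<lambda>a. ampl (\<pi> a)))"
        unfolding bicommutant_amp[OF irr] using T by blast
      show "cinner y (ampl (\<pi> b) ?\<xi>) = cinner 0 (ampl (\<pi> b) ?\<xi>)" for b
        using yM[OF subsetD[OF closure_subset rangeI]] by simp
    qed
    moreover have "cinner y (orth_proj ?M (ampl T ?\<xi>)) = 0" by (rule yM[OF orth_proj_in[OF M]])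
    ultimately have "cinner y y = 0" unfolding y_def cinner_diff_right by simp
    then have "ampl T ?\<xi> = orth_proj ?M (ampl T ?\<xi>)" by (simp add: cinner_self y_def)
    then show ?thesis using orth_proj_in[OF M] by metis
  qed
  have JM: "emb e x \<in> ?M" if e: "e \<in> B" for e x
  proof -
    have eq: "ampl (rank1 x e) ?\<xi> = complex_of_real (sqrt (w e)) *\<^sub>C emb e x"
    proof (rule amp_space_eqI)
      fix f assume f: "f \<in> B"
      show "coemb f (ampl (rank1 x e) ?\<xi>) = coemb f (complex_of_real (sqrt (w e)) *\<^sub>C emb e x)"
        unfolding coemb_ampl[OF cblin_rank1 f] coemb_gns_vec[OF f]
        using e f by (simp add: rank1_def cinner_scaleC_right
            orthonormal_familyD[OF ortho_B] cblin_scaleC[OF cblin_coemb] coemb_emb)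
    qed (simp_all add: ampl_in cblin_rank1 amp_space_scaleC emb_in e)
    have "complex_of_real (1 / sqrt (w e)) *\<^sub>C ampl (rank1 x e) ?\<xi> \<in> ?M"
      using M TM[OF cblin_rank1] unfolding closed_csubspace_def by blast
    moreover have "complex_of_real (1 / sqrt (w e)) *\<^sub>C ampl (rank1 x e) ?\<xi> = emb e x"
      unfolding eq scaleC_scaleC using pos[OF e] by simp
    ultimately show ?thesis by simp
  qed
  show "amp_space \<subseteq> ?M"
    using closed_csubspace_has_sum[OF M JM amp_space_expansion] by blast
qed

end

end

section \<open>KMS functionals\<close>

lemma analytic_extension_one:
  assumes dyn: "cstar_dynamical_system \<sigma>" shows "analytic_extension \<sigma> 1 (\<lambda>_. 1)"
  unfolding analytic_extension_def
  by (auto intro!: exI[of _ 0] derivative_eq_intros simp: dyn_one[OF dyn])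

lemma eq_on_analytic:
  fixes \<sigma> :: "real \<Rightarrow> 'a::{unital_cstar_algebra, second_countable_topology} \<Rightarrow> 'a"
  assumes dyn: "cstar_dynamical_system \<sigma>"
    and f: "continuous_on UNIV f" and g: "continuous_on UNIV (g :: 'a \<Rightarrow> 'b::t2_space)"
    and eq: "\<And>a F. analytic_extension \<sigma> a F \<Longrightarrow> f a = g a"
  shows "f a = g a"
proof -
  have "closed {a. f a = g a}" by (intro closed_Collect_eq f g)
  then have "closure {b. \<exists>F. analytic_extension \<sigma> b F} \<subseteq> {a. f a = g a}"
    by (intro closure_minimal) (use eq in blast)+
  then show ?thesis unfolding analytic_dense[OF dyn] by blast
qed

lemma star_rep_matrix_continuous: "star_rep K \<pi> \<Longrightarrow> continuous_on S (\<lambda>a. cinner x (\<pi> a y))"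
  by (rule linear_continuous_on) (rule star_rep_functional)

lemma star_rep_move: "star_rep K \<pi> \<Longrightarrow> cinner x (\<pi> a y) = cinner (\<pi> (star a) x) y"
  by (rule adjointsD') (rule star_rep_adjoints)

text \<open>The KMS condition extends from \<open>\<pi>(A)\<close> to the von Neumann algebra: this is the density theorem
  for the two vectors \<open>\<xi>\<close> and \<open>\<pi>(\<sigma>\<^bsub>i\<beta>\<^esub>(a)) \<xi>\<close>.\<close>

lemma KMS_bicommutant:
  fixes \<sigma> :: "real \<Rightarrow> 'a::{unital_cstar_algebra, second_countable_topology} \<Rightarrow> 'a"
  assumes dyn: "cstar_dynamical_system \<sigma>" and rep: "star_rep K \<pi>" and \<xi>: "\<xi> \<in> K"
    and \<psi>: "\<And>a. \<psi> a = cinner \<eta> (\<pi> a \<xi>)" and kms: "KMS_state \<sigma> \<beta> \<psi>"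
    and T: "T \<in> bicommutant K (range \<pi>)" and F: "analytic_extension \<sigma> a F"
  shows "cinner \<eta> (\<pi> a (T \<xi>)) = cinner \<eta> (T (\<pi> (F (\<i> * complex_of_real \<beta>)) \<xi>))"
proof -
  let ?a' = "F (\<i> * complex_of_real \<beta>)"
  have "cinner (\<pi> (star a) \<eta>) (\<pi> b \<xi>) = cinner \<eta> (\<pi> b (\<pi> ?a' \<xi>))" for b
  proof (rule eq_on_analytic[OF dyn star_rep_matrix_continuous[OF rep] star_rep_matrix_continuous[OF rep]])
    fix b G assume "analytic_extension \<sigma> b G"
    then have "\<psi> (a * b) = \<psi> (b * ?a')" using kms F unfolding KMS_state_def by blast
    then show "cinner (\<pi> (star a) \<eta>) (\<pi> b \<xi>) = cinner \<eta> (\<pi> b (\<pi> ?a' \<xi>))"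
      unfolding \<psi> star_rep_mult[OF rep] star_rep_move[OF rep, of \<eta> a] .
  qed
  from bicommutant_two_vectors[OF rep T \<xi> star_rep_in[OF rep] this]
  show ?thesis unfolding star_rep_move[OF rep, of \<eta> a] .
qed

text \<open>Taking \<open>b = 1\<close> in the KMS condition, the function \<open>z \<mapsto> \<psi>(\<sigma>\<^sub>z(a))\<close> has period \<open>i\<beta>\<close>, so it is constant
  by the case \<open>\<kappa> = 1\<close> of quasi-periodicity.\<close>

lemma KMS_invariant:
  fixes \<sigma> :: "real \<Rightarrow> 'a::{unital_cstar_algebra, second_countable_topology} \<Rightarrow> 'a"
  assumes dyn: "cstar_dynamical_system \<sigma>" and rep: "star_rep K \<pi>"
    and \<psi>: "\<And>a. \<psi> a = cinner \<eta> (\<pi> a \<xi>)" and kms: "KMS_state \<sigma> \<beta> \<psi>" and \<beta>: "\<beta> > 0"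
  shows "\<psi> (\<sigma> t a) = \<psi> a"
proof -
  have "cinner \<eta> (\<pi> (\<sigma> t a) \<xi>) = cinner \<eta> (\<pi> a \<xi>)"
  proof (rule eq_on_analytic[OF dyn star_rep_matrix_continuous[OF star_rep_twist[OF rep dyn]]
        star_rep_matrix_continuous[OF rep]])
    fix a F assume F: "analytic_extension \<sigma> a F"
    have per: "cinner \<eta> (\<pi> (F (complex_of_real t + \<i> * complex_of_real \<beta>)) \<xi>) =
        complex_of_real 1 * cinner \<eta> (\<pi> (F (complex_of_real t)) \<xi>)" for t
    proof -
      have "\<psi> (F (complex_of_real t) * 1) = \<psi> (1 * F (complex_of_real t + \<i> * complex_of_real \<beta>))"
        using kms analytic_extension_shift[OF dyn F, of t] analytic_extension_one[OF dyn]
        unfolding KMS_state_def by blast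
      then show ?thesis by (simp add: \<psi>)
    qed
    have "cinner \<eta> (\<pi> (F (complex_of_real t)) \<xi>) = cinner \<eta> (\<pi> a \<xi>)"
      using quasi_periodic_matrix_element[OF rep dyn F \<beta> zero_less_one per, of "complex_of_real t"] by simp
    moreover have "F (complex_of_real t) = \<sigma> t a" using F unfolding analytic_extension_def by blast
    ultimately show "cinner \<eta> (\<pi> (\<sigma> t a) \<xi>) = cinner \<eta> (\<pi> a \<xi>)" by simp
  qed
  then show ?thesis by (simp add: \<psi>)
qed

text \<open>If a density matrix with eigenvalues \<open>w\<close> defines a KMS state, the intertwining relation
  \<open>w\<^sub>e \<langle>e, \<pi>(a) f\<rangle> = w\<^sub>f \<langle>e, \<pi>(\<sigma>\<^bsub>i\<beta>\<^esub>(a)) f\<rangle>\<close> makes the span of the basis vectors with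
  \<open>w = 0\<close> invariant, and quasi-periodicity of matrix elements then shows that \<open>\<sigma>\<close> is implemented by the
  Hamiltonian with eigenvalues \<open>- log w / \<beta>\<close>.\<close>

lemma (in amplification) KMS_density_modular:
  fixes \<sigma> :: "real \<Rightarrow> 'a::{unital_cstar_algebra, second_countable_topology} \<Rightarrow> 'a"
  assumes dyn: "cstar_dynamical_system \<sigma>" and irr: "irreducible_rep UNIV \<pi>"
    and w: "\<And>e. e \<in> B \<Longrightarrow> 0 \<le> w e" "w summable_on B" and ne: "\<exists>e\<in>B. w e \<noteq> 0"
    and \<phi>: "\<And>a. \<phi> a = cinner (gns_vec w) (ampl (\<pi> a) (gns_vec w))"
    and kms: "KMS_state \<sigma> \<beta> \<phi>" and \<beta>: "\<beta> > 0"
  shows "\<And>e. e \<in> B \<Longrightarrow> 0 < w e"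
    and "\<And>a F e f z. analytic_extension \<sigma> a F \<Longrightarrow> e \<in> B \<Longrightarrow> f \<in> B \<Longrightarrow>
      cinner e (\<pi> (F z) f) =
        exp (\<i> * z * complex_of_real (- ln (w e) / \<beta> - - ln (w f) / \<beta>)) * cinner e (\<pi> a f)"
proof -
  note rep = irreducible_star_rep[OF irr] and arep = amp_rep[OF irr]
  note c = star_rep_cblin[OF rep]
  have one: "cinner (gns_vec w) (ampl (rank1 x e) (gns_vec w)) = complex_of_real (w e) * cinner e x"
    if "e \<in> B" for x e
  proof (rule has_sum_unique[OF gns_vec_form[OF w cblin_rank1]])
    show "((\<lambda>g. complex_of_real (w g) * cinner g (rank1 x e g)) has_sum complex_of_real (w e) * cinner e x) B"
      using that by (intro has_sum_finite_neutralI[of "{e}"])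
        (auto simp: rank1_def cinner_scaleC_right orthonormal_familyD[OF ortho_B])
  qed
  have two: "cinner (gns_vec w) (ampl (rank1 f y) (gns_vec w)) = complex_of_real (w f) * cinner y f"
    if "f \<in> B" for f y
  proof (rule has_sum_unique[OF gns_vec_form[OF w cblin_rank1]])
    show "((\<lambda>g. complex_of_real (w g) * cinner g (rank1 f y g)) has_sum complex_of_real (w f) * cinner y f) B"
      using that by (intro has_sum_finite_neutralI[of "{f}"])
        (auto simp: rank1_def cinner_scaleC_right orthonormal_familyD[OF ortho_B])
  qed
  have inter: "complex_of_real (w e) * cinner e (\<pi> a f) =
      complex_of_real (w f) * cinner e (\<pi> (F (\<i> * complex_of_real \<beta>)) f)"
    if F: "analytic_extension \<sigma> a F" and e: "e \<in> B" and f: "f \<in> B" for a F e f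
  proof -
    let ?a' = "F (\<i> * complex_of_real \<beta>)"
    have "ampl (rank1 f e) \<in> bicommutant amp_space (range (\<lambda>a. ampl (\<pi> a)))"
      unfolding bicommutant_amp[OF irr] using cblin_rank1 by blast
    from KMS_bicommutant[OF dyn arep gns_vec_in[OF w] \<phi> kms this F]
    have "cinner (gns_vec w) (ampl (rank1 (\<pi> a f) e) (gns_vec w)) =
        cinner (gns_vec w) (ampl (rank1 f (\<pi> (star ?a') e)) (gns_vec w))"
      unfolding ampl_comp[OF c cblin_rank1, symmetric] ampl_comp[OF cblin_rank1 c, symmetric]
        comp_rank1[OF c] rank1_comp[OF star_rep_adjoints[OF rep]] .
    then show ?thesis unfolding one[OF e] two[OF f] star_rep_move[OF rep, symmetric] .
  qed
  \<comment> \<open>The closed span of the basis vectors \<open>e\<close> with \<open>w e = 0\<close>.\<close>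
  define V where "V = {x. \<forall>e\<in>B. w e \<noteq> 0 \<longrightarrow> cinner e x = 0}"
  have V: "closed_csubspace V"
    using closed_csubspace_perp[of "{e \<in> B. w e \<noteq> 0}"] by (simp add: V_def Ball_def imp_conjL)
  have zero: "cinner e (\<pi> a f) = 0" if e: "e \<in> B" "w e \<noteq> 0" and f: "f \<in> B" "w f = 0" for a e f
    by (rule eq_on_analytic[OF dyn star_rep_matrix_continuous[OF rep] continuous_on_const])
       (use inter[OF _ e(1) f(1)] e(2) f(2) in simp)
  have "\<pi> a x \<in> V" if x: "x \<in> V" for a x
  proof -
    have "cinner e (\<pi> a x) = 0" if e: "e \<in> B" "w e \<noteq> 0" for e
    proof (rule has_sum_unique[OF cblin_has_sum[OF cblin_compose[OF cblin_cinner c] onb_expansion[OF B]] has_sum_0])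
      fix f assume f: "f \<in> B"
      show "cinner e (\<pi> a (cinner f x *\<^sub>C f)) = 0"
        using x f zero[OF e f] by (cases "w f = 0")
          (auto simp: V_def cblin_scaleC[OF c] cinner_scaleC_right cblin_zero[OF c])
    qed
    then show ?thesis by (simp add: V_def)
  qed
  then have "V = {0} \<or> V = UNIV" by (rule irreducible_invariant[OF irr V])
  moreover have "V \<noteq> UNIV"
  proof
    assume "V = UNIV"
    obtain e where e: "e \<in> B" "w e \<noteq> 0" using ne by blast
    then have "cinner e e = 0" using \<open>V = UNIV\<close> unfolding V_def by blast
    then show False using orthonormal_familyD[OF ortho_B e(1) e(1)] by simp
  qed
  ultimately have V0: "V = {0}" by blast
  show pos: "0 < w e" if e: "e \<in> B" for e
  proof (rule ccontr)
    assume "\<not> 0 < w e"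
    then have "w e = 0" using w(1)[OF e] by simp
    then have "e \<in> V" using e by (auto simp: V_def orthonormal_familyD[OF ortho_B])
    then show False using V0 orthonormal_familyD[OF ortho_B e e] by simp
  qed
  fix a F e f z assume F: "analytic_extension \<sigma> a F" and e: "e \<in> B" and f: "f \<in> B"
  have per: "cinner e (\<pi> (F (complex_of_real t + \<i> * complex_of_real \<beta>)) f) =
      complex_of_real (w e / w f) * cinner e (\<pi> (F (complex_of_real t)) f)" for t
    using inter[OF analytic_extension_shift[OF dyn F] e f, of t] pos[OF f] by (simp add: field_simps)
  have "cinner e (\<pi> (F z) f) = exp (- (\<i> * z * complex_of_real (ln (w e / w f) / \<beta>))) * cinner e (\<pi> a f)"
    by (rule quasi_periodic_matrix_element[OF rep dyn F \<beta> _ per]) (use pos[OF e] pos[OF f] in simp)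
  moreover have "- (\<i> * z * complex_of_real (ln (w e / w f) / \<beta>)) =
      \<i> * z * complex_of_real (- ln (w e) / \<beta> - - ln (w f) / \<beta>)"
  proof -
    have "ln (w e / w f) / \<beta> = - (- ln (w e) / \<beta> - - ln (w f) / \<beta>)"
      using pos[OF e] pos[OF f] by (simp add: ln_div diff_divide_distrib)
    then show ?thesis by (simp only:) (simp add: algebra_simps)
  qed
  ultimately show "cinner e (\<pi> (F z) f) =
      exp (\<i> * z * complex_of_real (- ln (w e) / \<beta> - - ln (w f) / \<beta>)) * cinner e (\<pi> a f)" by simp
qed

text \<open>An irreducible representation in which the dynamics is implemented by a Hamiltonian that is
  diagonal in the basis \<open>B\<close>, with eigenvalues \<open>h\<close>.\<close>

locale hamiltonian_rep = amplification B
  for B :: "'h::{chilbert_space, second_countable_topology} set" +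
  fixes \<sigma> :: "real \<Rightarrow> 'a::{unital_cstar_algebra, second_countable_topology} \<Rightarrow> 'a"
    and \<pi> :: "'a \<Rightarrow> 'h \<Rightarrow> 'h" and h :: "'h \<Rightarrow> real"
  assumes dyn: "cstar_dynamical_system \<sigma>" and irr: "irreducible_rep UNIV \<pi>"
    and modular: "\<And>a F e f z. analytic_extension \<sigma> a F \<Longrightarrow> e \<in> B \<Longrightarrow> f \<in> B \<Longrightarrow>
      cinner e (\<pi> (F z) f) = exp (\<i> * z * complex_of_real (h e - h f)) * cinner e (\<pi> a f)"
begin

lemmas rep = irreducible_star_rep[OF irr]
lemmas cblin_rep = star_rep_cblin[OF rep]

lemma modular_beta:
  assumes F: "analytic_extension \<sigma> a F" and e: "e \<in> B" "f \<in> B"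
  shows "cinner e (\<pi> (F (\<i> * complex_of_real \<beta>)) f) =
    complex_of_real (exp (- \<beta> * h e) / exp (- \<beta> * h f)) * cinner e (\<pi> a f)"
proof -
  have "\<i> * (\<i> * complex_of_real \<beta>) * complex_of_real (h e - h f) = complex_of_real (- \<beta> * h e - - \<beta> * h f)"
    by (simp add: algebra_simps)
  then show ?thesis unfolding modular[OF F e] by (simp only: exp_of_real exp_diff)
qed

definition evol :: "real \<Rightarrow> 'h \<Rightarrow> 'h" where
  "evol t = diag_op B (\<lambda>e. exp (\<i> * complex_of_real (t * h e)))"

lemma evol_bound: "e \<in> B \<Longrightarrow> cmod (exp (\<i> * complex_of_real (t * h e))) \<le> 1" by simp

lemma cblin_evol: "cblin (evol t)" unfolding evol_def by (rule cblin_diag_op[OF B evol_bound])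

lemma cinner_evol: "e \<in> B \<Longrightarrow> cinner e (evol t x) = exp (\<i> * complex_of_real (t * h e)) * cinner e x"
  unfolding evol_def by (rule cinner_diag_op[OF B evol_bound])

lemma evol_basis: "e \<in> B \<Longrightarrow> evol t e = exp (\<i> * complex_of_real (t * h e)) *\<^sub>C e"
  unfolding evol_def by (rule diag_op_basis[OF B evol_bound])

lemma adjoints_evol: "adjoints (evol t) (evol (- t))"
  using adjoints_diag_op[OF B evol_bound[where t = t]] by (simp add: evol_def exp_cnj)

lemma evol_implements: "\<pi> (\<sigma> t a) x = evol t (\<pi> a (evol (- t) x))"
proof -
  have mat: "cinner e (\<pi> (\<sigma> t a) f) = cinner e (evol t (\<pi> a (evol (- t) f)))" if e: "e \<in> B" "f \<in> B" for a e f
  proof (rule eq_on_analytic[OF dyn star_rep_matrix_continuous[OF star_rep_twist[OF rep dyn]]])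
    show "continuous_on UNIV (\<lambda>a. cinner e (evol t (\<pi> a (evol (- t) f))))"
      unfolding adjointsD'[OF adjoints_evol] by (rule star_rep_matrix_continuous[OF rep])
    fix a F assume F: "analytic_extension \<sigma> a F"
    have "F (complex_of_real t) = \<sigma> t a" using F unfolding analytic_extension_def by blast
    then have "cinner e (\<pi> (\<sigma> t a) f) = exp (\<i> * complex_of_real t * complex_of_real (h e - h f)) * cinner e (\<pi> a f)"
      using modular[OF F e, of "complex_of_real t"] by simp
    also have "\<i> * complex_of_real t * complex_of_real (h e - h f) =
        \<i> * complex_of_real (t * h e) + \<i> * complex_of_real (- t * h f)"
      by (simp add: algebra_simps)
    finally show "cinner e (\<pi> (\<sigma> t a) f) = cinner e (evol t (\<pi> a (evol (- t) f)))"
      by (simp only: cinner_evol[OF e(1)] evol_basis[OF e(2)] cblin_scaleC[OF cblin_rep] cinner_scaleC_right exp_add mult_ac)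
  qed
  have "\<pi> (\<sigma> t a) = (\<lambda>x. evol t (\<pi> a (evol (- t) x)))"
  proof (rule onb_operator_eqI[OF B cblin_rep])
    show "cblin (\<lambda>x. evol t (\<pi> a (evol (- t) x)))"
      by (intro cblin_compose[OF cblin_evol] cblin_compose[OF cblin_rep] cblin_evol)
    fix f assume f: "f \<in> B"
    show "\<pi> (\<sigma> t a) f = evol t (\<pi> a (evol (- t) f))" by (rule onb_coords_eqI[OF B]) (rule mat[OF _ f])
  qed
  then show ?thesis by (rule fun_cong)
qed

subsection \<open>Gibbs states are KMS states\<close>

text \<open>With \<open>T = e\<^bsup>-\<beta>H\<^esup>/Z\<close> the diagonal form of the dynamics says \<open>T \<pi>(a) = \<pi>(\<sigma>\<^bsub>i\<beta>\<^esub>(a)) T\<close>. Hence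
  \<open>Tr(T \<pi>(a) \<pi>(b)) = Tr(\<pi>(\<sigma>\<^bsub>i\<beta>\<^esub>(a)) T \<pi>(b)) = Tr(T \<pi>(b) \<pi>(\<sigma>\<^bsub>i\<beta>\<^esub>(a)))\<close> by cyclicity of the trace.\<close>

lemma Gibbs_KMS:
  assumes w: "\<And>e. e \<in> B \<Longrightarrow> w e = exp (- \<beta> * h e) / Z" and Z: "Z > 0" "(w has_sum 1) B"
    and \<psi>: "\<And>a. \<psi> a = (\<Sum>\<^sub>\<infinity>e\<in>B. complex_of_real (w e) * cinner e (\<pi> a e))"
  shows "KMS_state \<sigma> \<beta> \<psi>" and "\<psi> a = cinner (gns_vec w) (ampl (\<pi> a) (gns_vec w))"
proof -
  have w0: "0 < w e" if "e \<in> B" for e using w[OF that] Z by simp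
  then have w00: "0 \<le> w e" if "e \<in> B" for e using that less_imp_le by blast
  have sw: "w summable_on B" using Z(2) by (rule has_sum_imp_summable)
  show vec: "\<psi> a = cinner (gns_vec w) (ampl (\<pi> a) (gns_vec w))" for a
    unfolding \<psi> by (rule infsumI) (rule gns_vec_form[OF w00 sw cblin_rep])
  note arep = amp_rep[OF irr]
  have nw: "(\<lambda>e. cmod (complex_of_real (w e))) summable_on B"
    using sw by (rule summable_on_cong[THEN iffD1, rotated]) (simp add: w00)
  define T where "T = diag_op B (\<lambda>e. complex_of_real (w e))"
  have T: "cblin T" "\<And>b. b \<in> B \<Longrightarrow> T b = complex_of_real (w b) *\<^sub>C b"
    unfolding T_def using trace_class_diag(3,4)[OF B nw] by blast+
  show "KMS_state \<sigma> \<beta> \<psi>"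
    unfolding KMS_state_def
  proof (intro conjI allI impI)
    show "is_state \<psi>"
      unfolding is_state_def
    proof (intro conjI allI)
      show "clinear \<psi>"
        unfolding clinear_def vec
        by (simp add: star_rep_add[OF arep] star_rep_scaleC[OF arep] cinner_add_right cinner_scaleC_right
            scaleC_complex_def)
      show "\<psi> (star a * a) \<in> \<real>\<^sub>\<ge>\<^sub>0" for a
        unfolding vec star_rep_mult[OF arep] adjointsD[OF star_rep_adjoints[OF arep], symmetric] cinner_self by simp
      have "((\<lambda>e. complex_of_real (w e)) has_sum complex_of_real 1) B" by (rule has_sum_of_real[OF Z(2)])
      moreover have "\<psi> 1 = (\<Sum>\<^sub>\<infinity>e\<in>B. complex_of_real (w e))"
        unfolding \<psi> by (rule infsum_cong)
          (simp add: star_rep_one[OF rep] orthonormal_familyD[OF ortho_B])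
      ultimately show "\<psi> 1 = 1" by (simp add: infsumI)
    qed
    fix a b F G assume "analytic_extension \<sigma> a F \<and> analytic_extension \<sigma> b G"
    then have F: "analytic_extension \<sigma> a F" by blast
    let ?a' = "F (\<i> * complex_of_real \<beta>)"
    have comm: "T (\<pi> a c) = complex_of_real (w c) *\<^sub>C \<pi> ?a' c" if c: "c \<in> B" for c
    proof (rule onb_coords_eqI[OF B])
      fix e assume e: "e \<in> B"
      have we: "complex_of_real (w e) = complex_of_real (w c) * complex_of_real (exp (- \<beta> * h e) / exp (- \<beta> * h c))"
        unfolding of_real_mult[symmetric] of_real_eq_iff using w[OF e] w[OF c] by simp
      have "cinner e (T (\<pi> a c)) = complex_of_real (w e) * cinner e (\<pi> a c)"
        by (rule cinner_eigen_expansion[OF B T e])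
      also have "\<dots> = cinner e (complex_of_real (w c) *\<^sub>C \<pi> ?a' c)"
        unfolding we cinner_scaleC_right modular_beta[OF F e c] by (rule mult.assoc)
      finally show "cinner e (T (\<pi> a c)) = cinner e (complex_of_real (w c) *\<^sub>C \<pi> ?a' c)" .
    qed
    have "\<psi> (a * b) = (\<Sum>\<^sub>\<infinity>e\<in>B. complex_of_real (w e) * cinner e (\<pi> a (\<pi> b e)))"
      unfolding \<psi> star_rep_mult[OF rep] ..
    also have "\<dots> = (\<Sum>\<^sub>\<infinity>c\<in>B. cinner c (\<pi> b (T (\<pi> a c))))"
      by (rule infsumI[symmetric]) (rule diag_trace_cyclic(1)[OF B B nw cblin_rep cblin_rep T])
    also have "\<dots> = \<psi> (b * ?a')"
      unfolding \<psi> star_rep_mult[OF rep]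
      by (rule infsum_cong) (simp add: comm cblin_scaleC[OF cblin_rep] cinner_scaleC_right)
    finally show "\<psi> (a * b) = \<psi> (b * ?a')" .
  qed
qed

end

section \<open>KMS functionals on a multiple of an irreducible representation\<close>

text \<open>A *-homomorphism \<open>\<theta>\<close> from all bounded operators into the von Neumann algebra of a
  representation \<open>\<pi>\<^sub>2\<close>, extending \<open>\<pi>(a) \<mapsto> \<pi>\<^sub>2(a)\<close>. The last condition says that \<open>\<theta>\<close> is
  normal.\<close>

locale normal_extension = hamiltonian_rep B \<sigma> \<pi> h
  for B :: "'h::{chilbert_space, second_countable_topology} set"
    and \<sigma> :: "real \<Rightarrow> 'a::{unital_cstar_algebra, second_countable_topology} \<Rightarrow> 'a" and \<pi> h +
  fixes K\<^sub>2 :: "'k::chilbert_space set" and \<pi>\<^sub>2 :: "'a \<Rightarrow> 'k \<Rightarrow> 'k" and \<theta> :: "('h \<Rightarrow> 'h) \<Rightarrow> 'k \<Rightarrow> 'k"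
  assumes rep2: "star_rep K\<^sub>2 \<pi>\<^sub>2"
    and ext_in: "\<And>X. cblin X \<Longrightarrow> \<theta> X \<in> bicommutant K\<^sub>2 (range \<pi>\<^sub>2)"
    and ext_comp: "\<And>X Y v. cblin X \<Longrightarrow> cblin Y \<Longrightarrow> \<theta> (X \<circ> Y) v = \<theta> X (\<theta> Y v)"
    and ext_adj: "\<And>X Y. cblin X \<Longrightarrow> cblin Y \<Longrightarrow> adjoints X Y \<Longrightarrow> adjoints (\<theta> X) (\<theta> Y)"
    and ext_plus: "\<And>X Y v. cblin X \<Longrightarrow> cblin Y \<Longrightarrow> \<theta> (\<lambda>x. X x + Y x) v = \<theta> X v + \<theta> Y v"
    and ext_scale: "\<And>X c v. cblin X \<Longrightarrow> \<theta> (\<lambda>x. c *\<^sub>C X x) v = c *\<^sub>C \<theta> X v"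
    and ext_rep: "\<And>a. \<theta> (\<pi> a) = \<pi>\<^sub>2 a"
    and ext_normal: "\<And>v. v \<in> K\<^sub>2 \<Longrightarrow> (\<And>e. e \<in> B \<Longrightarrow> \<theta> (rank1 e e) v = 0) \<Longrightarrow> v = 0"
begin

lemma ext_bounded_ops: "cblin X \<Longrightarrow> \<theta> X \<in> bounded_ops K\<^sub>2"
  using ext_in by (auto simp: bicommutant_def dest: commutant_bounded_ops)

lemma ext_cblin: "cblin X \<Longrightarrow> cblin (\<theta> X)" by (rule bounded_ops_cblin[OF ext_bounded_ops])
lemma ext_into: "cblin X \<Longrightarrow> \<theta> X v \<in> K\<^sub>2" by (rule bounded_ops_in[OF ext_bounded_ops])

lemma ext_rank1_comp: "\<theta> (rank1 x y) (\<theta> (rank1 z u) v) = cinner y z *\<^sub>C \<theta> (rank1 x u) v"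
  unfolding ext_comp[OF cblin_rank1 cblin_rank1, symmetric] rank1_comp_rank1
  by (rule ext_scale[OF cblin_rank1])

text \<open>The projections \<open>\<theta>(|e\<rangle>\<langle>e|)\<close> are mutually orthogonal, so the series converges. Its defect is annihilated by
  all of them and vanishes by normality.\<close>

lemma ext_resolution:
  assumes v: "v \<in> K\<^sub>2" shows "((\<lambda>e. \<theta> (rank1 e e) v) has_sum v) B"
proof -
  have adj: "cinner (\<theta> (rank1 e e) u) z = cinner u (\<theta> (rank1 e e) z)" for e u z
    by (rule adjointsD[OF ext_adj[OF cblin_rank1 cblin_rank1 adjoints_rank1]])
  have oo: "cinner e f = (if e = f then 1 else 0)" if "e \<in> B" "f \<in> B" for e f
    by (rule orthonormal_familyD[OF ortho_B that])
  have prod: "cinner (\<theta> (rank1 e e) v) (\<theta> (rank1 f f) v) = cinner e f * cinner v (\<theta> (rank1 e f) v)" for e f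
    unfolding adj ext_rank1_comp cinner_scaleC_right ..
  have "(\<lambda>e. \<theta> (rank1 e e) v) summable_on B"
  proof (rule orthogonal_parts(3))
    show "cinner (\<theta> (rank1 e e) v) (\<theta> (rank1 f f) v) = 0" if "e \<in> B" "f \<in> B" "e \<noteq> f" for e f
      using that by (simp add: prod oo)
    show "cinner (\<theta> (rank1 e e) v) v = complex_of_real ((norm (\<theta> (rank1 e e) v))\<^sup>2)" if "e \<in> B" for e
    proof -
      have "cinner (\<theta> (rank1 e e) v) (\<theta> (rank1 e e) v) = cinner v (\<theta> (rank1 e e) v)"
        unfolding prod using oo[OF that that] by simp
      then show ?thesis unfolding cinner_self[symmetric] by (simp only: adj)
    qed
  qed
  then obtain s where s: "((\<lambda>e. \<theta> (rank1 e e) v) has_sum s) B" unfolding summable_on_def by blast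
  have K: "closed_csubspace K\<^sub>2" by (rule star_rep_closed[OF rep2])
  have "v - s = 0"
  proof (rule ext_normal)
    show "v - s \<in> K\<^sub>2"
      by (rule closed_csubspace_diff[OF K v closed_csubspace_has_sum[OF K ext_into[OF cblin_rank1] s]])
    fix f assume f: "f \<in> B"
    have "((\<lambda>e. \<theta> (rank1 f f) (\<theta> (rank1 e e) v)) has_sum \<theta> (rank1 f f) s) B"
      by (rule cblin_has_sum[OF ext_cblin[OF cblin_rank1] s])
    moreover have "((\<lambda>e. \<theta> (rank1 f f) (\<theta> (rank1 e e) v)) has_sum \<theta> (rank1 f f) v) B"
      unfolding ext_rank1_comp using f by (intro has_sum_finite_neutralI[of "{f}"]) (auto simp: oo)
    ultimately have "\<theta> (rank1 f f) s = \<theta> (rank1 f f) v" by (rule has_sum_unique)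
    then show "\<theta> (rank1 f f) (v - s) = 0" by (simp add: cblin_diff[OF ext_cblin[OF cblin_rank1]])
  qed
  then show ?thesis using s by simp
qed

text \<open>Since \<open>\<theta>\<close> is multiplicative, \<open>\<parallel>\<theta>(|x\<rangle>\<langle>f|) \<xi>\<parallel>\<^sup>2 = \<parallel>x\<parallel>\<^sup>2 \<langle>\<xi>, \<theta>(|f\<rangle>\<langle>f|) \<xi>\<rangle>\<close>. Continuity
  in \<open>x\<close> permits expanding \<open>x\<close> in the basis.\<close>

lemma ext_rank1_cblin: "cblin (\<lambda>x. cinner \<eta> (\<theta> (rank1 x f) \<xi>))"
proof (rule cblinI)
  have p: "rank1 (x + y) f = (\<lambda>z. rank1 x f z + rank1 y f z)" for x y
    by (simp add: rank1_def fun_eq_iff scaleC_add_right)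
  have s: "rank1 (c *\<^sub>C x) f = (\<lambda>z. c *\<^sub>C rank1 x f z)" for c x
    by (simp add: rank1_def fun_eq_iff scaleC_scaleC mult.commute)
  show "clinear (\<lambda>x. cinner \<eta> (\<theta> (rank1 x f) \<xi>))"
    unfolding clinear_def p s
    by (simp add: ext_plus cblin_rank1 ext_scale cinner_add_right cinner_scaleC_right scaleC_complex_def)
  fix x
  let ?C = "norm \<xi> * norm (\<theta> (rank1 f f) \<xi>)"
  have "complex_of_real ((norm (\<theta> (rank1 x f) \<xi>))\<^sup>2) = cinner \<xi> (\<theta> (rank1 f x) (\<theta> (rank1 x f) \<xi>))"
    unfolding cinner_self[symmetric] by (rule adjointsD[OF ext_adj[OF cblin_rank1 cblin_rank1 adjoints_rank1]])
  also have "\<dots> = complex_of_real ((norm x)\<^sup>2) * cinner \<xi> (\<theta> (rank1 f f) \<xi>)"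
    unfolding ext_rank1_comp cinner_self cinner_scaleC_right ..
  finally have "cmod (complex_of_real ((norm (\<theta> (rank1 x f) \<xi>))\<^sup>2)) =
      cmod (complex_of_real ((norm x)\<^sup>2) * cinner \<xi> (\<theta> (rank1 f f) \<xi>))" by (rule arg_cong)
  then have "(norm (\<theta> (rank1 x f) \<xi>))\<^sup>2 = (norm x)\<^sup>2 * cmod (cinner \<xi> (\<theta> (rank1 f f) \<xi>))"
    unfolding norm_mult norm_of_real by simp
  also have "\<dots> \<le> (norm x)\<^sup>2 * ?C" by (intro mult_left_mono Cauchy_Schwarz_cinner) simp
  also have "\<dots> = (sqrt ?C * norm x)\<^sup>2" by (simp add: power_mult_distrib)
  finally have "norm (\<theta> (rank1 x f) \<xi>) \<le> sqrt ?C * norm x" by (rule power2_le_imp_le) simp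
  then have "norm \<eta> * norm (\<theta> (rank1 x f) \<xi>) \<le> norm \<eta> * (sqrt ?C * norm x)" by (rule mult_left_mono) simp
  then show "norm (cinner \<eta> (\<theta> (rank1 x f) \<xi>)) \<le> (norm \<eta> * sqrt ?C) * norm x"
    using Cauchy_Schwarz_cinner[of \<eta> "\<theta> (rank1 x f) \<xi>"] by (simp add: mult.assoc)
qed

text \<open>A KMS functional \<open>\<omega>\<close> is invariant under the dynamics, so \<open>\<omega>(|e\<rangle>\<langle>f|)\<close> vanishes unless the
  energies agree. With this, the KMS condition reads
  \<open>\<omega>(X |e\<rangle>\<langle>f|) = e\<^bsup>\<beta>(h\<^sub>e - h\<^sub>f)\<^esup> \<omega>(|e\<rangle>\<langle>f| X)\<close> for all bounded \<open>X\<close>, and matrix units \<open>X\<close> show that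
  \<open>\<omega>\<close> is a multiple of the Gibbs functional.\<close>

context
  fixes \<eta> \<xi> :: 'k and \<psi> :: "'a \<Rightarrow> complex" and \<beta> :: real
  assumes \<xi>: "\<xi> \<in> K\<^sub>2" and \<psi>: "\<And>a. \<psi> a = cinner \<eta> (\<pi>\<^sub>2 a \<xi>)"
    and kms: "KMS_state \<sigma> \<beta> \<psi>" and \<beta>: "\<beta> > 0"
begin

lemma off_energy_zero:
  assumes e: "e \<in> B" "f \<in> B" "h e \<noteq> h f" shows "cinner \<eta> (\<theta> (rank1 e f) \<xi>) = 0"
proof -
  \<comment> \<open>At this time the matrix unit \<open>|e\<rangle>\<langle>f|\<close> is multiplied by \<open>e\<^bsup>it(h\<^sub>e - h\<^sub>f)\<^esup> = -1\<close>.\<close>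
  define t where "t = pi / (h e - h f)"
  have adj: "adjoints (\<theta> (evol t)) (\<theta> (evol (- t)))" by (rule ext_adj[OF cblin_evol cblin_evol adjoints_evol])
  have inv: "cinner \<eta> (\<theta> (rank1 e f) \<xi>) =
      cinner (\<theta> (evol (- t)) \<eta>) (\<theta> (rank1 e f) (\<theta> (evol (- t)) \<xi>))"
  proof (rule bicommutant_two_vectors[OF rep2 ext_in[OF cblin_rank1] \<xi> ext_into[OF cblin_evol]])
    fix a
    have ca: "cblin (\<pi> a \<circ> evol (- t))" by (rule cblin_comp[OF cblin_rep cblin_evol])
    have "\<pi> (\<sigma> t a) = evol t \<circ> (\<pi> a \<circ> evol (- t))" by (simp add: fun_eq_iff evol_implements)
    then have "\<pi>\<^sub>2 (\<sigma> t a) \<xi> = \<theta> (evol t) (\<pi>\<^sub>2 a (\<theta> (evol (- t)) \<xi>))"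
      unfolding ext_rep[symmetric] by (simp add: ext_comp[OF cblin_evol ca] ext_comp[OF cblin_rep cblin_evol])
    then have "\<psi> (\<sigma> t a) = cinner (\<theta> (evol (- t)) \<eta>) (\<pi>\<^sub>2 a (\<theta> (evol (- t)) \<xi>))"
      unfolding \<psi> by (simp add: adjointsD'[OF adj])
    then show "cinner \<eta> (\<pi>\<^sub>2 a \<xi>) = cinner (\<theta> (evol (- t)) \<eta>) (\<pi>\<^sub>2 a (\<theta> (evol (- t)) \<xi>))"
      using KMS_invariant[OF dyn rep2 \<psi> kms \<beta>, of t a] by (simp add: \<psi>)
  qed
  have c: "cblin (rank1 e f \<circ> evol (- t))" by (rule cblin_comp[OF cblin_rank1 cblin_evol])
  have "evol t \<circ> (rank1 e f \<circ> evol (- t)) = (\<lambda>z. (- 1) *\<^sub>C rank1 e f z)"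
  proof -
    have ex: "exp (\<i> * complex_of_real (t * h e)) * cnj (exp (\<i> * complex_of_real (t * h f))) = - 1"
    proof -
      have "\<i> * complex_of_real (t * h e) + cnj (\<i> * complex_of_real (t * h f)) = \<i> * complex_of_real (t * (h e - h f))"
        by (simp add: algebra_simps)
      also have "t * (h e - h f) = pi" using e(3) by (simp add: t_def)
      finally show ?thesis unfolding exp_cnj exp_add[symmetric] by simp
    qed
    have "rank1 e f \<circ> evol (- t) = rank1 e (evol t f)"
      using rank1_comp[OF adjoints_evol[of "- t"], of e f] by simp
    then have "evol t \<circ> (rank1 e f \<circ> evol (- t)) = rank1 (evol t e) (evol t f)"
      by (simp add: comp_rank1[OF cblin_evol])
    also have "\<dots> = (\<lambda>z. (exp (\<i> * complex_of_real (t * h e)) * cnj (exp (\<i> * complex_of_real (t * h f)))) *\<^sub>C rank1 e f z)"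
      unfolding evol_basis[OF e(1)] evol_basis[OF e(2)] rank1_def cinner_scaleC_left scaleC_scaleC
      by (simp only: mult_ac)
    finally show ?thesis unfolding ex .
  qed
  then have "\<theta> (evol t) (\<theta> (rank1 e f) (\<theta> (evol (- t)) \<xi>)) = (- 1) *\<^sub>C \<theta> (rank1 e f) \<xi>"
    using ext_comp[OF cblin_evol c, of t \<xi>] ext_comp[OF cblin_rank1 cblin_evol, of e f "- t" \<xi>]
      ext_scale[OF cblin_rank1, of "- 1" e f \<xi>] by simp
  then have "cinner \<eta> (\<theta> (rank1 e f) \<xi>) = - cinner \<eta> (\<theta> (rank1 e f) \<xi>)"
    using inv by (simp add: adjointsD'[OF adj, symmetric] cinner_minus_right)
  then show ?thesis by simp
qed

lemma KMS_matrix_unit: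
  assumes e: "e \<in> B" "f \<in> B" and X: "cblin X"
  shows "cinner \<eta> (\<theta> X (\<theta> (rank1 e f) \<xi>)) =
    complex_of_real (exp (- \<beta> * h f) / exp (- \<beta> * h e)) * cinner \<eta> (\<theta> (rank1 e f) (\<theta> X \<xi>))"
proof -
  let ?q = "complex_of_real (exp (- \<beta> * h f) / exp (- \<beta> * h e))"
  let ?E = "rank1 e f"
  define y where "y = cnj ?q *\<^sub>C \<theta> (rank1 f e) \<eta>"
  have yE: "cinner y v = ?q * cinner \<eta> (\<theta> ?E v)" for v
    unfolding y_def cinner_scaleC_left complex_cnj_cnj
    by (simp add: adjointsD[OF ext_adj[OF cblin_rank1 cblin_rank1 adjoints_rank1]])
  have an: "cinner \<eta> (\<pi>\<^sub>2 a (\<theta> ?E \<xi>)) = cinner y (\<pi>\<^sub>2 a \<xi>)" for a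
  proof (rule eq_on_analytic[OF dyn star_rep_matrix_continuous[OF rep2] star_rep_matrix_continuous[OF rep2]])
    fix a F assume F: "analytic_extension \<sigma> a F"
    let ?a' = "F (\<i> * complex_of_real \<beta>)"
    have right: "cinner \<eta> (\<theta> ?E (\<pi>\<^sub>2 b \<xi>)) = cinner \<eta> (\<theta> (rank1 e (\<pi> (star b) f)) \<xi>)" for b
      unfolding ext_rep[symmetric] ext_comp[OF cblin_rank1 cblin_rep, symmetric]
        rank1_comp[OF star_rep_adjoints[OF rep]] ..
    have flip: "cinner \<eta> (\<theta> (rank1 e x) \<xi>) = cnj (cinner \<xi> (\<theta> (rank1 x e) \<eta>))" for x
    proof -
      have "cinner \<eta> (\<theta> (rank1 e x) \<xi>) = cinner (\<theta> (rank1 x e) \<eta>) \<xi>"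
        by (rule adjointsD'[OF ext_adj[OF cblin_rank1 cblin_rank1 adjoints_rank1]])
      then show ?thesis by (simp flip: cinner_commute)
    qed
    \<comment> \<open>In the expansion of \<open>\<langle>f|\<pi>(b)\<close> only basis vectors \<open>k\<close> with the energy of \<open>e\<close>
      contribute; for them the passage from \<open>a\<close> to \<open>\<sigma>\<^bsub>i\<beta>\<^esub>(a)\<close> multiplies the matrix element by the same
      number.\<close>
    have ser: "((\<lambda>k. cinner f (\<pi> b k) * cinner \<eta> (\<theta> (rank1 e k) \<xi>)) has_sum cinner \<eta> (\<theta> ?E (\<pi>\<^sub>2 b \<xi>))) B" for b
    proof -
      let ?x = "\<pi> (star b) f"
      have "((\<lambda>k. cinner \<xi> (\<theta> (rank1 (cinner k ?x *\<^sub>C k) e) \<eta>)) has_sum cinner \<xi> (\<theta> (rank1 ?x e) \<eta>)) B"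
        by (rule cblin_has_sum[OF ext_rank1_cblin onb_expansion[OF B]])
      then have "((\<lambda>k. cnj (cinner \<xi> (\<theta> (rank1 (cinner k ?x *\<^sub>C k) e) \<eta>))) has_sum cnj (cinner \<xi> (\<theta> (rank1 ?x e) \<eta>))) B"
        by (simp only: has_sum_cnj_iff)
      moreover have "cnj (cinner \<xi> (\<theta> (rank1 (cinner k ?x *\<^sub>C k) e) \<eta>)) = cinner f (\<pi> b k) * cinner \<eta> (\<theta> (rank1 e k) \<xi>)" for k
      proof -
        have "cnj (cinner k ?x) = cinner f (\<pi> b k)"
          unfolding star_rep_move[OF rep, of f b k] by (rule cinner_commute[symmetric])
        then show ?thesis
          unfolding cblin_scaleC[OF ext_rank1_cblin] flip by (simp add: scaleC_complex_def)
      qed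
      ultimately show ?thesis unfolding right flip[of ?x] by (simp only:)
    qed
    have "cinner \<eta> (\<pi>\<^sub>2 a (\<theta> ?E \<xi>)) = cinner \<eta> (\<theta> ?E (\<pi>\<^sub>2 ?a' \<xi>))"
      by (rule KMS_bicommutant[OF dyn rep2 \<xi> \<psi> kms ext_in[OF cblin_rank1] F])
    also have "\<dots> = ?q * cinner \<eta> (\<theta> ?E (\<pi>\<^sub>2 a \<xi>))"
    proof (rule has_sum_unique[OF ser])
      show "((\<lambda>k. cinner f (\<pi> ?a' k) * cinner \<eta> (\<theta> (rank1 e k) \<xi>)) has_sum (?q * cinner \<eta> (\<theta> ?E (\<pi>\<^sub>2 a \<xi>)))) B"
        using has_sum_cmult_right[OF ser, of ?q a]
      proof (rule has_sum_cong[THEN iffD1, rotated])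
        fix k assume k: "k \<in> B"
        show "?q * (cinner f (\<pi> a k) * cinner \<eta> (\<theta> (rank1 e k) \<xi>)) = cinner f (\<pi> ?a' k) * cinner \<eta> (\<theta> (rank1 e k) \<xi>)"
          using off_energy_zero[OF e(1) k] modular_beta[OF F e(2) k, of \<beta>] by (cases "h e = h k") simp_all
      qed
    qed
    finally show "cinner \<eta> (\<pi>\<^sub>2 a (\<theta> ?E \<xi>)) = cinner y (\<pi>\<^sub>2 a \<xi>)" unfolding yE .
  qed
  have "cinner \<eta> (\<theta> X (\<theta> ?E \<xi>)) = cinner y (\<theta> X \<xi>)"
    by (rule bicommutant_two_vectors[OF rep2 ext_in[OF X] ext_into[OF cblin_rank1] \<xi> an])
  then show ?thesis unfolding yE .
qed

lemma KMS_functional_Gibbs: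
  "\<exists>c. (\<forall>e\<in>B. \<forall>f\<in>B. cinner \<eta> (\<theta> (rank1 e f) \<xi>) = (if e = f then c * complex_of_real (exp (- \<beta> * h e)) else 0)) \<and>
    (\<forall>X. cblin X \<longrightarrow> ((\<lambda>e. c * complex_of_real (exp (- \<beta> * h e)) * cinner e (X e)) has_sum cinner \<eta> (\<theta> X \<xi>)) B)"
proof -
  let ?s = "\<lambda>e. complex_of_real (exp (- \<beta> * h e))"
  have oo: "cinner e f = (if e = f then 1 else 0)" if "e \<in> B" "f \<in> B" for e f
    by (rule orthonormal_familyD[OF ortho_B that])
  obtain e0 where e0: "e0 \<in> B" using B_nonempty[OF irr] by blast
  define c where "c = cinner \<eta> (\<theta> (rank1 e0 e0) \<xi>) / ?s e0"
  have diag: "cinner \<eta> (\<theta> (rank1 f f) \<xi>) = c * ?s f" if f: "f \<in> B" for f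
    using KMS_matrix_unit[OF e0 f cblin_rank1, of f e0] by (simp add: ext_rank1_comp oo e0 f c_def)
  have off: "cinner \<eta> (\<theta> (rank1 e f) \<xi>) = 0" if "e \<in> B" "f \<in> B" "e \<noteq> f" for e f
    using KMS_matrix_unit[OF that(1,2) cblin_rank1, of e e] that by (simp add: ext_rank1_comp oo)
  have "((\<lambda>e. c * ?s e * cinner e (X e)) has_sum cinner \<eta> (\<theta> X \<xi>)) B" if X: "cblin X" for X
  proof -
    obtain X' where X': "cblin X'" "adjoints X X'" using ex_adjoint[OF X] by blast
    have "((\<lambda>e. cinner \<eta> (\<theta> (rank1 e e) (\<theta> X \<xi>))) has_sum cinner \<eta> (\<theta> X \<xi>)) B"
      by (rule cblin_has_sum[OF cblin_cinner ext_resolution[OF ext_into[OF X]]])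
    then show ?thesis
    proof (rule has_sum_cong[THEN iffD1, rotated])
      fix e assume e: "e \<in> B"
      have flip: "cinner \<eta> (\<theta> (rank1 e x) \<xi>) = cnj (cinner \<xi> (\<theta> (rank1 x e) \<eta>))" for x
      proof -
        have "cinner \<eta> (\<theta> (rank1 e x) \<xi>) = cinner (\<theta> (rank1 x e) \<eta>) \<xi>"
          by (rule adjointsD'[OF ext_adj[OF cblin_rank1 cblin_rank1 adjoints_rank1]])
        then show ?thesis by (simp flip: cinner_commute)
      qed
      have "\<theta> (rank1 e e) (\<theta> X \<xi>) = \<theta> (rank1 e (X' e)) \<xi>"
        unfolding ext_comp[OF cblin_rank1 X, symmetric] rank1_comp[OF X'(2)] ..
      moreover have "cinner \<xi> (\<theta> (rank1 (X' e) e) \<eta>) = cnj (c * ?s e * cinner e (X e))"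
      proof (rule has_sum_unique[OF cblin_has_sum[OF ext_rank1_cblin onb_expansion[OF B]]])
        have eXe: "cnj (cinner e (X e)) = cinner e (X' e)"
          unfolding adjointsD[OF X'(2), symmetric] by (rule cinner_commute[symmetric])
        have k: "cinner \<xi> (\<theta> (rank1 k e) \<eta>) = cnj (if k = e then c * ?s e else 0)" if "k \<in> B" for k
        proof -
          have "cinner \<eta> (\<theta> (rank1 e k) \<xi>) = (if k = e then c * ?s e else 0)"
            by (cases "k = e") (simp_all add: diag[OF e] off[OF e that])
          then have "cnj (cinner \<xi> (\<theta> (rank1 k e) \<eta>)) = (if k = e then c * ?s e else 0)" unfolding flip .
          from arg_cong[OF this, of cnj] show ?thesis unfolding complex_cnj_cnj .
        qed
        show "((\<lambda>k. cinner \<xi> (\<theta> (rank1 (cinner k (X' e) *\<^sub>C k) e) \<eta>)) has_sum cnj (c * ?s e * cinner e (X e))) B"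
          using e by (intro has_sum_finite_neutralI[of "{e}"])
            (auto simp: cblin_scaleC[OF ext_rank1_cblin] k scaleC_complex_def eXe mult_ac)
      qed
      ultimately show "cinner \<eta> (\<theta> (rank1 e e) (\<theta> X \<xi>)) = c * ?s e * cinner e (X e)"
        by (simp add: flip)
    qed
  qed
  then show ?thesis using diag off by (intro exI[of _ c]) auto
qed

end

end

section \<open>Gibbs states\<close>

context hamiltonian_rep
begin

definition Gibbs_sum :: "real \<Rightarrow> real" where
  "Gibbs_sum \<beta> = (\<Sum>\<^sub>\<infinity>e\<in>B. exp (- \<beta> * h e))"

definition Gibbs_weight :: "real \<Rightarrow> 'h \<Rightarrow> real" where
  "Gibbs_weight \<beta> e = exp (- \<beta> * h e) / Gibbs_sum \<beta>"

definition Gibbs_functional :: "real \<Rightarrow> 'a \<Rightarrow> complex" where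
  "Gibbs_functional \<beta> a = (\<Sum>\<^sub>\<infinity>e\<in>B. complex_of_real (Gibbs_weight \<beta> e) * cinner e (\<pi> a e))"

context
  fixes \<beta> :: real
  assumes summ: "(\<lambda>e. exp (- \<beta> * h e)) summable_on B"
begin

lemma Gibbs_sum_has_sum: "((\<lambda>e. exp (- \<beta> * h e)) has_sum Gibbs_sum \<beta>) B"
  unfolding Gibbs_sum_def by (rule has_sum_infsum[OF summ])

lemma Gibbs_sum_pos: "Gibbs_sum \<beta> > 0"
proof -
  obtain e where e: "e \<in> B" using B_nonempty[OF irr] by blast
  have "exp (- \<beta> * h e) \<le> Gibbs_sum \<beta>"
    using finite_sum_le_has_sum[OF Gibbs_sum_has_sum, of "{e}"] e by simp
  then show ?thesis using exp_gt_zero[of "- \<beta> * h e"] by linarith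
qed

lemma Gibbs_weight_has_sum: "(Gibbs_weight \<beta> has_sum 1) B"
proof -
  have "((\<lambda>e. exp (- \<beta> * h e) * (1 / Gibbs_sum \<beta>)) has_sum (Gibbs_sum \<beta> * (1 / Gibbs_sum \<beta>))) B"
    by (rule has_sum_cmult_left[OF Gibbs_sum_has_sum])
  then show ?thesis using Gibbs_sum_pos by (simp add: Gibbs_weight_def[abs_def])
qed

lemma Gibbs_weight_pos: "0 < Gibbs_weight \<beta> e"
  using Gibbs_sum_pos by (simp add: Gibbs_weight_def)

lemma Gibbs_weight_summable: "Gibbs_weight \<beta> summable_on B"
  by (rule has_sum_imp_summable[OF Gibbs_weight_has_sum])

lemma Gibbs_functional_KMS: "KMS_state \<sigma> \<beta> (Gibbs_functional \<beta>)"
  by (rule Gibbs_KMS(1)[OF Gibbs_weight_def Gibbs_sum_pos Gibbs_weight_has_sum Gibbs_functional_def])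

lemma Gibbs_functional_vector:
  "Gibbs_functional \<beta> a = cinner (gns_vec (Gibbs_weight \<beta>)) (ampl (\<pi> a) (gns_vec (Gibbs_weight \<beta>)))"
  by (rule Gibbs_KMS(2)[OF Gibbs_weight_def Gibbs_sum_pos Gibbs_weight_has_sum Gibbs_functional_def])

lemma Gibbs_gns_triple:
  "gns_triple (Gibbs_functional \<beta>) amp_space (\<lambda>a. ampl (\<pi> a)) (gns_vec (Gibbs_weight \<beta>))"
proof -
  note w = Gibbs_weight_pos[THEN less_imp_le] Gibbs_weight_summable
  show ?thesis
    unfolding gns_triple_def
    using amp_rep[OF irr] gns_vec_in[OF w] gns_vec_cyclic[OF w irr Gibbs_weight_pos] Gibbs_functional_vector
    by blast
qed

lemma Gibbs_type_I: "type_I_state (Gibbs_functional \<beta>)"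
  unfolding type_I_state_def using Gibbs_gns_triple type_I_amp[OF irr] by blast

end

text \<open>For \<open>C = B\<close> this is the GNS representation of the Gibbs states. A different basis \<open>C\<close> serves to compare
  two Hamiltonians that implement the dynamics in the same representation.\<close>

lemma ampl_normal_extension:
  assumes C: "is_onb C"
  shows "normal_extension B \<sigma> \<pi> h (amplification.amp_space C) (\<lambda>a. amplification.ampl C (\<pi> a))
    (amplification.ampl C)"
proof -
  interpret C: amplification C by (rule amplification.intro[OF C])
  show ?thesis
  proof (rule normal_extension.intro[OF hamiltonian_rep_axioms], unfold_locales)
    show "star_rep C.amp_space (\<lambda>a. C.ampl (\<pi> a))" by (rule C.amp_rep[OF irr])
    show "C.ampl X \<in> bicommutant C.amp_space (range (\<lambda>a. C.ampl (\<pi> a)))" if "cblin X" for X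
      unfolding C.bicommutant_amp[OF irr] using that by blast
    fix v assume v: "v \<in> C.amp_space" and z: "\<And>e. e \<in> B \<Longrightarrow> C.ampl (rank1 e e) v = 0"
    have "C.coemb c v = 0" if c: "c \<in> C" for c
    proof (rule onb_coords_eqI[OF B])
      fix e assume e: "e \<in> B"
      have "rank1 e e (C.coemb c v) = C.coemb c 0"
        unfolding C.coemb_ampl[OF cblin_rank1 c, symmetric] z[OF e] ..
      then have "cinner e (rank1 e e (C.coemb c v)) = 0" by (simp add: cblin_zero[OF C.cblin_coemb[OF c]])
      then show "cinner e (C.coemb c v) = cinner e 0"
        using orthonormal_familyD[OF ortho_B e e] by (simp add: rank1_def cinner_scaleC_right)
    qed
    moreover have "0 \<in> C.amp_space" using C.closed_csubspace_amp_space by (simp add: closed_csubspace_def)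
    ultimately show "v = 0"
      by (intro C.amp_space_eqI[OF v]) (simp_all add: cblin_zero[OF C.cblin_coemb])
  qed (simp_all add: C.ampl_comp C.adjoints_ampl C.ampl_plus C.ampl_scaleC)
qed

end

context normal_extension
begin

text \<open>A state that is a vector functional of a normal extension: normalisation determines the factor left open
  above, and summability of the Boltzmann weights is part of the conclusion.\<close>

lemma KMS_is_Gibbs:
  assumes \<xi>: "\<xi> \<in> K\<^sub>2" and \<psi>: "\<And>a. \<psi> a = cinner \<eta> (\<pi>\<^sub>2 a \<xi>)" and kms: "KMS_state \<sigma> \<beta> \<psi>" and \<beta>: "\<beta> > 0"
  shows "(\<lambda>e. exp (- \<beta> * h e)) summable_on B" and "\<psi> = Gibbs_functional \<beta>"
    and "\<And>e f. e \<in> B \<Longrightarrow> f \<in> B \<Longrightarrow>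
      cinner \<eta> (\<theta> (rank1 e f) \<xi>) = (if e = f then complex_of_real (Gibbs_weight \<beta> e) else 0)"
proof -
  obtain c where c: "\<And>e f. e \<in> B \<Longrightarrow> f \<in> B \<Longrightarrow>
      cinner \<eta> (\<theta> (rank1 e f) \<xi>) = (if e = f then c * complex_of_real (exp (- \<beta> * h e)) else 0)"
    and X: "\<And>X. cblin X \<Longrightarrow>
      ((\<lambda>e. c * complex_of_real (exp (- \<beta> * h e)) * cinner e (X e)) has_sum cinner \<eta> (\<theta> X \<xi>)) B"
    using KMS_functional_Gibbs[OF \<xi> \<psi> kms \<beta>] by blast
  have "\<psi> 1 = 1" using kms by (simp add: KMS_state_def is_state_def)
  then have "cinner \<eta> (\<theta> (\<pi> 1) \<xi>) = 1" by (simp add: ext_rep \<psi>)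
  then have one: "((\<lambda>e. c * complex_of_real (exp (- \<beta> * h e))) has_sum 1) B"
    using X[OF cblin_rep, of 1]
    by (subst has_sum_cong[where g = "\<lambda>e. c * complex_of_real (exp (- \<beta> * h e)) * cinner e (\<pi> 1 e)"])
       (simp_all add: star_rep_one[OF rep] orthonormal_familyD[OF ortho_B])
  have c0: "c \<noteq> 0"
  proof
    assume "c = 0"
    then have "((\<lambda>e. 0) has_sum (1::complex)) B" using one by simp
    then have "(1::complex) = 0" by (rule has_sum_unique[OF _ has_sum_0]) simp
    then show False by simp
  qed
  have "((\<lambda>e. (1 / c) * (c * complex_of_real (exp (- \<beta> * h e)))) has_sum ((1 / c) * 1)) B"
    by (rule has_sum_cmult_right[OF one])
  then have s: "((\<lambda>e. complex_of_real (exp (- \<beta> * h e))) has_sum (1 / c)) B" using c0 by simp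
  show summ: "(\<lambda>e. exp (- \<beta> * h e)) summable_on B"
    using has_sum_imp_summable[OF has_sum_Re[OF s]] by simp
  have "((\<lambda>e. complex_of_real (exp (- \<beta> * h e))) has_sum complex_of_real (Gibbs_sum \<beta>)) B"
    by (rule has_sum_of_real[OF Gibbs_sum_has_sum[OF summ]])
  then have "1 / c = complex_of_real (Gibbs_sum \<beta>)" using s has_sum_unique by blast
  then have cZ: "c = 1 / complex_of_real (Gibbs_sum \<beta>)" by (simp flip: \<open>1 / c = _\<close>)
  have cw: "c * complex_of_real (exp (- \<beta> * h e)) = complex_of_real (Gibbs_weight \<beta> e)" for e
    by (simp add: cZ Gibbs_weight_def)
  show "cinner \<eta> (\<theta> (rank1 e f) \<xi>) = (if e = f then complex_of_real (Gibbs_weight \<beta> e) else 0)"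
    if "e \<in> B" "f \<in> B" for e f using c[OF that] by (simp only: cw)
  show "\<psi> = Gibbs_functional \<beta>"
  proof
    fix a
    show "\<psi> a = Gibbs_functional \<beta> a"
      unfolding Gibbs_functional_def \<psi>
      using infsumI[OF X[OF cblin_rep, of a]] by (simp only: cw ext_rep)
  qed
qed

end

subsection \<open>Extremality\<close>

text \<open>Polarisation: \<open>\<psi>\<close> is real on \<open>(1 + a)\<^sup>*(1 + a)\<close> and on \<open>(1 + i a)\<^sup>*(1 + i a)\<close>.\<close>

lemma state_hermitian:
  assumes \<psi>: "is_state \<psi>" shows "\<psi> (star a) = cnj (\<psi> a)"
proof -
  have l: "clinear \<psi>" and p: "\<And>a. \<psi> (star a * a) \<in> \<real>\<^sub>\<ge>\<^sub>0" using \<psi> by (simp_all add: is_state_def)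
  have add: "\<psi> (x + y) = \<psi> x + \<psi> y" for x y using l by (simp add: clinear_def)
  have sc: "\<psi> (c *\<^sub>C x) = c * \<psi> x" for c x using l by (simp add: clinear_def scaleC_complex_def)
  have im: "Im (\<psi> (star x * x)) = 0" for x using p[of x] by (simp add: complex_nonneg_Reals_iff)
  have e1: "star (1 + a) * (1 + a) = 1 + a + star a + star a * a"
    by (simp add: star_add distrib_left distrib_right add_ac)
  have e2: "star (1 + \<i> *\<^sub>C a) * (1 + \<i> *\<^sub>C a) = 1 + \<i> *\<^sub>C a + (- \<i>) *\<^sub>C star a + star a * a"
    by (simp add: star_add star_scaleC star_one distrib_left distrib_right left_diff_distrib cvec.scale_right_diff_distrib scaleC_mult_left scaleC_mult_right
        scaleC_add_right scaleC_scaleC add_ac)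
  have i1: "Im (\<psi> 1) = 0" using im[of 1] by simp
  have 1: "Im (\<psi> a) + Im (\<psi> (star a)) = 0"
    using im[of "1 + a"] im[of a] i1 unfolding e1 add by simp
  have 2: "Re (\<psi> a) - Re (\<psi> (star a)) = 0"
    using im[of "1 + \<i> *\<^sub>C a"] im[of a] i1 unfolding e2 add sc by simp
  show ?thesis by (rule complex_eqI) (use 1 2 in simp_all)
qed

text \<open>Nonnegativity on \<open>(a - \<psi>(a))\<^sup>*(a - \<psi>(a))\<close>.\<close>

lemma state_Cauchy_Schwarz:
  assumes \<psi>: "is_state \<psi>" shows "(cmod (\<psi> a))\<^sup>2 \<le> Re (\<psi> (star a * a))"
proof -
  have l: "clinear \<psi>" and p: "\<And>a. \<psi> (star a * a) \<in> \<real>\<^sub>\<ge>\<^sub>0" and one: "\<psi> 1 = 1"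
    using \<psi> by (simp_all add: is_state_def)
  have add: "\<psi> (x + y) = \<psi> x + \<psi> y" for x y using l by (simp add: clinear_def)
  have sc: "\<psi> (c *\<^sub>C x) = c * \<psi> x" for c x using l by (simp add: clinear_def scaleC_complex_def)
  define c where "c = - \<psi> a"
  have "star (a + c *\<^sub>C 1) * (a + c *\<^sub>C 1) = star a * a + c *\<^sub>C star a + cnj c *\<^sub>C a + (cnj c * c) *\<^sub>C 1"
    by (simp add: star_add star_scaleC star_one distrib_left distrib_right scaleC_mult_left scaleC_mult_right
        scaleC_add_right scaleC_scaleC add_ac mult.commute)
  then have "\<psi> (star (a + c *\<^sub>C 1) * (a + c *\<^sub>C 1)) = \<psi> (star a * a) + c * cnj (\<psi> a) + cnj c * \<psi> a + cnj c * c"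
    by (simp add: add sc one state_hermitian[OF \<psi>])
  also have "\<dots> = \<psi> (star a * a) - complex_of_real ((cmod (\<psi> a))\<^sup>2)"
    unfolding complex_norm_square by (simp add: c_def mult.commute)
  finally have "0 \<le> Re (\<psi> (star a * a) - complex_of_real ((cmod (\<psi> a))\<^sup>2))"
    using p[of "a + c *\<^sub>C 1"] by (simp add: complex_nonneg_Reals_iff)
  then show ?thesis by simp
qed

text \<open>A KMS state that is dominated by a multiple of the Gibbs state is given by a vector functional
  in the GNS representation of the latter, by the Riesz representation theorem.\<close>

lemma (in hamiltonian_rep) dominated_KMS_eq_Gibbs:
  assumes summ: "(\<lambda>e. exp (- \<beta> * h e)) summable_on B" and \<beta>: "\<beta> > 0" and kms: "KMS_state \<sigma> \<beta> \<psi>"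
    and C: "0 \<le> C" and dom: "\<And>a. Re (\<psi> (star a * a)) \<le> C * Re (Gibbs_functional \<beta> (star a * a))"
  shows "\<psi> = Gibbs_functional \<beta>"
proof -
  let ?\<xi> = "gns_vec (Gibbs_weight \<beta>)"
  have st: "is_state \<psi>" using kms by (simp add: KMS_state_def)
  note arep = amp_rep[OF irr]
  have D1: "clinear (\<lambda>a. ampl (\<pi> a) ?\<xi>)" by (rule star_rep_clinear[OF arep])
  have D2: "clinear \<psi>" using st by (simp add: is_state_def)
  have bd: "norm (\<psi> a) \<le> sqrt C * norm (ampl (\<pi> a) ?\<xi>)" for a
  proof -
    have "cinner ?\<xi> (ampl (\<pi> (star a)) (ampl (\<pi> a) ?\<xi>)) = complex_of_real ((norm (ampl (\<pi> a) ?\<xi>))\<^sup>2)"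
      unfolding cinner_self[symmetric] by (rule adjointsD[OF star_rep_adjoints[OF arep], symmetric])
    then have "Re (Gibbs_functional \<beta> (star a * a)) = (norm (ampl (\<pi> a) ?\<xi>))\<^sup>2"
      unfolding Gibbs_functional_vector[OF summ] star_rep_mult[OF arep] by simp
    then have "(cmod (\<psi> a))\<^sup>2 \<le> (sqrt C * norm (ampl (\<pi> a) ?\<xi>))\<^sup>2"
      using state_Cauchy_Schwarz[OF st, of a] dom[of a] C by (simp add: power_mult_distrib)
    then show ?thesis by (rule power2_le_imp_le) (simp add: C)
  qed
  obtain G :: "ell2 \<Rightarrow> complex" where G: "cblin G" "\<And>a. G (ampl (\<pi> a) ?\<xi>) = \<psi> a"
    by (rule bounded_factorization[OF D1 D2 _ bd]) (use C in auto)
  obtain S where S: "adjoints G S" using ex_adjoint[OF G(1)] by blast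
  have "\<psi> a = cinner (S 1) (ampl (\<pi> a) ?\<xi>)" for a
  proof -
    have "cinner 1 (G (ampl (\<pi> a) ?\<xi>)) = cinner (S 1) (ampl (\<pi> a) ?\<xi>)" by (rule adjointsD'[OF S])
    then show ?thesis by (simp add: cinner_complex_def G(2))
  qed
  moreover have "?\<xi> \<in> amp_space"
    by (rule gns_vec_in[OF Gibbs_weight_pos[OF summ, THEN less_imp_le] Gibbs_weight_summable[OF summ]])
  ultimately show ?thesis using normal_extension.KMS_is_Gibbs(2)[OF ampl_normal_extension[OF B]] kms \<beta> by blast
qed

text \<open>Both members of a convex decomposition are dominated by multiples of the Gibbs state.\<close>

lemma (in hamiltonian_rep) Gibbs_extremal:
  assumes summ: "(\<lambda>e. exp (- \<beta> * h e)) summable_on B" and \<beta>: "\<beta> > 0"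
  shows "extremal_KMS_state \<sigma> \<beta> (Gibbs_functional \<beta>)"
proof -
  have half: "\<psi>\<^sub>1 = Gibbs_functional \<beta>"
    if k1: "KMS_state \<sigma> \<beta> \<psi>\<^sub>1" and k2: "KMS_state \<sigma> \<beta> \<psi>\<^sub>2" and t: "0 < t" "t < 1"
      and eq: "\<And>a. Gibbs_functional \<beta> a = complex_of_real t * \<psi>\<^sub>1 a + complex_of_real (1 - t) * \<psi>\<^sub>2 a"
    for \<psi>\<^sub>1 \<psi>\<^sub>2 t
  proof (rule dominated_KMS_eq_Gibbs[OF summ \<beta> k1])
    show "0 \<le> 1 / t" using t by simp
    fix a
    have "0 \<le> Re (\<psi>\<^sub>2 (star a * a))"
      using k2 by (simp add: KMS_state_def is_state_def complex_nonneg_Reals_iff)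
    then have "t * Re (\<psi>\<^sub>1 (star a * a)) \<le> Re (Gibbs_functional \<beta> (star a * a))"
      unfolding eq using t by simp
    then show "Re (\<psi>\<^sub>1 (star a * a)) \<le> 1 / t * Re (Gibbs_functional \<beta> (star a * a))"
      using t by (simp add: field_simps)
  qed
  show ?thesis
    unfolding extremal_KMS_state_def
  proof (intro conjI allI impI)
    show "KMS_state \<sigma> \<beta> (Gibbs_functional \<beta>)" by (rule Gibbs_functional_KMS[OF summ])
    fix \<psi>\<^sub>1 \<psi>\<^sub>2 t
    assume a: "KMS_state \<sigma> \<beta> \<psi>\<^sub>1 \<and> KMS_state \<sigma> \<beta> \<psi>\<^sub>2 \<and> 0 < t \<and> t < 1 \<and>
      Gibbs_functional \<beta> = (\<lambda>a. complex_of_real t * \<psi>\<^sub>1 a + complex_of_real (1 - t) * \<psi>\<^sub>2 a)"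
    then have eq: "Gibbs_functional \<beta> a = complex_of_real t * \<psi>\<^sub>1 a + complex_of_real (1 - t) * \<psi>\<^sub>2 a" for a
      by (elim conjE) (erule fun_cong)
    show "\<psi>\<^sub>1 = Gibbs_functional \<beta>" by (rule half[of \<psi>\<^sub>1 \<psi>\<^sub>2 t]) (use a eq in simp_all)
    show "\<psi>\<^sub>2 = Gibbs_functional \<beta>" by (rule half[of \<psi>\<^sub>2 \<psi>\<^sub>1 "1 - t"]) (use a eq in simp_all)
  qed
qed

section \<open>Uniqueness of GNS representations\<close>

text \<open>A unitary from \<open>K\<close> onto \<open>K'\<close> and its inverse, both extended by \<open>0\<close> on the orthogonal complements; the
  identities of the subspaces thereby become projections.\<close>

definition unitary_intertwiner ::
  "'h::chilbert_space set \<Rightarrow> ('a::unital_cstar_algebra \<Rightarrow> 'h \<Rightarrow> 'h) \<Rightarrow>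
   'k::chilbert_space set \<Rightarrow> ('a \<Rightarrow> 'k \<Rightarrow> 'k) \<Rightarrow> ('h \<Rightarrow> 'k) \<Rightarrow> ('k \<Rightarrow> 'h) \<Rightarrow> bool" where
  "unitary_intertwiner K \<pi> K' \<pi>' U V \<longleftrightarrow> cblin U \<and> cblin V \<and> adjoints U V \<and>
     (\<forall>x. U x \<in> K') \<and> (\<forall>y. V y \<in> K) \<and> (\<forall>x. V (U x) = orth_proj K x) \<and> (\<forall>y. U (V y) = orth_proj K' y) \<and>
     (\<forall>a x. U (\<pi> a x) = \<pi>' a (U x)) \<and> (\<forall>a y. V (\<pi>' a y) = \<pi> a (V y))"

lemma unitary_intertwiner_sym:
  "unitary_intertwiner K \<pi> K' \<pi>' U V \<Longrightarrow> unitary_intertwiner K' \<pi>' K \<pi> V U"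
  unfolding unitary_intertwiner_def using adjoints_sym by blast

text \<open>\<open>\<pi>\<^sub>1(a) \<xi>\<^sub>1 \<mapsto> \<pi>\<^sub>2(a) \<xi>\<^sub>2\<close> is isometric, so it extends to the closures, and so does its inverse.\<close>

lemma GNS_unique:
  assumes g1: "gns_triple \<psi> K\<^sub>1 \<pi>\<^sub>1 \<xi>\<^sub>1" and g2: "gns_triple \<psi> K\<^sub>2 \<pi>\<^sub>2 \<xi>\<^sub>2"
  shows "\<exists>U V. unitary_intertwiner K\<^sub>1 \<pi>\<^sub>1 K\<^sub>2 \<pi>\<^sub>2 U V"
proof -
  have half: "\<exists>U. cblin U \<and> (\<forall>x. U x \<in> K') \<and> (\<forall>a. U (\<pi> a \<xi>) = \<pi>' a \<xi>') \<and>
      (\<forall>x. U (orth_proj K x) = U x) \<and> (\<forall>a x. U (\<pi> a x) = \<pi>' a (U x))"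
    if g: "gns_triple \<psi> K \<pi> \<xi>" and g': "gns_triple \<psi> K' \<pi>' \<xi>'" for K \<pi> \<xi> K' \<pi>' \<xi>'
  proof -
    have rep: "star_rep K \<pi>" "star_rep K' \<pi>'" and cy: "closure (range (\<lambda>a. \<pi> a \<xi>)) = K" "closure (range (\<lambda>a. \<pi>' a \<xi>')) = K'"
      and f: "\<And>a. \<psi> a = cinner \<xi> (\<pi> a \<xi>)" "\<And>a. \<psi> a = cinner \<xi>' (\<pi>' a \<xi>')"
      using g g' by (simp_all add: gns_triple_def)
    have K: "closed_csubspace K" by (rule star_rep_closed[OF rep(1)])
    have n1: "(norm (\<pi> a \<xi>))\<^sup>2 = Re (\<psi> (star a * a))" for a
      unfolding norm_eq_cinner f(1) star_rep_mult[OF rep(1)] adjointsD[OF star_rep_adjoints[OF rep(1)]] ..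
    have n2: "(norm (\<pi>' a \<xi>'))\<^sup>2 = Re (\<psi> (star a * a))" for a
      unfolding norm_eq_cinner f(2) star_rep_mult[OF rep(2)] adjointsD[OF star_rep_adjoints[OF rep(2)]] ..
    have "(norm (\<pi>' a \<xi>'))\<^sup>2 = (norm (\<pi> a \<xi>))\<^sup>2" for a unfolding n1 n2 ..
    then have le: "norm (\<pi>' a \<xi>') \<le> 1 * norm (\<pi> a \<xi>)" for a by (simp add: power2_eq_iff_nonneg)
    obtain U where U: "cblin U" "\<And>a. U (\<pi> a \<xi>) = \<pi>' a \<xi>'"
      "\<And>x. (\<And>v. v \<in> closure (range (\<lambda>a. \<pi> a \<xi>)) \<Longrightarrow> cinner v x = 0) \<Longrightarrow> U x = 0"
      "\<And>x. U x \<in> closure (range (\<lambda>a. \<pi>' a \<xi>'))"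
      by (rule bounded_factorization[OF star_rep_clinear[OF rep(1)] star_rep_clinear[OF rep(2)] _ le]) auto
    have UP: "U (orth_proj K x) = U x" for x
    proof -
      have "U (x - orth_proj K x) = 0" unfolding cy(1)[symmetric]
        by (rule U(3)) (unfold cy(1), rule orth_proj_perp[OF K])
      then show ?thesis by (simp add: cblin_diff[OF U(1)])
    qed
    have "U (\<pi> a x) = \<pi>' a (U x)" for a x
    proof -
      have "U (\<pi> a (orth_proj K x)) = \<pi>' a (U (orth_proj K x))"
      proof (rule cblin_eq_on_closure[where S = "range (\<lambda>a. \<pi> a \<xi>)" and f = "\<lambda>x. U (\<pi> a x)" and g = "\<lambda>x. \<pi>' a (U x)"])
        show "cblin (\<lambda>x. U (\<pi> a x))" by (rule cblin_compose[OF U(1) star_rep_cblin[OF rep(1)]])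
        show "cblin (\<lambda>x. \<pi>' a (U x))" by (rule cblin_compose[OF star_rep_cblin[OF rep(2)] U(1)])
        show "orth_proj K x \<in> closure (range (\<lambda>a. \<pi> a \<xi>))" unfolding cy(1) by (rule orth_proj_in[OF K])
        fix y assume "y \<in> range (\<lambda>a. \<pi> a \<xi>)"
        then obtain b where "y = \<pi> b \<xi>" by blast
        then show "U (\<pi> a y) = \<pi>' a (U y)"
          by (simp add: star_rep_mult[OF rep(1), symmetric] star_rep_mult[OF rep(2), symmetric] U(2))
      qed
      then show ?thesis by (simp add: UP bounded_ops_proj[OF K star_rep_bounded_ops[OF rep(1)]])
    qed
    then show ?thesis using U(1,2,4) UP unfolding cy(2) by blast
  qed
  obtain U where U: "cblin U" "\<And>x. U x \<in> K\<^sub>2" "\<And>a. U (\<pi>\<^sub>1 a \<xi>\<^sub>1) = \<pi>\<^sub>2 a \<xi>\<^sub>2" "\<And>x. U (orth_proj K\<^sub>1 x) = U x"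
    "\<And>a x. U (\<pi>\<^sub>1 a x) = \<pi>\<^sub>2 a (U x)" using half[OF g1 g2] by blast
  obtain V where V: "cblin V" "\<And>x. V x \<in> K\<^sub>1" "\<And>a. V (\<pi>\<^sub>2 a \<xi>\<^sub>2) = \<pi>\<^sub>1 a \<xi>\<^sub>1" "\<And>x. V (orth_proj K\<^sub>2 x) = V x"
    "\<And>a x. V (\<pi>\<^sub>2 a x) = \<pi>\<^sub>1 a (V x)" using half[OF g2 g1] by blast
  have cy: "closure (range (\<lambda>a. \<pi>\<^sub>1 a \<xi>\<^sub>1)) = K\<^sub>1" "closure (range (\<lambda>a. \<pi>\<^sub>2 a \<xi>\<^sub>2)) = K\<^sub>2"
    and rep: "star_rep K\<^sub>1 \<pi>\<^sub>1" "star_rep K\<^sub>2 \<pi>\<^sub>2"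
    and f: "\<And>a. \<psi> a = cinner \<xi>\<^sub>1 (\<pi>\<^sub>1 a \<xi>\<^sub>1)" "\<And>a. \<psi> a = cinner \<xi>\<^sub>2 (\<pi>\<^sub>2 a \<xi>\<^sub>2)"
    using g1 g2 by (simp_all add: gns_triple_def)
  have K: "closed_csubspace K\<^sub>1" "closed_csubspace K\<^sub>2"
    by (rule star_rep_closed[OF rep(1)], rule star_rep_closed[OF rep(2)])
  have VU: "V (U x) = orth_proj K\<^sub>1 x" for x
  proof -
    have "V (U (orth_proj K\<^sub>1 x)) = orth_proj K\<^sub>1 x"
    proof (rule cblin_eq_on_closure[OF cblin_compose[OF V(1) U(1)] cblin_id, where S = "range (\<lambda>a. \<pi>\<^sub>1 a \<xi>\<^sub>1)"])
      show "orth_proj K\<^sub>1 x \<in> closure (range (\<lambda>a. \<pi>\<^sub>1 a \<xi>\<^sub>1))" unfolding cy(1) by (rule orth_proj_in[OF K(1)])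
    qed (auto simp: U(3) V(3))
    then show ?thesis by (simp add: U(4))
  qed
  have UV: "U (V x) = orth_proj K\<^sub>2 x" for x
  proof -
    have "U (V (orth_proj K\<^sub>2 x)) = orth_proj K\<^sub>2 x"
    proof (rule cblin_eq_on_closure[OF cblin_compose[OF U(1) V(1)] cblin_id, where S = "range (\<lambda>a. \<pi>\<^sub>2 a \<xi>\<^sub>2)"])
      show "orth_proj K\<^sub>2 x \<in> closure (range (\<lambda>a. \<pi>\<^sub>2 a \<xi>\<^sub>2))" unfolding cy(2) by (rule orth_proj_in[OF K(2)])
    qed (auto simp: U(3) V(3))
    then show ?thesis by (simp add: V(4))
  qed
  have "adjoints U V" unfolding adjoints_def
  proof (intro allI)
    fix x y
    \<comment> \<open>The adjoint of \<open>V\<close> agrees with \<open>U\<close> on the orbit of the cyclic vector, hence everywhere.\<close>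
    obtain V' where V': "cblin V'" "adjoints V V'" using ex_adjoint[OF V(1)] by blast
    have gen: "V' (\<pi>\<^sub>1 a \<xi>\<^sub>1) = orth_proj K\<^sub>2 (V' (\<pi>\<^sub>1 a \<xi>\<^sub>1))" for a
    proof (rule cinner_eqI)
      fix z
      have "cinner z (V' (\<pi>\<^sub>1 a \<xi>\<^sub>1)) = cinner (V (orth_proj K\<^sub>2 z)) (\<pi>\<^sub>1 a \<xi>\<^sub>1)"
        unfolding V(4) by (rule adjointsD[OF V'(2), symmetric])
      also have "\<dots> = cinner z (orth_proj K\<^sub>2 (V' (\<pi>\<^sub>1 a \<xi>\<^sub>1)))"
        unfolding adjointsD[OF V'(2)] adjointsD[OF adjoints_orth_proj[OF K(2)]] ..
      finally show "cinner z (V' (\<pi>\<^sub>1 a \<xi>\<^sub>1)) = cinner z (orth_proj K\<^sub>2 (V' (\<pi>\<^sub>1 a \<xi>\<^sub>1)))" .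
    qed
    have inn: "cinner (\<pi>\<^sub>2 b \<xi>\<^sub>2) (V' (\<pi>\<^sub>1 a \<xi>\<^sub>1)) = cinner (\<pi>\<^sub>2 b \<xi>\<^sub>2) (\<pi>\<^sub>2 a \<xi>\<^sub>2)" for a b
    proof -
      have "cinner (\<pi>\<^sub>2 b \<xi>\<^sub>2) (V' (\<pi>\<^sub>1 a \<xi>\<^sub>1)) = cinner (\<pi>\<^sub>1 b \<xi>\<^sub>1) (\<pi>\<^sub>1 a \<xi>\<^sub>1)"
        unfolding adjointsD[OF V'(2), symmetric] V(3) ..
      also have "\<dots> = \<psi> (star b * a)"
        unfolding f(1) star_rep_mult[OF rep(1)] adjointsD[OF star_rep_adjoints[OF rep(1)]] ..
      also have "\<dots> = cinner (\<pi>\<^sub>2 b \<xi>\<^sub>2) (\<pi>\<^sub>2 a \<xi>\<^sub>2)"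
        unfolding f(2) star_rep_mult[OF rep(2)] adjointsD[OF star_rep_adjoints[OF rep(2)]] ..
      finally show ?thesis .
    qed
    have V'D: "V' (\<pi>\<^sub>1 a \<xi>\<^sub>1) = U (\<pi>\<^sub>1 a \<xi>\<^sub>1)" for a
    proof -
      define d where "d = V' (\<pi>\<^sub>1 a \<xi>\<^sub>1) - \<pi>\<^sub>2 a \<xi>\<^sub>2"
      have dK: "d \<in> K\<^sub>2" unfolding d_def
        by (rule closed_csubspace_diff[OF K(2) _ star_rep_in[OF rep(2)]])
           (subst gen, rule orth_proj_in[OF K(2)])
      have "cinner d z = 0" if "z \<in> K\<^sub>2" for z
      proof (rule cblin_eq_on_closure[OF cblin_cinner, where S = "range (\<lambda>a. \<pi>\<^sub>2 a \<xi>\<^sub>2)" and g = "\<lambda>_. 0"])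
        show "z \<in> closure (range (\<lambda>a. \<pi>\<^sub>2 a \<xi>\<^sub>2))" using that cy(2) by simp
        show "cblin (\<lambda>_::ell2. 0::complex)" by (rule cblinI[of _ 0]) (simp_all add: clinear_def)
        fix v assume "v \<in> range (\<lambda>a. \<pi>\<^sub>2 a \<xi>\<^sub>2)"
        then obtain b where "v = \<pi>\<^sub>2 b \<xi>\<^sub>2" by blast
        then have "cinner v d = 0" by (simp add: d_def cinner_diff_right inn)
        then show "cinner d v = 0" by (rule cinner_eq_zero_commute)
      qed
      then have "cinner d d = 0" using dK by blast
      then show ?thesis by (simp add: cinner_self d_def U(3))
    qed
    have VK: "V' x = V' (orth_proj K\<^sub>1 x)" for x
    proof (rule cinner_eqI)
      fix z
      have "cinner z (V' (orth_proj K\<^sub>1 x)) = cinner (orth_proj K\<^sub>1 (V z)) x"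
        unfolding adjointsD[OF V'(2), symmetric] adjointsD[OF adjoints_orth_proj[OF K(1)]] ..
      then show "cinner z (V' x) = cinner z (V' (orth_proj K\<^sub>1 x))"
        unfolding orth_proj_id[OF K(1) V(2)] adjointsD[OF V'(2)] by simp
    qed
    have "V' (orth_proj K\<^sub>1 x) = U (orth_proj K\<^sub>1 x)"
    proof (rule cblin_eq_on_closure[OF V'(1) U(1), where S = "range (\<lambda>a. \<pi>\<^sub>1 a \<xi>\<^sub>1)"])
      show "orth_proj K\<^sub>1 x \<in> closure (range (\<lambda>a. \<pi>\<^sub>1 a \<xi>\<^sub>1))" unfolding cy(1) by (rule orth_proj_in[OF K(1)])
    qed (auto simp: V'D)
    then have "V' x = U x" using VK[of x] U(4)[of x] by simp
    then show "cinner (U x) y = cinner x (V y)" using adjointsD'[OF V'(2), of x y] by simp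
  qed
  then show ?thesis
    unfolding unitary_intertwiner_def using U V VU UV by blast
qed

text \<open>Conjugation with the inverse unitary maps the commutant of \<open>\<pi>'\<close> into that of \<open>\<pi>\<close>.\<close>

lemma transport_bicommutant:
  assumes u: "unitary_intertwiner K \<pi> K' \<pi>' U V" and K: "closed_csubspace K" "closed_csubspace K'"
    and X: "X \<in> bicommutant K (range \<pi>)"
  shows "(\<lambda>v. U (X (V v))) \<in> bicommutant K' (range \<pi>')"
proof -
  have U: "cblin U" "cblin V" "\<And>x. U x \<in> K'" "\<And>y. V y \<in> K" "\<And>x. V (U x) = orth_proj K x"
    "\<And>y. U (V y) = orth_proj K' y" "\<And>a x. U (\<pi> a x) = \<pi>' a (U x)" "\<And>a y. V (\<pi>' a y) = \<pi> a (V y)"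
    and adj: "adjoints U V"
    using u by (simp_all add: unitary_intertwiner_def)
  have bX: "X \<in> bounded_ops K" using X by (simp add: bicommutant_def commutant_bounded_ops)
  have V0: "V y = 0" if "\<And>v. v \<in> K' \<Longrightarrow> cinner v y = 0" for y
  proof -
    have "cinner (U (V y)) y = 0" by (rule that[OF U(3)])
    then have "cinner (V y) (V y) = 0" unfolding adjointsD[OF adj] .
    then show ?thesis by (simp add: cinner_self)
  qed
  have U0: "U y = 0" if "\<And>v. v \<in> K \<Longrightarrow> cinner v y = 0" for y
  proof -
    have "cinner (V (U y)) y = 0" by (rule that[OF U(4)])
    then have "cinner (U y) (U y) = 0" unfolding adjointsD[OF adjoints_sym[OF adj]] .
    then show ?thesis by (simp add: cinner_self)
  qed
  show ?thesis
    unfolding bicommutant_def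
  proof (rule commutantI)
    show "(\<lambda>v. U (X (V v))) \<in> bounded_ops K'"
    proof (rule bounded_opsI)
      show "cblin (\<lambda>v. U (X (V v)))"
        by (intro cblin_compose[OF U(1)] cblin_compose[OF bounded_ops_cblin[OF bX]] U(2))
      show "U (X (V x)) = 0" if "\<And>v. v \<in> K' \<Longrightarrow> cinner v x = 0" for x
        using V0[OF that] by (simp add: cblin_zero[OF U(1)] cblin_zero[OF bounded_ops_cblin[OF bX]])
    qed (rule U(3))
    fix S v assume S: "S \<in> commutant K' (range \<pi>')"
    have bS: "S \<in> bounded_ops K'" by (rule commutant_bounded_ops[OF S])
    have VSU: "(\<lambda>u. V (S (U u))) \<in> commutant K (range \<pi>)"
    proof (rule commutantI)
      show "(\<lambda>u. V (S (U u))) \<in> bounded_ops K"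
      proof (rule bounded_opsI)
        show "cblin (\<lambda>u. V (S (U u)))"
          by (intro cblin_compose[OF U(2)] cblin_compose[OF bounded_ops_cblin[OF bS]] U(1))
        show "V (S (U x)) = 0" if "\<And>v. v \<in> K \<Longrightarrow> cinner v x = 0" for x
          using U0[OF that] by (simp add: cblin_zero[OF U(2)] cblin_zero[OF bounded_ops_cblin[OF bS]])
      qed (rule U(4))
      fix A u assume "A \<in> range \<pi>"
      then obtain a where A: "A = \<pi> a" by blast
      show "V (S (U (A u))) = A (V (S (U u)))"
        unfolding A U(7) commutantD[OF S rangeI] U(8) ..
    qed
    have "S (U (X (V v))) = orth_proj K' (S (U (X (V v))))"
      by (rule orth_proj_id[OF K(2) bounded_ops_in[OF bS], symmetric])
    also have "\<dots> = U (V (S (U (X (V v)))))" by (rule U(6)[symmetric])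
    also have "\<dots> = U (X (V (S (U (V v)))))"
      unfolding commutantD[OF X[unfolded bicommutant_def] VSU] ..
    also have "\<dots> = U (X (V (S v)))" unfolding U(6) bounded_ops_proj[OF K(2) bS] ..
    finally show "U (X (V (S v))) = S (U (X (V v)))" ..
  qed
qed

section \<open>States that are quasi-equivalent to a Gibbs state\<close>

context hamiltonian_rep
begin

text \<open>The GNS representation of \<open>\<phi>\<close> is a multiple of \<open>\<pi>\<close>, so an isomorphism of von Neumann algebras turns
  \<open>B(\<H>)\<close> into operators of the GNS representation of \<open>\<psi>\<close>. This is a normal extension: the projection onto
  the common kernel of the \<open>\<theta>(|e\<rangle>\<langle>e|)\<close> lies in the bicommutant, so it is of the form \<open>\<theta>(X)\<close>; then
  \<open>\<theta>(|e\<rangle>\<langle>e| X) = 0\<close> and therefore \<open>|e\<rangle>\<langle>e| X = 0\<close> for all \<open>e\<close>, that is, \<open>X = 0\<close>.\<close>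

lemma quasi_equivalent_KMS:
  assumes s0: "(\<lambda>e. exp (- \<beta>\<^sub>0 * h e)) summable_on B" and g1: "gns_triple (Gibbs_functional \<beta>\<^sub>0) K\<^sub>1 \<pi>\<^sub>1 \<xi>\<^sub>1"
    and g2: "gns_triple \<psi> K\<^sub>2 \<pi>\<^sub>2 \<xi>\<^sub>2" and qe: "quasi_equivalent_reps K\<^sub>1 \<pi>\<^sub>1 K\<^sub>2 \<pi>\<^sub>2"
    and kms: "KMS_state \<sigma> \<beta> \<psi>" and \<beta>: "\<beta> > 0"
  shows "(\<lambda>e. exp (- \<beta> * h e)) summable_on B" and "\<psi> = Gibbs_functional \<beta>"
proof -
  let ?M1 = "bicommutant K\<^sub>1 (range \<pi>\<^sub>1)" and ?M2 = "bicommutant K\<^sub>2 (range \<pi>\<^sub>2)"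
  have rep1: "star_rep K\<^sub>1 \<pi>\<^sub>1" using g1 by (simp add: gns_triple_def)
  have rep2: "star_rep K\<^sub>2 \<pi>\<^sub>2" and \<xi>2: "\<xi>\<^sub>2 \<in> K\<^sub>2" and \<psi>: "\<And>a. \<psi> a = cinner \<xi>\<^sub>2 (\<pi>\<^sub>2 a \<xi>\<^sub>2)"
    using g2 by (simp_all add: gns_triple_def)
  note K1 = star_rep_closed[OF rep1] and K2 = star_rep_closed[OF rep2] and Ka = closed_csubspace_amp_space
  obtain U V where u: "unitary_intertwiner amp_space (\<lambda>a. ampl (\<pi> a)) K\<^sub>1 \<pi>\<^sub>1 U V"
    using GNS_unique[OF Gibbs_gns_triple[OF s0] g1] by blast
  have U: "cblin U" "cblin V" "\<And>x. U x \<in> K\<^sub>1" "\<And>y. V y \<in> amp_space" "\<And>x. V (U x) = orth_proj amp_space x"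
    "\<And>y. U (V y) = orth_proj K\<^sub>1 y" "\<And>a x. U (ampl (\<pi> a) x) = \<pi>\<^sub>1 a (U x)" and adj: "adjoints U V"
    using u by (simp_all add: unitary_intertwiner_def)
  have VU: "V (U x) = x" if "x \<in> amp_space" for x using U(5) orth_proj_id[OF Ka that] by simp
  define A where "A X = (\<lambda>v. U (ampl X (V v)))" for X
  have AM: "A X \<in> ?M1" if "cblin X" for X
    unfolding A_def
    by (rule transport_bicommutant[OF u Ka K1]) (use that in \<open>auto simp: bicommutant_amp[OF irr]\<close>)
  have A_comp: "A (X \<circ> Y) = A X \<circ> A Y" if "cblin X" "cblin Y" for X Y
    using that by (simp add: A_def fun_eq_iff ampl_comp VU ampl_in)
  have A_plus: "A (\<lambda>x. X x + Y x) = (\<lambda>v. A X v + A Y v)" if "cblin X" "cblin Y" for X Y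
    using that by (simp add: A_def ampl_plus cblin_add[OF U(1)])
  have A_scale: "A (\<lambda>x. c *\<^sub>C X x) = (\<lambda>v. c *\<^sub>C A X v)" if "cblin X" for X c
    using that by (simp add: A_def ampl_scaleC cblin_scaleC[OF U(1)])
  have A_adj: "adjoints (A X) (A Y)" if "cblin X" "cblin Y" "adjoints X Y" for X Y
    unfolding adjoints_def A_def
    by (simp add: adjointsD[OF adj] adjointsD[OF adjoints_ampl[OF that]] adjointsD[OF adjoints_sym[OF adj]])
  have A_rep: "A (\<pi> a) = \<pi>\<^sub>1 a" for a
    by (simp add: A_def fun_eq_iff U(6,7) bounded_ops_proj[OF K1 star_rep_bounded_ops[OF rep1]])
  have A_inj: "X = Y" if "A X = A Y" "cblin X" "cblin Y" for X Y
  proof -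
    obtain e where e: "e \<in> B" using B_nonempty[OF irr] by blast
    have rec: "coemb e (V (A X (U (emb e x)))) = X x" if "cblin X" for X x
      using that e by (simp add: A_def VU emb_in ampl_in coemb_ampl coemb_emb)
    have "X x = Y x" for x using rec[OF that(2), of x] rec[OF that(3), of x] that(1) by simp
    then show ?thesis by blast
  qed
  have A_surj: "\<exists>X. cblin X \<and> A X = R" if R: "R \<in> ?M1" for R
  proof -
    have "(\<lambda>v. V (R (U v))) \<in> bicommutant amp_space (range (\<lambda>a. ampl (\<pi> a)))"
      by (rule transport_bicommutant[OF unitary_intertwiner_sym[OF u] K1 Ka R])
    then obtain X where X: "cblin X" "(\<lambda>v. V (R (U v))) = ampl X" unfolding bicommutant_amp[OF irr] by blast
    have bR: "R \<in> bounded_ops K\<^sub>1" using R by (simp add: bicommutant_def commutant_bounded_ops)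
    have "A X = R"
      unfolding A_def X(2)[symmetric]
      by (simp add: fun_eq_iff U(6) orth_proj_id[OF K1 bounded_ops_in[OF bR]] bounded_ops_proj[OF K1 bR])
    then show ?thesis using X(1) by blast
  qed
  obtain \<Theta> where bij: "bij_betw \<Theta> ?M1 ?M2"
    and T_plus: "\<forall>S\<in>?M1. \<forall>T\<in>?M1. \<Theta> (\<lambda>x. S x + T x) = (\<lambda>x. \<Theta> S x + \<Theta> T x)"
    and T_scale: "\<forall>c. \<forall>T\<in>?M1. \<Theta> (\<lambda>x. c *\<^sub>C T x) = (\<lambda>x. c *\<^sub>C \<Theta> T x)"
    and T_comp: "\<forall>S\<in>?M1. \<forall>T\<in>?M1. \<Theta> (S \<circ> T) = \<Theta> S \<circ> \<Theta> T"
    and T_adj: "\<forall>S\<in>?M1. \<forall>T\<in>?M1. adjoint_pair S T \<longrightarrow> adjoint_pair (\<Theta> S) (\<Theta> T)"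
    and T_rep: "\<forall>a. \<Theta> (\<pi>\<^sub>1 a) = \<pi>\<^sub>2 a"
    using qe unfolding quasi_equivalent_reps_def Let_def by blast
  define \<theta> where "\<theta> X = \<Theta> (A X)" for X
  have \<theta>_in: "\<theta> X \<in> ?M2" if "cblin X" for X
    unfolding \<theta>_def by (rule bij_betwE[OF bij, rule_format]) (rule AM[OF that])
  have \<theta>_comp: "\<theta> (X \<circ> Y) = \<theta> X \<circ> \<theta> Y" if "cblin X" "cblin Y" for X Y
    unfolding \<theta>_def A_comp[OF that] using T_comp AM that by blast
  have \<theta>_adj: "adjoints (\<theta> X) (\<theta> Y)" if "cblin X" "cblin Y" "adjoints X Y" for X Y
    using T_adj AM that A_adj[OF that] unfolding adjoint_pair_eq \<theta>_def by blast
  have \<theta>_scale: "\<theta> (\<lambda>x. c *\<^sub>C X x) = (\<lambda>v. c *\<^sub>C \<theta> X v)" if "cblin X" for X c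
    unfolding \<theta>_def A_scale[OF that] using T_scale AM[OF that] by blast
  have \<theta>_inj: "X = Y" if "\<theta> X = \<theta> Y" "cblin X" "cblin Y" for X Y
    using inj_onD[OF bij_betw_imp_inj_on[OF bij] that(1)[unfolded \<theta>_def] AM AM] that(2,3) A_inj by blast
  have \<theta>_zero: "\<theta> (\<lambda>_. 0) = (\<lambda>_. 0)"
    using \<theta>_scale[OF cblin_id, of 0] by simp
  have \<theta>_cblin: "cblin (\<theta> X)" if "cblin X" for X
    by (rule bounded_ops_cblin[OF commutant_bounded_ops[OF \<theta>_in[OF that, unfolded bicommutant_def]]])
  define N where "N = {v \<in> K\<^sub>2. \<forall>e\<in>B. \<theta> (rank1 e e) v = 0}"
  have N: "closed_csubspace N"
  proof -
    have "N = K\<^sub>2 \<inter> (\<Inter>e\<in>B. {v. \<theta> (rank1 e e) v = 0})" by (auto simp: N_def)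
    moreover have "closed {v. \<theta> (rank1 e e) v = 0}" for e
      by (intro closed_Collect_eq cblin_continuous_on[OF \<theta>_cblin[OF cblin_rank1]] continuous_on_const)
    ultimately have "closed N" using K2 by (auto simp: closed_csubspace_def)
    then show ?thesis
      using K2 unfolding closed_csubspace_def
      by (auto simp: N_def cblin_zero[OF \<theta>_cblin[OF cblin_rank1]] cblin_add[OF \<theta>_cblin[OF cblin_rank1]]
          cblin_scaleC[OF \<theta>_cblin[OF cblin_rank1]])
  qed
  have Q: "orth_proj N \<in> ?M2"
    unfolding bicommutant_def
  proof (rule commutantI)
    show "orth_proj N \<in> bounded_ops K\<^sub>2"
    proof (rule bounded_opsI[OF cblin_orth_proj[OF N]])
      show "orth_proj N x \<in> K\<^sub>2" for x using orth_proj_in[OF N, of x] by (simp add: N_def)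
      show "orth_proj N x = 0" if "\<And>v. v \<in> K\<^sub>2 \<Longrightarrow> cinner v x = 0" for x
        by (rule orth_proj_zero[OF N]) (rule that, simp add: N_def)
    qed
    fix S x assume S: "S \<in> commutant K\<^sub>2 (range \<pi>\<^sub>2)"
    have bS: "S \<in> bounded_ops K\<^sub>2" by (rule commutant_bounded_ops[OF S])
    obtain S' where S': "adjoints S S'" using ex_adjoint[OF bounded_ops_cblin[OF bS]] by blast
    have ES: "\<theta> (rank1 e e) (S v) = S (\<theta> (rank1 e e) v)" for e v
      by (rule commutantD[OF \<theta>_in[OF cblin_rank1, unfolded bicommutant_def] S])
    have sa: "adjoints (\<theta> (rank1 e e)) (\<theta> (rank1 e e))" for e
      by (rule \<theta>_adj[OF cblin_rank1 cblin_rank1 adjoints_rank1])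
    have ES': "\<theta> (rank1 e e) (S' v) = S' (\<theta> (rank1 e e) v)" for e v
      by (rule cinner_eqI) (simp add: adjointsD[OF S', symmetric] adjointsD'[OF sa] ES)
    have S'K: "S' v \<in> K\<^sub>2" for v
    proof -
      have "S' v = orth_proj K\<^sub>2 (S' v)"
        by (rule cinner_eqI)
           (simp add: adjointsD'[OF adjoints_orth_proj[OF K2]] adjointsD[OF S', symmetric] bounded_ops_proj[OF K2 bS])
      then show ?thesis using orth_proj_in[OF K2, of "S' v"] by simp
    qed
    show "orth_proj N (S x) = S (orth_proj N x)"
    proof (rule invariant_projection_commutes[OF N bounded_ops_cblin[OF bS] S'])
      show "S v \<in> N" if "v \<in> N" for v
        using that by (auto simp: N_def ES bounded_ops_in[OF bS] cblin_zero[OF bounded_ops_cblin[OF bS]])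
      show "S' v \<in> N" if "v \<in> N" for v
        using that cinner_eqI[of "S' 0" 0] by (auto simp: N_def ES' S'K adjointsD[OF S', symmetric])
    qed
  qed
  then have "orth_proj N \<in> \<Theta> ` ?M1" by (simp only: bij_betw_imp_surj_on[OF bij])
  then obtain R where R: "\<Theta> R = orth_proj N" "R \<in> ?M1" by (metis imageE)
  obtain X where X': "cblin X" "A X = R" using A_surj[OF R(2)] by blast
  then have X: "cblin X" "\<theta> X = orth_proj N" using R(1) by (simp_all add: \<theta>_def)
  have "rank1 e e \<circ> X = (\<lambda>_. 0)" if e: "e \<in> B" for e
  proof (rule \<theta>_inj)
    show "\<theta> (rank1 e e \<circ> X) = \<theta> (\<lambda>_. 0)"
      unfolding \<theta>_comp[OF cblin_rank1 X(1)] X(2) \<theta>_zero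
      using orth_proj_in[OF N] e by (auto simp: N_def fun_eq_iff)
    show "cblin (rank1 e e \<circ> X)" by (rule cblin_comp[OF cblin_rank1 X(1)])
    show "cblin (\<lambda>_::'h. 0::'h)" using cblin_scale[OF cblin_id, of 0] by simp
  qed
  then have "rank1 e e (X x) = 0" if "e \<in> B" for e x
    using that by (metis comp_apply)
  then have X0: "cinner e (X x) = 0" if e: "e \<in> B" for e x
    using arg_cong[of "rank1 e e (X x)" 0 "cinner e"] e orthonormal_familyD[OF ortho_B e e]
    by (simp add: cinner_scaleC_right rank1_def)
  have "X = (\<lambda>_. 0)"
  proof
    show "X x = 0" for x by (rule onb_coords_eqI[OF B]) (simp add: X0)
  qed
  then have QO: "orth_proj N = (\<lambda>_. 0)" using X(2) \<theta>_zero by simp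
  have ne: "normal_extension B \<sigma> \<pi> h K\<^sub>2 \<pi>\<^sub>2 \<theta>"
  proof (rule normal_extension.intro[OF hamiltonian_rep_axioms], unfold_locales)
    show "\<theta> (\<lambda>x. X x + Y x) v = \<theta> X v + \<theta> Y v" if "cblin X" "cblin Y" for X Y v
      unfolding \<theta>_def A_plus[OF that] using T_plus AM that by (simp add: fun_eq_iff)
    show "v = 0" if v: "v \<in> K\<^sub>2" "\<And>e. e \<in> B \<Longrightarrow> \<theta> (rank1 e e) v = 0" for v
    proof -
      have "v \<in> N" using v by (simp add: N_def)
      then show ?thesis using orth_proj_id[OF N] QO by metis
    qed
    show "\<theta> (\<pi> a) = \<pi>\<^sub>2 a" for a unfolding \<theta>_def A_rep using T_rep by blast
  qed (simp_all add: rep2 \<theta>_in \<theta>_comp \<theta>_adj \<theta>_scale)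
  show "(\<lambda>e. exp (- \<beta> * h e)) summable_on B" by (rule normal_extension.KMS_is_Gibbs(1)[OF ne \<xi>2 \<psi> kms \<beta>])
  show "\<psi> = Gibbs_functional \<beta>" by (rule normal_extension.KMS_is_Gibbs(2)[OF ne \<xi>2 \<psi> kms \<beta>])
qed

text \<open>All Gibbs states have the same GNS representation and differ in the cyclic vector only.\<close>

lemma Gibbs_quasi_equivalent:
  assumes s: "(\<lambda>e. exp (- \<beta>\<^sub>0 * h e)) summable_on B" "(\<lambda>e. exp (- \<beta> * h e)) summable_on B"
  shows "quasi_equivalent_states (Gibbs_functional \<beta>\<^sub>0) (Gibbs_functional \<beta>)"
proof -
  have "quasi_equivalent_reps amp_space (\<lambda>a. ampl (\<pi> a)) amp_space (\<lambda>a. ampl (\<pi> a))"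
    unfolding quasi_equivalent_reps_def Let_def by (rule exI[of _ id]) simp
  then show ?thesis unfolding quasi_equivalent_states_def
    using Gibbs_gns_triple[OF s(1)] Gibbs_gns_triple[OF s(2)] by blast
qed

end

section \<open>Admissible triples\<close>

text \<open>The norm of a positive diagonal operator is the supremum of its eigenvalues.\<close>

lemma onorm_eigenbasis:
  assumes B: "is_onb B" and T: "cblin T" "\<And>e. e \<in> B \<Longrightarrow> T e = complex_of_real (t e) *\<^sub>C e"
    and t: "\<And>e. e \<in> B \<Longrightarrow> 0 \<le> t e"
  shows "e \<in> B \<Longrightarrow> t e \<le> onorm T" and "0 \<le> C \<Longrightarrow> (\<And>e. e \<in> B \<Longrightarrow> t e \<le> C) \<Longrightarrow> onorm T \<le> C"
proof -
  assume e: "e \<in> B"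
  then have "norm e = 1" using B by (simp add: is_onb_def)
  then show "t e \<le> onorm T"
    using onorm[OF cblin_bounded_linear[OF T(1)], of e] T(2)[OF e] t[OF e] by (simp add: norm_scaleC_hilbert)
next
  assume C: "0 \<le> C" "\<And>e. e \<in> B \<Longrightarrow> t e \<le> C"
  have d: "cmod (complex_of_real (t e)) \<le> C" if "e \<in> B" for e using C(2) t that by simp
  have eq: "T = diag_op B (\<lambda>e. complex_of_real (t e))"
    by (rule onb_operator_eqI[OF B T(1) cblin_diag_op[OF B d]]) (simp_all add: T(2) diag_op_basis[OF B d])
  show "onorm T \<le> C" unfolding eq by (rule onorm_bound[OF C(1)]) (rule norm_diag_op[OF B d C(1)])
qed

text \<open>An eigenbasis of the density matrix \<open>\<rho>\<close> is an eigenbasis of the Hamiltonian \<open>H\<close>, which implements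
  the dynamics; \<open>\<phi>\<close> is its Gibbs state.\<close>

lemma admissible_hamiltonian_rep:
  fixes \<sigma> :: "real \<Rightarrow> 'a::{unital_cstar_algebra, second_countable_topology} \<Rightarrow> 'a"
    and \<pi> :: "'a \<Rightarrow> 'h::{chilbert_space, second_countable_topology} \<Rightarrow> 'h"
  assumes dyn: "cstar_dynamical_system \<sigma>" and kms: "KMS_state \<sigma> \<beta> \<phi>" and \<beta>: "\<beta> > 0"
    and adm: "admissible_triple \<phi> \<pi> \<rho>"
  obtains B r where "is_onb B" "\<And>e. e \<in> B \<Longrightarrow> \<rho> e = complex_of_real (r e) *\<^sub>C e"
    "\<And>e. e \<in> B \<Longrightarrow> 0 < r e" "r summable_on B" "hamiltonian_rep B \<sigma> \<pi> (\<lambda>e. - ln (r e) / \<beta>)"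
    "\<phi> = hamiltonian_rep.Gibbs_functional B \<pi> (\<lambda>e. - ln (r e) / \<beta>) \<beta>"
proof -
  have irr: "irreducible_rep UNIV \<pi>" and pos: "positive_op \<rho>" and tc: "trace_class \<rho>"
    and \<phi>: "\<And>a. \<phi> a = op_trace (\<pi> a \<circ> \<rho>) / op_trace \<rho>"
    using adm by (simp_all add: admissible_triple_def)
  note rep = irreducible_star_rep[OF irr] and c = positive_op_cblin[OF pos]
  obtain B r where B: "is_onb B" and r: "\<And>e. e \<in> B \<Longrightarrow> \<rho> e = complex_of_real (r e) *\<^sub>C e"
    and r0: "\<And>e. e \<in> B \<Longrightarrow> 0 \<le> r e" using trace_class_positive(2)[OF pos tc] by blast
  interpret amplification B by (rule amplification.intro[OF B])
  have s: "r summable_on B" by (rule trace_class_positive_diag_summable[OF B tc r r0])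
  have sc: "(\<lambda>e. cmod (complex_of_real (r e))) summable_on B"
    using s by (rule summable_on_cong[THEN iffD1, rotated]) (simp add: r0)
  define R where "R = (\<Sum>\<^sub>\<infinity>e\<in>B. r e)"
  have Rs: "(r has_sum R) B" unfolding R_def by (rule has_sum_infsum[OF s])
  have tr: "op_trace \<rho> = complex_of_real R"
    by (rule trans[OF op_trace_diag[OF B sc c r] infsumI[OF has_sum_of_real[OF Rs]]])
  have "\<phi> 1 = 1" using kms by (simp add: KMS_state_def is_state_def)
  then have "R \<noteq> 0" using \<phi>[of 1] by (auto simp: tr)
  moreover have "R \<ge> 0" using Rs r0 by (rule has_sum_nonneg)
  ultimately have R: "R > 0" by simp
  define w where "w e = r e / R" for e
  have w0: "\<And>e. e \<in> B \<Longrightarrow> 0 \<le> w e" using r0 R by (simp add: w_def)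
  have ws: "w summable_on B"
    using summable_on_cmult_left[OF s, of "1 / R"] by (simp add: w_def[abs_def])
  have form: "((\<lambda>e. complex_of_real (w e) * cinner e (\<pi> a e)) has_sum \<phi> a) B"
    and vec: "\<phi> a = cinner (gns_vec w) (ampl (\<pi> a) (gns_vec w))" for a
  proof -
    note ca = star_rep_cblin[OF rep, of a]
    have "((\<lambda>e. complex_of_real (r e) * cinner e (\<pi> a e)) has_sum op_trace (\<pi> a \<circ> \<rho>)) B"
      by (subst op_trace_comp_diag[OF B sc ca c r], assumption)
         (rule has_sum_infsum, rule diag_trace_cyclic(2)[OF B B sc ca cblin_id c r])
    from has_sum_cmult_right[OF this, of "1 / complex_of_real R"]
    show f: "((\<lambda>e. complex_of_real (w e) * cinner e (\<pi> a e)) has_sum \<phi> a) B"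
      by (simp add: \<phi> tr w_def)
    show "\<phi> a = cinner (gns_vec w) (ampl (\<pi> a) (gns_vec w))"
      by (rule has_sum_unique[OF f gns_vec_form[OF w0 ws ca]])
  qed
  have ne: "\<exists>e\<in>B. w e \<noteq> 0"
  proof (rule ccontr)
    assume "\<not> ?thesis"
    then have "(r has_sum 0) B" using R by (intro has_sum_0) (auto simp: w_def)
    then show False using Rs R has_sum_unique by fastforce
  qed
  note mod = KMS_density_modular[OF dyn irr w0 ws ne vec kms \<beta>]
  have rpos: "\<And>e. e \<in> B \<Longrightarrow> 0 < r e" using mod(1) R by (simp add: w_def zero_less_divide_iff)
  let ?h = "\<lambda>e. - ln (r e) / \<beta>"
  have ham: "hamiltonian_rep B \<sigma> \<pi> ?h"
  proof (unfold_locales, rule dyn, rule irr)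
    fix a F e f z assume F: "analytic_extension \<sigma> a F" and e: "e \<in> B" "f \<in> B"
    have "ln (w e) = ln (r e) - ln R" if "e \<in> B" for e
      unfolding w_def by (rule ln_divide_pos[OF rpos[OF that] R])
    then have "- ln (w e) / \<beta> - - ln (w f) / \<beta> = ?h e - ?h f"
      using e by (simp add: diff_divide_distrib)
    then show "cinner e (\<pi> (F z) f) = exp (\<i> * z * complex_of_real (?h e - ?h f)) * cinner e (\<pi> a f)"
      using mod(2)[OF _ F e, of z] by simp
  qed
  interpret hamiltonian_rep B \<sigma> \<pi> ?h by (rule ham)
  have ex: "exp (- \<beta> * ?h e) = r e" if "e \<in> B" for e using rpos[OF that] \<beta> by simp
  have "Gibbs_sum \<beta> = R" unfolding Gibbs_sum_def R_def by (rule infsum_cong[OF ex])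
  then have gw: "Gibbs_weight \<beta> e = w e" if "e \<in> B" for e unfolding Gibbs_weight_def w_def ex[OF that] by simp
  have "\<phi> = Gibbs_functional \<beta>"
  proof
    fix a
    have "Gibbs_functional \<beta> a = (\<Sum>\<^sub>\<infinity>e\<in>B. complex_of_real (w e) * cinner e (\<pi> a e))"
      unfolding Gibbs_functional_def by (rule infsum_cong) (simp only: gw)
    then show "\<phi> a = Gibbs_functional \<beta> a" using infsumI[OF form] by simp
  qed
  then show ?thesis using that B r rpos s ham by blast
qed

text \<open>A unitary equivalence of multiples has a nonzero block, which by Schur's lemma is a multiple
  of a unitary.\<close>

lemma irreducible_equivalent:
  fixes B :: "'h::{chilbert_space, second_countable_topology} set"
    and B' :: "'k::{chilbert_space, second_countable_topology} set"
  assumes B: "is_onb B" "is_onb B'" and irr: "irreducible_rep UNIV \<pi>" "irreducible_rep UNIV \<pi>'"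
    and g: "gns_triple \<phi> (amplification.amp_space B) (\<lambda>a. amplification.ampl B (\<pi> a)) \<xi>"
      "gns_triple \<phi> (amplification.amp_space B') (\<lambda>a. amplification.ampl B' (\<pi>' a)) \<xi>'"
  shows "\<exists>W W'. cblin W \<and> cblin W' \<and> adjoints W W' \<and> (\<forall>x. W' (W x) = x) \<and> (\<forall>y. W (W' y) = y) \<and>
    (\<forall>a x. W (\<pi> a x) = \<pi>' a (W x))"
proof -
  interpret A: amplification B by (rule amplification.intro[OF B(1)])
  interpret A': amplification B' by (rule amplification.intro[OF B(2)])
  note c = star_rep_cblin[OF irreducible_star_rep[OF irr(1)]] and c' = star_rep_cblin[OF irreducible_star_rep[OF irr(2)]]
  obtain U V where u: "unitary_intertwiner A.amp_space (\<lambda>a. A.ampl (\<pi> a)) A'.amp_space (\<lambda>a. A'.ampl (\<pi>' a)) U V"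
    using GNS_unique[OF g] by blast
  have U: "cblin U" "cblin V" "adjoints U V" "\<And>x. U x \<in> A'.amp_space" "\<And>x. V (U x) = orth_proj A.amp_space x"
    "\<And>a x. U (A.ampl (\<pi> a) x) = A'.ampl (\<pi>' a) (U x)" "\<And>a y. V (A'.ampl (\<pi>' a) y) = A.ampl (\<pi> a) (V y)"
    using u by (simp_all add: unitary_intertwiner_def)
  obtain e where e: "e \<in> B" using A.B_nonempty[OF irr(1)] by blast
  obtain x0 :: 'h where x0: "x0 \<noteq> 0" using irreducible_nontrivial[OF irr(1)] by blast
  have "U (A.emb e x0) \<noteq> 0"
  proof
    assume "U (A.emb e x0) = 0"
    then have "A.emb e x0 = 0"
      using U(5)[of "A.emb e x0"] orth_proj_id[OF A.closed_csubspace_amp_space A.emb_in[OF e]]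
      by (simp add: cblin_zero[OF U(2)])
    then show False using A.norm_emb[OF e, of x0] x0 by simp
  qed
  moreover have "0 \<in> A'.amp_space" using A'.closed_csubspace_amp_space by (simp add: closed_csubspace_def)
  ultimately have "\<not> (\<forall>f\<in>B'. A'.coemb f (U (A.emb e x0)) = A'.coemb f 0)" using A'.amp_space_eqI[OF U(4)] by blast
  then obtain f where f: "f \<in> B'" and nz: "A'.coemb f (U (A.emb e x0)) \<noteq> 0"
    using cblin_zero[OF A'.cblin_coemb] by force
  define W where "W x = A'.coemb f (U (A.emb e x))" for x
  define W' where "W' y = A.coemb e (V (A'.emb f y))" for y
  have W: "cblin W" "cblin W'" unfolding W_def W'_def
    by (rule cblin_compose[OF A'.cblin_coemb[OF f] cblin_compose[OF U(1) A.cblin_emb[OF e]]],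
        rule cblin_compose[OF A.cblin_coemb[OF e] cblin_compose[OF U(2) A'.cblin_emb[OF f]]])
  have adj: "adjoints W W'"
    unfolding adjoints_def W_def W'_def
    by (simp add: adjointsD[OF adjoints_sym[OF A'.emb_coemb_adjoints[OF f]]] adjointsD[OF U(3)]
        adjointsD[OF A.emb_coemb_adjoints[OF e]])
  have int: "W (\<pi> a x) = \<pi>' a (W x)" for a x
    by (simp add: W_def A.ampl_emb[OF c e, symmetric] U(6) A'.coemb_ampl[OF c' f])
  have int': "W' (\<pi>' a x) = \<pi> a (W' x)" for a x
    by (simp add: W'_def A'.ampl_emb[OF c' f, symmetric] U(7) A.coemb_ampl[OF c e])
  obtain k where k: "\<And>x. W' (W x) = k *\<^sub>C x"
    using Schur[OF irr(1) cblin_compose[OF W(2,1)]] by (auto simp: int int')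
  obtain k' where k': "\<And>x. W (W' x) = k' *\<^sub>C x"
    using Schur[OF irr(2) cblin_compose[OF W]] by (auto simp: int int')
  have Wx0: "W x0 \<noteq> 0" using nz by (simp add: W_def)
  have "k *\<^sub>C W x0 = k' *\<^sub>C W x0" using k'[of "W x0"] by (simp add: k cblin_scaleC[OF W(1)])
  then have "(k - k') *\<^sub>C W x0 = 0" by (simp add: cvec.scale_left_diff_distrib)
  then have kk: "k' = k" using Wx0 by simp
  have q: "complex_of_real ((norm (W x0))\<^sup>2) = k * complex_of_real ((norm x0)\<^sup>2)"
    unfolding cinner_self[symmetric] by (simp add: adjointsD[OF adj] k cinner_scaleC_right)
  define l where "l = (norm (W x0))\<^sup>2 / (norm x0)\<^sup>2"
  have l: "l > 0" using Wx0 x0 by (simp add: l_def)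
  have kl: "k = complex_of_real l" using q x0 unfolding l_def of_real_divide by (simp add: field_simps)
  define s where "s = complex_of_real (1 / sqrt l)"
  have ss: "s * s * k = 1" using l unfolding s_def kl of_real_mult[symmetric] by simp
  have cs: "cnj s = s" by (simp add: s_def)
  show ?thesis
  proof (intro exI conjI allI)
    show "cblin (\<lambda>x. s *\<^sub>C W x)" "cblin (\<lambda>x. s *\<^sub>C W' x)" by (intro cblin_scale W)+
    show "adjoints (\<lambda>x. s *\<^sub>C W x) (\<lambda>x. s *\<^sub>C W' x)" using adjoints_scale[OF adj, of s] by (simp add: cs)
    show "s *\<^sub>C W' (s *\<^sub>C W x) = x" for x
      by (simp add: cblin_scaleC[OF W(2)] k scaleC_scaleC mult.assoc[symmetric] ss)
    show "s *\<^sub>C W (s *\<^sub>C W' x) = x" for x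
      by (simp add: cblin_scaleC[OF W(1)] k' kk scaleC_scaleC mult.assoc[symmetric] ss)
    show "s *\<^sub>C W (\<pi> a x) = \<pi>' a (s *\<^sub>C W x)" for a x by (simp add: int cblin_scaleC[OF c'])
  qed
qed

text \<open>Schur's lemma provides a unitary \<open>W\<close> between the two representations, so an eigenbasis \<open>B'\<close> of \<open>\<rho>'\<close>
  is transported to a basis \<open>C\<close> in which \<open>\<pi>\<close> has a diagonal Hamiltonian. Since \<open>\<phi>\<close> is a KMS state, it is
  the Gibbs state of this Hamiltonian, with the same values on matrix units as those computed from \<open>\<rho>\<close>.
  Thus \<open>\<rho>\<close> is a multiple \<open>k\<close> of the transported \<open>\<rho>'\<close>, and both have norm \<open>1\<close>.\<close>

lemma admissible_spectrum_unique:
  fixes \<sigma> :: "real \<Rightarrow> 'a::{unital_cstar_algebra, second_countable_topology} \<Rightarrow> 'a"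
    and \<pi> :: "'a \<Rightarrow> 'h::{chilbert_space, second_countable_topology} \<Rightarrow> 'h"
    and \<pi>' :: "'a \<Rightarrow> 'k::{chilbert_space, second_countable_topology} \<Rightarrow> 'k"
  assumes dyn: "cstar_dynamical_system \<sigma>" and kms: "KMS_state \<sigma> \<beta> \<phi>" and \<beta>: "\<beta> > 0"
    and adm: "admissible_triple \<phi> \<pi> \<rho>" and adm': "admissible_triple \<phi> \<pi>' \<rho>'"
  obtains B B' r W where "is_onb B" "is_onb B'" "bij_betw W B B'"
    "\<And>e. e \<in> B \<Longrightarrow> 0 < r e" "\<And>e. e \<in> B \<Longrightarrow> \<rho> e = complex_of_real (r e) *\<^sub>C e"
    "\<And>e. e \<in> B \<Longrightarrow> \<rho>' (W e) = complex_of_real (r e) *\<^sub>C W e"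
proof -
  obtain B r where B: "is_onb B" and r: "\<And>e. e \<in> B \<Longrightarrow> \<rho> e = complex_of_real (r e) *\<^sub>C e"
    and r0: "\<And>e. e \<in> B \<Longrightarrow> 0 < r e" and rs: "r summable_on B" and ham: "hamiltonian_rep B \<sigma> \<pi> (\<lambda>e. - ln (r e) / \<beta>)"
    and \<phi>: "\<phi> = hamiltonian_rep.Gibbs_functional B \<pi> (\<lambda>e. - ln (r e) / \<beta>) \<beta>"
    using admissible_hamiltonian_rep[OF dyn kms \<beta> adm] by metis
  obtain B' r' where B': "is_onb B'" and r': "\<And>e. e \<in> B' \<Longrightarrow> \<rho>' e = complex_of_real (r' e) *\<^sub>C e"
    and r'0: "\<And>e. e \<in> B' \<Longrightarrow> 0 < r' e" and r's: "r' summable_on B'" and ham': "hamiltonian_rep B' \<sigma> \<pi>' (\<lambda>e. - ln (r' e) / \<beta>)"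
    and \<phi>': "\<phi> = hamiltonian_rep.Gibbs_functional B' \<pi>' (\<lambda>e. - ln (r' e) / \<beta>) \<beta>"
    using admissible_hamiltonian_rep[OF dyn kms \<beta> adm'] by metis
  interpret R: hamiltonian_rep B \<sigma> \<pi> "\<lambda>e. - ln (r e) / \<beta>" by (rule ham)
  interpret R': hamiltonian_rep B' \<sigma> \<pi>' "\<lambda>e. - ln (r' e) / \<beta>" by (rule ham')
  have ex: "exp (- \<beta> * (- ln (r e) / \<beta>)) = r e" if "e \<in> B" for e using r0[OF that] \<beta> by simp
  have ex': "exp (- \<beta> * (- ln (r' e) / \<beta>)) = r' e" if "e \<in> B'" for e using r'0[OF that] \<beta> by simp
  have s: "(\<lambda>e. exp (- \<beta> * (- ln (r e) / \<beta>))) summable_on B"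
    using rs by (rule summable_on_cong[THEN iffD2, rotated]) (rule ex)
  have s': "(\<lambda>e. exp (- \<beta> * (- ln (r' e) / \<beta>))) summable_on B'"
    using r's by (rule summable_on_cong[THEN iffD2, rotated]) (rule ex')
  obtain W W' where W: "cblin W" "cblin W'" and adj: "adjoints W W'" and WW: "\<And>x. W' (W x) = x" "\<And>y. W (W' y) = y"
    and int: "\<And>a x. W (\<pi> a x) = \<pi>' a (W x)"
    using irreducible_equivalent[OF B B' R.irr R'.irr R.Gibbs_gns_triple[OF s, folded \<phi>]
        R'.Gibbs_gns_triple[OF s', folded \<phi>']] by blast
  have WB: "bij_betw W (W' ` B') B'" by (rule bij_betw_byWitness[where f' = W']) (auto simp: WW)
  define C where "C = W' ` B'"
  have C: "is_onb C"
    unfolding is_onb_def C_def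
  proof (intro conjI ballI allI impI)
    have cW: "cinner (W' x) (W' y) = cinner x y" for x y by (simp add: adjointsD[OF adjoints_sym[OF adj]] WW)
    fix e assume "e \<in> W' ` B'" 
    then obtain b where b: "b \<in> B'" "e = W' b" by blast
    have "norm b = 1" using B' b(1) by (simp add: is_onb_def)
    then show "norm e = 1" unfolding norm_eq_1_cinner[symmetric] b(2) cW by (simp add: cinner_self)
    fix f assume "f \<in> W' ` B'" "e \<noteq> f"
    then obtain b' where b': "b' \<in> B'" "f = W' b'" "b \<noteq> b'" using b(2) by blast
    then show "cinner e f = 0" unfolding b(2) b'(2) cW using B' b(1) by (simp add: is_onb_def)
  next
    fix x assume "\<forall>e\<in>W' ` B'. cinner e x = 0"
    then have "\<forall>b\<in>B'. cinner b (W x) = 0" by (simp add: adjointsD[OF adjoints_sym[OF adj]])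
    then have "W x = 0" using B' by (simp add: is_onb_def)
    then show "x = 0" using WW(1)[of x] by (simp add: cblin_zero[OF W(2)])
  qed
  have WC: "W e \<in> B'" if "e \<in> C" for e using that by (auto simp: C_def WW)
  let ?h = "\<lambda>e. - ln (r' (W e)) / \<beta>"
  have hamC: "hamiltonian_rep C \<sigma> \<pi> ?h"
  proof (unfold_locales, rule C, rule dyn, rule R.irr)
    fix a F e f z assume F: "analytic_extension \<sigma> a F" and e: "e \<in> C" "f \<in> C"
    have "cinner e (\<pi> b f) = cinner (W e) (\<pi>' b (W f))" for b
      by (simp add: int[symmetric] adjointsD[OF adj] WW)
    then show "cinner e (\<pi> (F z) f) = exp (\<i> * z * complex_of_real (?h e - ?h f)) * cinner e (\<pi> a f)"
      using R'.modular[OF F WC[OF e(1)] WC[OF e(2)], of z] by simp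
  qed
  interpret RC: hamiltonian_rep C \<sigma> \<pi> ?h by (rule hamC)
  let ?w = "R.Gibbs_weight \<beta>"
  note w = R.Gibbs_weight_pos[OF s, THEN less_imp_le] R.Gibbs_weight_summable[OF s]
  have wC: "cinner (R.gns_vec ?w) (R.ampl (rank1 e f) (R.gns_vec ?w)) =
      (if e = f then complex_of_real (RC.Gibbs_weight \<beta> e) else 0)" if "e \<in> C" "f \<in> C" for e f
    by (rule normal_extension.KMS_is_Gibbs(3)[OF RC.ampl_normal_extension[OF B] R.gns_vec_in[OF w] _ kms \<beta> that])
       (unfold \<phi>, rule R.Gibbs_functional_vector[OF s])
  have sC: "(\<lambda>e. exp (- \<beta> * ?h e)) summable_on C"
    by (rule normal_extension.KMS_is_Gibbs(1)[OF RC.ampl_normal_extension[OF B] R.gns_vec_in[OF w] _ kms \<beta>])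
       (unfold \<phi>, rule R.Gibbs_functional_vector[OF s])
  define k where "k = R.Gibbs_sum \<beta> / RC.Gibbs_sum \<beta>"
  have k: "k > 0" using R.Gibbs_sum_pos[OF s] RC.Gibbs_sum_pos[OF sC] by (simp add: k_def)
  have pos: "positive_op \<rho>" "positive_op \<rho>'" and n1: "onorm \<rho> = 1" "onorm \<rho>' = 1"
    using adm adm' by (simp_all add: admissible_triple_def)
  note c\<rho> = positive_op_cblin[OF pos(1)] and c\<rho>' = positive_op_cblin[OF pos(2)]
  have \<rho>C: "\<rho> e = complex_of_real (k * r' (W e)) *\<^sub>C e" if e: "e \<in> C" for e
  proof (rule onb_coords_eqI[OF C])
    fix f assume f: "f \<in> C"
    have "((\<lambda>b. complex_of_real (?w b) * cinner b (rank1 e f b)) has_sum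
        (if e = f then complex_of_real (RC.Gibbs_weight \<beta> e) else 0)) B"
      unfolding wC[OF e f, symmetric] by (rule R.gns_vec_form[OF w cblin_rank1])
    from has_sum_cmult_right[OF this, of "complex_of_real (R.Gibbs_sum \<beta>)"]
    have "((\<lambda>b. complex_of_real (R.Gibbs_sum \<beta>) * (complex_of_real (?w b) * cinner b (rank1 e f b))) has_sum
        complex_of_real (R.Gibbs_sum \<beta>) * (if e = f then complex_of_real (RC.Gibbs_weight \<beta> e) else 0)) B" .
    moreover have "complex_of_real (R.Gibbs_sum \<beta>) * (if e = f then complex_of_real (RC.Gibbs_weight \<beta> e) else 0) =
        (if e = f then complex_of_real (k * r' (W e)) else 0)"
      unfolding RC.Gibbs_weight_def ex'[OF WC[OF e]] k_def by simp
    ultimately have 1: "((\<lambda>b. complex_of_real (R.Gibbs_sum \<beta>) * (complex_of_real (?w b) * cinner b (rank1 e f b))) has_sum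
        (if e = f then complex_of_real (k * r' (W e)) else 0)) B"
      by (simp only:)
    have 2: "((\<lambda>b. cinner f b * cinner b (\<rho> e)) has_sum cinner f (\<rho> e)) B"
      using onb_Parseval[OF B, of f "\<rho> e"] by (simp flip: cinner_commute)
    have "cinner f (\<rho> e) = (if e = f then complex_of_real (k * r' (W e)) else 0)"
    proof (rule has_sum_unique[OF 2], rule has_sum_cong[THEN iffD1, OF _ 1])
      fix b assume b: "b \<in> B"
      have "R.Gibbs_sum \<beta> * ?w b = r b" using R.Gibbs_sum_pos[OF s] unfolding R.Gibbs_weight_def ex[OF b] by simp
      then have "complex_of_real (R.Gibbs_sum \<beta>) * (complex_of_real (?w b) * x) = complex_of_real (r b) * x" for x
        unfolding mult.assoc[symmetric] of_real_mult[symmetric] by simp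
      then show "complex_of_real (R.Gibbs_sum \<beta>) * (complex_of_real (?w b) * cinner b (rank1 e f b)) = cinner f b * cinner b (\<rho> e)"
        by (simp add: cinner_eigen_expansion[OF B c\<rho> r b] rank1_def cinner_scaleC_right mult_ac)
    qed
    then show "cinner f (\<rho> e) = cinner f (complex_of_real (k * r' (W e)) *\<^sub>C e)"
      using orthonormal_familyD[OF is_onb_orthonormal[OF C] f e] by (simp add: cinner_scaleC_right)
  qed
  have "k = 1"
  proof (rule antisym)
    have p: "\<And>e. e \<in> C \<Longrightarrow> 0 \<le> k * r' (W e)" using k r'0[OF WC] less_imp_le by (metis mult_pos_pos)
    have b1: "k * r' (W e) \<le> 1" if "e \<in> C" for e using onorm_eigenbasis(1)[OF C c\<rho> \<rho>C p that] n1 by simp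
    have b2: "r' e \<le> 1" if "e \<in> B'" for e using onorm_eigenbasis(1)[OF B' c\<rho>' r' r'0[THEN less_imp_le] that] n1 by simp
    have "onorm \<rho>' \<le> 1 / k"
    proof (rule onorm_eigenbasis(2)[OF B' c\<rho>' r' r'0[THEN less_imp_le]])
      fix e assume e: "e \<in> B'"
      have "k * r' (W (W' e)) \<le> 1" by (rule b1) (use e in \<open>simp add: C_def\<close>)
      then show "r' e \<le> 1 / k" using k by (simp add: WW field_simps)
    qed (use k in simp_all)
    then show "k \<le> 1" using n1 k by (simp add: field_simps)
    have "onorm \<rho> \<le> k"
      by (rule onorm_eigenbasis(2)[OF C c\<rho> \<rho>C p]) (use k b2[OF WC] in simp_all)
    then show "1 \<le> k" using n1 by simp
  qed
  then show ?thesis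
    using that[of C B' W "\<lambda>e. r' (W e)"] C B' WB[folded C_def] \<rho>C r'0[OF WC] r'[OF WC] by simp
qed

section \<open>Exponentials of a diagonal Hamiltonian\<close>

text \<open>In a basis of eigenvectors, every operator of the theorem is diagonal, and statements about its trace
  become statements about series of exponentials.\<close>

lemma represented_hamiltonian_diag:
  assumes B: "is_onb B" and T: "cblin T" "\<And>e. e \<in> B \<Longrightarrow> T e = complex_of_real (t e) *\<^sub>C e"
  shows "represented_hamiltonian \<beta> T = diag_graph B (\<lambda>e. complex_of_real (- 1 / \<beta> * ln (t e)))"
proof -
  have "op_graph T = diag_graph B (\<lambda>e. complex_of_real (t e))" by (rule op_graph_eq_diag_graph[OF B T])
  then show ?thesis unfolding represented_hamiltonian_def by (simp only: fun_calc_diag_graph[OF B])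
qed

context
  fixes B :: "'h::chilbert_space set" and h :: "'h \<Rightarrow> real" and H :: "('h \<times> 'h) set"
  assumes B: "is_onb B" and H: "H = diag_graph B (\<lambda>e. complex_of_real (h e))"
begin

lemma neg_exp_diag: "neg_exp s H = diag_graph B (\<lambda>e. exp (- s * complex_of_real (h e)))"
  unfolding neg_exp_def H by (rule fun_calc_diag_graph[OF B])

lemma neg_exp_diag_real: "neg_exp (complex_of_real b) H = diag_graph B (\<lambda>e. complex_of_real (exp (- b * h e)))"
  unfolding neg_exp_diag by (rule diag_graph_cong) (simp add: exp_of_real[symmetric])

lemma norm_neg_exp: "cmod (exp (- s * complex_of_real (h e))) = exp (- Re s * h e)"
  by (simp add: norm_exp_eq_Re)

lemma trace_class_neg_exp:
  "(\<lambda>e. exp (- Re s * h e)) summable_on B \<Longrightarrow> trace_class_graph (neg_exp s H)"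
  unfolding neg_exp_diag by (rule trace_class_graph_diag[OF B]) (simp only: norm_neg_exp)

lemma trace_class_neg_exp_iff:
  "trace_class_graph (neg_exp (complex_of_real b) H) \<longleftrightarrow> (\<lambda>e. exp (- b * h e)) summable_on B"
proof
  assume "trace_class_graph (neg_exp (complex_of_real b) H)"
  then obtain T where T: "diag_graph B (\<lambda>e. complex_of_real (exp (- b * h e))) = op_graph T" "trace_class T"
    unfolding neg_exp_diag_real trace_class_graph_def by blast
  show "(\<lambda>e. exp (- b * h e)) summable_on B"
    by (rule trace_class_positive_diag_summable[OF B T(2) op_graph_diag_graphD[OF B T(1)]]) simp_all
qed (use trace_class_neg_exp[of "complex_of_real b"] in simp)

lemma op_trace_neg_exp:
  assumes s: "(\<lambda>e. exp (- Re s * h e)) summable_on B"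
  shows "op_trace (of_graph (neg_exp s H)) = (\<Sum>\<^sub>\<infinity>e\<in>B. exp (- s * complex_of_real (h e)))"
proof -
  have d: "(\<lambda>e. cmod (exp (- s * complex_of_real (h e)))) summable_on B" using s by (simp only: norm_neg_exp)
  show ?thesis
    unfolding neg_exp_diag trace_class_diag(2)[OF B d] of_graph_op_graph
    by (rule op_trace_diag[OF B d trace_class_diag(3)[OF B d] trace_class_diag(4)[OF B d]])
qed

text \<open>For nonnegative energies summability is monotone in the inverse temperature. Nonnegativity comes from the
  normalisation \<open>\<parallel>\<rho>\<parallel> = 1\<close>.\<close>

lemma summable_above_critical:
  assumes h: "\<And>e. e \<in> B \<Longrightarrow> 0 \<le> h e" and s: "critical_beta H < ereal x"
  shows "(\<lambda>e. exp (- x * h e)) summable_on B"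
proof -
  obtain b where b: "trace_class_graph (neg_exp (complex_of_real b) H)" "b < x"
    using s unfolding critical_beta_def Inf_less_iff by auto
  show ?thesis
  proof (rule summable_on_comparison_test)
    show "(\<lambda>e. exp (- b * h e)) summable_on B" using b(1) by (simp only: trace_class_neg_exp_iff)
    show "exp (- x * h e) \<le> exp (- b * h e)" if "e \<in> B" for e
      using mult_right_mono[of b x "h e"] b(2) h[OF that] by simp
  qed simp
qed

end

text \<open>Density matrices of two admissible triples have the same eigenvalues with the same multiplicities, so the
  trace in the definition of the partition function does not depend on the triple.\<close>

lemma partition_trace_unique:
  fixes \<sigma> :: "real \<Rightarrow> 'a::{unital_cstar_algebra, second_countable_topology} \<Rightarrow> 'a"
    and \<rho> :: "'h::{chilbert_space, second_countable_topology} \<Rightarrow> 'h"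
    and \<rho>' :: "'k::{chilbert_space, second_countable_topology} \<Rightarrow> 'k"
  assumes dyn: "cstar_dynamical_system \<sigma>" and kms: "KMS_state \<sigma> \<beta> \<phi>" and \<beta>: "\<beta> > 0"
    and adm: "admissible_triple \<phi> \<pi> \<rho>" and adm': "admissible_triple \<phi> \<pi>' \<rho>'"
    and tc: "trace_class_graph (neg_exp (complex_of_real (Re s)) (represented_hamiltonian \<beta> \<rho>))"
  shows "op_trace (of_graph (neg_exp s (represented_hamiltonian \<beta> \<rho>'))) =
    op_trace (of_graph (neg_exp s (represented_hamiltonian \<beta> \<rho>)))"
proof -
  obtain B B' r W where B: "is_onb B" "is_onb B'" and W: "bij_betw W B B'"
    and r: "\<And>e. e \<in> B \<Longrightarrow> \<rho> e = complex_of_real (r e) *\<^sub>C e"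
    and r': "\<And>e. e \<in> B \<Longrightarrow> \<rho>' (W e) = complex_of_real (r e) *\<^sub>C W e"
    using admissible_spectrum_unique[OF dyn kms \<beta> adm adm'] by metis
  have c: "cblin \<rho>" "cblin \<rho>'" using adm adm' by (simp_all add: admissible_triple_def positive_op_cblin)
  define V where "V = the_inv_into B W"
  have VW: "V (W e) = e" if "e \<in> B" for e
    unfolding V_def by (rule the_inv_into_f_f[OF bij_betw_imp_inj_on[OF W] that])
  have r'': "\<rho>' f = complex_of_real (r (V f)) *\<^sub>C f" if "f \<in> B'" for f
    using that r' VW bij_betw_imp_surj_on[OF W] by auto
  let ?l = "\<lambda>e. - 1 / \<beta> * ln (r e)"
  note H = represented_hamiltonian_diag[OF B(1) c(1) r] and H' = represented_hamiltonian_diag[OF B(2) c(2) r'']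
  have s: "(\<lambda>e. exp (- Re s * ?l e)) summable_on B"
    using tc by (rule trace_class_neg_exp_iff[OF B(1) H, THEN iffD1, rotated])
  have "(\<lambda>e. exp (- Re s * ?l (V (W e)))) summable_on B"
    using s by (rule summable_on_cong[THEN iffD1, rotated]) (simp only: VW)
  then have s': "(\<lambda>f. exp (- Re s * ?l (V f))) summable_on B'"
    by (simp only: summable_on_reindex_bij_betw[OF W, of "\<lambda>f. exp (- Re s * ?l (V f))"])
  have "(\<Sum>\<^sub>\<infinity>f\<in>B'. exp (- s * complex_of_real (?l (V f)))) = (\<Sum>\<^sub>\<infinity>e\<in>B. exp (- s * complex_of_real (?l (V (W e)))))"
    by (rule infsum_reindex_bij_betw[OF W, symmetric])
  also have "\<dots> = (\<Sum>\<^sub>\<infinity>e\<in>B. exp (- s * complex_of_real (?l e)))" by (rule infsum_cong) (simp only: VW)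
  finally show ?thesis
    using op_trace_neg_exp[OF B(1) H s] op_trace_neg_exp[OF B(2) H' s'] by simp
qed

context hamiltonian_rep
begin

lemma gibbs_state_eq_Gibbs_functional:
  assumes H: "H = diag_graph B (\<lambda>e. complex_of_real (h e))"
    and s: "(\<lambda>e. exp (- \<beta> * h e)) summable_on B"
  shows "gibbs_state \<pi> H \<beta> = Gibbs_functional \<beta>"
proof
  fix a
  let ?d = "\<lambda>e. complex_of_real (exp (- \<beta> * h e))"
  have d: "(\<lambda>e. cmod (?d e)) summable_on B" using s by simp
  note D = trace_class_diag[OF B d]
  have "gibbs_state \<pi> H \<beta> a = op_trace (\<pi> a \<circ> diag_op B ?d) / op_trace (diag_op B ?d)"
    unfolding gibbs_state_def neg_exp_diag_real[OF B H] D(2) of_graph_op_graph ..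
  also have "op_trace (\<pi> a \<circ> diag_op B ?d) = (\<Sum>\<^sub>\<infinity>e\<in>B. ?d e * cinner e (\<pi> a e))"
    by (rule op_trace_comp_diag[OF B d cblin_rep D(3) D(4)])
  also have "op_trace (diag_op B ?d) = complex_of_real (Gibbs_sum \<beta>)"
    by (rule trans[OF op_trace_diag[OF B d D(3) D(4)] infsumI[OF has_sum_of_real[OF Gibbs_sum_has_sum[OF s]]]])
  also have "(\<Sum>\<^sub>\<infinity>e\<in>B. ?d e * cinner e (\<pi> a e)) / complex_of_real (Gibbs_sum \<beta>) = Gibbs_functional \<beta> a"
    unfolding Gibbs_functional_def divide_inverse infsum_cmult_left'[symmetric] Gibbs_weight_def
    by (rule infsum_cong) simp
  finally show "gibbs_state \<pi> H \<beta> a = Gibbs_functional \<beta> a" .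
qed

text \<open>The norm of \<open>e\<^bsup>-\<beta>H\<^esup>\<close> is \<open>e\<^bsup>-\<beta> inf h\<^esup>\<close>, so it is \<open>1\<close> for all \<open>\<beta>\<close> if it is \<open>1\<close> for one.\<close>

lemma onorm_exp_eq_1:
  assumes \<beta>: "\<beta> > 0" "\<beta>\<^sub>0 > 0" and h: "\<And>e. e \<in> B \<Longrightarrow> 0 \<le> h e"
    and T: "cblin T" "\<And>e. e \<in> B \<Longrightarrow> T e = complex_of_real (exp (- \<beta> * h e)) *\<^sub>C e"
    and T0: "cblin T\<^sub>0" "\<And>e. e \<in> B \<Longrightarrow> T\<^sub>0 e = complex_of_real (exp (- \<beta>\<^sub>0 * h e)) *\<^sub>C e" "onorm T\<^sub>0 = 1"
  shows "onorm T = 1"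
proof (rule antisym)
  show "onorm T \<le> 1" by (rule onorm_eigenbasis(2)[OF B T]) (use \<beta> h in simp_all)
  have le: "exp (- \<beta> * h e) \<le> onorm T" if "e \<in> B" for e
    by (rule onorm_eigenbasis(1)[OF B T _ that]) simp_all
  have pos: "0 < onorm T" using B_nonempty[OF irr] le exp_gt_zero order_less_le_trans by blast
  have "onorm T\<^sub>0 \<le> onorm T powr (\<beta>\<^sub>0 / \<beta>)"
  proof (rule onorm_eigenbasis(2)[OF B T0(1,2)])
    fix e assume e: "e \<in> B"
    have "exp (- \<beta>\<^sub>0 * h e) = exp (- \<beta> * h e) powr (\<beta>\<^sub>0 / \<beta>)" using \<beta> by (simp add: powr_def)
    also have "\<dots> \<le> onorm T powr (\<beta>\<^sub>0 / \<beta>)" by (rule powr_mono2) (use \<beta> le[OF e] in simp_all)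
    finally show "exp (- \<beta>\<^sub>0 * h e) \<le> onorm T powr (\<beta>\<^sub>0 / \<beta>)" .
  qed simp_all
  then have "1 \<le> onorm T powr (\<beta>\<^sub>0 / \<beta>)" using T0(3) by simp
  moreover have "onorm T powr (\<beta>\<^sub>0 / \<beta>) < 1" if "onorm T < 1"
    using powr_less_mono2[of "\<beta>\<^sub>0 / \<beta>" "onorm T" 1] that pos \<beta> by simp
  ultimately show "1 \<le> onorm T" by force
qed

end

theorem proposition2p5:
  fixes \<sigma> :: "real \<Rightarrow> 'a::{unital_cstar_algebra, second_countable_topology} \<Rightarrow> 'a"
    and \<phi> :: "'a \<Rightarrow> complex"
    and \<pi> :: "'a \<Rightarrow> 'h::{chilbert_space, second_countable_topology} \<Rightarrow> 'h"
    and \<rho> :: "'h \<Rightarrow> 'h"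
    and H :: "('h \<times> 'h) set"
    and \<beta>\<^sub>0 :: real
  assumes "cstar_dynamical_system \<sigma>"
    and "0 < \<beta>\<^sub>0"
    and "extremal_KMS_state \<sigma> \<beta>\<^sub>0 \<phi>"
    and "type_I_state \<phi>"
    and "admissible_triple \<phi> \<pi> \<rho>"
    and "H = represented_hamiltonian \<beta>\<^sub>0 \<rho>"
  shows
    "(\<forall>\<beta>>0. neg_exp (complex_of_real \<beta>) H = op_graph (op_powr \<rho> (\<beta> / \<beta>\<^sub>0))) \<and>
     (\<forall>s. critical_beta H < ereal (Re s) \<longrightarrow> trace_class_graph (neg_exp s H)) \<and>
     (\<forall>\<beta>>0. trace_class_graph (neg_exp (complex_of_real \<beta>) H) \<longrightarrow>
        extremal_KMS_state \<sigma> \<beta> (gibbs_state \<pi> H \<beta>) \<and>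
        type_I_state (gibbs_state \<pi> H \<beta>) \<and>
        admissible_triple (gibbs_state \<pi> H \<beta>) \<pi> (op_powr \<rho> (\<beta> / \<beta>\<^sub>0)) \<and>
        represented_hamiltonian \<beta> (op_powr \<rho> (\<beta> / \<beta>\<^sub>0)) = H \<and>
        (\<forall>s. critical_beta H < ereal (Re s) \<longrightarrow>
           partition_function TYPE('h) \<beta> (gibbs_state \<pi> H \<beta>) s = op_trace (of_graph (neg_exp s H)))) \<and>
     {\<psi>. (\<exists>\<beta>>0. KMS_state \<sigma> \<beta> \<psi>) \<and> quasi_equivalent_states \<phi> \<psi>} =
       {gibbs_state \<pi> H \<beta> |\<beta>. 0 < \<beta> \<and> trace_class_graph (neg_exp (complex_of_real \<beta>) H)} \<and>
     ((\<forall>b>0. critical_beta H = ereal b \<longrightarrow> \<not> trace_class_graph (neg_exp (complex_of_real b) H)) \<longrightarrow>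
       {\<psi>. (\<exists>\<beta>>0. KMS_state \<sigma> \<beta> \<psi>) \<and> quasi_equivalent_states \<phi> \<psi>} =
         {gibbs_state \<pi> H \<beta> |\<beta>. 0 < \<beta> \<and> critical_beta H < ereal \<beta>})"
proof -
  note dyn = assms(1) and \<beta>0 = assms(2) and adm = assms(5)
  have kms: "KMS_state \<sigma> \<beta>\<^sub>0 \<phi>" using assms(3) by (simp add: extremal_KMS_state_def)
  have irr: "irreducible_rep UNIV \<pi>" and c\<rho>: "cblin \<rho>" and n\<rho>: "onorm \<rho> = 1"
    using adm by (simp_all add: admissible_triple_def positive_op_cblin)
  obtain B r where B: "is_onb B" and r: "\<And>e. e \<in> B \<Longrightarrow> \<rho> e = complex_of_real (r e) *\<^sub>C e"
    and r0: "\<And>e. e \<in> B \<Longrightarrow> 0 < r e" and rs: "r summable_on B" and ham: "hamiltonian_rep B \<sigma> \<pi> (\<lambda>e. - ln (r e) / \<beta>\<^sub>0)"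
    and \<phi>: "\<phi> = hamiltonian_rep.Gibbs_functional B \<pi> (\<lambda>e. - ln (r e) / \<beta>\<^sub>0) \<beta>\<^sub>0"
    using admissible_hamiltonian_rep[OF dyn kms \<beta>0 adm] by metis
  define h where "h = (\<lambda>e. - ln (r e) / \<beta>\<^sub>0)"
  interpret hamiltonian_rep B \<sigma> \<pi> h unfolding h_def by (rule ham)
  note \<phi> = \<phi>[folded h_def]
  have rh: "r e = exp (- \<beta>\<^sub>0 * h e)" if "e \<in> B" for e using r0[OF that] \<beta>0 by (simp add: h_def)
  have s0: "(\<lambda>e. exp (- \<beta>\<^sub>0 * h e)) summable_on B"
    using rs by (rule summable_on_cong[THEN iffD1, rotated]) (rule rh)
  have h0: "0 \<le> h e" if "e \<in> B" for e
    using onorm_eigenbasis(1)[OF B c\<rho> r r0[THEN less_imp_le] that] n\<rho> r0[OF that] \<beta>0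
    by (simp add: h_def divide_nonpos_pos)
  have H: "H = diag_graph B (\<lambda>e. complex_of_real (h e))"
    using represented_hamiltonian_diag[OF B c\<rho> r, of \<beta>\<^sub>0] by (simp add: h_def assms(6))
  note tc_iff = trace_class_neg_exp_iff[OF B H]
  have crit: "(\<lambda>e. exp (- x * h e)) summable_on B" if "critical_beta H < ereal x" for x
    by (rule summable_above_critical[OF B H h0 that])
  have \<rho>G: "op_graph \<rho> = diag_graph B (\<lambda>e. complex_of_real (r e))" by (rule op_graph_eq_diag_graph[OF B c\<rho> r])
  let ?d = "\<lambda>\<beta> e. complex_of_real (exp (- \<beta> * h e))"
  have d1: "cmod (?d \<beta> e) \<le> 1" if "\<beta> > 0" "e \<in> B" for \<beta> e using that h0 by simp
  have powr: "op_powr \<rho> (\<beta> / \<beta>\<^sub>0) = diag_op B (?d \<beta>)" if \<beta>: "\<beta> > 0" for \<beta>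
  proof -
    have "fun_calc (\<lambda>l. complex_of_real (l powr (\<beta> / \<beta>\<^sub>0))) (op_graph \<rho>) = diag_graph B (\<lambda>e. complex_of_real (r e powr (\<beta> / \<beta>\<^sub>0)))"
      unfolding \<rho>G by (rule fun_calc_diag_graph[OF B])
    also have "\<dots> = diag_graph B (?d \<beta>)"
    proof (rule diag_graph_cong)
      fix e assume e: "e \<in> B"
      show "complex_of_real (r e powr (\<beta> / \<beta>\<^sub>0)) = ?d \<beta> e"
        unfolding rh[OF e] using \<beta>0 by (simp add: powr_def)
    qed
    also have "\<dots> = op_graph (diag_op B (?d \<beta>))" by (rule diag_graph_eq_op_graph[OF B d1[OF \<beta>]])
    finally show ?thesis by (simp add: op_powr_def)
  qed
  have 1: "neg_exp (complex_of_real \<beta>) H = op_graph (op_powr \<rho> (\<beta> / \<beta>\<^sub>0))" if \<beta>: "\<beta> > 0" for \<beta>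
    unfolding neg_exp_diag_real[OF B H] powr[OF \<beta>] by (rule diag_graph_eq_op_graph[OF B d1[OF \<beta>]])
  have 2: "trace_class_graph (neg_exp s H)" if "critical_beta H < ereal (Re s)" for s
    by (rule trace_class_neg_exp[OF B H crit[OF that]])
  have gibbs: "gibbs_state \<pi> H \<beta> = Gibbs_functional \<beta>" if "(\<lambda>e. exp (- \<beta> * h e)) summable_on B" for \<beta>
    by (rule gibbs_state_eq_Gibbs_functional[OF H that])
  have 3: "extremal_KMS_state \<sigma> \<beta> (gibbs_state \<pi> H \<beta>) \<and>
        type_I_state (gibbs_state \<pi> H \<beta>) \<and>
        admissible_triple (gibbs_state \<pi> H \<beta>) \<pi> (op_powr \<rho> (\<beta> / \<beta>\<^sub>0)) \<and>
        represented_hamiltonian \<beta> (op_powr \<rho> (\<beta> / \<beta>\<^sub>0)) = H \<and>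
        (\<forall>s. critical_beta H < ereal (Re s) \<longrightarrow>
           partition_function TYPE('h) \<beta> (gibbs_state \<pi> H \<beta>) s = op_trace (of_graph (neg_exp s H)))"
    if \<beta>: "\<beta> > 0" and tc: "trace_class_graph (neg_exp (complex_of_real \<beta>) H)" for \<beta>
  proof -
    have s: "(\<lambda>e. exp (- \<beta> * h e)) summable_on B" using tc by (simp only: tc_iff)
    have dn: "(\<lambda>e. cmod (?d \<beta> e)) summable_on B" using s by simp
    note D = trace_class_diag[OF B dn]
    let ?D = "op_powr \<rho> (\<beta> / \<beta>\<^sub>0)"
    have cD: "cblin ?D" and De: "\<And>e. e \<in> B \<Longrightarrow> ?D e = ?d \<beta> e *\<^sub>C e" and tD: "trace_class ?D"
      unfolding powr[OF \<beta>] by (rule D(3), rule D(4), assumption, rule D(1))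
    have ext: "extremal_KMS_state \<sigma> \<beta> (gibbs_state \<pi> H \<beta>)" unfolding gibbs[OF s] by (rule Gibbs_extremal[OF s \<beta>])
    have ty: "type_I_state (gibbs_state \<pi> H \<beta>)" unfolding gibbs[OF s] by (rule Gibbs_type_I[OF s])
    have "onorm ?D = 1"
      by (rule onorm_exp_eq_1[OF \<beta> \<beta>0 h0 cD De c\<rho> _ n\<rho>]) (simp_all add: r rh)
    moreover have "positive_op ?D" by (rule positive_op_diag(1)[OF B cD De]) simp_all
    moreover have "gibbs_state \<pi> H \<beta> a = op_trace (\<pi> a \<circ> ?D) / op_trace ?D" for a
      unfolding gibbs_state_def 1[OF \<beta>] of_graph_op_graph ..
    ultimately have ad: "admissible_triple (gibbs_state \<pi> H \<beta>) \<pi> ?D"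
      using irr tD by (simp add: admissible_triple_def)
    have rH: "represented_hamiltonian \<beta> ?D = H"
      using represented_hamiltonian_diag[OF B cD De, of \<beta>] \<beta> by (simp add: H)
    have pf: "partition_function TYPE('h) \<beta> (gibbs_state \<pi> H \<beta>) s = op_trace (of_graph (neg_exp s H))"
      if sc: "critical_beta H < ereal (Re s)" for s
      unfolding partition_function_def
    proof (rule the_equality)
      show "\<exists>(\<pi>' :: 'a \<Rightarrow> 'h \<Rightarrow> 'h) \<rho>'. admissible_triple (gibbs_state \<pi> H \<beta>) \<pi>' \<rho>' \<and>
          op_trace (of_graph (neg_exp s H)) = op_trace (of_graph (neg_exp s (represented_hamiltonian \<beta> \<rho>')))"
        using ad rH by metis
      fix z assume "\<exists>(\<pi>' :: 'a \<Rightarrow> 'h \<Rightarrow> 'h) \<rho>'. admissible_triple (gibbs_state \<pi> H \<beta>) \<pi>' \<rho>' \<and>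
          z = op_trace (of_graph (neg_exp s (represented_hamiltonian \<beta> \<rho>')))"
      then obtain \<pi>' :: "'a \<Rightarrow> 'h \<Rightarrow> 'h" and \<rho>' where ad': "admissible_triple (gibbs_state \<pi> H \<beta>) \<pi>' \<rho>'"
        and z: "z = op_trace (of_graph (neg_exp s (represented_hamiltonian \<beta> \<rho>')))" by blast
      have kms': "KMS_state \<sigma> \<beta> (gibbs_state \<pi> H \<beta>)" using ext by (simp add: extremal_KMS_state_def)
      have "trace_class_graph (neg_exp (complex_of_real (Re s)) (represented_hamiltonian \<beta> ?D))"
        unfolding rH by (rule 2) (use sc in simp)
      from partition_trace_unique[OF dyn kms' \<beta> ad ad' this]
      show "z = op_trace (of_graph (neg_exp s H))" unfolding z rH .
    qed
    show ?thesis using ext ty ad rH pf by blast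
  qed
  have 4: "{\<psi>. (\<exists>\<beta>>0. KMS_state \<sigma> \<beta> \<psi>) \<and> quasi_equivalent_states \<phi> \<psi>} =
       {gibbs_state \<pi> H \<beta> |\<beta>. 0 < \<beta> \<and> trace_class_graph (neg_exp (complex_of_real \<beta>) H)}"
  proof (intro set_eqI iffI)
    fix \<psi> assume "\<psi> \<in> {\<psi>. (\<exists>\<beta>>0. KMS_state \<sigma> \<beta> \<psi>) \<and> quasi_equivalent_states \<phi> \<psi>}"
    then obtain \<beta> where \<beta>: "\<beta> > 0" "KMS_state \<sigma> \<beta> \<psi>" and "quasi_equivalent_states \<phi> \<psi>" by blast
    then obtain K\<^sub>1 \<pi>\<^sub>1 \<xi>\<^sub>1 K\<^sub>2 \<pi>\<^sub>2 \<xi>\<^sub>2 where g: "gns_triple \<phi> K\<^sub>1 \<pi>\<^sub>1 \<xi>\<^sub>1" "gns_triple \<psi> K\<^sub>2 \<pi>\<^sub>2 \<xi>\<^sub>2"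
      and q: "quasi_equivalent_reps K\<^sub>1 \<pi>\<^sub>1 K\<^sub>2 \<pi>\<^sub>2"
      unfolding quasi_equivalent_states_def by blast
    note Q = quasi_equivalent_KMS[OF s0 g(1)[unfolded \<phi>] g(2) q \<beta>(2,1)]
    have "\<psi> = gibbs_state \<pi> H \<beta>" using Q(2) gibbs[OF Q(1)] by simp
    moreover have "trace_class_graph (neg_exp (complex_of_real \<beta>) H)" using Q(1) by (simp only: tc_iff)
    ultimately show "\<psi> \<in> {gibbs_state \<pi> H \<beta> |\<beta>. 0 < \<beta> \<and> trace_class_graph (neg_exp (complex_of_real \<beta>) H)}"
      using \<beta>(1) by blast
  next
    fix \<psi> assume "\<psi> \<in> {gibbs_state \<pi> H \<beta> |\<beta>. 0 < \<beta> \<and> trace_class_graph (neg_exp (complex_of_real \<beta>) H)}"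
    then obtain \<beta> where \<beta>: "\<beta> > 0" and tc: "trace_class_graph (neg_exp (complex_of_real \<beta>) H)"
      and \<psi>: "\<psi> = gibbs_state \<pi> H \<beta>" by blast
    have s: "(\<lambda>e. exp (- \<beta> * h e)) summable_on B" using tc by (simp only: tc_iff)
    have "KMS_state \<sigma> \<beta> \<psi>" unfolding \<psi> gibbs[OF s] by (rule Gibbs_functional_KMS[OF s])
    moreover have "quasi_equivalent_states \<phi> \<psi>"
      unfolding \<psi> gibbs[OF s] \<phi> by (rule Gibbs_quasi_equivalent[OF s0 s])
    ultimately show "\<psi> \<in> {\<psi>. (\<exists>\<beta>>0. KMS_state \<sigma> \<beta> \<psi>) \<and> quasi_equivalent_states \<phi> \<psi>}" using \<beta> by blast
  qed
  have 5: "{\<psi>. (\<exists>\<beta>>0. KMS_state \<sigma> \<beta> \<psi>) \<and> quasi_equivalent_states \<phi> \<psi>} =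
         {gibbs_state \<pi> H \<beta> |\<beta>. 0 < \<beta> \<and> critical_beta H < ereal \<beta>}"
    if nc: "\<forall>b>0. critical_beta H = ereal b \<longrightarrow> \<not> trace_class_graph (neg_exp (complex_of_real b) H)"
  proof -
    have "trace_class_graph (neg_exp (complex_of_real \<beta>) H) \<longleftrightarrow> critical_beta H < ereal \<beta>" if \<beta>: "\<beta> > 0" for \<beta>
    proof
      assume tc: "trace_class_graph (neg_exp (complex_of_real \<beta>) H)"
      then have "critical_beta H \<le> ereal \<beta>" unfolding critical_beta_def by (intro Inf_lower) blast
      moreover have "critical_beta H \<noteq> ereal \<beta>" using nc \<beta> tc by blast
      ultimately show "critical_beta H < ereal \<beta>" by simp
    qed (use 2[of "complex_of_real \<beta>"] in simp)
    then show ?thesis unfolding 4 by blast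
  qed
  show ?thesis
  proof (rule conjI[OF _ conjI[OF _ conjI[OF _ conjI[OF 4 impI[OF 5]]]]])
    show "\<forall>\<beta>>0. neg_exp (complex_of_real \<beta>) H = op_graph (op_powr \<rho> (\<beta> / \<beta>\<^sub>0))" using 1 by simp
    show "\<forall>s. critical_beta H < ereal (Re s) \<longrightarrow> trace_class_graph (neg_exp s H)" using 2 by simp
  qed (intro allI impI, rule 3, assumption+)
qed

end
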